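(* Let $u$ be the entropy solution of $u_t+f(u)_x=0$, $x\in\mathbb{R}$, $t>0$, $u(x,0)=u_0(x)$, where $f:\mathbb{R}\to\mathbb{R}$ is twice continuously differentiable and convex, and $u_0\in BV(\mathbb{R})$ is $\mathrm{Lip}^+$ bounded and of compact support. Then the front tracking approximation $u^{\delta,\Delta x}$ of $u$ (with $\delta=O(\Delta x)$) satisfies $$W_1\big(u(t),u^{\delta,\Delta x}(t)\big)\leq C\,\Delta x^2$$ for all $t\in[0,T)$, for any $T>0$. If in addition $u_0\in\mathcal{B}$, then $$W_p\big(u(t),u^{\delta,\Delta x}(t)\big)\leq C\,\Delta x^{1+1/p},\qquad p\in[1,\infty]$$ (with $1/\infty:=0$). Here $C:=C_{T,f,\mathrm{supp}(u_0)}$ is a constant depending on $T$, $f$ and $\mathrm{supp}(u_0)$.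
   Context: $\mathrm{Lip}^+$ bounded: $v:\mathbb{R}\to\mathbb{R}$ is $\mathrm{Lip}^+$ bounded if there is a constant $c$ with $\frac{v(x+z)-v(x)}{z}\leq c$ for all $x,z\in\mathbb{R}$, $z\neq0$. $\mathcal{B}:=\{u\in L^\infty(\mathbb{R}): u\geq0,\ \mathrm{supp}(u)\text{ compact},\ \int_{\mathbb{R}}u\,dx=1\}$. Front tracking approximation: for $\Delta x>0$ set $x_{i+1/2}=(i+\tfrac12)\Delta x$ and $u_0^{\Delta x}(x)=u_i:=\frac1{\Delta x}\int_{x_{i-1/2}}^{x_{i+1/2}}u_0(y)\,dy$ for $x\in[x_{i-1/2},x_{i+1/2})$, $i\in\mathbb{Z}$. With $M=\|u_0\|_{L^\infty(\mathbb{R})}$ and $\delta=O(\Delta x)$, $\delta>0$, let $f^\delta$ be the piecewise linear interpolation of $f$, $$f^\delta(u)=f(j\delta)+(u-j\delta)\frac{f((j+1)\delta)-f(j\delta)}{\delta},\quad u\in(j\delta,(j+1)\delta],\quad j\in\mathbb{Z}\cap[-(M+1)/\delta,M/\delta].$$ Then $u^{\delta,\Delta x}$ is the unique entropy solution of $u_t+f^\delta(u)_x=0$, $u(x,0)=u_0^{\Delta x}(x)$. Wasserstein distances: for $u,v$ with $\int_{\mathbb{R}}(u-v)\,dx=0$ and $\int_{\mathbb{R}}|x||u-v|\,dx<\infty$ (not necessarily nonnegative), $W_1(u,v)=\int_{\mathbb{R}}\left|\int_{-\infty}^x(u-v)(y)\,dy\right|dx$. For $u,v\in\mathcal{B}$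 and $p\in[1,\infty]$, $W_p(u,v)=\|U^{-1}-V^{-1}\|_{L^p([0,1])}$, where $U(x)=\int_{-\infty}^xu\,dy$, $U^{-1}(\xi)=\inf\{x:U(x)>\xi\}$, and similarly for $V$; this agrees with the usual $p$-Wasserstein distance of the measures $u\,dx$, $v\,dx$, and for $p=1$ with the formula above.
   Formalization: The constant C may depend, besides T, f and supp(u_0), on the Lip^+ constant c of u_0 and on the constant in δ=O(Δx); with T, f, supp(u_0) alone the bound fails already at t=0 (replace u_0 by A·u_0, A→∞). *)

theory Defs
  imports "HOL-Analysis.Analysis" "HOL-Probability.Essential_Supremum"
begin

text \<open>Elements of L-infinity, L1 and BV are represented by Borel functions; the notions below that are
  meant for equivalence classes (support, norms, sign, bounds) are insensitive to null sets.\<close>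

section \<open>Function classes on the real line\<close>

definition Linf_norm :: "'a measure \<Rightarrow> ('a \<Rightarrow> real) \<Rightarrow> ennreal" where
  "Linf_norm M g = esssup M (\<lambda>x. ennreal \<bar>g x\<bar>)"

definition supp :: "(real \<Rightarrow> real) \<Rightarrow> real set" where
  "supp v = {x. \<forall>e>0. \<not> (AE y in lborel. y \<in> ball x e \<longrightarrow> v y = 0)}"

definition Lip_plus_bound :: "real \<Rightarrow> (real \<Rightarrow> real) \<Rightarrow> bool" where
  "Lip_plus_bound c v \<longleftrightarrow> (\<forall>x z. z \<noteq> 0 \<longrightarrow> (v (x + z) - v x) / z \<le> c)"

text \<open>BV: integrable, and the distributional derivative is a finite measure.\<close>
definition BV :: "(real \<Rightarrow> real) set" where
  "BV = {v. integrable lborel v \<and>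
     (\<exists>V. \<forall>\<phi>. \<phi> C1_differentiable_on UNIV \<longrightarrow> bounded {x. \<phi> x \<noteq> 0} \<longrightarrow> (\<forall>x. \<bar>\<phi> x\<bar> \<le> 1) \<longrightarrow>
        (LINT x|lborel. v x * deriv \<phi> x) \<le> V)}"

definition \<B> :: "(real \<Rightarrow> real) set" where
  "\<B> = {v \<in> borel_measurable borel. Linf_norm lborel v < \<infinity> \<and> (AE x in lborel. 0 \<le> v x) \<and>
     compact (supp v) \<and> (LINT x|lborel. v x) = 1}"

definition C2 :: "(real \<Rightarrow> real) \<Rightarrow> bool" where
  "C2 f \<longleftrightarrow> f C1_differentiable_on UNIV \<and> deriv f C1_differentiable_on UNIV"

section \<open>Entropy solutions\<close>

text \<open>Space-time points are pairs (t, x). Restricting these functions to t \<ge> 0 gives the test functions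
  on the closed half plane, which do not have to vanish at t = 0.\<close>
definition test_fun ::
  "(real \<times> real \<Rightarrow> real) \<Rightarrow> (real \<times> real \<Rightarrow> real) \<Rightarrow> (real \<times> real \<Rightarrow> real) \<Rightarrow> bool" where
  "test_fun \<phi> \<phi>t \<phi>x \<longleftrightarrow> (\<forall>z. 0 \<le> \<phi> z) \<and> bounded {z. \<phi> z \<noteq> 0} \<and>
     (\<forall>t x. ((\<lambda>s. \<phi> (s, x)) has_real_derivative \<phi>t (t, x)) (at t)) \<and>
     (\<forall>t x. ((\<lambda>y. \<phi> (t, y)) has_real_derivative \<phi>x (t, x)) (at x)) \<and>
     continuous_on UNIV \<phi>t \<and> continuous_on UNIV \<phi>x"

text \<open>Kruzkov entropy solution of the Cauchy problem with flux f and initial datum u0, in the form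
  u t x for t \<ge> 0. To give a meaning to u t for every t, u is the representative that is continuous in time
  with values in L1_loc.\<close>
definition entropy_solution ::
  "(real \<Rightarrow> real) \<Rightarrow> (real \<Rightarrow> real) \<Rightarrow> (real \<Rightarrow> real \<Rightarrow> real) \<Rightarrow> bool" where
  "entropy_solution f u0 u \<longleftrightarrow>
     set_borel_measurable borel ({0..} \<times> UNIV) (\<lambda>(t, x). u t x) \<and>
     (\<exists>b. \<forall>t\<ge>0. AE x in lborel. \<bar>u t x\<bar> \<le> b) \<and>
     (\<forall>R. \<forall>t\<ge>0. ((\<lambda>s. LINT x:{-R..R}|lborel. \<bar>u s x - u t x\<bar>) \<longlongrightarrow> 0) (at t within {0..})) \<and>
     (\<forall>k \<phi> \<phi>t \<phi>x. test_fun \<phi> \<phi>t \<phi>x \<longrightarrow>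
        0 \<le> (LINT (t, x):({0..} \<times> UNIV)|lborel.
                \<bar>u t x - k\<bar> * \<phi>t (t, x) + sgn (u t x - k) * (f (u t x) - f k) * \<phi>x (t, x))
            + (LINT x|lborel. \<bar>u0 x - k\<bar> * \<phi> (0, x)))"

section \<open>Front tracking\<close>

text \<open>x lies in the cell [(i - 1/2) dx, (i + 1/2) dx) for i = floor (x/dx + 1/2).\<close>
definition cell_average :: "real \<Rightarrow> (real \<Rightarrow> real) \<Rightarrow> real \<Rightarrow> real" where
  "cell_average dx u0 x = (let i = real_of_int \<lfloor>x / dx + 1/2\<rfloor> in
     1 / dx * (LINT y:{(i - 1/2) * dx..(i + 1/2) * dx}|lborel. u0 y))"

definition node_index :: "real \<Rightarrow> real \<Rightarrow> int set" where
  "node_index M \<delta> = {j. - (M + 1) / \<delta> \<le> real_of_int j \<and> real_of_int j \<le> M / \<delta>}"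

definition flux_domain :: "real \<Rightarrow> real \<Rightarrow> real set" where
  "flux_domain M \<delta> = (\<Union>j\<in>node_index M \<delta>. {real_of_int j * \<delta><..(real_of_int j + 1) * \<delta>})"

text \<open>Here j is the index with u in (j \<delta>, (j+1) \<delta>]. The same formula is used for all integers j, which
  extends the interpolant from flux_domain M \<delta> to the whole line; an entropy solution with data
  bounded by M only takes values in [-M, M], so the extension is immaterial when flux_domain M \<delta>
  contains [-M, M].\<close>
definition flux_interp :: "(real \<Rightarrow> real) \<Rightarrow> real \<Rightarrow> real \<Rightarrow> real" where
  "flux_interp f \<delta> u = (let j = real_of_int (\<lceil>u / \<delta>\<rceil> - 1) in
     f (j * \<delta>) + (u - j * \<delta>) * ((f ((j + 1) * \<delta>) - f (j * \<delta>)) / \<delta>))"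

text \<open>The first three conditions say that the approximation is defined, M being the sup norm of u0.\<close>
definition front_tracking_approximation ::
  "(real \<Rightarrow> real) \<Rightarrow> (real \<Rightarrow> real) \<Rightarrow> real \<Rightarrow> real \<Rightarrow> (real \<Rightarrow> real \<Rightarrow> real) \<Rightarrow> bool" where
  "front_tracking_approximation f u0 \<delta> dx v \<longleftrightarrow>
     (let M = enn2real (Linf_norm lborel u0) in
       0 < dx \<and> 0 < \<delta> \<and> {- M..M} \<subseteq> flux_domain M \<delta> \<and>
       entropy_solution (flux_interp f \<delta>) (cell_average dx u0) v)"

lemma flux_interp_eq:
  assumes "0 < \<delta>" and "u \<in> {real_of_int j * \<delta><..(real_of_int j + 1) * \<delta>}"
  shows "flux_interp f \<delta> u =
    f (j * \<delta>) + (u - j * \<delta>) * ((f ((j + 1) * \<delta>) - f (j * \<delta>)) / \<delta>)"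
proof -
  have "real_of_int j < u / \<delta>" "u / \<delta> \<le> real_of_int j + 1"
    using assms by (auto simp: field_simps)
  then have "\<lceil>u / \<delta>\<rceil> = j + 1"
    by (intro ceiling_unique) auto
  then show ?thesis
    by (simp add: flux_interp_def Let_def)
qed

text \<open>For \<delta> \<le> 1 the index range always reaches far enough.\<close>
lemma flux_domain_covers:
  assumes "0 < \<delta>" "\<delta> \<le> 1"
  shows "{- M..M} \<subseteq> flux_domain M \<delta>"
proof
  fix u assume u: "u \<in> {- M..M}"
  define j where "j = \<lceil>u / \<delta>\<rceil> - 1"
  have lower: "real_of_int j < u / \<delta>" and upper: "u / \<delta> \<le> real_of_int j + 1"
    unfolding j_def by linarith+
  have l: "real_of_int j * \<delta> < u" and r: "u \<le> (real_of_int j + 1) * \<delta>"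
    using lower upper assms by (simp_all add: field_simps)
  have "- (M + 1) \<le> real_of_int j * \<delta>" "real_of_int j * \<delta> \<le> M"
    using l r u assms by (auto simp: algebra_simps)
  then have "j \<in> node_index M \<delta>"
    using assms by (auto simp: node_index_def field_simps)
  with l r show "u \<in> flux_domain M \<delta>"
    unfolding flux_domain_def by auto
qed

section \<open>Wasserstein distances\<close>

definition W1_defined :: "(real \<Rightarrow> real) \<Rightarrow> (real \<Rightarrow> real) \<Rightarrow> bool" where
  "W1_defined u v \<longleftrightarrow> integrable lborel (\<lambda>x. u x - v x) \<and> (LINT x|lborel. u x - v x) = 0 \<and>
     integrable lborel (\<lambda>x. \<bar>x\<bar> * \<bar>u x - v x\<bar>)"

definition W1 :: "(real \<Rightarrow> real) \<Rightarrow> (real \<Rightarrow> real) \<Rightarrow> ennreal" where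
  "W1 u v = (\<integral>\<^sup>+x. ennreal \<bar>LINT y:{..x}|lborel. u y - v y\<bar> \<partial>lborel)"

definition distribution_fun :: "(real \<Rightarrow> real) \<Rightarrow> real \<Rightarrow> real" where
  "distribution_fun u x = (LINT y:{..x}|lborel. u y)"

definition quantile_fun :: "(real \<Rightarrow> real) \<Rightarrow> real \<Rightarrow> real" where
  "quantile_fun u \<xi> = Inf {x. distribution_fun u x > \<xi>}"

definition Lp_norm :: "'a measure \<Rightarrow> ennreal \<Rightarrow> ('a \<Rightarrow> real) \<Rightarrow> ennreal" where
  "Lp_norm M p g =
    (if p = \<infinity> then Linf_norm M g
     else let I = (\<integral>\<^sup>+x. ennreal (\<bar>g x\<bar> powr enn2real p) \<partial>M)
          in if I = \<infinity> then \<infinity> else ennreal (enn2real I powr (1 / enn2real p)))"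

text \<open>For u and v in \<open>\<B>\<close>. The value of a quantile function at the single point 1 is irrelevant.\<close>
definition Wp :: "ennreal \<Rightarrow> (real \<Rightarrow> real) \<Rightarrow> (real \<Rightarrow> real) \<Rightarrow> ennreal" where
  "Wp p u v = Lp_norm (restrict_space lborel {0..1}) p (\<lambda>\<xi>. quantile_fun u \<xi> - quantile_fun v \<xi>)"

end

theory Submission
  imports Defs
begin

text \<open>The primitive U of an entropy solution u in x is a weak solution of \<open>U\<^sub>t + f(U\<^sub>x) = 0\<close>. Integrating the
  conservation law along a line of slope q gives \<open>U(t, x) \<le> U(0, x - t q) + t f\<^sup>*(q)\<close>. Conversely, U lies
  above every Hopf-Lax function whose data lie below those of U, because testing the entropy inequality
  near a first touching point excludes that a strict classical subsolution touches U from below. Both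
  statements tolerate small errors in the flux and in the data.

  Now let V be the primitive of the front tracking approximation. The primitive of the cell averages is
  smoothed at scale \<open>\<Delta>x\<close> to W, which inherits the one-sided Lipschitz bound, exceeds neither initial
  primitive by more than \<open>O(\<Delta>x\<^sup>2)\<close>, and has \<open>L\<^sup>1\<close> distance \<open>O(\<Delta>x\<^sup>2)\<close> to both. Let H be the Hopf-Lax
  function for W and the flux \<open>f(k) + \<Delta>x\<^sup>2 k\<^sup>2 / 2\<close>. Up to \<open>O(\<Delta>x\<^sup>2)\<close>, U - H is nonnegative and at most
  the initial difference at the foot of the characteristic that minimizes H; the one-sided Lipschitz bound makes
  the foot points spread out, so the integral of U - H is \<open>O(\<Delta>x\<^sup>2)\<close>. The same holds for V - H, and \<open>W\<^sub>1\<close> is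
  the integral of \<open>\<bar>U - V\<bar>\<close>.

  For nonnegative data, cell averaging moves mass by at most \<open>\<Delta>x\<close> and the interpolated flux changes speeds by
  \<open>O(\<delta>)\<close>, so that U and V are squeezed between \<open>O(\<Delta>x)\<close>-translates of each other. This is the bound for
  \<open>W\<^sub>\<infinity>\<close>, and interpolation with \<open>W\<^sub>1\<close> gives the other exponents.\<close>

text \<open>Two obstacles shape the argument. The flux of the front tracking solution is only
  piecewise linear, so its derivative jumps and the first-order condition for minimizers is lost;
  both solutions are therefore measured against the Hopf-Lax function of one smooth flux. Its
  quadratic term makes the flux strictly convex, which keeps minimizing characteristics from
  crossing. Moreover the integrated error has to be of second order although the initial primitives
  may differ at first order near jumps of \<open>u0\<close>. The one-sided Lipschitz bound limits
  their difference at x to \<Delta>x times u0 (x - \<Delta>x) - u0 (x + \<Delta>x), up to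
  \<open>O(\<Delta>x\<^sup>2)\<close>, and a difference of translates integrates to zero. This is
  why H is placed below both U and V: up to \<open>O(\<Delta>x\<^sup>2)\<close> the differences U -
  H and V - H are nonnegative, so that their plain integrals control the integral of |U - V|.
  Everything is derived from the Kruzkov inequality. Test functions only have to be C1, and all of
  them are built from squares of positive parts. For \<Delta>x at least 1 the estimate follows from
  crude bounds on the supports.\<close>

section \<open>Smooth steps and mollification\<close>

lemma pos_part_square_taylor:
  fixes s t :: real
  shows "\<bar>(max 0 t)\<^sup>2 - (max 0 s)\<^sup>2 - (t - s) * (2 * max 0 s)\<bar> \<le> (t - s)\<^sup>2"
proof -
  consider "s \<ge> 0" "t \<ge> 0" | "s \<ge> 0" "t < 0" | "s < 0" "t \<ge> 0" | "s < 0" "t < 0" by linarith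
  then show ?thesis
  proof cases
    case 1
    then have "(max 0 t)\<^sup>2 - (max 0 s)\<^sup>2 - (t - s) * (2 * max 0 s) = (t - s)\<^sup>2"
      by (simp add: power2_eq_square algebra_simps)
    then show ?thesis by simp
  next
    case 2
    have st: "s * t \<le> 0" using 2 by (simp add: mult_nonneg_nonpos)
    have eq: "(max 0 t)\<^sup>2 - (max 0 s)\<^sup>2 - (t - s) * (2 * max 0 s) = s\<^sup>2 - 2 * (s * t)"
      using 2 by (simp add: power2_eq_square algebra_simps)
    have "(t - s)\<^sup>2 = t\<^sup>2 + (s\<^sup>2 - 2 * (s * t))" by (simp add: power2_eq_square algebra_simps)
    moreover have "0 \<le> s\<^sup>2 - 2 * (s * t)" using st zero_le_power2[of s] by linarith
    ultimately show ?thesis unfolding eq by simp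
  next
    case 3
    have st: "s * t \<le> 0" using 3 by (simp add: mult_nonpos_nonneg)
    have eq: "(max 0 t)\<^sup>2 - (max 0 s)\<^sup>2 - (t - s) * (2 * max 0 s) = t\<^sup>2"
      using 3 by simp
    have "(t - s)\<^sup>2 = t\<^sup>2 + (s\<^sup>2 - 2 * (s * t))" by (simp add: power2_eq_square algebra_simps)
    moreover have "0 \<le> s\<^sup>2 - 2 * (s * t)" using st zero_le_power2[of s] by linarith
    ultimately show ?thesis unfolding eq by simp
  next
    case 4 then show ?thesis by simp
  qed
qed

lemma quadratic_remainder_imp_DERIV:
  fixes f :: "real \<Rightarrow> real"
  assumes "\<And>y. \<bar>f y - f x - (y - x) * D\<bar> \<le> C * (y - x)\<^sup>2"
  shows "(f has_real_derivative D) (at x)"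
proof -
  have "((\<lambda>y. (f y - f x) / (y - x) - D) \<longlongrightarrow> 0) (at x)"
  proof (rule Lim_null_comparison)
    show "\<forall>\<^sub>F y in at x. norm ((f y - f x) / (y - x) - D) \<le> C * \<bar>y - x\<bar>"
    proof (rule eventually_mono[OF eventually_neq_at_within[of x x]])
      fix y assume "y \<noteq> x"
      have "norm ((f y - f x) / (y - x) - D) = \<bar>f y - f x - (y - x) * D\<bar> / \<bar>y - x\<bar>"
        using \<open>y \<noteq> x\<close> by (simp add: field_simps flip: abs_divide)
      also have "\<dots> \<le> C * (y - x)\<^sup>2 / \<bar>y - x\<bar>" by (intro divide_right_mono assms) simp
      also have "\<dots> = C * \<bar>y - x\<bar>" using \<open>y \<noteq> x\<close> by (simp add: power2_eq_square field_simps abs_if)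
      finally show "norm ((f y - f x) / (y - x) - D) \<le> C * \<bar>y - x\<bar>" .
    qed
    show "((\<lambda>y. C * \<bar>y - x\<bar>) \<longlongrightarrow> 0) (at x)"
      by (auto intro!: tendsto_eq_intros)
  qed
  then show ?thesis
    by (simp add: has_field_derivative_iff LIM_zero_iff)
qed

lemma DERIV_pos_part_square:
  fixes x :: real
  shows "((\<lambda>x. (max 0 x)\<^sup>2) has_real_derivative 2 * max 0 x) (at x)"
  by (rule quadratic_remainder_imp_DERIV[where C = 1]) (use pos_part_square_taylor in simp)

text \<open>A C1 step from 0 to 1 across [0, 1]: the primitive of the tent function
  \<open>hat\<close>, which has height 2 and mass 1. Both are written with positive parts so that
  continuity and the Taylor bound follow termwise.\<close>

definition sstep :: "real \<Rightarrow> real" where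
  "sstep s = 2 * ((max 0 s)\<^sup>2 - 2 * (max 0 (s - 1/2))\<^sup>2 + (max 0 (s - 1))\<^sup>2)"

definition hat :: "real \<Rightarrow> real" where
  "hat s = 4 * (max 0 s - 2 * max 0 (s - 1/2) + max 0 (s - 1))"

text \<open>The derivative \<open>hat\<close> is Lipschitz, hence the remainder is quadratic
  uniformly in s and t. With such a bound \<open>DERIV_mol_prim\<close> differentiates under the
  integral by one direct estimate, for arbitrary integrable densities.\<close>

lemma sstep_taylor: "\<bar>sstep t - sstep s - (t - s) * hat s\<bar> \<le> 8 * (t - s)\<^sup>2"
proof -
  have "\<bar>(max 0 t)\<^sup>2 - (max 0 s)\<^sup>2 - (t - s) * (2 * max 0 s)\<bar> \<le> (t - s)\<^sup>2"
    by (rule pos_part_square_taylor)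
  moreover have "\<bar>(max 0 (t-1/2))\<^sup>2 - (max 0 (s-1/2))\<^sup>2 - (t - s) * (2 * max 0 (s-1/2))\<bar> \<le> (t - s)\<^sup>2"
    using pos_part_square_taylor[of "t-1/2" "s-1/2"] by simp
  moreover have "\<bar>(max 0 (t-1))\<^sup>2 - (max 0 (s-1))\<^sup>2 - (t - s) * (2 * max 0 (s-1))\<bar> \<le> (t - s)\<^sup>2"
    using pos_part_square_taylor[of "t-1" "s-1"] by simp
  moreover have "sstep t - sstep s - (t - s) * hat s =
     2 * ((max 0 t)\<^sup>2 - (max 0 s)\<^sup>2 - (t - s) * (2 * max 0 s))
     - 4 * ((max 0 (t-1/2))\<^sup>2 - (max 0 (s-1/2))\<^sup>2 - (t - s) * (2 * max 0 (s-1/2)))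
     + 2 * ((max 0 (t-1))\<^sup>2 - (max 0 (s-1))\<^sup>2 - (t - s) * (2 * max 0 (s-1)))"
    unfolding sstep_def hat_def by (simp add: algebra_simps)
  moreover have "\<bar>2 * a - 4 * b + 2 * c\<bar> \<le> 8 * d"
    if "\<bar>a\<bar> \<le> d" "\<bar>b\<bar> \<le> d" "\<bar>c\<bar> \<le> d" for a b c d :: real
    using that by linarith
  ultimately show ?thesis by metis
qed

lemma DERIV_sstep: "(sstep has_real_derivative hat s) (at s)"
  by (rule quadratic_remainder_imp_DERIV[where C = 8]) (rule sstep_taylor)

lemma hat_nonneg: "0 \<le> hat s" and hat_le: "hat s \<le> 2"
  unfolding hat_def by (auto simp: max_def)

lemma hat_eq_0: "s \<le> 0 \<or> 1 \<le> s \<Longrightarrow> hat s = 0"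
  unfolding hat_def by (elim disjE) (simp_all add: max_def)

lemma hat_Lipschitz: "\<bar>hat s - hat t\<bar> \<le> 16 * \<bar>s - t\<bar>"
proof -
  have "\<bar>max 0 a - max 0 b\<bar> \<le> \<bar>a - b\<bar>" for a b :: real by linarith
  from this[of s t] this[of "s-1/2" "t-1/2"] this[of "s-1" "t-1"]
  have "\<bar>max 0 s - max 0 t\<bar> \<le> \<bar>s - t\<bar>" "\<bar>max 0 (s-1/2) - max 0 (t-1/2)\<bar> \<le> \<bar>s - t\<bar>"
    "\<bar>max 0 (s-1) - max 0 (t-1)\<bar> \<le> \<bar>s - t\<bar>" by simp_all
  note 1 = this
  have eq: "hat s - hat t = 4 * (max 0 s - max 0 t) - 8 * (max 0 (s-1/2) - max 0 (t-1/2))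
      + 4 * (max 0 (s-1) - max 0 (t-1))"
    by (simp add: hat_def)
  have "\<bar>4 * a - 8 * b + 4 * c\<bar> \<le> 16 * d"
    if "\<bar>a\<bar> \<le> d" "\<bar>b\<bar> \<le> d" "\<bar>c\<bar> \<le> d" for a b c d :: real
    using that by linarith
  from this[OF 1] show ?thesis unfolding eq .
qed

lemma sstep_mono: "s \<le> t \<Longrightarrow> sstep s \<le> sstep t"
  by (rule DERIV_nonneg_imp_nondecreasing[of s t sstep]) (use DERIV_sstep hat_nonneg in blast)+

lemma sstep_le_0: "s \<le> 0 \<Longrightarrow> sstep s = 0"
  by (simp add: sstep_def)

lemma sstep_ge_1: "1 \<le> s \<Longrightarrow> sstep s = 1"
  by (simp add: sstep_def power2_eq_square algebra_simps)

lemma sstep_nonneg: "0 \<le> sstep s"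
  using sstep_mono[of "min 0 s" s] sstep_le_0[of "min 0 s"] by simp

lemma sstep_le_1: "sstep s \<le> 1"
  using sstep_mono[of s "max 1 s"] sstep_ge_1[of "max 1 s"] by simp

lemma sstep_eq: "s \<le> 0 \<Longrightarrow> sstep s = 0" "1 \<le> s \<Longrightarrow> sstep s = 1"
  by (fact sstep_le_0, fact sstep_ge_1)

lemma continuous_hat [continuous_intros]:
  "continuous_on A f \<Longrightarrow> continuous_on A (\<lambda>x. hat (f x))"
  unfolding hat_def by (intro continuous_intros)

lemma continuous_sstep [continuous_intros]:
  "continuous_on A f \<Longrightarrow> continuous_on A (\<lambda>x. sstep (f x))"
  unfolding sstep_def by (intro continuous_intros)

lemma measurable_hat [measurable]: "hat \<in> borel_measurable borel"
  by (intro borel_measurable_continuous_onI continuous_intros)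

lemma measurable_sstep [measurable]: "sstep \<in> borel_measurable borel"
  by (intro borel_measurable_continuous_onI continuous_intros)

text \<open>The kernel lives on (x, x + \<epsilon>), so the average looks only to the right of x.
  Applied in time, it involves only later times, which keeps it meaningful at time 0.\<close>

definition mol :: "real \<Rightarrow> (real \<Rightarrow> real) \<Rightarrow> real \<Rightarrow> real" where
  "mol \<epsilon> v x = (LINT y|lborel. hat ((x - y) / \<epsilon> + 1) / \<epsilon> * v y)"

text \<open>A smoothed distribution function: the indicator of \<open>{..x}\<close> is replaced by a
  step that is 1 up to x and falls to 0 at x + \<epsilon>. Its derivative in x is
  \<open>mol\<close>.\<close>

definition mol_prim :: "real \<Rightarrow> (real \<Rightarrow> real) \<Rightarrow> real \<Rightarrow> real" where
  "mol_prim \<epsilon> v x = (LINT y|lborel. sstep ((x - y) / \<epsilon> + 1) * v y)"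

lemma kernel_nonneg: "0 < \<epsilon> \<Longrightarrow> 0 \<le> hat s / \<epsilon>" and kernel_le: "0 < \<epsilon> \<Longrightarrow> hat s / \<epsilon> \<le> 2 / \<epsilon>"
  using hat_nonneg[of s] hat_le[of s] by (auto intro: divide_right_mono)

lemma kernel_eq_0: "0 < \<epsilon> \<Longrightarrow> y \<le> x \<or> x + \<epsilon> \<le> y \<Longrightarrow> hat ((x - y) / \<epsilon> + 1) = 0"
  by (rule hat_eq_0) (auto simp: field_simps)

lemma integrable_bounded_mult:
  fixes v w :: "real \<Rightarrow> real"
  assumes "integrable lborel v" "w \<in> borel_measurable borel" "\<And>y. \<bar>w y\<bar> \<le> C"
  shows "integrable lborel (\<lambda>y. w y * v y)"
proof (rule Bochner_Integration.integrable_bound)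
  show "integrable lborel (\<lambda>y. C * v y)" using assms(1) by simp
  show "(\<lambda>y. w y * v y) \<in> borel_measurable lborel"
    using assms borel_measurable_integrable[OF assms(1)] by measurable
  have "\<bar>w y\<bar> * \<bar>v y\<bar> \<le> \<bar>C\<bar> * \<bar>v y\<bar>" for y
    by (intro mult_right_mono) (use assms(3)[of y] in auto)
  then show "AE x in lborel. norm (w x * v x) \<le> norm (C * v x)"
    by (simp add: abs_mult)
qed

lemma integrable_mol:
  assumes "integrable lborel v" "0 < \<epsilon>"
  shows "integrable lborel (\<lambda>y. hat ((x - y) / \<epsilon> + 1) / \<epsilon> * v y)"
  by (rule integrable_bounded_mult[where C = "2 / \<epsilon>", OF assms(1)])
     (use kernel_nonneg[OF assms(2)] kernel_le[OF assms(2)] in \<open>auto simp only: abs_of_nonneg, measurable\<close>)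

lemma integrable_mol_prim:
  assumes "integrable lborel v"
  shows "integrable lborel (\<lambda>y. sstep ((x - y) / \<epsilon> + 1) * v y)"
  by (rule integrable_bounded_mult[where C = 1, OF assms])
     (use sstep_nonneg sstep_le_1 in auto)

lemma DERIV_mol_prim:
  assumes "integrable lborel v" "0 < \<epsilon>"
  shows "(mol_prim \<epsilon> v has_real_derivative mol \<epsilon> v x) (at x)"
proof (rule quadratic_remainder_imp_DERIV[where C = "8 / \<epsilon>\<^sup>2 * (LINT y|lborel. \<bar>v y\<bar>)"])
  fix z
  have int: "integrable lborel (\<lambda>y. \<bar>v y\<bar>)" using assms by simp
  have eq: "mol_prim \<epsilon> v z - mol_prim \<epsilon> v x - (z - x) * mol \<epsilon> v x =
    (LINT y|lborel. sstep ((z - y) / \<epsilon> + 1) * v y - sstep ((x - y) / \<epsilon> + 1) * v y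
        - (z - x) * (hat ((x - y) / \<epsilon> + 1) / \<epsilon> * v y))"
    unfolding mol_prim_def mol_def
    by (simp only: Bochner_Integration.integral_diff Bochner_Integration.integral_mult_right_zero
        integrable_mol[OF assms] integrable_mol_prim[OF assms(1)] Bochner_Integration.integrable_diff
        integrable_mult_right)
  have le: "\<bar>LINT y|lborel. sstep ((z - y) / \<epsilon> + 1) * v y - sstep ((x - y) / \<epsilon> + 1) * v y
        - (z - x) * (hat ((x - y) / \<epsilon> + 1) / \<epsilon> * v y)\<bar> \<le> (LINT y|lborel. 8 / \<epsilon>\<^sup>2 * (z - x)\<^sup>2 * \<bar>v y\<bar>)"
  proof (rule integral_abs_bound_integral)
    show "integrable lborel (\<lambda>y. sstep ((z - y) / \<epsilon> + 1) * v y - sstep ((x - y) / \<epsilon> + 1) * v y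
        - (z - x) * (hat ((x - y) / \<epsilon> + 1) / \<epsilon> * v y))"
      using integrable_mol[OF assms, of x] integrable_mol_prim[OF assms(1)]
      by (intro Bochner_Integration.integrable_diff integrable_mult_right) auto
    show "integrable lborel (\<lambda>y. 8 / \<epsilon>\<^sup>2 * (z - x)\<^sup>2 * \<bar>v y\<bar>)" using int by simp
    fix y
    let ?s = "sstep ((z - y) / \<epsilon> + 1) - sstep ((x - y) / \<epsilon> + 1) - (z - x) / \<epsilon> * hat ((x - y) / \<epsilon> + 1)"
    have "\<bar>?s\<bar> \<le> 8 * ((z - x) / \<epsilon>)\<^sup>2"
      using sstep_taylor[of "(z - y) / \<epsilon> + 1" "(x - y) / \<epsilon> + 1"] by (simp add: diff_divide_distrib)
    then have "\<bar>?s\<bar> * \<bar>v y\<bar>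
       \<le> 8 * ((z - x) / \<epsilon>)\<^sup>2 * \<bar>v y\<bar>"
      by (intro mult_right_mono) auto
    then show "\<bar>sstep ((z - y) / \<epsilon> + 1) * v y - sstep ((x - y) / \<epsilon> + 1) * v y
        - (z - x) * (hat ((x - y) / \<epsilon> + 1) / \<epsilon> * v y)\<bar> \<le> 8 / \<epsilon>\<^sup>2 * (z - x)\<^sup>2 * \<bar>v y\<bar>"
    proof -
      assume *: "\<bar>?s\<bar> * \<bar>v y\<bar> \<le> 8 * ((z - x) / \<epsilon>)\<^sup>2 * \<bar>v y\<bar>"
      have "sstep ((z - y) / \<epsilon> + 1) * v y - sstep ((x - y) / \<epsilon> + 1) * v y
        - (z - x) * (hat ((x - y) / \<epsilon> + 1) / \<epsilon> * v y) = ?s * v y"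
        by (simp add: left_diff_distrib)
      then show ?thesis using * by (simp add: abs_mult power_divide)
    qed
  qed
  show "\<bar>mol_prim \<epsilon> v z - mol_prim \<epsilon> v x - (z - x) * mol \<epsilon> v x\<bar>
     \<le> 8 / \<epsilon>\<^sup>2 * (LINT y|lborel. \<bar>v y\<bar>) * (z - x)\<^sup>2"
    using le unfolding eq Bochner_Integration.integral_mult_right_zero
    by (simp only: ac_simps)
qed

lemma kernel_integral:
  assumes "0 < \<epsilon>"
  shows "has_bochner_integral lborel (\<lambda>y. hat ((x - y) / \<epsilon> + 1) / \<epsilon>) 1"
proof -
  have "has_bochner_integral lborel (\<lambda>y. (hat ((x - y) / \<epsilon> + 1) / \<epsilon>) * indicator {x..x + \<epsilon>} y)
     (- sstep ((x - (x + \<epsilon>)) / \<epsilon> + 1) - (- sstep ((x - x) / \<epsilon> + 1)))"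
  proof (rule has_bochner_integral_FTC_Icc_nonneg)
    show "((\<lambda>y. - sstep ((x - y) / \<epsilon> + 1)) has_real_derivative hat ((x - y) / \<epsilon> + 1) / \<epsilon>) (at y)" for y
      using assms by (auto intro!: derivative_eq_intros DERIV_chain2[OF DERIV_sstep])
  qed (use assms kernel_nonneg[OF assms] in auto)
  moreover have "(\<lambda>y. (hat ((x - y) / \<epsilon> + 1) / \<epsilon>) * indicator {x..x + \<epsilon>} y) =
      (\<lambda>y. hat ((x - y) / \<epsilon> + 1) / \<epsilon>)"
    using kernel_eq_0[OF assms, of _ x] by (intro ext) (simp add: indicator_def not_le, force)
  ultimately show ?thesis using assms by (simp add: sstep_eq)
qed

lemma kernel_nn_integral:
  assumes "0 < \<epsilon>"
  shows "(\<integral>\<^sup>+y. ennreal (hat ((x - y) / \<epsilon> + 1) / \<epsilon>) \<partial>lborel) = 1"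
    and "(\<integral>\<^sup>+x. ennreal (hat ((x - y) / \<epsilon> + 1) / \<epsilon>) \<partial>lborel) = 1"
proof -
  show "(\<integral>\<^sup>+y. ennreal (hat ((x - y) / \<epsilon> + 1) / \<epsilon>) \<partial>lborel) = 1"
    using kernel_integral[OF assms, of x] kernel_nonneg[OF assms]
    by (subst nn_integral_eq_integral) (auto simp: has_bochner_integral_iff)
  have "has_bochner_integral lborel (\<lambda>x. (hat ((x - y) / \<epsilon> + 1) / \<epsilon>) * indicator {y - \<epsilon>..y} x)
     (sstep ((y - y) / \<epsilon> + 1) - sstep ((y - \<epsilon> - y) / \<epsilon> + 1))"
  proof (rule has_bochner_integral_FTC_Icc_nonneg)
    show "((\<lambda>x. sstep ((x - y) / \<epsilon> + 1)) has_real_derivative hat ((x - y) / \<epsilon> + 1) / \<epsilon>) (at x)" for x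
      by (rule DERIV_chain2[OF DERIV_sstep, THEN DERIV_cong]) (use assms in \<open>auto intro!: derivative_eq_intros\<close>)
  qed (use assms kernel_nonneg[OF assms] in auto)
  moreover have "(\<lambda>x. (hat ((x - y) / \<epsilon> + 1) / \<epsilon>) * indicator {y - \<epsilon>..y} x) =
      (\<lambda>x. hat ((x - y) / \<epsilon> + 1) / \<epsilon>)"
    using kernel_eq_0[OF assms, of y] by (intro ext) (simp add: indicator_def not_le, force)
  ultimately show "(\<integral>\<^sup>+x. ennreal (hat ((x - y) / \<epsilon> + 1) / \<epsilon>) \<partial>lborel) = 1"
    using assms kernel_nonneg[OF assms]
    by (subst nn_integral_eq_integral)
       (auto simp add: has_bochner_integral_iff sstep_eq simp del: integral_divide_zero times_divide_eq_left)
qed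

text \<open>The kernel is a probability density on (x, x + \<epsilon>), so only the values of
  \<open>v\<close> there matter. This one estimate supplies sup bounds (\<open>c = 0\<close>),
  vanishing (\<open>d = 0\<close>) and convergence where \<open>v\<close> is continuous.\<close>

lemma mol_const_diff:
  assumes "integrable lborel v" "0 < \<epsilon>" "\<And>y. x < y \<Longrightarrow> y < x + \<epsilon> \<Longrightarrow> \<bar>v y - c\<bar> \<le> d"
  shows "\<bar>mol \<epsilon> v x - c\<bar> \<le> d"
proof -
  let ?k = "\<lambda>y. hat ((x - y) / \<epsilon> + 1) / \<epsilon>"
  have k: "integrable lborel ?k" "(LINT y|lborel. ?k y) = 1"
    using kernel_integral[OF assms(2), of x] by (auto simp: has_bochner_integral_iff)
  have eq: "mol \<epsilon> v x - c = (LINT y|lborel. ?k y * v y - ?k y * c)"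
    unfolding mol_def using k(2)
    by (subst Bochner_Integration.integral_diff[OF integrable_mol[OF assms(1,2), of x] integrable_mult_left[OF k(1)]])
       (simp only: Bochner_Integration.integral_mult_left_zero mult_1_left)
  have le: "\<bar>LINT y|lborel. ?k y * v y - ?k y * c\<bar> \<le> (LINT y|lborel. ?k y * d)"
  proof (rule integral_abs_bound_integral)
    show "integrable lborel (\<lambda>y. ?k y * v y - ?k y * c)"
      using k(1) integrable_mol[OF assms(1,2), of x] by (intro Bochner_Integration.integrable_diff integrable_mult_left)
    show "integrable lborel (\<lambda>y. ?k y * d)" by (rule integrable_mult_left) (rule k(1))
    fix y
    have "\<bar>?k y\<bar> * \<bar>v y - c\<bar> \<le> ?k y * d"
    proof (cases "x < y \<and> y < x + \<epsilon>")
      case True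
      then show ?thesis using assms(3)[of y] kernel_nonneg[OF assms(2), of "(x - y) / \<epsilon> + 1"]
        by (simp only: abs_of_nonneg mult_left_mono)
    next
      case False
      then show ?thesis using kernel_eq_0[OF assms(2), of y x] by auto
    qed
    then show "\<bar>?k y * v y - ?k y * c\<bar> \<le> ?k y * d"
      unfolding abs_mult[symmetric] right_diff_distrib .
  qed
  show ?thesis using le unfolding eq by (simp only: Bochner_Integration.integral_mult_left_zero k(2) mult_1_left)
qed

lemma mol_diff:
  assumes "integrable lborel v" "integrable lborel w" "0 < \<epsilon>"
  shows "mol \<epsilon> (\<lambda>y. v y - w y) x = mol \<epsilon> v x - mol \<epsilon> w x"
  unfolding mol_def using integrable_mol[OF assms(1,3), of x] integrable_mol[OF assms(2,3), of x]
  by (subst Bochner_Integration.integral_diff[symmetric]) (auto simp: right_diff_distrib)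

lemma mol_L1_bound:
  assumes "integrable lborel v" "0 < \<epsilon>"
  shows "\<bar>mol \<epsilon> v x\<bar> \<le> 2 / \<epsilon> * (LINT y|lborel. \<bar>v y\<bar>)"
proof -
  have "\<bar>mol \<epsilon> v x\<bar> \<le> (LINT y|lborel. 2 / \<epsilon> * \<bar>v y\<bar>)"
    unfolding mol_def
  proof (rule integral_abs_bound_integral)
    fix y show "\<bar>hat ((x - y) / \<epsilon> + 1) / \<epsilon> * v y\<bar> \<le> 2 / \<epsilon> * \<bar>v y\<bar>"
      unfolding abs_mult using kernel_nonneg[OF assms(2)] kernel_le[OF assms(2)]
      by (intro mult_right_mono) (simp_all only: abs_of_nonneg abs_ge_zero)
  qed (use assms integrable_mol in auto)
  then show ?thesis by simp
qed

lemma mol_Lipschitz: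
  assumes "integrable lborel v" "0 < \<epsilon>"
  shows "\<bar>mol \<epsilon> v x - mol \<epsilon> v z\<bar> \<le> 16 / \<epsilon>\<^sup>2 * (LINT y|lborel. \<bar>v y\<bar>) * \<bar>x - z\<bar>"
proof -
  have eq: "mol \<epsilon> v x - mol \<epsilon> v z = (LINT y|lborel. hat ((x - y) / \<epsilon> + 1) / \<epsilon> * v y - hat ((z - y) / \<epsilon> + 1) / \<epsilon> * v y)"
    unfolding mol_def using integrable_mol[OF assms, of x] integrable_mol[OF assms, of z] by simp
  have le: "\<bar>LINT y|lborel. hat ((x - y) / \<epsilon> + 1) / \<epsilon> * v y - hat ((z - y) / \<epsilon> + 1) / \<epsilon> * v y\<bar> \<le> (LINT y|lborel. 16 / \<epsilon>\<^sup>2 * \<bar>x - z\<bar> * \<bar>v y\<bar>)"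
  proof (rule integral_abs_bound_integral)
    fix y
    have "\<bar>hat ((x - y) / \<epsilon> + 1) - hat ((z - y) / \<epsilon> + 1)\<bar> \<le> 16 * \<bar>(x - z) / \<epsilon>\<bar>"
      using hat_Lipschitz[of "(x - y) / \<epsilon> + 1" "(z - y) / \<epsilon> + 1"] by (simp add: diff_divide_distrib)
    then have "\<bar>hat ((x - y) / \<epsilon> + 1) - hat ((z - y) / \<epsilon> + 1)\<bar> / \<epsilon> * \<bar>v y\<bar> \<le> 16 * \<bar>(x - z) / \<epsilon>\<bar> / \<epsilon> * \<bar>v y\<bar>"
      using assms by (intro mult_right_mono divide_right_mono) auto
    moreover have "hat ((x - y) / \<epsilon> + 1) / \<epsilon> * v y - hat ((z - y) / \<epsilon> + 1) / \<epsilon> * v y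
       = (hat ((x - y) / \<epsilon> + 1) - hat ((z - y) / \<epsilon> + 1)) / \<epsilon> * v y"
      by (simp add: left_diff_distrib diff_divide_distrib)
    then have "\<bar>hat ((x - y) / \<epsilon> + 1) / \<epsilon> * v y - hat ((z - y) / \<epsilon> + 1) / \<epsilon> * v y\<bar>
       = \<bar>hat ((x - y) / \<epsilon> + 1) - hat ((z - y) / \<epsilon> + 1)\<bar> / \<epsilon> * \<bar>v y\<bar>"
      using assms by (simp add: abs_mult)
    moreover have "16 * \<bar>(x - z) / \<epsilon>\<bar> / \<epsilon> * \<bar>v y\<bar> = 16 / \<epsilon>\<^sup>2 * \<bar>x - z\<bar> * \<bar>v y\<bar>"
      using assms by (simp add: power2_eq_square)
    ultimately show "\<bar>hat ((x - y) / \<epsilon> + 1) / \<epsilon> * v y - hat ((z - y) / \<epsilon> + 1) / \<epsilon> * v y\<bar> \<le> 16 / \<epsilon>\<^sup>2 * \<bar>x - z\<bar> * \<bar>v y\<bar>"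
      by linarith
  qed (use assms integrable_mol in auto)
  show ?thesis using le unfolding eq Bochner_Integration.integral_mult_right_zero
    by (simp only: ac_simps)
qed

text \<open>The smooth step and the indicator of \<open>{..x}\<close> agree except on an interval of
  length \<epsilon>, where they differ by at most 1.\<close>

lemma mol_prim_close:
  assumes "integrable lborel v" "0 < \<epsilon>" "\<And>y. \<bar>v y\<bar> \<le> B"
  shows "\<bar>mol_prim \<epsilon> v x - (LINT y:{..x}|lborel. v y)\<bar> \<le> B * \<epsilon>"
proof -
  have s: "integrable lborel (\<lambda>y. indicator {..x} y *\<^sub>R v y)"
    using assms(1) by (intro integrable_mult_indicator) auto
  have "mol_prim \<epsilon> v x - (LINT y:{..x}|lborel. v y) =
     (LINT y|lborel. sstep ((x - y) / \<epsilon> + 1) * v y - indicator {..x} y *\<^sub>R v y)"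
    unfolding mol_prim_def set_lebesgue_integral_def
    by (rule Bochner_Integration.integral_diff[symmetric]) (use s integrable_mol_prim[OF assms(1)] in auto)
  also have "\<bar>LINT y|lborel. sstep ((x - y) / \<epsilon> + 1) * v y - indicator {..x} y *\<^sub>R v y\<bar>
    \<le> (LINT y|lborel. B * indicator {x..x+\<epsilon>} y)"
  proof (rule integral_abs_bound_integral)
    fix y
    have B: "0 \<le> B" using assms(3)[of 0] by linarith
    consider "y \<le> x" | "x < y" "y < x + \<epsilon>" | "x + \<epsilon> \<le> y" by linarith
    then show "\<bar>sstep ((x - y) / \<epsilon> + 1) * v y - indicator {..x} y *\<^sub>R v y\<bar> \<le> B * indicator {x..x+\<epsilon>} y"
    proof cases
      case 1 then show ?thesis using assms B by (simp add: sstep_ge_1)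
    next
      case 2
      have "\<bar>sstep ((x - y) / \<epsilon> + 1)\<bar> * \<bar>v y\<bar> \<le> 1 * B"
        using sstep_nonneg sstep_le_1 assms(3) B by (intro mult_mono) auto
      then show ?thesis using 2 by (simp add: abs_mult)
    next
      case 3
      have "(x - y) / \<epsilon> + 1 \<le> 0" using 3 assms(2) by (simp add: field_simps)
      then show ?thesis using 3 B assms(2) by (simp add: sstep_le_0)
    qed
  qed (use s integrable_mol_prim[OF assms(1)] assms(2) in auto)
  also have "\<dots> = B * \<epsilon>" using assms(2) by simp
  finally show ?thesis .
qed

lemma measurable_mol [measurable]:
  assumes [measurable]: "(\<lambda>(t, y). v t y) \<in> borel_measurable (M \<Otimes>\<^sub>M lborel)" "f \<in> measurable M borel"
  shows "(\<lambda>t. mol \<epsilon> (v t) (f t)) \<in> borel_measurable M"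
proof -
  have "(\<lambda>(t, y). hat ((f t - y) / \<epsilon> + 1) / \<epsilon> * v t y) \<in> borel_measurable (M \<Otimes>\<^sub>M lborel)"
    by measurable
  from lborel.borel_measurable_lebesgue_integral[OF this] show ?thesis
    unfolding mol_def by simp
qed

text \<open>Tonelli's theorem, because the kernel has mass 1 also as a function of x for fixed
  y.\<close>

lemma mol_L1_contraction:
  assumes v: "integrable lborel v" and e: "0 < \<epsilon>"
  shows "(\<integral>\<^sup>+x. ennreal \<bar>mol \<epsilon> v x\<bar> \<partial>lborel) \<le> (\<integral>\<^sup>+x. ennreal \<bar>v x\<bar> \<partial>lborel)"
proof -
  have [measurable]: "v \<in> borel_measurable borel" using borel_measurable_integrable[OF v] by simp
  have "(\<integral>\<^sup>+x. ennreal \<bar>mol \<epsilon> v x\<bar> \<partial>lborel) \<le>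
     (\<integral>\<^sup>+x. (\<integral>\<^sup>+y. ennreal (hat ((x - y) / \<epsilon> + 1) / \<epsilon>) * ennreal \<bar>v y\<bar> \<partial>lborel) \<partial>lborel)"
  proof (rule nn_integral_mono)
    fix x
    have "ennreal \<bar>mol \<epsilon> v x\<bar> \<le> (\<integral>\<^sup>+y. ennreal \<bar>hat ((x - y) / \<epsilon> + 1) / \<epsilon> * v y\<bar> \<partial>lborel)"
      using integral_norm_bound_ennreal[OF integrable_mol[OF v e, of x]] by (simp add: mol_def)
    also have "\<dots> = (\<integral>\<^sup>+y. ennreal (hat ((x - y) / \<epsilon> + 1) / \<epsilon>) * ennreal \<bar>v y\<bar> \<partial>lborel)"
      using kernel_nonneg[OF e]
      by (intro nn_integral_cong) (simp only: abs_mult abs_of_nonneg ennreal_mult abs_ge_zero)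
    finally show "ennreal \<bar>mol \<epsilon> v x\<bar> \<le> \<dots>" .
  qed
  also have "\<dots> = (\<integral>\<^sup>+y. (\<integral>\<^sup>+x. ennreal (hat ((x - y) / \<epsilon> + 1) / \<epsilon>) * ennreal \<bar>v y\<bar> \<partial>lborel) \<partial>lborel)"
    by (rule lborel_pair.Fubini') measurable
  also have "\<dots> = (\<integral>\<^sup>+y. ennreal \<bar>v y\<bar> \<partial>lborel)"
    by (intro nn_integral_cong) (subst nn_integral_multc, use kernel_nn_integral(2)[OF e] in auto)
  finally show ?thesis .
qed

lemma tendsto_zero_ennrealI:
  fixes f :: "'a \<Rightarrow> ennreal"
  assumes "\<And>e. 0 < e \<Longrightarrow> eventually (\<lambda>n. f n \<le> ennreal e) F"
  shows "(f \<longlongrightarrow> 0) F"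
proof (rule order_tendstoI)
  fix a :: ennreal assume "0 < a"
  then obtain z where z: "0 < z" "z < a" using dense by blast
  then obtain e where e: "z = ennreal e" "0 < e"
    by (cases z) (auto simp: top_unique ennreal_less_zero_iff)
  from assms[OF e(2)] show "eventually (\<lambda>n. f n < a) F"
    by (rule eventually_mono) (use e z in auto)
qed auto

text \<open>The predicate \<open>measurable_on\<close> provides continuous functions that converge
  almost everywhere. Clipping their values at \<open>B\<close> and multiplying by a cutoff equal to
  1 on [-R, R] leaves the limit unchanged and yields the domination.\<close>

lemma L1_approx_continuous:
  fixes v :: "real \<Rightarrow> real"
  assumes [measurable]: "v \<in> borel_measurable borel" and B: "\<And>y. \<bar>v y\<bar> \<le> B"
    and R: "\<And>y. R < \<bar>y\<bar> \<Longrightarrow> v y = 0" and e: "0 < (e::real)"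
  obtains w where "continuous_on UNIV w" "\<And>y. \<bar>w y\<bar> \<le> B" "\<And>y. R + 1 < \<bar>y\<bar> \<Longrightarrow> w y = 0"
    "(\<integral>\<^sup>+x. ennreal \<bar>v x - w x\<bar> \<partial>lborel) \<le> ennreal e"
proof -
  have B0: "0 \<le> B" using B[of 0] by linarith
  have "v measurable_on UNIV"
    by (rule lebesgue_measurable_imp_measurable_on_real) (auto intro: measurable_completion)
  then obtain N g where N: "negligible N" and g: "\<And>n. continuous_on UNIV (g n)"
    and lim: "\<And>x. x \<notin> N \<Longrightarrow> (\<lambda>n. g n x) \<longlonglongrightarrow> v x"
    unfolding measurable_on_def by auto
  define w where "w n x = max 0 (min 1 (R + 1 - \<bar>x\<bar>)) * max (-B) (min B (g n x))" for n :: nat and x :: real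
  have cw: "continuous_on UNIV (w n)" for n
    unfolding w_def by (intro continuous_intros g)
  have wB: "\<bar>w n y\<bar> \<le> B" for n y
  proof -
    have "\<bar>max 0 (min 1 r)\<bar> \<le> 1" "\<bar>max (-B) (min B r)\<bar> \<le> B" for r :: real
      using B0 by (auto simp: abs_le_iff)
    then have "\<bar>max 0 (min 1 (R + 1 - \<bar>y\<bar>))\<bar> * \<bar>max (-B) (min B (g n y))\<bar> \<le> 1 * B"
      by (intro mult_mono) (assumption | simp)+
    then show ?thesis unfolding w_def abs_mult by (simp only: mult_1_left)
  qed
  have w0: "w n y = 0" if "R + 1 < \<bar>y\<bar>" for n y
    using that by (simp add: w_def)
  have [measurable]: "w n \<in> borel_measurable borel" for n
    by (rule borel_measurable_continuous_onI[OF cw])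
  have "(\<lambda>n. \<integral>\<^sup>+x. ennreal \<bar>v x - w n x\<bar> \<partial>lborel) \<longlonglongrightarrow> (\<integral>\<^sup>+x. 0 \<partial>(lborel :: real measure))"
  proof (rule nn_integral_dominated_convergence[where u' = "\<lambda>x. 0" and w = "\<lambda>x. ennreal (2 * B) * indicator {-\<bar>R\<bar>-1..\<bar>R\<bar>+1} x"])
    show "AE x in lborel. ennreal \<bar>v x - w j x\<bar> \<le> ennreal (2 * B) * indicator {-\<bar>R\<bar>-1..\<bar>R\<bar>+1} x" for j
    proof (rule AE_I2)
      fix x
      show "ennreal \<bar>v x - w j x\<bar> \<le> ennreal (2 * B) * indicator {-\<bar>R\<bar>-1..\<bar>R\<bar>+1} x"
      proof (cases "x \<in> {-\<bar>R\<bar>-1..\<bar>R\<bar>+1}")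
        case True
        have "\<bar>v x - w j x\<bar> \<le> 2 * B" using B[of x] wB[of j x] by linarith
        with True show ?thesis by (simp add: ennreal_leI)
      next
        case False
        then have "R < \<bar>x\<bar>" "R + 1 < \<bar>x\<bar>" by auto
        then have "v x = 0" "w j x = 0" using R[of x] w0[of x j] by auto
        then show ?thesis by simp
      qed
    qed
    show "(\<integral>\<^sup>+x. ennreal (2 * B) * indicator {-\<bar>R\<bar>-1..\<bar>R\<bar>+1} x \<partial>lborel) < \<infinity>"
      by (subst nn_integral_cmult_indicator) (auto simp: ennreal_mult_less_top)
    have "AE x in lborel. x \<notin> N"
    proof -
      have "N \<in> null_sets lebesgue" using N negligible_iff_null_sets by blast
      then have "AE x in lebesgue. x \<notin> N" by (rule AE_not_in)
      then show ?thesis by (simp only: AE_completion_iff)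
    qed
    then show "AE x in lborel. (\<lambda>n. ennreal \<bar>v x - w n x\<bar>) \<longlonglongrightarrow> 0"
    proof (rule AE_mp, intro AE_I2 impI)
      fix x assume "x \<notin> N"
      have "(\<lambda>n. w n x) \<longlonglongrightarrow> max 0 (min 1 (R + 1 - \<bar>x\<bar>)) * max (-B) (min B (v x))"
        unfolding w_def by (intro tendsto_intros lim \<open>x \<notin> N\<close>)
      moreover have "max 0 (min 1 (R + 1 - \<bar>x\<bar>)) * max (-B) (min B (v x)) = v x"
        using B[of x] R[of x] by (cases "R < \<bar>x\<bar>") auto
      ultimately have "(\<lambda>n. \<bar>v x - w n x\<bar>) \<longlonglongrightarrow> \<bar>v x - v x\<bar>"
        by (intro tendsto_intros) simp
      then have "(\<lambda>n. ennreal \<bar>v x - w n x\<bar>) \<longlonglongrightarrow> ennreal \<bar>v x - v x\<bar>"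
        by (rule tendsto_ennrealI)
      then show "(\<lambda>n. ennreal \<bar>v x - w n x\<bar>) \<longlonglongrightarrow> 0" by simp
    qed
  qed auto
  then have "(\<lambda>n. \<integral>\<^sup>+x. ennreal \<bar>v x - w n x\<bar> \<partial>lborel) \<longlonglongrightarrow> 0" by simp
  then have "eventually (\<lambda>n. (\<integral>\<^sup>+x. ennreal \<bar>v x - w n x\<bar> \<partial>lborel) < ennreal e) sequentially"
    by (rule order_tendstoD) (use e in simp)
  then obtain n where "(\<integral>\<^sup>+x. ennreal \<bar>v x - w n x\<bar> \<partial>lborel) < ennreal e"
    by (auto simp: eventually_sequentially)
  then show thesis by (intro that[OF cw wB w0] less_imp_le)
qed

lemma integrable_bounded_support:
  fixes v :: "real \<Rightarrow> real"
  assumes [measurable]: "v \<in> borel_measurable borel" and B: "\<And>y. \<bar>v y\<bar> \<le> B"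
    and R: "\<And>y. R < \<bar>y\<bar> \<Longrightarrow> v y = 0"
  shows "integrable lborel v"
proof (rule Bochner_Integration.integrable_bound)
  show "integrable lborel (\<lambda>x. B * indicator {-R..R} x :: real)"
    by (intro integrable_mult_right integrable_real_indicator) (auto simp: emeasure_lborel_Icc_eq)
  show "AE x in lborel. norm (v x) \<le> norm (B * indicator {-R..R} x :: real)"
  proof (rule AE_I2)
    fix x show "norm (v x) \<le> norm (B * indicator {-R..R} x :: real)"
    proof (cases "R < \<bar>x\<bar>")
      case True
      then show ?thesis by (simp add: R)
    next
      case False
      then have "x \<in> {-R..R}" by auto
      then show ?thesis using B[of x] by simp
    qed
  qed
qed simp

text \<open>A three-term estimate with a continuous \<open>w\<close> close to \<open>v\<close>: the
  contraction property controls the mollified difference, uniform continuity controls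
  \<open>mol\<close> applied to \<open>w\<close> against \<open>w\<close> itself.\<close>

lemma mol_tendsto_L1:
  assumes v[measurable]: "v \<in> borel_measurable borel" and B: "\<And>y. \<bar>v y\<bar> \<le> B"
    and R: "\<And>y. R < \<bar>y\<bar> \<Longrightarrow> v y = 0"
    and \<epsilon>: "\<And>n. 0 < \<epsilon> n" "\<epsilon> \<longlonglongrightarrow> 0"
  shows "(\<lambda>n. \<integral>\<^sup>+x. ennreal \<bar>mol (\<epsilon> n) v x - v x\<bar> \<partial>lborel) \<longlonglongrightarrow> 0"
proof (rule tendsto_zero_ennrealI)
  fix e :: real assume e: "0 < e"
  then have e3: "0 < e / 3" by simp
  obtain w where cw: "continuous_on UNIV w" and wB: "\<And>y. \<bar>w y\<bar> \<le> B"
    and w0: "\<And>y. R + 1 < \<bar>y\<bar> \<Longrightarrow> w y = 0"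
    and vw: "(\<integral>\<^sup>+x. ennreal \<bar>v x - w x\<bar> \<partial>lborel) \<le> ennreal (e / 3)"
    by (rule L1_approx_continuous[where R = R, OF v B R e3]) (assumption | rule that)+
  have [measurable]: "w \<in> borel_measurable borel"
    by (rule borel_measurable_continuous_onI[OF cw])
  have iv: "integrable lborel v" by (rule integrable_bounded_support[OF v B R])
  have iw: "integrable lborel w" by (rule integrable_bounded_support[OF _ wB w0]) auto
  \<comment> \<open>\<open>w\<close> vanishes beyond R + 1 and \<open>mol\<close> looks at most 1 to
    the right, so the mollification error of \<open>w\<close> vanishes outside [-X, X]. The
    tolerance \<open>d\<close> makes the contribution from inside equal to e/3.\<close>
  define X where "X = \<bar>R\<bar> + 3"
  define d where "d = e / 3 / (2 * X)"
  have X: "0 < X" unfolding X_def by linarith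
  then have d: "0 < d" unfolding d_def using e by simp
  have "uniformly_continuous_on {-X-1..X+1} w"
    by (intro compact_uniformly_continuous continuous_on_subset[OF cw]) auto
  then obtain r where r: "0 < r" and rw: "\<And>x y. x \<in> {-X-1..X+1} \<Longrightarrow> y \<in> {-X-1..X+1} \<Longrightarrow> \<bar>y - x\<bar> < r \<Longrightarrow> \<bar>w y - w x\<bar> < d"
    unfolding uniformly_continuous_on_def dist_real_def using d by metis
  have "eventually (\<lambda>n. \<epsilon> n < min r 1) sequentially"
    by (rule order_tendstoD[OF \<epsilon>(2)]) (use r in simp)
  then show "\<forall>\<^sub>F n in sequentially. (\<integral>\<^sup>+x. ennreal \<bar>mol (\<epsilon> n) v x - v x\<bar> \<partial>lborel) \<le> ennreal e"
  proof (rule eventually_mono)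
    fix n assume n: "\<epsilon> n < min r 1"
    have e0: "0 < \<epsilon> n" by (rule \<epsilon>)
    have vwi: "integrable lborel (\<lambda>x. v x - w x)" using iv iw by simp
    have mw: "\<bar>mol (\<epsilon> n) w x - w x\<bar> \<le> d * indicator {-X..X} x" for x
    proof (cases "x \<in> {-X..X}")
      case True
      have "\<bar>mol (\<epsilon> n) w x - w x\<bar> \<le> d"
        by (rule mol_const_diff[OF iw e0], rule less_imp_le, rule rw) (use True n in auto)
      with True show ?thesis by simp
    next
      case False
      then have "\<bar>x\<bar> > X" by auto
      have "\<bar>mol (\<epsilon> n) w x - 0\<bar> \<le> 0"
      proof (rule mol_const_diff[OF iw e0])
        fix y assume "x < y" "y < x + \<epsilon> n"
        then have "R + 1 < \<bar>y\<bar>" using n \<open>\<bar>x\<bar> > X\<close> unfolding X_def by linarith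
        then show "\<bar>w y - 0\<bar> \<le> 0" using w0 by simp
      qed
      moreover have "w x = 0" by (rule w0) (use \<open>\<bar>x\<bar> > X\<close> in \<open>simp add: X_def\<close>)
      ultimately show ?thesis using False by simp
    qed
    have "(\<integral>\<^sup>+x. ennreal \<bar>mol (\<epsilon> n) v x - v x\<bar> \<partial>lborel) \<le>
      (\<integral>\<^sup>+x. ennreal \<bar>mol (\<epsilon> n) (\<lambda>x. v x - w x) x\<bar> + (ennreal \<bar>v x - w x\<bar> + ennreal d * indicator {-X..X} x) \<partial>lborel)"
    proof (rule nn_integral_mono)
      fix x
      have "\<bar>mol (\<epsilon> n) v x - v x\<bar> \<le> \<bar>mol (\<epsilon> n) (\<lambda>x. v x - w x) x\<bar> + (\<bar>v x - w x\<bar> + d * indicator {-X..X} x)"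
        unfolding mol_diff[OF iv iw e0] using mw[of x] by linarith
      then have "ennreal \<bar>mol (\<epsilon> n) v x - v x\<bar> \<le> ennreal (\<bar>mol (\<epsilon> n) (\<lambda>x. v x - w x) x\<bar> + (\<bar>v x - w x\<bar> + d * indicator {-X..X} x))"
        by (rule ennreal_leI)
      also have "\<dots> = ennreal \<bar>mol (\<epsilon> n) (\<lambda>x. v x - w x) x\<bar> + (ennreal \<bar>v x - w x\<bar> + ennreal d * indicator {-X..X} x)"
        using d by (cases "x \<in> {-X..X}") (simp_all add: ennreal_plus)
      finally show "ennreal \<bar>mol (\<epsilon> n) v x - v x\<bar> \<le> \<dots>" .
    qed
    also have "\<dots> = (\<integral>\<^sup>+x. ennreal \<bar>mol (\<epsilon> n) (\<lambda>x. v x - w x) x\<bar> \<partial>lborel) + ((\<integral>\<^sup>+x. ennreal \<bar>v x - w x\<bar> \<partial>lborel) + ennreal d * ennreal (2 * X))"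
      using X by (subst nn_integral_add, measurable)
        (subst nn_integral_add, auto simp: nn_integral_cmult_indicator)
    also have "\<dots> \<le> ennreal (e/3) + (ennreal (e/3) + ennreal d * ennreal (2 * X))"
      by (intro add_mono order_refl vw order_trans[OF mol_L1_contraction[OF vwi e0] vw])
    also have "\<dots> = ennreal e"
    proof -
      have "d * (2 * X) = e / 3" using X by (simp add: d_def)
      moreover have "ennreal d * ennreal (2 * X) = ennreal (d * (2 * X))"
        using d X by (intro ennreal_mult[symmetric]) auto
      ultimately have "ennreal d * ennreal (2 * X) = ennreal (e / 3)" by (simp only:)
      moreover have "ennreal (e/3) + (ennreal (e/3) + ennreal (e/3)) = ennreal (e/3 + (e/3 + e/3))"
        by (metis ennreal_plus add_nonneg_nonneg e3 less_imp_le)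
      moreover have "e/3 + (e/3 + e/3) = e" by simp
      ultimately show ?thesis by (simp only:)
    qed
    finally show "(\<integral>\<^sup>+x. ennreal \<bar>mol (\<epsilon> n) v x - v x\<bar> \<partial>lborel) \<le> ennreal e" .
  qed
qed

section \<open>Hopf-Lax functions\<close>

text \<open>The increment is split at the corner (t, x + h q) into a step in time and a step in
  space. Each is compared with the partial derivative at (t, x) by the mean value inequality, where
  continuity keeps the derivatives within \<open>e'\<close>.\<close>

lemma DERIV_along_line:
  fixes \<Phi> :: "real \<Rightarrow> real \<Rightarrow> real"
  assumes S: "open S" "(t, x) \<in> S"
    and dt: "\<And>t x. (t, x) \<in> S \<Longrightarrow> ((\<lambda>s. \<Phi> s x) has_real_derivative \<Phi>t (t, x)) (at t)"
    and dx: "\<And>t x. (t, x) \<in> S \<Longrightarrow> ((\<lambda>y. \<Phi> t y) has_real_derivative \<Phi>x (t, x)) (at x)"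
    and ct: "continuous_on S \<Phi>t" and cx: "continuous_on S \<Phi>x"
  shows "((\<lambda>h. \<Phi> (t + h) (x + h * q)) has_real_derivative \<Phi>t (t, x) + q * \<Phi>x (t, x)) (at 0)"
proof -
  have ict: "isCont \<Phi>t (t, x)" and icx: "isCont \<Phi>x (t, x)"
    using ct cx S by (auto simp: continuous_on_eq_continuous_at)
  have "((\<lambda>h. (\<Phi> (t + h) (x + h * q) - \<Phi> t x) / h - (\<Phi>t (t, x) + q * \<Phi>x (t, x))) \<longlongrightarrow> 0) (at 0)"
  proof (rule LIM_I)
    fix e :: real assume e: "0 < e"
    define c where "c = 1 + \<bar>q\<bar>"
    define e' where "e' = e / 2 / c"
    have "0 < c" unfolding c_def by linarith
    then have e': "0 < e'" and "e' * c < e" using e by (auto simp: e'_def)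
    then have ee: "e' * (1 + \<bar>q\<bar>) < e" by (simp add: c_def)
    obtain d1 where d1: "0 < d1" "\<And>z. dist z (t, x) < d1 \<Longrightarrow> \<bar>\<Phi>t z - \<Phi>t (t, x)\<bar> \<le> e'"
      using ict e' unfolding continuous_at_eps_delta dist_real_def by (meson less_imp_le)
    obtain d2 where d2: "0 < d2" "\<And>z. dist z (t, x) < d2 \<Longrightarrow> \<bar>\<Phi>x z - \<Phi>x (t, x)\<bar> \<le> e'"
      using icx e' unfolding continuous_at_eps_delta dist_real_def by (meson less_imp_le)
    obtain d3 where d3: "0 < d3" "ball (t, x) d3 \<subseteq> S"
      using S by (auto simp: open_contains_ball)
    define d where "d = min d1 (min d2 d3)"
    have d: "0 < d" using d1 d2 d3 by (simp add: d_def)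
    have near: "(s, y) \<in> S \<and> \<bar>\<Phi>t (s, y) - \<Phi>t (t, x)\<bar> \<le> e' \<and> \<bar>\<Phi>x (s, y) - \<Phi>x (t, x)\<bar> \<le> e'"
      if "\<bar>s - t\<bar> + \<bar>y - x\<bar> < d" for s y
    proof -
      have "dist (s, y) (t, x) \<le> \<bar>s - t\<bar> + \<bar>y - x\<bar>"
        by (simp add: dist_Pair_Pair dist_real_def sqrt_sum_squares_le_sum_abs)
      then have "dist (s, y) (t, x) < d1" "dist (s, y) (t, x) < d2" "dist (s, y) (t, x) < d3"
        using that unfolding d_def by linarith+
      moreover have "(s, y) \<in> ball (t, x) d3" using calculation(3) by (simp add: dist_commute)
      ultimately show ?thesis using d1 d2 d3 by blast
    qed
    show "\<exists>s>0. \<forall>h. h \<noteq> 0 \<and> norm (h - 0) < s \<longrightarrow>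
      norm ((\<Phi> (t + h) (x + h * q) - \<Phi> t x) / h - (\<Phi>t (t, x) + q * \<Phi>x (t, x)) - 0) < e"
    proof (intro exI[of _ "d / (1 + \<bar>q\<bar>)"] conjI allI impI)
      show "0 < d / (1 + \<bar>q\<bar>)" using d by (simp add: add_pos_nonneg)
      fix h :: real assume h: "h \<noteq> 0 \<and> norm (h - 0) < d / (1 + \<bar>q\<bar>)"
      have "\<bar>h\<bar> < d / (1 + \<bar>q\<bar>)" using h by simp
      then have "\<bar>h\<bar> * (1 + \<bar>q\<bar>) < d" by (simp add: pos_less_divide_eq add_pos_nonneg)
      then have hd: "\<bar>h\<bar> + \<bar>h * q\<bar> < d" by (simp add: abs_mult algebra_simps)
      define y where "y = x + h * q"
      have 1: "norm ((\<Phi> (t + h) y - (t + h) * \<Phi>t (t, x)) - (\<Phi> t y - t * \<Phi>t (t, x))) \<le> e' * norm ((t + h) - t)"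
      proof (rule field_differentiable_bound[where S = "closed_segment t (t + h)" and f' = "\<lambda>s. \<Phi>t (s, y) - \<Phi>t (t, x)"])
        fix s assume "s \<in> closed_segment t (t + h)"
        then have "\<bar>s - t\<bar> \<le> \<bar>h\<bar>" by (auto simp: closed_segment_eq_real_ivl split: if_splits)
        then have "\<bar>s - t\<bar> + \<bar>y - x\<bar> < d" using hd by (simp add: y_def)
        note n = near[OF this]
        show "((\<lambda>s. \<Phi> s y - s * \<Phi>t (t, x)) has_real_derivative \<Phi>t (s, y) - \<Phi>t (t, x)) (at s within closed_segment t (t + h))"
          using n by (auto intro!: derivative_eq_intros dt[THEN has_field_derivative_at_within])
        show "norm (\<Phi>t (s, y) - \<Phi>t (t, x)) \<le> e'" using n by simp
      qed auto
      have 2: "norm ((\<Phi> t y - y * \<Phi>x (t, x)) - (\<Phi> t x - x * \<Phi>x (t, x))) \<le> e' * norm (y - x)"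
      proof (rule field_differentiable_bound[where S = "closed_segment x y" and f' = "\<lambda>z. \<Phi>x (t, z) - \<Phi>x (t, x)"])
        fix z assume "z \<in> closed_segment x y"
        then have "\<bar>z - x\<bar> \<le> \<bar>y - x\<bar>" by (auto simp: closed_segment_eq_real_ivl split: if_splits)
        then have "\<bar>t - t\<bar> + \<bar>z - x\<bar> < d" using hd by (simp add: y_def)
        note n = near[OF this]
        show "((\<lambda>z. \<Phi> t z - z * \<Phi>x (t, x)) has_real_derivative \<Phi>x (t, z) - \<Phi>x (t, x)) (at z within closed_segment x y)"
          using n by (auto intro!: derivative_eq_intros dx[THEN has_field_derivative_at_within])
        show "norm (\<Phi>x (t, z) - \<Phi>x (t, x)) \<le> e'" using n by simp
      qed auto
      define D where "D = \<Phi> (t + h) y - \<Phi> t x - h * (\<Phi>t (t, x) + q * \<Phi>x (t, x))"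
      have "D = ((\<Phi> (t + h) y - (t + h) * \<Phi>t (t, x)) - (\<Phi> t y - t * \<Phi>t (t, x)))
         + ((\<Phi> t y - y * \<Phi>x (t, x)) - (\<Phi> t x - x * \<Phi>x (t, x)))"
        unfolding D_def y_def by (simp add: algebra_simps)
      then have "\<bar>D\<bar> \<le> e' * \<bar>h\<bar> + e' * \<bar>h * q\<bar>"
        using 1 2 by (simp add: y_def)
      also have "\<dots> = \<bar>h\<bar> * (e' * (1 + \<bar>q\<bar>))" by (simp add: abs_mult algebra_simps)
      also have "\<dots> < \<bar>h\<bar> * e" using ee h by (intro mult_strict_left_mono) auto
      finally have "\<bar>D\<bar> / \<bar>h\<bar> < e" using h by (simp add: divide_less_eq mult.commute)
      moreover have "(\<Phi> (t + h) (x + h * q) - \<Phi> t x) / h - (\<Phi>t (t, x) + q * \<Phi>x (t, x)) = D / h"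
        using h by (simp add: D_def y_def field_simps)
      ultimately show "norm ((\<Phi> (t + h) (x + h * q) - \<Phi> t x) / h - (\<Phi>t (t, x) + q * \<Phi>x (t, x)) - 0) < e"
        by simp
    qed
  qed
  then show ?thesis
    by (simp add: has_field_derivative_iff LIM_zero_iff)
qed

lemma Lipschitz2_continuous:
  fixes H :: "real \<Rightarrow> real \<Rightarrow> real"
  assumes "\<And>t s x y. \<bar>H t x - H s y\<bar> \<le> C * (\<bar>t - s\<bar> + \<bar>x - y\<bar>)"
    and "continuous_on A p" "continuous_on A q"
  shows "continuous_on A (\<lambda>z. H (p z) (q z))"
proof -
  have "((\<lambda>w. H (p w) (q w)) \<longlongrightarrow> H (p z) (q z)) (at z within A)" if "z \<in> A" for z
  proof (rule Lim_transform_bound[THEN LIM_zero_cancel])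
    show "\<forall>\<^sub>F w in at z within A. norm (H (p w) (q w) - H (p z) (q z)) \<le> norm (C * (\<bar>p w - p z\<bar> + \<bar>q w - q z\<bar>))"
      using assms(1) by (intro always_eventually allI) (simp add: order_trans[OF assms(1)])
    have "(p \<longlongrightarrow> p z) (at z within A)" "(q \<longlongrightarrow> q z) (at z within A)"
      using assms(2,3) that by (auto simp: continuous_on_def)
    then show "((\<lambda>w. C * (\<bar>p w - p z\<bar> + \<bar>q w - q z\<bar>)) \<longlongrightarrow> 0) (at z within A)"
      by (auto intro!: tendsto_eq_intros)
  qed
  then show ?thesis by (simp add: continuous_on_def)
qed

lemma sliding_integral_DERIV:
  fixes h :: "real \<Rightarrow> real"
  assumes h: "continuous_on UNIV h" and e: "0 \<le> \<epsilon>"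
  shows "((\<lambda>x. integral {0..\<epsilon>} (\<lambda>r. h (x + r))) has_real_derivative h (x + \<epsilon>) - h x) (at x)"
proof -
  have "\<exists>P. \<forall>x. (-\<infinity> :: ereal) < ereal x \<longrightarrow> ereal x < \<infinity> \<longrightarrow> (P has_vector_derivative h x) (at x)"
    by (rule einterval_antiderivative) (use h in \<open>auto simp: continuous_on_eq_continuous_at\<close>)
  then obtain P where P: "\<And>x. (P has_real_derivative h x) (at x)"
    by (auto simp: has_real_derivative_iff_has_vector_derivative)
  have eq: "integral {0..\<epsilon>} (\<lambda>r. h (x + r)) = P (x + \<epsilon>) - P x" for x
  proof -
    have "((\<lambda>r. h (x + r)) has_integral (P (x + \<epsilon>) - P (x + 0))) {0..\<epsilon>}"
    proof (rule fundamental_theorem_of_calculus[OF e])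
      fix r
      have "((\<lambda>r. P (x + r)) has_real_derivative h (x + r)) (at r)"
        using DERIV_shift[of P "h (x + r)" r x] P[of "x + r"] by (simp add: add.commute)
      then show "((\<lambda>r. P (x + r)) has_vector_derivative h (x + r)) (at r within {0..\<epsilon>})"
        by (simp add: has_real_derivative_iff_has_vector_derivative has_vector_derivative_at_within)
    qed
    then show ?thesis by (simp add: integral_unique)
  qed
  have "((\<lambda>x. P (x + \<epsilon>)) has_real_derivative h (x + \<epsilon>)) (at x)"
    using P[of "x + \<epsilon>"] by (simp add: DERIV_shift)
  then show ?thesis unfolding eq using P[of x] by (intro derivative_intros)
qed

text \<open>Averaging a Lipschitz function that satisfies the one-sided dynamic programming inequality in both
  variables gives a classical subsolution, since this inequality is linear in the function.\<close>
lemma Steklov_average: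
  fixes H :: "real \<Rightarrow> real \<Rightarrow> real"
  assumes Lip: "\<And>t s x y. \<bar>H t x - H s y\<bar> \<le> C * (\<bar>t - s\<bar> + \<bar>x - y\<bar>)"
    and slope: "\<And>t x y. x \<le> y \<Longrightarrow> a * (y - x) \<le> H t y - H t x \<and> H t y - H t x \<le> b * (y - x)"
    and dyn: "\<And>t h x k. 0 \<le> t \<Longrightarrow> 0 \<le> h \<Longrightarrow> k \<in> {a..b} \<Longrightarrow> H (t + h) (x + h * g' k) \<le> H t x + h * (k * g' k - g k)"
    and e: "0 < \<epsilon>"
  obtains \<Phi> \<Phi>t \<Phi>x where
    "\<And>t x. ((\<lambda>s. \<Phi> s x) has_real_derivative \<Phi>t (t, x)) (at t)"
    "\<And>t x. ((\<lambda>y. \<Phi> t y) has_real_derivative \<Phi>x (t, x)) (at x)"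
    "continuous_on UNIV \<Phi>t" "continuous_on UNIV \<Phi>x"
    "\<And>t x. \<Phi>x (t, x) \<in> {a..b}"
    "\<And>t x. \<bar>\<Phi> t x - H t x\<bar> \<le> 2 * C * \<epsilon>"
    "\<And>t x. 0 \<le> t \<Longrightarrow> \<Phi>t (t, x) + g (\<Phi>x (t, x)) \<le> 0"
proof -
  note cH = Lipschitz2_continuous[of H, OF Lip, continuous_intros]
  have C: "0 \<le> C" using Lip[of 1 0 0 0] by simp
  define \<Phi> where "\<Phi> t x = integral {0..\<epsilon>} (\<lambda>s. integral {0..\<epsilon>} (\<lambda>r. H (t + s) (x + r))) / \<epsilon>\<^sup>2" for t x
  define \<Phi>x where "\<Phi>x = (\<lambda>(t, x). integral {0..\<epsilon>} (\<lambda>s. H (t + s) (x + \<epsilon>) - H (t + s) x) / \<epsilon>\<^sup>2)"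
  define \<Phi>t where "\<Phi>t = (\<lambda>(t, x). integral {0..\<epsilon>} (\<lambda>r. H (t + \<epsilon>) (x + r) - H t (x + r)) / \<epsilon>\<^sup>2)"
  \<comment> \<open>With the order of integration exchanged, the inner integral slides in t, so the
    time derivative is found in the same way as the space derivative.\<close>
  have swap: "\<Phi> t x = integral {0..\<epsilon>} (\<lambda>r. integral {0..\<epsilon>} (\<lambda>s. H (t + s) (x + r))) / \<epsilon>\<^sup>2" for t x
  proof -
    have "continuous_on (cbox (0, 0) (\<epsilon>, \<epsilon>)) (\<lambda>(s, r). H (t + s) (x + r))"
      unfolding split_beta by (intro continuous_intros)
    from integral_swap_continuous[OF this] show ?thesis
      unfolding \<Phi>_def by (simp add: cbox_interval)
  qed
  have ci: "continuous_on A (\<lambda>t. integral {0..\<epsilon>} (\<lambda>r. H (t + p) (x + r)))" for A p x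
  proof -
    have "continuous_on A (\<lambda>t. integral (cbox 0 \<epsilon>) (\<lambda>r. H (t + p) (x + r)))"
      by (rule integral_continuous_on_param) (auto simp: split_beta intro!: continuous_intros)
    then show ?thesis by (simp add: cbox_interval)
  qed
  have ci': "continuous_on A (\<lambda>r. integral {0..\<epsilon>} (\<lambda>s. H (t + s) (p + r)))" for A p t
  proof -
    have "continuous_on A (\<lambda>r. integral (cbox 0 \<epsilon>) (\<lambda>s. H (t + s) (p + r)))"
      by (rule integral_continuous_on_param) (auto simp: split_beta intro!: continuous_intros)
    then show ?thesis by (simp add: cbox_interval)
  qed
  have ci'': "continuous_on A (\<lambda>s. integral {0..\<epsilon>} (\<lambda>r. H (t + s) (p + r)))" for A p t
  proof -
    have "continuous_on A (\<lambda>s. integral (cbox 0 \<epsilon>) (\<lambda>r. H (t + s) (p + r)))"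
      by (rule integral_continuous_on_param) (auto simp: split_beta intro!: continuous_intros)
    then show ?thesis by (simp add: cbox_interval)
  qed
  have Dx: "((\<lambda>y. \<Phi> t y) has_real_derivative \<Phi>x (t, x)) (at x)" for t x
  proof -
    have "((\<lambda>y. integral (cbox 0 \<epsilon>) (\<lambda>s. integral {0..\<epsilon>} (\<lambda>r. H (t + s) (y + r)))) has_real_derivative
        integral (cbox 0 \<epsilon>) (\<lambda>s. H (t + s) (x + \<epsilon>) - H (t + s) x)) (at x within UNIV)"
    proof (rule leibniz_rule_field_derivative)
      show "((\<lambda>y. integral {0..\<epsilon>} (\<lambda>r. H (t + s) (y + r))) has_real_derivative H (t + s) (y + \<epsilon>) - H (t + s) y) (at y within UNIV)" for y s
      proof -
        have "continuous_on UNIV (\<lambda>z. H (t + s) z)" by (intro continuous_intros)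
        from sliding_integral_DERIV[OF this, of \<epsilon> y] show ?thesis using e by simp
      qed
      show "(\<lambda>s. integral {0..\<epsilon>} (\<lambda>r. H (t + s) (y + r))) integrable_on cbox 0 \<epsilon>" for y
        by (rule integrable_continuous) (rule ci'')
    qed (auto simp: split_beta intro!: continuous_intros)
    then show ?thesis
      unfolding \<Phi>_def \<Phi>x_def by (simp add: cbox_interval DERIV_cdivide)
  qed
  have Dt: "((\<lambda>s. \<Phi> s x) has_real_derivative \<Phi>t (t, x)) (at t)" for t x
  proof -
    have "((\<lambda>t. integral (cbox 0 \<epsilon>) (\<lambda>r. integral {0..\<epsilon>} (\<lambda>s. H (t + s) (x + r)))) has_real_derivative
        integral (cbox 0 \<epsilon>) (\<lambda>r. H (t + \<epsilon>) (x + r) - H t (x + r))) (at t within UNIV)"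
    proof (rule leibniz_rule_field_derivative)
      show "((\<lambda>t. integral {0..\<epsilon>} (\<lambda>s. H (t + s) (x + r))) has_real_derivative H (t + \<epsilon>) (x + r) - H t (x + r)) (at t within UNIV)" for t r
      proof -
        have "continuous_on UNIV (\<lambda>t. H t (x + r))" by (intro continuous_intros)
        from sliding_integral_DERIV[OF this, of \<epsilon> t] show ?thesis using e by simp
      qed
      show "(\<lambda>r. integral {0..\<epsilon>} (\<lambda>s. H (t + s) (x + r))) integrable_on cbox 0 \<epsilon>" for t
        by (rule integrable_continuous) (rule ci')
    qed (auto simp: split_beta intro!: continuous_intros)
    then show ?thesis
      unfolding swap \<Phi>t_def by (simp add: cbox_interval DERIV_cdivide)
  qed
  have cx: "continuous_on UNIV \<Phi>x"
  proof -
    have "continuous_on UNIV (\<lambda>z. integral (cbox 0 \<epsilon>) (\<lambda>s. H (fst z + s) (snd z + \<epsilon>) - H (fst z + s) (snd z)))"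
      by (rule integral_continuous_on_param) (auto simp: split_beta intro!: continuous_intros)
    then show ?thesis unfolding \<Phi>x_def split_beta using e by (intro continuous_intros) (auto simp: cbox_interval)
  qed
  have ct: "continuous_on UNIV \<Phi>t"
  proof -
    have "continuous_on UNIV (\<lambda>z. integral (cbox 0 \<epsilon>) (\<lambda>r. H (fst z + \<epsilon>) (snd z + r) - H (fst z) (snd z + r)))"
      by (rule integral_continuous_on_param) (auto simp: split_beta intro!: continuous_intros)
    then show ?thesis unfolding \<Phi>t_def split_beta using e by (intro continuous_intros) (auto simp: cbox_interval)
  qed
  have int: "(\<lambda>s. H (p + s) y) integrable_on {0..\<epsilon>}" "(\<lambda>s. H p (y + s)) integrable_on {0..\<epsilon>}" for p y
    by (auto intro!: integrable_continuous_real continuous_intros)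
  have slopes: "\<Phi>x (t, x) \<in> {a..b}" for t x
  proof -
    have i: "(\<lambda>s. H (t + s) (x + \<epsilon>) - H (t + s) x) integrable_on {0..\<epsilon>}"
      by (intro integrable_diff int)
    have "integral {0..\<epsilon>} (\<lambda>s. a * \<epsilon>) \<le> integral {0..\<epsilon>} (\<lambda>s. H (t + s) (x + \<epsilon>) - H (t + s) x)"
      by (rule integral_le[OF _ i]) (use slope[of x "x + \<epsilon>"] e in auto)
    moreover have "integral {0..\<epsilon>} (\<lambda>s. H (t + s) (x + \<epsilon>) - H (t + s) x) \<le> integral {0..\<epsilon>} (\<lambda>s. b * \<epsilon>)"
      by (rule integral_le[OF i]) (use slope[of x "x + \<epsilon>"] e in auto)
    ultimately show ?thesis
      using e by (simp add: \<Phi>x_def field_simps power2_eq_square)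
  qed
  have close: "\<bar>\<Phi> t x - H t x\<bar> \<le> 2 * C * \<epsilon>" for t x
  proof -
    have in1: "\<bar>integral {0..\<epsilon>} (\<lambda>r. H (t + s) (x + r)) - \<epsilon> * H t x\<bar> \<le> 2 * C * \<epsilon> * \<epsilon>" if s: "s \<in> {0..\<epsilon>}" for s
    proof -
      have "norm (integral {0..\<epsilon>} (\<lambda>r. H (t + s) (x + r) - H t x)) \<le> 2 * C * \<epsilon> * (\<epsilon> - 0)"
      proof (rule integral_bound)
        fix r assume "r \<in> {0..\<epsilon>}"
        then have "C * (\<bar>t + s - t\<bar> + \<bar>x + r - x\<bar>) \<le> C * (\<epsilon> + \<epsilon>)"
          using s C by (intro mult_left_mono) auto
        then show "norm (H (t + s) (x + r) - H t x) \<le> 2 * C * \<epsilon>"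
          using Lip[of "t + s" "x + r" t x] by simp
      qed (use e in \<open>auto intro!: continuous_intros\<close>)
      moreover have "integral {0..\<epsilon>} (\<lambda>r. H (t + s) (x + r) - H t x) = integral {0..\<epsilon>} (\<lambda>r. H (t + s) (x + r)) - \<epsilon> * H t x"
        using e by (subst Henstock_Kurzweil_Integration.integral_diff) (auto simp: int)
      ultimately show ?thesis by simp
    qed
    have "norm (integral {0..\<epsilon>} (\<lambda>s. integral {0..\<epsilon>} (\<lambda>r. H (t + s) (x + r)) - \<epsilon> * H t x)) \<le> 2 * C * \<epsilon> * \<epsilon> * (\<epsilon> - 0)"
      by (rule integral_bound) (use e in1 in \<open>auto intro!: continuous_intros ci''\<close>)
    moreover have "integral {0..\<epsilon>} (\<lambda>s. integral {0..\<epsilon>} (\<lambda>r. H (t + s) (x + r)) - \<epsilon> * H t x)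
        = \<epsilon>\<^sup>2 * (\<Phi> t x - H t x)"
    proof -
      have "(\<lambda>s. integral {0..\<epsilon>} (\<lambda>r. H (t + s) (x + r))) integrable_on {0..\<epsilon>}"
        by (intro integrable_continuous_real ci'')
      then show ?thesis
        using e by (subst Henstock_Kurzweil_Integration.integral_diff)
          (auto simp: \<Phi>_def power2_eq_square right_diff_distrib)
    qed
    ultimately have "\<bar>\<epsilon>\<^sup>2 * (\<Phi> t x - H t x)\<bar> \<le> 2 * C * \<epsilon> * \<epsilon> * (\<epsilon> - 0)"
      by (simp only: real_norm_def)
    then have "\<epsilon>\<^sup>2 * \<bar>\<Phi> t x - H t x\<bar> \<le> \<epsilon>\<^sup>2 * (2 * C * \<epsilon>)"
      by (simp add: abs_mult power2_eq_square mult_ac)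
    then show ?thesis using e by simp
  qed
  \<comment> \<open>The direction \<open>g' k\<close> is the same for all shifted copies of
    \<open>H\<close>, so their inequalities can be averaged over the shifts.\<close>
  have step: "\<Phi> (t + h) (x + h * g' k) \<le> \<Phi> t x + h * (k * g' k - g k)"
    if "0 \<le> t" "0 \<le> h" "k \<in> {a..b}" for t h x k
  proof -
    let ?L = "h * (k * g' k - g k)"
    have "integral {0..\<epsilon>} (\<lambda>s. integral {0..\<epsilon>} (\<lambda>r. H (t + h + s) (x + h * g' k + r))) \<le>
      integral {0..\<epsilon>} (\<lambda>s. integral {0..\<epsilon>} (\<lambda>r. H (t + s) (x + r)) + \<epsilon> * ?L)"
    proof (rule integral_le)
      fix s assume s: "s \<in> {0..\<epsilon>}"
      have "integral {0..\<epsilon>} (\<lambda>r. H (t + h + s) (x + h * g' k + r)) \<le> integral {0..\<epsilon>} (\<lambda>r. H (t + s) (x + r) + ?L)"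
      proof (rule integral_le)
        fix r
        show "H (t + h + s) (x + h * g' k + r) \<le> H (t + s) (x + r) + ?L"
          using dyn[of "t + s" h k "x + r"] that s by (simp add: algebra_simps)
      qed (intro int integrable_add integrable_const_ivl)+
      also have "\<dots> = integral {0..\<epsilon>} (\<lambda>r. H (t + s) (x + r)) + \<epsilon> * ?L"
        using e by (subst Henstock_Kurzweil_Integration.integral_add) (auto simp: int)
      finally show "integral {0..\<epsilon>} (\<lambda>r. H (t + h + s) (x + h * g' k + r)) \<le> \<dots>" .
    qed (auto intro!: integrable_continuous_real continuous_intros ci'')
    also have "\<dots> = integral {0..\<epsilon>} (\<lambda>s. integral {0..\<epsilon>} (\<lambda>r. H (t + s) (x + r))) + \<epsilon>\<^sup>2 * ?L"
      using e by (subst Henstock_Kurzweil_Integration.integral_add)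
        (auto simp: power2_eq_square intro!: integrable_continuous_real ci'')
    finally show ?thesis using e unfolding \<Phi>_def by (simp add: field_simps)
  qed
  have pde: "\<Phi>t (t, x) + g (\<Phi>x (t, x)) \<le> 0" if t: "0 \<le> t" for t x
  proof -
    \<comment> \<open>The direction is adapted to the slope at the point itself: with this k the
      inequality along the line reads \<open>\<Phi>t + k * g' k \<le> k * g' k - g k\<close>, which
      is the claim.\<close>
    define k where "k = \<Phi>x (t, x)"
    have k: "k \<in> {a..b}" unfolding k_def by (rule slopes)
    have "((\<lambda>h. \<Phi> (t + h) (x + h * g' k)) has_real_derivative \<Phi>t (t, x) + g' k * \<Phi>x (t, x)) (at 0)"
      by (rule DERIV_along_line[of UNIV]) (use Dt Dx ct cx in auto)
    then have D: "((\<lambda>h. \<Phi> (t + h) (x + h * g' k) - h * (k * g' k - g k)) has_real_derivative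
       \<Phi>t (t, x) + g' k * \<Phi>x (t, x) - (k * g' k - g k)) (at 0)"
      by (auto intro!: derivative_eq_intros)
    have "\<Phi>t (t, x) + g' k * \<Phi>x (t, x) - (k * g' k - g k) \<le> 0"
    proof (rule ccontr)
      assume "\<not> ?thesis"
      then obtain d where d: "0 < d" "\<And>h. 0 < h \<Longrightarrow> h < d \<Longrightarrow>
         \<Phi> (t + 0) (x + 0 * g' k) - 0 * (k * g' k - g k) < \<Phi> (t + (0 + h)) (x + (0 + h) * g' k) - (0 + h) * (k * g' k - g k)"
        using DERIV_pos_inc_right[OF D] by auto
      have "\<Phi> t x < \<Phi> (t + d/2) (x + d/2 * g' k) - d/2 * (k * g' k - g k)"
        using d(2)[of "d/2"] d(1) by simp
      then show False using step[OF t _ k, of "d/2" x] d(1) by simp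
    qed
    then show ?thesis by (simp add: k_def algebra_simps)
  qed
  show thesis by (rule that[OF Dt Dx ct cx slopes close pde])
qed

locale convex_flux =
  fixes g g' :: "real \<Rightarrow> real"
  assumes DERIV_g: "\<And>k. (g has_real_derivative g' k) (at k)"
    and mono_g': "\<And>k m. k \<le> m \<Longrightarrow> g' k \<le> g' m"
    and cont_g': "continuous_on UNIV g'"
begin

text \<open>The convex conjugate of \<open>g\<close> at the slope \<open>g' k\<close>. Parametrizing
  slopes by k avoids a supremum and an inverse of \<open>g'\<close>, which may be constant on
  intervals.\<close>

definition legendre :: "real \<Rightarrow> real" where "legendre k = k * g' k - g k"

lemma continuous_g: "continuous_on A g"
  using DERIV_g DERIV_continuous_on has_field_derivative_at_within by blast

lemma continuous_legendre: "continuous_on A legendre"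
  unfolding legendre_def by (intro continuous_intros continuous_g continuous_on_subset[OF cont_g']) auto

lemma tangent: "g k + g' k * (m - k) \<le> g m"
proof (cases m k rule: linorder_cases)
  case less
  obtain z where z: "m < z" "z < k" "g k - g m = (k - m) * g' z"
    using MVT2[OF less, of g g'] DERIV_g by blast
  have "(k - m) * g' z \<le> (k - m) * g' k" using z mono_g'[of z k] by (intro mult_left_mono) auto
  then show ?thesis using z(3) by (simp add: algebra_simps)
next
  case greater
  obtain z where z: "k < z" "z < m" "g m - g k = (m - k) * g' z"
    using MVT2[OF greater, of g g'] DERIV_g by blast
  have "(m - k) * g' k \<le> (m - k) * g' z" using z mono_g'[of k z] by (intro mult_left_mono) auto
  then show ?thesis using z(3) by (simp add: algebra_simps)
qed simp

lemma legendre_ge: "m * g' k - g m \<le> legendre k"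
  using tangent[of k m] by (simp add: legendre_def algebra_simps)

end

locale hopf_lax = convex_flux +
  fixes a b :: real and A0 :: "real \<Rightarrow> real"
  assumes ab: "a \<le> b"
    and slope: "\<And>x y. x \<le> y \<Longrightarrow> a * (y - x) \<le> A0 y - A0 x \<and> A0 y - A0 x \<le> b * (y - x)"
begin

text \<open>The Hopf-Lax formula, the infimum over y of A0(y) + t g*((x - y)/t), with y = x - t
  g'(k). Restricting k to the interval of slopes of \<open>A0\<close> turns it into a minimum over a
  compact set, and the formula makes sense for every real t, including 0. The Lipschitz bound holds
  for all times, as the averaging in \<open>Steklov_average\<close> requires.\<close>

definition HL :: "real \<Rightarrow> real \<Rightarrow> real" where
  "HL t x = Inf ((\<lambda>k. A0 (x - t * g' k) + t * legendre k) ` {a..b})"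

lemma A0_Lipschitz: "\<bar>A0 y - A0 x\<bar> \<le> (\<bar>a\<bar> + \<bar>b\<bar>) * \<bar>y - x\<bar>"
proof -
  have *: "\<bar>A0 y - A0 x\<bar> \<le> (\<bar>a\<bar> + \<bar>b\<bar>) * (y - x)" if "x \<le> y" for x y
  proof -
    have "-\<bar>a\<bar> * (y - x) \<le> a * (y - x)" "b * (y - x) \<le> \<bar>b\<bar> * (y - x)" "0 \<le> \<bar>a\<bar> * (y - x)" "0 \<le> \<bar>b\<bar> * (y - x)"
      using that mult_right_mono[of "-\<bar>a\<bar>" a "y - x"] mult_right_mono[of b "\<bar>b\<bar>" "y - x"] by auto
    then show ?thesis using slope[OF that] unfolding distrib_right abs_le_iff by linarith
  qed
  show ?thesis using *[of x y] *[of y x] by (cases "x \<le> y") (auto simp: abs_minus_commute)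
qed

lemma continuous_A0: "continuous_on A A0"
proof -
  have "\<bar>A0 x - A0 y\<bar> \<le> (\<bar>a\<bar> + \<bar>b\<bar>) * (\<bar>t - s\<bar> + \<bar>x - y\<bar>)" for t s x y :: real
  proof -
    have "(\<bar>a\<bar> + \<bar>b\<bar>) * \<bar>x - y\<bar> \<le> (\<bar>a\<bar> + \<bar>b\<bar>) * (\<bar>t - s\<bar> + \<bar>x - y\<bar>)" by (intro mult_left_mono) auto
    then show ?thesis using A0_Lipschitz[of x y] by linarith
  qed
  from Lipschitz2_continuous[where H = "\<lambda>(t::real) x. A0 x" and p = "\<lambda>_. 0" and q = "\<lambda>z. z",
      OF this continuous_on_const continuous_on_id]
  show ?thesis by simp
qed

lemma continuous_HL_arg: "continuous_on {a..b} (\<lambda>k. A0 (x - t * g' k) + t * legendre k)"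
  by (intro continuous_intros continuous_on_compose2[OF continuous_A0[of UNIV]]
      continuous_on_subset[OF cont_g'] continuous_legendre) auto

lemma HL_attained: "\<exists>k\<in>{a..b}. HL t x = A0 (x - t * g' k) + t * legendre k"
proof -
  obtain k where k: "k \<in> {a..b}" "\<And>m. m \<in> {a..b} \<Longrightarrow>
      A0 (x - t * g' k) + t * legendre k \<le> A0 (x - t * g' m) + t * legendre m"
    using continuous_attains_inf[OF _ _ continuous_HL_arg, of x t] ab by auto
  have "HL t x = A0 (x - t * g' k) + t * legendre k"
    unfolding HL_def by (intro cInf_eq_minimum) (use k in auto)
  with k show ?thesis by blast
qed

lemma HL_le: 
  assumes "k \<in> {a..b}" shows "HL t x \<le> A0 (x - t * g' k) + t * legendre k"
  unfolding HL_def
proof (rule cInf_lower)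
  show "bdd_below ((\<lambda>k. A0 (x - t * g' k) + t * legendre k) ` {a..b})"
    by (intro bounded_imp_bdd_below compact_imp_bounded compact_continuous_image continuous_HL_arg) auto
qed (use assms in auto)

lemma HL_0: "HL 0 x = A0 x"
  using HL_attained[of 0 x] by auto

text \<open>For one common k the feet of the two competitors are exactly y - x apart, so the slope
  bounds of \<open>A0\<close> carry over to the minimum.\<close>

lemma HL_slope:
  assumes "x \<le> y" shows "a * (y - x) \<le> HL t y - HL t x \<and> HL t y - HL t x \<le> b * (y - x)"
proof -
  obtain k where k: "k \<in> {a..b}" "HL t x = A0 (x - t * g' k) + t * legendre k" using HL_attained by blast
  obtain m where m: "m \<in> {a..b}" "HL t y = A0 (y - t * g' m) + t * legendre m" using HL_attained by blast
  have "HL t y \<le> A0 (y - t * g' k) + t * legendre k" "HL t x \<le> A0 (x - t * g' m) + t * legendre m"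
    using HL_le[OF k(1), of t y] HL_le[OF m(1), of t x] .
  then show ?thesis
    using k m slope[of "x - t * g' k" "y - t * g' k"] slope[of "x - t * g' m" "y - t * g' m"] assms by simp
qed

lemma HL_Lipschitz: "\<exists>C. \<forall>t s x y. \<bar>HL t x - HL s y\<bar> \<le> C * (\<bar>t - s\<bar> + \<bar>x - y\<bar>)"
proof -
  have "bounded (g' ` {a..b})" "bounded (legendre ` {a..b})"
    by (auto intro!: compact_imp_bounded compact_continuous_image continuous_legendre continuous_on_subset[OF cont_g'])
  then obtain G L where "\<forall>k\<in>{a..b}. \<bar>g' k\<bar> \<le> G" and "\<forall>k\<in>{a..b}. \<bar>legendre k\<bar> \<le> L"
    unfolding bounded_iff by auto
  then have G: "\<And>k. k \<in> {a..b} \<Longrightarrow> \<bar>g' k\<bar> \<le> G" and L: "\<And>k. k \<in> {a..b} \<Longrightarrow> \<bar>legendre k\<bar> \<le> L"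
    by blast+
  have G0: "0 \<le> G" "0 \<le> L" using G[of a] L[of a] ab by auto
  define N where "N = \<bar>a\<bar> + \<bar>b\<bar>"
  have N: "0 \<le> N" by (simp add: N_def)
  define C where "C = N + (N * G + L)"
  have one: "HL t x - HL s y \<le> C * (\<bar>t - s\<bar> + \<bar>x - y\<bar>)" for t s x y
  proof -
    obtain k where k: "k \<in> {a..b}" "HL s y = A0 (y - s * g' k) + s * legendre k" using HL_attained by blast
    have "HL t x \<le> A0 (x - t * g' k) + t * legendre k" by (rule HL_le[OF k(1)])
    moreover have "A0 (x - t * g' k) - A0 (y - s * g' k) \<le> N * \<bar>(x - t * g' k) - (y - s * g' k)\<bar>"
      using A0_Lipschitz[of "x - t * g' k" "y - s * g' k"] by (simp add: N_def)
    moreover have "N * \<bar>(x - t * g' k) - (y - s * g' k)\<bar> \<le> N * (\<bar>x - y\<bar> + \<bar>t - s\<bar> * G)"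
    proof (intro mult_left_mono N)
      have "(x - t * g' k) - (y - s * g' k) = (x - y) - (t - s) * g' k" by (simp add: algebra_simps)
      moreover have "\<bar>(t - s) * g' k\<bar> \<le> \<bar>t - s\<bar> * G" unfolding abs_mult using G[OF k(1)] by (intro mult_left_mono) auto
      ultimately show "\<bar>(x - t * g' k) - (y - s * g' k)\<bar> \<le> \<bar>x - y\<bar> + \<bar>t - s\<bar> * G" by linarith
    qed
    moreover have "t * legendre k - s * legendre k \<le> \<bar>t - s\<bar> * L"
    proof -
      have "(t - s) * legendre k \<le> \<bar>(t - s) * legendre k\<bar>" by (rule abs_ge_self)
      also have "\<dots> \<le> \<bar>t - s\<bar> * L" unfolding abs_mult using L[OF k(1)] by (intro mult_left_mono) auto
      finally show ?thesis by (simp add: left_diff_distrib)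
    qed
    moreover have "0 \<le> (N * G + L) * \<bar>x - y\<bar>" "0 \<le> N * \<bar>t - s\<bar>" using N G0 by auto
    ultimately show ?thesis unfolding C_def using k(2) by (simp add: algebra_simps)
  qed
  have "\<bar>HL t x - HL s y\<bar> \<le> C * (\<bar>t - s\<bar> + \<bar>x - y\<bar>)" for t s x y
    using one[of t x s y] one[of s y t x] by (simp add: abs_le_iff abs_minus_commute)
  then show ?thesis by blast
qed

text \<open>A path that runs for time t with speed \<open>g' m\<close> and for time h with speed
  \<open>g' k\<close> is replaced by the straight line with the mean speed q. By the intermediate
  value theorem q equals \<open>g' n\<close> for some n between k and m, and the conjugate at q is
  at most the weighted mean of the conjugates, by \<open>legendre_ge\<close> used twice with
  n.\<close>

lemma HL_dynamic:
  assumes "0 \<le> t" "0 \<le> h" "k \<in> {a..b}"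
  shows "HL (t + h) (x + h * g' k) \<le> HL t x + h * legendre k"
proof (cases "t + h = 0")
  case True
  then have "t = 0" "h = 0" using assms by auto
  then show ?thesis by simp
next
  case False
  then have th: "0 < t + h" using assms by simp
  obtain m where m: "m \<in> {a..b}" "HL t x = A0 (x - t * g' m) + t * legendre m" using HL_attained by blast
  define q where "q = (h * g' k + t * g' m) / (t + h)"
  have ex: "\<exists>n\<in>{a..b}. g' n = q"
  proof -
    have qk: "q = g' m + h / (t + h) * (g' k - g' m)" using th by (simp add: q_def field_simps)
    have qm: "q = g' k + t / (t + h) * (g' m - g' k)" using th by (simp add: q_def field_simps)
    have nn: "0 \<le> h / (t + h)" "0 \<le> t / (t + h)" using assms th by auto
    show ?thesis
    proof (cases "k \<le> m")
      case True
      then have gkm: "g' k \<le> g' m" by (rule mono_g')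
      have "g' k \<le> q" using mult_nonneg_nonneg[OF nn(2), of "g' m - g' k"] gkm qm by linarith
      moreover have "q \<le> g' m" using mult_nonneg_nonpos[OF nn(1), of "g' k - g' m"] gkm qk by linarith
      ultimately obtain n where "k \<le> n" "n \<le> m" "g' n = q"
        using IVT'[of g' k q m] True continuous_on_subset[OF cont_g'] by blast
      then show ?thesis using assms m by auto
    next
      case False
      then have gkm: "g' m \<le> g' k" by (intro mono_g') auto
      have "g' m \<le> q" using mult_nonneg_nonneg[OF nn(1), of "g' k - g' m"] gkm qk by linarith
      moreover have "q \<le> g' k" using mult_nonneg_nonpos[OF nn(2), of "g' m - g' k"] gkm qm by linarith
      ultimately obtain n where "m \<le> n" "n \<le> k" "g' n = q"
        using IVT'[of g' m q k] False continuous_on_subset[OF cont_g'] by force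
      then show ?thesis using assms m by auto
    qed
  qed
  then obtain n where n: "n \<in> {a..b}" "g' n = q" by blast
  have eq: "(t + h) * g' n = h * g' k + t * g' m" using th by (simp add: n q_def)
  have "HL (t + h) (x + h * g' k) \<le> A0 (x + h * g' k - (t + h) * g' n) + (t + h) * legendre n"
    by (rule HL_le[OF n(1)])
  also have "x + h * g' k - (t + h) * g' n = x - t * g' m" unfolding eq by simp
  also have "(t + h) * legendre n = h * (n * g' k - g n) + t * (n * g' m - g n)"
    unfolding legendre_def right_diff_distrib using eq by (simp add: algebra_simps)
  also have "\<dots> \<le> h * legendre k + t * legendre m"
    using assms by (intro add_mono mult_left_mono legendre_ge) auto
  finally show ?thesis using m by simp
qed

text \<open>Since \<open>g 0 = 0\<close>, the conjugate is nonnegative and vanishes at k = 0. This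
  provides the boundary values far from the support of the data.\<close>

lemma HL_const:
  assumes "0 \<in> {a..b}" "g 0 = 0" "0 \<le> t" "\<And>k. k \<in> {a..b} \<Longrightarrow> A0 (x - t * g' k) = c"
  shows "HL t x = c"
proof -
  obtain k where k: "k \<in> {a..b}" "HL t x = A0 (x - t * g' k) + t * legendre k" using HL_attained by blast
  have "0 \<le> legendre k" using legendre_ge[of 0 k] assms by simp
  then have "c \<le> HL t x" using k assms(4)[OF k(1)] assms(3) by simp
  moreover have "HL t x \<le> c" using HL_le[OF assms(1), of t x] assms by (simp add: legendre_def)
  ultimately show ?thesis by simp
qed

end

section \<open>Entropy solutions\<close>

lemma integrable_bounded_support2:
  fixes h :: "real \<times> real \<Rightarrow> real"
  assumes [measurable]: "h \<in> borel_measurable borel" and B: "\<And>z. \<bar>h z\<bar> \<le> B"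
    and R: "\<And>z. R < norm z \<Longrightarrow> h z = 0"
  shows "integrable lborel h"
proof (rule Bochner_Integration.integrable_bound)
  show "integrable lborel (\<lambda>z. B * indicator (cball 0 R) z :: real)"
    by (intro integrable_mult_right integrable_real_indicator)
       (auto simp: emeasure_lborel_cball_finite[unfolded infinity_ennreal_def])
  show "AE z in lborel. norm (h z) \<le> norm (B * indicator (cball 0 R) z :: real)"
  proof (rule AE_I2)
    fix z show "norm (h z) \<le> norm (B * indicator (cball 0 R) z :: real)"
    proof (cases "R < norm z")
      case True
      then show ?thesis by (simp add: R)
    next
      case False
      then have "z \<in> cball 0 R" by auto
      then show ?thesis using B[of z] by simp
    qed
  qed
qed simp

lemma set_integrable_half:
  fixes h :: "real \<times> real \<Rightarrow> real"
  assumes "integrable lborel h" shows "set_integrable lborel ({0..} \<times> UNIV) h"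
  unfolding set_integrable_def
  by (intro integrable_mult_indicator assms) (auto intro!: borel_closed closed_Times)

lemma test_fun_bounded_support:
  assumes "test_fun \<phi> \<phi>t \<phi>x"
  obtains R C where "0 \<le> R" "\<And>z. \<bar>\<phi>t z\<bar> \<le> C" "\<And>z. \<bar>\<phi>x z\<bar> \<le> C"
    "\<And>z. R < norm z \<Longrightarrow> \<phi> z = 0 \<and> \<phi>t z = 0 \<and> \<phi>x z = 0"
proof -
  have dt: "((\<lambda>s. \<phi> (s, x)) has_real_derivative \<phi>t (t, x)) (at t)"
    and dx: "((\<lambda>y. \<phi> (t, y)) has_real_derivative \<phi>x (t, x)) (at x)" for t x
    using assms by (auto simp: test_fun_def)
  have ct: "continuous_on UNIV \<phi>t" and cx: "continuous_on UNIV \<phi>x"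
    and bd: "bounded {z. \<phi> z \<noteq> 0}"
    using assms by (auto simp: test_fun_def)
  obtain R where R: "0 < R" "\<And>z. \<phi> z \<noteq> 0 \<Longrightarrow> norm z \<le> R"
    using bd by (auto simp: bounded_pos)
  have z0: "\<phi> z = 0" if "R < norm z" for z using R(2)[of z] that by fastforce
  have t0: "\<phi>t (t, x) = 0" if "R < norm (t, x)" for t x
  proof -
    have "((\<lambda>s. \<phi> (s, x)) has_real_derivative 0) (at t)"
    proof (rule has_field_derivative_transform_within_open[of "\<lambda>_. 0"])
      show "open {s. R < norm (s, x)}" by (intro open_Collect_less continuous_intros)
    qed (use that z0 in auto)
    then show ?thesis using dt DERIV_unique by blast
  qed
  have x0: "\<phi>x (t, x) = 0" if "R < norm (t, x)" for t x
  proof -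
    have "((\<lambda>y. \<phi> (t, y)) has_real_derivative 0) (at x)"
    proof (rule has_field_derivative_transform_within_open[of "\<lambda>_. 0"])
      show "open {y. R < norm (t, y)}" by (intro open_Collect_less continuous_intros)
    qed (use that z0 in auto)
    then show ?thesis using dx DERIV_unique by blast
  qed
  have "bounded (\<phi>t ` cball 0 R)" "bounded (\<phi>x ` cball 0 R)"
    by (auto intro!: compact_imp_bounded compact_continuous_image continuous_on_subset[OF ct] continuous_on_subset[OF cx])
  then obtain C1 C2 where C: "\<forall>z\<in>cball 0 R. \<bar>\<phi>t z\<bar> \<le> C1" "\<forall>z\<in>cball 0 R. \<bar>\<phi>x z\<bar> \<le> C2"
    unfolding bounded_iff by auto
  have "\<bar>\<phi>t z\<bar> \<le> max 0 (max C1 C2)" for z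
    using C(1) t0[of "fst z" "snd z"] by (cases "R < norm z") (auto simp: not_less max_def dest!: bspec[of _ _ z])
  moreover have "\<bar>\<phi>x z\<bar> \<le> max 0 (max C1 C2)" for z
    using C(2) x0[of "fst z" "snd z"] by (cases "R < norm z") (auto simp: not_less max_def dest!: bspec[of _ _ z])
  ultimately show thesis using R(1) z0 t0 x0 by (intro that[of R "max 0 (max C1 C2)"]) auto
qed

lemma test_fun_measurable:
  assumes "test_fun \<phi> \<phi>t \<phi>x"
  shows "\<phi>t \<in> borel_measurable borel" "\<phi>x \<in> borel_measurable borel"
    "(\<lambda>x. \<phi> (0, x)) \<in> borel_measurable borel"
proof -
  show "\<phi>t \<in> borel_measurable borel" "\<phi>x \<in> borel_measurable borel"
    using assms by (auto simp: test_fun_def intro: borel_measurable_continuous_onI)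
  have "continuous_on UNIV (\<lambda>x. \<phi> (0, x))"
    using assms unfolding test_fun_def by (metis DERIV_isCont continuous_at_imp_continuous_on)
  then show "(\<lambda>x. \<phi> (0, x)) \<in> borel_measurable borel" by (rule borel_measurable_continuous_onI)
qed

lemma test_fun_initial_integrable:
  assumes \<phi>: "test_fun \<phi> \<phi>t \<phi>x" and [measurable]: "w \<in> borel_measurable borel" and w: "\<And>x. \<bar>w x\<bar> \<le> B"
  shows "integrable lborel (\<lambda>x. w x * \<phi> (0, x))"
proof -
  obtain R C where R: "0 \<le> R" "\<And>z. R < norm z \<Longrightarrow> \<phi> z = 0 \<and> \<phi>t z = 0 \<and> \<phi>x z = 0"
    using test_fun_bounded_support[OF \<phi>] by metis
  note [measurable] = test_fun_measurable[OF \<phi>]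
  have c: "continuous_on UNIV (\<lambda>x. \<phi> (0, x))"
    using \<phi> unfolding test_fun_def by (metis DERIV_isCont continuous_at_imp_continuous_on)
  have "bounded ((\<lambda>x. \<phi> (0, x)) ` {-R..R})"
    by (intro compact_imp_bounded compact_continuous_image continuous_on_subset[OF c]) auto
  then obtain D where D: "\<forall>x\<in>{-R..R}. \<bar>\<phi> (0, x)\<bar> \<le> D" unfolding bounded_iff by auto
  have z: "\<phi> (0, x) = 0" if "R < \<bar>x\<bar>" for x using R(2)[of "(0, x)"] that by simp
  have B: "\<bar>\<phi> (0, x)\<bar> \<le> \<bar>D\<bar>" for x
  proof (cases "R < \<bar>x\<bar>")
    case False
    then have "x \<in> {-R..R}" by auto
    then have "\<bar>\<phi> (0, x)\<bar> \<le> D" using D by blast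
    then show ?thesis by linarith
  qed (simp add: z)
  have "integrable lborel (\<lambda>x. \<phi> (0, x))"
    by (rule integrable_bounded_support[OF _ B z]) auto
  then show ?thesis by (rule integrable_bounded_mult[OF _ _ w]) simp
qed

lemma test_fun_integrable:
  assumes \<phi>: "test_fun \<phi> \<phi>t \<phi>x" and [measurable]: "w \<in> borel_measurable borel" and w: "\<And>z. \<bar>w z\<bar> \<le> B"
  shows "set_integrable lborel ({0..} \<times> UNIV) (\<lambda>z. w z * \<phi>t z)"
    "set_integrable lborel ({0..} \<times> UNIV) (\<lambda>z. w z * \<phi>x z)"
proof -
  obtain R C where R: "0 \<le> R" "\<And>z. \<bar>\<phi>t z\<bar> \<le> C" "\<And>z. \<bar>\<phi>x z\<bar> \<le> C"
      "\<And>z. R < norm z \<Longrightarrow> \<phi> z = 0 \<and> \<phi>t z = 0 \<and> \<phi>x z = 0"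
    using test_fun_bounded_support[OF \<phi>] by metis
  note [measurable] = test_fun_measurable[OF \<phi>]
  have B: "0 \<le> B" "0 \<le> C" using w[of 0] R(2)[of 0] by auto
  have "\<bar>w z * \<phi>t z\<bar> \<le> B * C" "\<bar>w z * \<phi>x z\<bar> \<le> B * C" for z
    using w[of z] R(2,3)[of z] B unfolding abs_mult by (auto intro!: mult_mono)
  then show "set_integrable lborel ({0..} \<times> UNIV) (\<lambda>z. w z * \<phi>t z)"
    "set_integrable lborel ({0..} \<times> UNIV) (\<lambda>z. w z * \<phi>x z)"
    using R(4) by (auto intro!: set_integrable_half integrable_bounded_support2[where R = R and B = "B * C"])
qed

text \<open>These identities say that constants solve the weak equation. They remove the constant
  parts of the Kruzkov inequality in \<open>weak_form\<close> and
  \<open>one_sided_entropy\<close>.\<close>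

lemma test_fun_FTC:
  assumes \<phi>: "test_fun \<phi> \<phi>t \<phi>x"
  shows "(LINT z:({0..} \<times> UNIV)|lborel. \<phi>t z) = - (LINT x|lborel. \<phi> (0, x))"
    and "(LINT z:({0..} \<times> UNIV)|lborel. \<phi>x z) = 0"
proof -
  obtain R C where R: "0 \<le> R" "\<And>z. R < norm z \<Longrightarrow> \<phi> z = 0 \<and> \<phi>t z = 0 \<and> \<phi>x z = 0"
    using test_fun_bounded_support[OF \<phi>] by metis
  have dt: "((\<lambda>s. \<phi> (s, x)) has_real_derivative \<phi>t (t, x)) (at t)"
    and dx: "((\<lambda>y. \<phi> (t, y)) has_real_derivative \<phi>x (t, x)) (at x)" for t x
    using \<phi> by (auto simp: test_fun_def)
  have ct: "continuous_on UNIV \<phi>t" and cx: "continuous_on UNIV \<phi>x"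
    using \<phi> by (auto simp: test_fun_def)
  have n1: "\<bar>t\<bar> \<le> norm (t, x)" "\<bar>x\<bar> \<le> norm (t, x)" for t x :: real
    using norm_fst_le[of t x] norm_snd_le[of x t] by auto
  have nz: "\<phi> (t, x) = 0 \<and> \<phi>t (t, x) = 0 \<and> \<phi>x (t, x) = 0" if "R < \<bar>t\<bar> \<or> R < \<bar>x\<bar>" for t x
    using R(2)[of "(t, x)"] n1[of t x] n1[of x t] that by fastforce
  have it: "integrable (lborel \<Otimes>\<^sub>M lborel) (\<lambda>z. indicator ({0..} \<times> UNIV) z *\<^sub>R \<phi>t z)"
    and ix: "integrable (lborel \<Otimes>\<^sub>M lborel) (\<lambda>z. indicator ({0..} \<times> UNIV) z *\<^sub>R \<phi>x z)"
    using test_fun_integrable[OF \<phi>, of "\<lambda>_. 1" 1] by (auto simp: set_integrable_def lborel_prod)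
  have inner_t: "(LINT t|lborel. indicator ({0..} \<times> UNIV) (t, x) *\<^sub>R \<phi>t (t, x)) = - \<phi> (0, x)" for x
  proof -
    have "has_bochner_integral lborel (\<lambda>t. indicator {0..R+1} t *\<^sub>R \<phi>t (t, x)) (\<phi> (R + 1, x) - \<phi> (0, x))"
    proof (rule has_bochner_integral_FTC_Icc)
      show "((\<lambda>t. \<phi> (t, x)) has_vector_derivative \<phi>t (t, x)) (at t within {0..R+1})" for t
        using dt[of x t] by (simp add: has_real_derivative_iff_has_vector_derivative has_vector_derivative_at_within)
      show "continuous_on {0..R+1} (\<lambda>t. \<phi>t (t, x))"
        by (intro continuous_on_compose2[OF ct] continuous_intros) auto
    qed (use R in auto)
    moreover have "(LINT t|lborel. indicator ({0..} \<times> UNIV) (t, x) *\<^sub>R \<phi>t (t, x)) =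
       (LINT t|lborel. indicator {0..R+1} t *\<^sub>R \<phi>t (t, x))"
      by (intro Bochner_Integration.integral_cong refl) (use nz[of _ x] in \<open>auto simp: indicator_def\<close>)
    ultimately show ?thesis using nz[of "R + 1" x] R(1) by (simp add: has_bochner_integral_iff)
  qed
  show "(LINT z:({0..} \<times> UNIV)|lborel. \<phi>t z) = - (LINT x|lborel. \<phi> (0, x))"
    using lborel_pair.integral_snd[of "\<lambda>t x. indicator ({0..} \<times> UNIV) (t, x) *\<^sub>R \<phi>t (t, x)"] it
    unfolding inner_t by (simp add: set_lebesgue_integral_def lborel_prod case_prod_beta')
  have inner_x: "(LINT x|lborel. indicator ({0..} \<times> UNIV) (t, x) *\<^sub>R \<phi>x (t, x)) = 0" for t
  proof -
    have "has_bochner_integral lborel (\<lambda>x. indicator {-R-1..R+1} x *\<^sub>R \<phi>x (t, x)) (\<phi> (t, R + 1) - \<phi> (t, -R-1))"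
    proof (rule has_bochner_integral_FTC_Icc)
      show "((\<lambda>x. \<phi> (t, x)) has_vector_derivative \<phi>x (t, x)) (at x within {-R-1..R+1})" for x
        using dx[of t x] by (simp add: has_real_derivative_iff_has_vector_derivative has_vector_derivative_at_within)
      show "continuous_on {-R-1..R+1} (\<lambda>x. \<phi>x (t, x))"
        by (intro continuous_on_compose2[OF cx] continuous_intros) auto
    qed (use R in auto)
    then have "(LINT x|lborel. indicator {-R-1..R+1} x *\<^sub>R \<phi>x (t, x)) = 0"
      using nz[of t "R + 1"] nz[of t "-R-1"] R(1) by (simp add: has_bochner_integral_iff)
    moreover have "indicator {-R-1..R+1} x *\<^sub>R \<phi>x (t, x) = \<phi>x (t, x)" for x
      using nz[of t x] by (cases "x \<in> {-R-1..R+1}") (auto simp: abs_if split: if_splits)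
    ultimately have "(LINT x|lborel. \<phi>x (t, x)) = 0" by (simp only:)
    then show ?thesis by (cases "0 \<le> t") auto
  qed
  show "(LINT z:({0..} \<times> UNIV)|lborel. \<phi>x z) = 0"
    using lborel_pair.integral_fst'[OF ix] unfolding inner_x
    by (simp add: set_lebesgue_integral_def lborel_prod)
qed

lemma locally_Lipschitz_continuous:
  fixes F :: "real \<Rightarrow> real"
  assumes F_Lipschitz: "\<And>r. \<exists>L. \<forall>p\<in>{-r..r}. \<forall>q\<in>{-r..r}. \<bar>F p - F q\<bar> \<le> L * \<bar>p - q\<bar>"
  shows "continuous_on A F"
proof -
  have "isCont F p" for p
  proof -
    obtain L where L: "\<forall>r\<in>{-(\<bar>p\<bar>+1)..\<bar>p\<bar>+1}. \<forall>q\<in>{-(\<bar>p\<bar>+1)..\<bar>p\<bar>+1}. \<bar>F r - F q\<bar> \<le> L * \<bar>r - q\<bar>"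
      using F_Lipschitz[of "\<bar>p\<bar> + 1"] by blast
    have "((\<lambda>q. F q - F p) \<longlongrightarrow> 0) (at p)"
    proof (rule Lim_null_comparison)
      have "eventually (\<lambda>q. dist q p < 1) (at p)" by (auto simp: eventually_at intro: exI[of _ 1])
      then show "\<forall>\<^sub>F q in at p. norm (F q - F p) \<le> L * \<bar>q - p\<bar>"
    proof (rule eventually_mono)
        fix q assume "dist q p < 1"
        then have "q \<in> {-(\<bar>p\<bar>+1)..\<bar>p\<bar>+1}" "p \<in> {-(\<bar>p\<bar>+1)..\<bar>p\<bar>+1}" unfolding dist_real_def by auto
        then have "\<bar>F q - F p\<bar> \<le> L * \<bar>q - p\<bar>" using L by blast
        then show "norm (F q - F p) \<le> L * \<bar>q - p\<bar>" by simp
      qed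
      show "((\<lambda>q. L * \<bar>q - p\<bar>) \<longlongrightarrow> 0) (at p)" by (auto intro!: tendsto_eq_intros)
    qed
    then show ?thesis by (simp add: isCont_def LIM_zero_iff)
  qed
  then show ?thesis by (simp add: continuous_at_imp_continuous_on)
qed

text \<open>A normalized form of \<open>entropy_solution\<close>: \<open>u\<close> is Borel on the
  whole plane and bounded everywhere, for negative times too, and the flux is locally Lipschitz,
  which includes piecewise linear interpolants.\<close>

locale entropy_sol =
  fixes F u0 :: "real \<Rightarrow> real" and u :: "real \<Rightarrow> real \<Rightarrow> real"
  assumes meas: "(\<lambda>z. u (fst z) (snd z)) \<in> borel_measurable borel"
    and bounded_u: "\<exists>B. \<forall>t x. \<bar>u t x\<bar> \<le> B"
    and L1_cont: "\<And>R t. 0 \<le> t \<Longrightarrow>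
      ((\<lambda>s. LINT x:{-R..R}|lborel. \<bar>u s x - u t x\<bar>) \<longlongrightarrow> 0) (at t within {0..})"
    and entropy: "\<And>k \<phi> \<phi>t \<phi>x. test_fun \<phi> \<phi>t \<phi>x \<Longrightarrow>
        0 \<le> (LINT z:({0..} \<times> UNIV)|lborel. \<bar>u (fst z) (snd z) - k\<bar> * \<phi>t z
                + sgn (u (fst z) (snd z) - k) * (F (u (fst z) (snd z)) - F k) * \<phi>x z)
            + (LINT x|lborel. \<bar>u0 x - k\<bar> * \<phi> (0, x))"
    and F_Lipschitz: "\<And>r. \<exists>L. \<forall>p\<in>{-r..r}. \<forall>q\<in>{-r..r}. \<bar>F p - F q\<bar> \<le> L * \<bar>p - q\<bar>"
    and u0_meas[measurable]: "u0 \<in> borel_measurable borel"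
    and bounded_u0: "\<exists>B. \<forall>x. \<bar>u0 x\<bar> \<le> B"
begin

lemma continuous_F: "continuous_on A F"
  by (rule locally_Lipschitz_continuous[OF F_Lipschitz])

lemma measurable_F [measurable]: "F \<in> borel_measurable borel"
  by (rule borel_measurable_continuous_onI[OF continuous_F])

lemma measurable_u [measurable]:
  assumes [measurable]: "p \<in> borel_measurable M" "q \<in> borel_measurable M"
  shows "(\<lambda>w. u (p w) (q w)) \<in> borel_measurable M"
proof -
  have "(\<lambda>w. (p w, q w)) \<in> M \<rightarrow>\<^sub>M borel" unfolding borel_prod[symmetric] by measurable
  from measurable_compose[OF this meas] show ?thesis by simp
qed

lemma bounded_F_u: "\<exists>B. \<forall>t x. \<bar>F (u t x) - c\<bar> \<le> B"
proof -
  obtain B where B: "\<forall>t x. \<bar>u t x\<bar> \<le> B" using bounded_u by blast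
  have "bounded (F ` {-B..B})"
    by (intro compact_imp_bounded compact_continuous_image continuous_F) auto
  then obtain D where D: "\<forall>p\<in>{-B..B}. \<bar>F p\<bar> \<le> D" unfolding bounded_iff by auto
  have FD: "\<bar>F (u t x)\<bar> \<le> D" for t x
  proof -
    have "u t x \<in> {-B..B}" using B[rule_format, of t x] by auto
    then show ?thesis using D by blast
  qed
  have "\<bar>F (u t x) - c\<bar> \<le> D + \<bar>c\<bar>" for t x using FD[of t x] by linarith
  then show ?thesis by blast
qed

lemma measurable_fst_snd_real [measurable]:
  "(fst :: real \<times> real \<Rightarrow> real) \<in> borel_measurable borel" "(snd :: real \<times> real \<Rightarrow> real) \<in> borel_measurable borel"
  by (auto intro!: borel_measurable_continuous_onI continuous_intros)

lemma integrable_uF: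
  assumes \<phi>: "test_fun \<phi> \<phi>t \<phi>x"
  shows "set_integrable lborel ({0..} \<times> UNIV) (\<lambda>z. u (fst z) (snd z) * \<phi>t z)"
    "set_integrable lborel ({0..} \<times> UNIV) (\<lambda>z. F (u (fst z) (snd z)) * \<phi>x z)"
    "set_integrable lborel ({0..} \<times> UNIV) (\<lambda>z. \<bar>u (fst z) (snd z) - k\<bar> * \<phi>t z)"
    "set_integrable lborel ({0..} \<times> UNIV) (\<lambda>z. sgn (u (fst z) (snd z) - k) * (F (u (fst z) (snd z)) - F k) * \<phi>x z)"
    "set_integrable lborel ({0..} \<times> UNIV) \<phi>t" "set_integrable lborel ({0..} \<times> UNIV) \<phi>x"
proof -
  obtain B where B: "\<forall>t x. \<bar>u t x\<bar> \<le> B" using bounded_u by blast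
  obtain D where D: "\<forall>t x. \<bar>F (u t x) - 0\<bar> \<le> D" using bounded_F_u by blast
  obtain E where E: "\<forall>t x. \<bar>F (u t x) - F k\<bar> \<le> E" using bounded_F_u by blast
  show "set_integrable lborel ({0..} \<times> UNIV) (\<lambda>z. u (fst z) (snd z) * \<phi>t z)"
    by (rule test_fun_integrable(1)[OF \<phi>]) (use B in auto)
  show "set_integrable lborel ({0..} \<times> UNIV) (\<lambda>z. F (u (fst z) (snd z)) * \<phi>x z)"
    by (rule test_fun_integrable(2)[OF \<phi>]) (use D in auto)
  have "\<bar>\<bar>u t x - k\<bar>\<bar> \<le> B + \<bar>k\<bar>" for t x using B[rule_format, of t x] by linarith
  then show "set_integrable lborel ({0..} \<times> UNIV) (\<lambda>z. \<bar>u (fst z) (snd z) - k\<bar> * \<phi>t z)"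
    by (intro test_fun_integrable(1)[OF \<phi>]) auto
  have "\<bar>sgn (u t x - k) * (F (u t x) - F k)\<bar> \<le> E" for t x
    using E[rule_format, of t x] by (auto simp: abs_mult sgn_if)
  then show "set_integrable lborel ({0..} \<times> UNIV) (\<lambda>z. sgn (u (fst z) (snd z) - k) * (F (u (fst z) (snd z)) - F k) * \<phi>x z)"
    by (intro test_fun_integrable(2)[OF \<phi>]) auto
  show "set_integrable lborel ({0..} \<times> UNIV) \<phi>t" "set_integrable lborel ({0..} \<times> UNIV) \<phi>x"
    using test_fun_integrable[OF \<phi>, of "\<lambda>_. 1" 1] by auto
qed

text \<open>For constants beyond the range of \<open>u\<close> and \<open>u0\<close> the Kruzkov
  inequality is linear. The constants K and -K give the two opposite inequalities.\<close>

lemma weak_form: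
  assumes \<phi>: "test_fun \<phi> \<phi>t \<phi>x"
  shows "(LINT z:({0..} \<times> UNIV)|lborel. u (fst z) (snd z) * \<phi>t z)
     + (LINT z:({0..} \<times> UNIV)|lborel. F (u (fst z) (snd z)) * \<phi>x z) + (LINT x|lborel. u0 x * \<phi> (0, x)) = 0"
    (is "?A + ?B + ?C = 0")
proof -
  obtain B where B: "\<forall>t x. \<bar>u t x\<bar> \<le> B" using bounded_u by blast
  obtain D where D: "\<forall>x. \<bar>u0 x\<bar> \<le> D" using bounded_u0 by blast
  define K where "K = \<bar>B\<bar> + \<bar>D\<bar> + 1"
  have uK: "u t x < K" "- K < u t x" "u0 x < K" "- K < u0 x" for t x
    using B[rule_format, of t x] D[rule_format, of x] unfolding K_def by linarith+
  note int = integrable_uF[OF \<phi>]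
  note FTC = test_fun_FTC[OF \<phi>]
  have iu0: "integrable lborel (\<lambda>x. u0 x * \<phi> (0, x))"
    by (rule test_fun_initial_integrable[OF \<phi>]) (use D in auto)
  have i0: "integrable lborel (\<lambda>x. \<phi> (0, x))"
    using test_fun_initial_integrable[OF \<phi>, of "\<lambda>_. 1" 1] by simp
  have "0 \<le> (LINT z:({0..} \<times> UNIV)|lborel. K * \<phi>t z - u (fst z) (snd z) * \<phi>t z + (F K * \<phi>x z - F (u (fst z) (snd z)) * \<phi>x z))
     + (LINT x|lborel. K * \<phi> (0, x) - u0 x * \<phi> (0, x))"
  proof -
    have "\<bar>u (fst z) (snd z) - K\<bar> * \<phi>t z + sgn (u (fst z) (snd z) - K) * (F (u (fst z) (snd z)) - F K) * \<phi>x z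
      = K * \<phi>t z - u (fst z) (snd z) * \<phi>t z + (F K * \<phi>x z - F (u (fst z) (snd z)) * \<phi>x z)" for z
      using uK(1,2)[of "fst z" "snd z"] by (simp add: algebra_simps abs_if sgn_if)
    moreover have "\<bar>u0 x - K\<bar> * \<phi> (0, x) = K * \<phi> (0, x) - u0 x * \<phi> (0, x)" for x
      using uK(3,4)[of x] by (simp add: algebra_simps abs_if)
    ultimately show ?thesis using entropy[OF \<phi>, of K] by simp
  qed
  also have "\<dots> = K * (LINT z:({0..} \<times> UNIV)|lborel. \<phi>t z) - ?A + (F K * (LINT z:({0..} \<times> UNIV)|lborel. \<phi>x z) - ?B)
     + (K * (LINT x|lborel. \<phi> (0, x)) - ?C)"
    using int iu0 i0 by (subst set_integral_add set_integral_diff; auto intro!: set_integral_diff set_integrable_mult_right)+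
  finally have 1: "?A + ?B + ?C \<le> 0" unfolding FTC by simp
  have "0 \<le> (LINT z:({0..} \<times> UNIV)|lborel. K * \<phi>t z + u (fst z) (snd z) * \<phi>t z + (F (u (fst z) (snd z)) * \<phi>x z - F (-K) * \<phi>x z))
     + (LINT x|lborel. K * \<phi> (0, x) + u0 x * \<phi> (0, x))"
  proof -
    have "\<bar>u (fst z) (snd z) - (-K)\<bar> * \<phi>t z + sgn (u (fst z) (snd z) - (-K)) * (F (u (fst z) (snd z)) - F (-K)) * \<phi>x z
      = K * \<phi>t z + u (fst z) (snd z) * \<phi>t z + (F (u (fst z) (snd z)) * \<phi>x z - F (-K) * \<phi>x z)" for z
      using uK(1,2)[of "fst z" "snd z"] by (simp add: algebra_simps abs_if sgn_if)
    moreover have "\<bar>u0 x - (-K)\<bar> * \<phi> (0, x) = K * \<phi> (0, x) + u0 x * \<phi> (0, x)" for x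
      using uK(3,4)[of x] by (simp add: algebra_simps abs_if)
    ultimately show ?thesis using entropy[OF \<phi>, of "-K"] by simp
  qed
  also have "\<dots> = K * (LINT z:({0..} \<times> UNIV)|lborel. \<phi>t z) + ?A + (?B - F (-K) * (LINT z:({0..} \<times> UNIV)|lborel. \<phi>x z))
     + (K * (LINT x|lborel. \<phi> (0, x)) + ?C)"
    using int iu0 i0 by (subst set_integral_add set_integral_diff; auto intro!: set_integral_diff set_integrable_mult_right)+
  finally have 2: "0 \<le> ?A + ?B + ?C" unfolding FTC by simp
  from 1 2 show ?thesis by simp
qed

text \<open>Half the sum of the Kruzkov inequality and the weak identity, because 2 max 0 s = |s| +
  s.\<close>

lemma one_sided_entropy:
  assumes \<phi>: "test_fun \<phi> \<phi>t \<phi>x"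
  shows "0 \<le> (LINT z:({0..} \<times> UNIV)|lborel. max 0 (u (fst z) (snd z) - k) * \<phi>t z
      + (if u (fst z) (snd z) > k then F (u (fst z) (snd z)) - F k else 0) * \<phi>x z)
      + (LINT x|lborel. max 0 (u0 x - k) * \<phi> (0, x))"
proof -
  obtain D where D: "\<forall>x. \<bar>u0 x\<bar> \<le> D" using bounded_u0 by blast
  note int = integrable_uF[OF \<phi>]
  note FTC = test_fun_FTC[OF \<phi>]
  have iu0: "integrable lborel (\<lambda>x. u0 x * \<phi> (0, x))"
    by (rule test_fun_initial_integrable[OF \<phi>]) (use D in auto)
  have i0: "integrable lborel (\<lambda>x. \<phi> (0, x))"
    using test_fun_initial_integrable[OF \<phi>, of "\<lambda>_. 1" 1] by simp
  have "\<bar>\<bar>u0 x - k\<bar>\<bar> \<le> D + \<bar>k\<bar>" for x using D[rule_format, of x] by linarith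
  then have ia: "integrable lborel (\<lambda>x. \<bar>u0 x - k\<bar> * \<phi> (0, x))"
    by (intro test_fun_initial_integrable[OF \<phi>]) auto
  let ?h = "{0..} \<times> UNIV :: (real \<times> real) set"
  let ?E = "\<lambda>z. \<bar>u (fst z) (snd z) - k\<bar> * \<phi>t z
     + sgn (u (fst z) (snd z) - k) * (F (u (fst z) (snd z)) - F k) * \<phi>x z"
  let ?G = "\<lambda>z. u (fst z) (snd z) * \<phi>t z - k * \<phi>t z + (F (u (fst z) (snd z)) * \<phi>x z - F k * \<phi>x z)"
  have iE: "set_integrable lborel ?h ?E" and iG: "set_integrable lborel ?h ?G"
    using int by (auto intro!: set_integral_add set_integral_diff)
  have "(LINT z:?h|lborel. ?G z) = (LINT z:?h|lborel. u (fst z) (snd z) * \<phi>t z) - k * (LINT z:?h|lborel. \<phi>t z)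
     + ((LINT z:?h|lborel. F (u (fst z) (snd z)) * \<phi>x z) - F k * (LINT z:?h|lborel. \<phi>x z))"
    using int by (subst set_integral_add set_integral_diff; auto intro!: set_integral_diff)+
  then have G0: "(LINT z:?h|lborel. ?G z) + (LINT x|lborel. u0 x * \<phi> (0, x) - k * \<phi> (0, x)) = 0"
    using weak_form[OF \<phi>] iu0 i0 unfolding FTC by simp
  have "2 * (max 0 (u (fst z) (snd z) - k) * \<phi>t z
      + (if u (fst z) (snd z) > k then F (u (fst z) (snd z)) - F k else 0) * \<phi>x z) = ?E z + ?G z" for z
    by (auto simp: algebra_simps max_def sgn_if abs_if)
  moreover have "2 * (max 0 (u0 x - k) * \<phi> (0, x)) = \<bar>u0 x - k\<bar> * \<phi> (0, x) + (u0 x * \<phi> (0, x) - k * \<phi> (0, x))" for x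
    by (auto simp: algebra_simps max_def abs_if)
  ultimately have "2 * (LINT z:?h|lborel. max 0 (u (fst z) (snd z) - k) * \<phi>t z
      + (if u (fst z) (snd z) > k then F (u (fst z) (snd z)) - F k else 0) * \<phi>x z)
      = (LINT z:?h|lborel. ?E z + ?G z)"
    and "2 * (LINT x|lborel. max 0 (u0 x - k) * \<phi> (0, x)) =
     (LINT x|lborel. \<bar>u0 x - k\<bar> * \<phi> (0, x) + (u0 x * \<phi> (0, x) - k * \<phi> (0, x)))"
    by (simp_all only: set_integral_mult_right[symmetric] integral_mult_right_zero[symmetric])
  then have "2 * ((LINT z:?h|lborel. max 0 (u (fst z) (snd z) - k) * \<phi>t z
      + (if u (fst z) (snd z) > k then F (u (fst z) (snd z)) - F k else 0) * \<phi>x z)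
      + (LINT x|lborel. max 0 (u0 x - k) * \<phi> (0, x))) =
     (LINT z:?h|lborel. ?E z + ?G z) + (LINT x|lborel. \<bar>u0 x - k\<bar> * \<phi> (0, x) + (u0 x * \<phi> (0, x) - k * \<phi> (0, x)))"
    by (simp only: distrib_left)
  also have "\<dots> = (LINT z:?h|lborel. ?E z) + (LINT x|lborel. \<bar>u0 x - k\<bar> * \<phi> (0, x))"
    using G0 set_integral_add(2)[OF iE iG] ia iu0 i0 by simp
  also have "\<dots> \<ge> 0" by (rule entropy[OF \<phi>])
  finally show ?thesis by simp
qed

text \<open>This symmetry turns every upper bound proved for solutions into a lower bound.\<close>

lemma reflect: "entropy_sol (\<lambda>p. - F (- p)) (\<lambda>x. - u0 x) (\<lambda>t x. - u t x)"
proof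
  show "(\<lambda>z. - u (fst z) (snd z)) \<in> borel_measurable borel" using meas by simp
  show "\<exists>B. \<forall>t x. \<bar>- u t x\<bar> \<le> B" using bounded_u by simp
  show "\<exists>B. \<forall>x. \<bar>- u0 x\<bar> \<le> B" using bounded_u0 by simp
  show "((\<lambda>s. LINT x:{-R..R}|lborel. \<bar>- u s x - - u t x\<bar>) \<longlongrightarrow> 0) (at t within {0..})" if "0 \<le> t" for R t
  proof -
    have "\<bar>- u s x - - u t x\<bar> = \<bar>u s x - u t x\<bar>" for s x by simp
    then show ?thesis using L1_cont[OF that] by simp
  qed
  show "\<exists>L. \<forall>p\<in>{-r..r}. \<forall>q\<in>{-r..r}. \<bar>- F (- p) - - F (- q)\<bar> \<le> L * \<bar>p - q\<bar>" for r
  proof -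
    obtain L where L: "\<forall>p\<in>{-r..r}. \<forall>q\<in>{-r..r}. \<bar>F p - F q\<bar> \<le> L * \<bar>p - q\<bar>" using F_Lipschitz by blast
    have "\<bar>- F (- p) - - F (- q)\<bar> \<le> L * \<bar>p - q\<bar>" if "p \<in> {-r..r}" "q \<in> {-r..r}" for p q
      using L[rule_format, of "-p" "-q"] that by (simp add: abs_minus_commute)
    then show ?thesis by blast
  qed
  show "(\<lambda>x. - u0 x) \<in> borel_measurable borel" by simp
  fix k \<phi> \<phi>t \<phi>x assume \<phi>: "test_fun \<phi> \<phi>t \<phi>x"
  have "\<bar>- u (fst z) (snd z) - k\<bar> * \<phi>t z + sgn (- u (fst z) (snd z) - k) * (- F (- (- u (fst z) (snd z))) - - F (- k)) * \<phi>x z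
     = \<bar>u (fst z) (snd z) - (-k)\<bar> * \<phi>t z + sgn (u (fst z) (snd z) - (-k)) * (F (u (fst z) (snd z)) - F (-k)) * \<phi>x z" for z
    by (cases "u (fst z) (snd z)" "- k" rule: linorder_cases) (auto simp: algebra_simps)
  moreover have "\<bar>- u0 x - k\<bar> * \<phi> (0, x) = \<bar>u0 x - (-k)\<bar> * \<phi> (0, x)" for x
    by (auto simp: abs_if)
  ultimately show "0 \<le> (LINT z:({0..} \<times> UNIV)|lborel. \<bar>- u (fst z) (snd z) - k\<bar> * \<phi>t z
                + sgn (- u (fst z) (snd z) - k) * (- F (- (- u (fst z) (snd z))) - - F (- k)) * \<phi>x z)
            + (LINT x|lborel. \<bar>- u0 x - k\<bar> * \<phi> (0, x))"
    using entropy[OF \<phi>, of "-k"] by (simp only:)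
qed

end

lemma AE_Ioo_ex:
  fixes a b :: real
  assumes "AE s in lborel. P s" "a < b"
  obtains s where "a < s" "s < b" "P s"
proof -
  have "\<exists>s\<in>{a<..<b}. P s"
  proof (rule ccontr)
    assume "\<not> ?thesis"
    then have "AE s in lborel. s \<notin> {a<..<b}" using assms(1) by (auto elim!: AE_mp)
    then have "{a<..<b} \<in> null_sets lborel" by (subst AE_iff_null_sets) auto
    then show False using assms(2) by (auto simp: null_sets_def)
  qed
  then show thesis using that by auto
qed

lemma AE_lborel_sections:
  fixes Q :: "real \<times> real \<Rightarrow> bool"
  assumes "AE z in lborel. Q z" shows "AE t in lborel. AE x in lborel. Q (t, x)"
proof -
  have "AE z in lborel \<Otimes>\<^sub>M lborel. Q z" unfolding lborel_prod by (rule assms)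
  from lborel_pair.AE_pair[OF this] show ?thesis .
qed

section \<open>Finite speed of propagation and the maximum principle\<close>

context entropy_sol begin

text \<open>The test function is the square of the positive distance to the boundary of a backward
  cone. Its time derivative carries the factor L1, its space derivative a factor of modulus at most
  1; as L < L1, the entropy integrand is nonpositive. The initial term vanishes, so the integrand is
  zero, which leaves no mass of (u - k)+ in the cone.\<close>

lemma cone:
  assumes L: "\<And>t x. \<bar>F (u t x) - F k\<bar> \<le> L * \<bar>u t x - k\<bar>" and L1: "L < L1" "0 < L1"
    and u0k: "\<And>x. \<bar>x - x0\<bar> < r \<Longrightarrow> u0 x \<le> k"
  shows "AE z in lborel. 0 \<le> fst z \<longrightarrow> L1 * fst z + sqrt (1 + (snd z - x0)\<^sup>2) < r \<longrightarrow> u (fst z) (snd z) \<le> k"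
proof -
  \<comment> \<open>A smooth substitute for |y - x0| whose derivative still has modulus at most
    1.\<close>
  define q where "q = (\<lambda>y. sqrt (1 + (y - x0)\<^sup>2))"
  define q' where "q' = (\<lambda>y. (y - x0) / sqrt (1 + (y - x0)\<^sup>2))"
  define P where "P = (\<lambda>z. max 0 (r - L1 * fst z - q (snd z)))"
  \<comment> \<open>The step in time equals 1 from time -1 on. It only cuts off the unbounded past
    part of the cone, since test functions live on the whole plane.\<close>
  define \<phi> where "\<phi> = (\<lambda>z. sstep (fst z + 2) * (P z)\<^sup>2)"
  define \<phi>t where "\<phi>t = (\<lambda>z. hat (fst z + 2) * (P z)\<^sup>2 + sstep (fst z + 2) * (2 * P z * - L1))"
  define \<phi>x where "\<phi>x = (\<lambda>z. sstep (fst z + 2) * (2 * P z * - q' (snd z)))"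
  have pos1: "0 < 1 + y\<^sup>2" for y :: real by (simp add: add_pos_nonneg)
  have q_abs: "\<bar>y - x0\<bar> \<le> q y" for y
    unfolding q_def by (rule real_le_rsqrt) simp
  have q_pos: "0 < q y" for y unfolding q_def using pos1 by simp
  have q'_le: "\<bar>q' y\<bar> \<le> 1" for y
    using q_abs[of y] q_pos[of y] by (simp add: q'_def q_def)
  have Dq: "(q has_real_derivative q' y) (at y)" for y
  proof -
    have "((\<lambda>y. sqrt (1 + (y - x0)\<^sup>2)) has_real_derivative inverse (sqrt (1 + (y - x0)\<^sup>2)) / 2 * (2 * (y - x0))) (at y)"
      by (rule DERIV_chain2[where f = sqrt and g = "\<lambda>y. 1 + (y - x0)\<^sup>2", OF DERIV_real_sqrt[OF pos1]]) (auto intro!: derivative_eq_intros)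
    moreover have "inverse S / 2 * (2 * d) = d / S" for S d :: real by (simp add: field_simps)
    ultimately show ?thesis unfolding q_def q'_def by (simp only:)
  qed
  have cq: "continuous_on A q" for A unfolding q_def by (intro continuous_intros)
  have cq': "continuous_on A q'" for A unfolding q'_def using q_pos unfolding q_def
    by (intro continuous_intros) (metis less_irrefl)
  have cP: "continuous_on UNIV P" unfolding P_def
    by (intro continuous_intros continuous_on_compose2[OF cq[of UNIV]]) auto
  have \<phi>: "test_fun \<phi> \<phi>t \<phi>x"
    unfolding test_fun_def
  proof (intro conjI allI)
    show "0 \<le> \<phi> z" for z unfolding \<phi>_def by (intro mult_nonneg_nonneg sstep_nonneg zero_le_power2)
    have "{z. \<phi> z \<noteq> 0} \<subseteq> {-2..r / L1} \<times> {x0 - (r + 2 * L1)..x0 + (r + 2 * L1)}"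
    proof
      fix z assume "z \<in> {z. \<phi> z \<noteq> 0}"
      then have s: "sstep (fst z + 2) \<noteq> 0" "P z \<noteq> 0" by (auto simp: \<phi>_def)
      have t: "- 2 < fst z" using s(1) sstep_le_0[of "fst z + 2"] by linarith
      have p: "L1 * fst z + q (snd z) < r" using s(2) unfolding P_def by linarith
      have "L1 * (-2) \<le> L1 * fst z" using t L1 by (intro mult_left_mono) auto
      then have "\<bar>snd z - x0\<bar> \<le> r + 2 * L1" using p q_abs[of "snd z"] by linarith
      moreover have "L1 * fst z \<le> r" using p q_pos[of "snd z"] by linarith
      then have "fst z \<le> r / L1" using L1 by (simp add: pos_le_divide_eq mult.commute)
      ultimately have "snd z \<in> {x0 - (r + 2 * L1)..x0 + (r + 2 * L1)}" "fst z \<in> {-2..r / L1}" using t by auto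
      then show "z \<in> {-2..r / L1} \<times> {x0 - (r + 2 * L1)..x0 + (r + 2 * L1)}" by (simp add: mem_Times_iff)
    qed
    then show "bounded {z. \<phi> z \<noteq> 0}" by (rule bounded_subset[rotated]) (intro bounded_Times; simp)
    show "((\<lambda>s. \<phi> (s, x)) has_real_derivative \<phi>t (t, x)) (at t)" for t x
    proof -
      have "((\<lambda>s. (max 0 (r - L1 * s - q x))\<^sup>2) has_real_derivative (2 * max 0 (r - L1 * t - q x)) * - L1) (at t)"
        by (rule DERIV_chain2[OF DERIV_pos_part_square]) (auto intro!: derivative_eq_intros)
      moreover have "((\<lambda>s. sstep (s + 2)) has_real_derivative hat (t + 2) * 1) (at t)"
        by (rule DERIV_chain2[OF DERIV_sstep]) (auto intro!: derivative_eq_intros)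
      ultimately have "((\<lambda>s. sstep (s + 2) * (max 0 (r - L1 * s - q x))\<^sup>2) has_real_derivative
         (hat (t + 2) * 1) * (max 0 (r - L1 * t - q x))\<^sup>2 + (2 * max 0 (r - L1 * t - q x)) * - L1 * sstep (t + 2)) (at t)"
        by (intro DERIV_mult) 
      then show ?thesis unfolding \<phi>_def \<phi>t_def P_def fst_conv snd_conv
        by (rule DERIV_cong) (simp only: mult_1_right mult.commute mult.left_commute)
    qed
    show "((\<lambda>y. \<phi> (t, y)) has_real_derivative \<phi>x (t, x)) (at x)" for t x
    proof -
      have "((\<lambda>y. (max 0 (r - L1 * t - q y))\<^sup>2) has_real_derivative (2 * max 0 (r - L1 * t - q x)) * - q' x) (at x)"
        by (rule DERIV_chain2[OF DERIV_pos_part_square]) (auto intro!: derivative_eq_intros Dq)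
      then have "((\<lambda>y. sstep (t + 2) * (max 0 (r - L1 * t - q y))\<^sup>2) has_real_derivative
         sstep (t + 2) * ((2 * max 0 (r - L1 * t - q x)) * - q' x)) (at x)"
        by (rule DERIV_cmult)
      then show ?thesis unfolding \<phi>_def \<phi>x_def P_def fst_conv snd_conv .
    qed
    show "continuous_on UNIV \<phi>t" unfolding \<phi>t_def by (intro continuous_intros cP)
    show "continuous_on UNIV \<phi>x" unfolding \<phi>x_def
      by (intro continuous_intros cP continuous_on_compose2[OF cq'[of UNIV]]) auto
  qed
  define pu where "pu = (\<lambda>z. max 0 (u (fst z) (snd z) - k))"
  define Fu where "Fu = (\<lambda>z. if u (fst z) (snd z) > k then F (u (fst z) (snd z)) - F k else 0)"
  define h where "h = (\<lambda>z. pu z * \<phi>t z + Fu z * \<phi>x z)"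
  have ih: "set_integrable lborel ({0..} \<times> UNIV) h"
  proof -
    obtain B where B: "\<forall>t x. \<bar>u t x\<bar> \<le> B" using bounded_u by blast
    obtain D where D: "\<forall>t x. \<bar>F (u t x) - F k\<bar> \<le> D" using bounded_F_u by blast
    have D0: "0 \<le> D" using D[rule_format, of 0 0] by linarith
    have "\<bar>pu z\<bar> \<le> B + \<bar>k\<bar>" for z
      unfolding pu_def using B[rule_format, of "fst z" "snd z"] by linarith
    moreover have "\<bar>Fu z\<bar> \<le> D" for z using D D0 by (simp add: Fu_def)
    moreover have "pu \<in> borel_measurable borel" "Fu \<in> borel_measurable borel"
      unfolding pu_def Fu_def by measurable
    ultimately show ?thesis unfolding h_def
      by (intro set_integral_add test_fun_integrable[OF \<phi>])
  qed
  have h_le: "h z \<le> - (2 * P z * (L1 - L) * pu z)" if "0 \<le> fst z" for z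
  proof -
    have "hat (fst z + 2) = 0" "sstep (fst z + 2) = 1" using that by (auto simp: hat_eq_0 sstep_ge_1)
    then have eq: "h z = 2 * P z * (- L1 * pu z - Fu z * q' (snd z))"
      by (simp add: h_def \<phi>t_def \<phi>x_def algebra_simps)
    have "\<bar>Fu z\<bar> \<le> L * pu z" using L[of "fst z" "snd z"] by (auto simp: Fu_def pu_def abs_of_nonneg)
    moreover have "\<bar>Fu z * q' (snd z)\<bar> \<le> \<bar>Fu z\<bar> * 1" unfolding abs_mult by (intro mult_left_mono q'_le) auto
    ultimately have "- L1 * pu z - Fu z * q' (snd z) \<le> - L1 * pu z + L * pu z" by linarith
    then have "2 * P z * (- L1 * pu z - Fu z * q' (snd z)) \<le> 2 * P z * (- L1 * pu z + L * pu z)"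
      by (rule mult_left_mono) (simp add: P_def)
    moreover have "2 * P z * (- L1 * pu z + L * pu z) = - (2 * P z * (L1 - L) * pu z)"
      by (simp add: algebra_simps)
    ultimately show ?thesis unfolding eq by (simp only:)
  qed
  have u0_0: "max 0 (u0 x - k) * \<phi> (0, x) = 0" for x
  proof (cases "\<bar>x - x0\<bar> < r")
    case True then show ?thesis using u0k[OF True] by simp
  next
    case False
    then have "P (0, x) = 0" using q_abs[of x] by (simp add: P_def)
    then show ?thesis by (simp add: \<phi>_def)
  qed
  have h0: "0 \<le> (LINT z:({0..} \<times> UNIV)|lborel. h z)"
    using one_sided_entropy[OF \<phi>, of k] unfolding u0_0 h_def pu_def Fu_def
    by (simp only: Bochner_Integration.integral_zero add_0_right)
  let ?G = "\<lambda>z. indicator ({0..} \<times> UNIV) z *\<^sub>R (- h z)"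
  have Gn: "0 \<le> ?G z" for z
  proof (cases "0 \<le> fst z")
    case True
    have "0 \<le> P z" "0 \<le> L1 - L" "0 \<le> pu z" using L1 unfolding P_def pu_def by auto
    then have "0 \<le> 2 * P z * (L1 - L) * pu z" by (intro mult_nonneg_nonneg) simp_all
    then have "0 \<le> - h z" using h_le[OF True] by linarith
    then show ?thesis by (simp add: indicator_def)
  qed (auto simp: indicator_def mem_Times_iff)
  have iG: "integrable lborel ?G"
    using ih unfolding set_integrable_def scaleR_minus_right by (rule Bochner_Integration.integrable_minus)
  have "integral\<^sup>L lborel ?G = - (LINT z:({0..} \<times> UNIV)|lborel. h z)"
    unfolding set_lebesgue_integral_def scaleR_minus_right by (rule Bochner_Integration.integral_minus)
  then have "integral\<^sup>L lborel ?G \<le> 0" using h0 by linarith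
  moreover have "0 \<le> integral\<^sup>L lborel ?G" using Gn by (intro Bochner_Integration.integral_nonneg)
  ultimately have "AE z in lborel. ?G z = 0"
    using integral_nonneg_eq_0_iff_AE[OF iG] Gn by auto
  then show ?thesis
  proof (rule AE_mp, intro AE_I2 impI)
    fix z assume G: "?G z = 0" and t: "0 \<le> fst z" and c: "L1 * fst z + sqrt (1 + (snd z - x0)\<^sup>2) < r"
    have "h z = 0" using G t by (simp add: indicator_def mem_Times_iff)
    then have le: "2 * P z * (L1 - L) * pu z \<le> 0" using h_le[OF t] by linarith
    have "0 < P z" using c unfolding P_def q_def by linarith
    then have "0 < 2 * P z * (L1 - L)" using L1 by simp
    then have "pu z \<le> 0" using le by (metis mult_pos_pos not_le)
    then show "u (fst z) (snd z) \<le> k" unfolding pu_def by linarith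
  qed
qed

text \<open>Continuity in time with values in local L1 passes a bound from almost every nearby time
  to the time t. Only later times are used, so t = 0 is covered.\<close>

lemma bound_all_times:
  assumes t: "0 \<le> t" and \<eta>: "0 < \<eta>" and I: "I \<subseteq> {-R..R}" "I \<in> sets borel"
    and ae: "AE s in lborel. AE x in lborel. t < s \<longrightarrow> s < t + \<eta> \<longrightarrow> x \<in> I \<longrightarrow> u s x \<le> k"
  shows "AE x in lborel. x \<in> I \<longrightarrow> u t x \<le> k"
proof -
  obtain B where B: "\<forall>t x. \<bar>u t x\<bar> \<le> B" using bounded_u by blast
  note [measurable] = I(2)
  let ?g = "\<lambda>x. indicator I x * max 0 (u t x - k)"
  have gB: "\<bar>?g x\<bar> \<le> B + \<bar>k\<bar>" for x
    using B[rule_format, of t x] by (auto simp: indicator_def max_def abs_if split: if_splits)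
  have ig: "integrable lborel ?g"
  proof (rule integrable_bounded_support[where R = R, OF _ gB])
    fix x :: real assume "R < \<bar>x\<bar>"
    then have "x \<notin> {-R..R}" by auto
    then have "x \<notin> I" using I(1) by blast
    then show "?g x = 0" by simp
  qed measurable
  have "integral\<^sup>L lborel ?g \<le> 0"
  proof (rule field_le_epsilon)
    fix e :: real assume e: "0 < e"
    have "eventually (\<lambda>s. (LINT x:{-R..R}|lborel. \<bar>u s x - u t x\<bar>) < e) (at t within {0..})"
      by (rule order_tendstoD[OF L1_cont[OF t]]) (rule e)
    then obtain d where d: "0 < d" "\<And>s. 0 \<le> s \<Longrightarrow> s \<noteq> t \<Longrightarrow> dist s t < d \<Longrightarrow> (LINT x:{-R..R}|lborel. \<bar>u s x - u t x\<bar>) < e"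
      unfolding eventually_at by auto
    obtain s where s: "t < s" "s < t + min \<eta> d" "AE x in lborel. t < s \<longrightarrow> s < t + \<eta> \<longrightarrow> x \<in> I \<longrightarrow> u s x \<le> k"
      using AE_Ioo_ex[OF ae, of t "t + min \<eta> d"] \<eta> d(1) by auto
    have mB: "\<bar>indicator {-R..R} x *\<^sub>R \<bar>u s x - u t x\<bar>\<bar> \<le> B + B" for x
      using B[rule_format, of t x] B[rule_format, of s x] by (auto simp: indicator_def)
    have im: "integrable lborel (\<lambda>x. indicator {-R..R} x *\<^sub>R \<bar>u s x - u t x\<bar>)"
      by (rule integrable_bounded_support[where R = R, OF _ mB]) (auto simp: indicator_def)
    have "integral\<^sup>L lborel ?g \<le> (LINT x|lborel. indicator {-R..R} x *\<^sub>R \<bar>u s x - u t x\<bar>)"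
    proof (rule integral_mono_AE[OF ig im])
      show "AE x in lborel. ?g x \<le> indicator {-R..R} x *\<^sub>R \<bar>u s x - u t x\<bar>"
        using s(3) by (rule AE_mp) (use s I(1) in \<open>auto intro!: AE_I2 simp: indicator_def\<close>)
    qed
    also have "\<dots> < e" using d(2)[of s] s t by (simp add: dist_real_def set_lebesgue_integral_def)
    finally show "integral\<^sup>L lborel ?g \<le> 0 + e" by simp
  qed
  moreover have "0 \<le> integral\<^sup>L lborel ?g" by (intro Bochner_Integration.integral_nonneg) auto
  ultimately have "AE x in lborel. ?g x = 0"
    by (subst integral_nonneg_eq_0_iff_AE[OF ig, symmetric]) auto
  then show ?thesis by (rule AE_mp) (auto intro!: AE_I2 simp: max_def split: if_splits)
qed

text \<open>The margin 2 has two sources: sqrt (1 + (x - x0)^2) exceeds |x - x0| by at most 1, and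
  another unit pays for the times in (t, t + 1/L1) from which the bound is transported to t.\<close>

lemma one_sided_propagation:
  assumes L: "\<And>t x. \<bar>F (u t x) - F k\<bar> \<le> L * \<bar>u t x - k\<bar>" and L1: "L < L1" "0 < L1"
    and u0k: "\<And>x. \<bar>x - x0\<bar> < r \<Longrightarrow> u0 x \<le> k" and t: "0 \<le> t"
  shows "AE x in lborel. 2 + \<bar>x - x0\<bar> + L1 * t \<le> r \<longrightarrow> u t x \<le> k"
proof -
  let ?I = "{x. 2 + \<bar>x - x0\<bar> + L1 * t \<le> r}"
  have Lt: "0 \<le> L1 * t" using L1 t by simp
  have I: "?I \<subseteq> {-(\<bar>x0\<bar> + \<bar>r\<bar>)..\<bar>x0\<bar> + \<bar>r\<bar>}"
  proof
    fix x assume "x \<in> ?I"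
    then have "2 + \<bar>x - x0\<bar> \<le> r" using Lt by simp
    then show "x \<in> {-(\<bar>x0\<bar> + \<bar>r\<bar>)..\<bar>x0\<bar> + \<bar>r\<bar>}" by auto
  qed
  have "AE s in lborel. AE x in lborel. 0 \<le> s \<longrightarrow> L1 * s + sqrt (1 + (x - x0)\<^sup>2) < r \<longrightarrow> u s x \<le> k"
    using AE_lborel_sections[OF cone[OF L L1 u0k]] by simp
  then have "AE s in lborel. AE x in lborel. t < s \<longrightarrow> s < t + 1 / L1 \<longrightarrow> x \<in> ?I \<longrightarrow> u s x \<le> k"
  proof (rule eventually_mono)
    fix s assume ae: "AE x in lborel. 0 \<le> s \<longrightarrow> L1 * s + sqrt (1 + (x - x0)\<^sup>2) < r \<longrightarrow> u s x \<le> k"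
    show "AE x in lborel. t < s \<longrightarrow> s < t + 1 / L1 \<longrightarrow> x \<in> ?I \<longrightarrow> u s x \<le> k"
      using ae
    proof (rule eventually_mono, intro impI)
      fix x assume k: "0 \<le> s \<longrightarrow> L1 * s + sqrt (1 + (x - x0)\<^sup>2) < r \<longrightarrow> u s x \<le> k"
        and s: "t < s" "s < t + 1 / L1" and x: "x \<in> ?I"
      have "L1 * s < L1 * (t + 1 / L1)" using s L1 by (intro mult_strict_left_mono)
      then have "L1 * s < L1 * t + 1" using L1 by (simp add: distrib_left)
      moreover have "sqrt (1 + (x - x0)\<^sup>2) \<le> 1 + \<bar>x - x0\<bar>"
        by (rule real_le_lsqrt) (auto simp: power2_eq_square algebra_simps abs_mult_self_eq)
      ultimately have "L1 * s + sqrt (1 + (x - x0)\<^sup>2) < r" using x by simp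
      then show "u s x \<le> k" using k s t by simp
    qed
  qed
  then have "AE x in lborel. x \<in> ?I \<longrightarrow> u t x \<le> k"
    by (rule bound_all_times[OF t _ I, rotated 2]) (use L1 in auto)
  then show ?thesis by simp
qed

text \<open>The cones with integer radius around 0 exhaust the line.\<close>

lemma max_principle:
  assumes u0k: "\<And>x. u0 x \<le> k" and t: "0 \<le> t"
  shows "AE x in lborel. u t x \<le> k"
proof -
  obtain B where B: "\<forall>t x. \<bar>u t x\<bar> \<le> B" using bounded_u by blast
  define r where "r = max \<bar>k\<bar> B"
  obtain L where L: "\<forall>p\<in>{-r..r}. \<forall>q\<in>{-r..r}. \<bar>F p - F q\<bar> \<le> L * \<bar>p - q\<bar>" using F_Lipschitz by blast
  have Lu: "\<bar>F (u t x) - F k\<bar> \<le> L * \<bar>u t x - k\<bar>" for t x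
  proof -
    have "u t x \<in> {-r..r}" "k \<in> {-r..r}" using B[rule_format, of t x] unfolding r_def by auto
    then show ?thesis using L by blast
  qed
  have "AE x in lborel. \<forall>n::nat. 2 + \<bar>x - 0\<bar> + (\<bar>L\<bar> + 1) * t \<le> real n \<longrightarrow> u t x \<le> k"
    unfolding AE_all_countable
    by (intro allI one_sided_propagation[OF Lu _ _ u0k t]) auto
  then show ?thesis
  proof (rule AE_mp, intro AE_I2 impI)
    fix x assume *: "\<forall>n::nat. 2 + \<bar>x - 0\<bar> + (\<bar>L\<bar> + 1) * t \<le> real n \<longrightarrow> u t x \<le> k"
    obtain n :: nat where "2 + \<bar>x - 0\<bar> + (\<bar>L\<bar> + 1) * t \<le> real n" using real_arch_simple by blast
    then show "u t x \<le> k" using * by blast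
  qed
qed

text \<open>The cones centred at n and -n with radius n - R have bases outside [-R, R]. For growing
  n they exhaust the two half-lines to which the data have not yet spread.\<close>

lemma one_sided_support:
  assumes L: "\<And>t x. \<bar>F (u t x) - F 0\<bar> \<le> L * \<bar>u t x\<bar>" "0 \<le> L"
    and u0: "\<And>x. R < \<bar>x\<bar> \<Longrightarrow> u0 x \<le> 0" and t: "0 \<le> t"
  shows "AE x in lborel. R + 2 + (L + 1) * t \<le> \<bar>x\<bar> \<longrightarrow> u t x \<le> 0"
proof -
  have p: "AE x in lborel. 2 + \<bar>x - real n\<bar> + (L + 1) * t \<le> real n - R \<longrightarrow> u t x \<le> 0" for n
    by (rule one_sided_propagation[of 0 L]) (use L t u0 in auto)
  have m: "AE x in lborel. 2 + \<bar>x - - real n\<bar> + (L + 1) * t \<le> real n - R \<longrightarrow> u t x \<le> 0" for n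
    by (rule one_sided_propagation[of 0 L]) (use L t u0 in auto)
  have "AE x in lborel. \<forall>n. (2 + \<bar>x - real n\<bar> + (L + 1) * t \<le> real n - R \<longrightarrow> u t x \<le> 0) \<and>
      (2 + \<bar>x - - real n\<bar> + (L + 1) * t \<le> real n - R \<longrightarrow> u t x \<le> 0)"
    unfolding AE_all_countable using p m by (auto intro: AE_conjI)
  then show ?thesis
  proof (rule AE_mp, intro AE_I2 impI)
    fix x assume *: "\<forall>n. (2 + \<bar>x - real n\<bar> + (L + 1) * t \<le> real n - R \<longrightarrow> u t x \<le> 0) \<and>
      (2 + \<bar>x - - real n\<bar> + (L + 1) * t \<le> real n - R \<longrightarrow> u t x \<le> 0)" and x: "R + 2 + (L + 1) * t \<le> \<bar>x\<bar>"
    obtain n :: nat where n: "\<bar>x\<bar> \<le> real n" using real_arch_simple by blast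
    show "u t x \<le> 0"
    proof (cases "0 \<le> x")
      case True
      then have "2 + \<bar>x - real n\<bar> + (L + 1) * t \<le> real n - R" using x n by (simp add: abs_if)
      then show ?thesis using * by blast
    next
      case False
      then have "2 + \<bar>x - - real n\<bar> + (L + 1) * t \<le> real n - R" using x n by (simp add: abs_if)
      then show ?thesis using * by blast
    qed
  qed
qed

end

section \<open>Choice of representatives\<close>

lemma borel_section:
  fixes u :: "real \<Rightarrow> real \<Rightarrow> real"
  assumes "(\<lambda>z. u (fst z) (snd z)) \<in> borel_measurable borel"
  shows "u t \<in> borel_measurable borel"
proof -
  have "(\<lambda>x. (t, x)) \<in> borel \<rightarrow>\<^sub>M (borel :: (real \<times> real) measure)"
    by (intro borel_measurable_continuous_onI continuous_intros)
  from measurable_compose[OF this assms] show ?thesis by simp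
qed

text \<open>The two conditions of \<open>entropy_solution\<close> that survive changes of
  \<open>u t\<close> on null sets at each time. Measurability and pointwise bounds are kept apart,
  as they have to be secured anew for each modified representative.\<close>

definition entropic :: "(real \<Rightarrow> real) \<Rightarrow> (real \<Rightarrow> real) \<Rightarrow> (real \<Rightarrow> real \<Rightarrow> real) \<Rightarrow> bool" where
  "entropic F u0 u \<longleftrightarrow>
     (\<forall>R. \<forall>t\<ge>0. ((\<lambda>s. LINT x:{-R..R}|lborel. \<bar>u s x - u t x\<bar>) \<longlongrightarrow> 0) (at t within {0..})) \<and>
     (\<forall>k \<phi> \<phi>t \<phi>x. test_fun \<phi> \<phi>t \<phi>x \<longrightarrow>
        0 \<le> (LINT z:({0..} \<times> UNIV)|lborel. \<bar>u (fst z) (snd z) - k\<bar> * \<phi>t z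
                + sgn (u (fst z) (snd z) - k) * (F (u (fst z) (snd z)) - F k) * \<phi>x z)
            + (LINT x|lborel. \<bar>u0 x - k\<bar> * \<phi> (0, x)))"

text \<open>Equality almost everywhere at each time gives equality almost everywhere in the half
  plane by Fubini; joint measurability of both functions enters here.\<close>

lemma entropic_cong_AE:
  assumes [measurable]: "(\<lambda>z. u (fst z) (snd z)) \<in> borel_measurable borel"
      "(\<lambda>z. w (fst z) (snd z)) \<in> borel_measurable borel" "F \<in> borel_measurable borel"
    and eq: "\<And>t. 0 \<le> t \<Longrightarrow> AE x in lborel. u t x = w t x" and u: "entropic F u0 u"
  shows "entropic F u0 w"
  unfolding entropic_def
proof (intro conjI allI impI)
  note [measurable] = borel_section[of u, OF assms(1)] borel_section[of w, OF assms(2)]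
  fix R t :: real assume t: "0 \<le> t"
  have "(LINT x:{-R..R}|lborel. \<bar>u s x - u t x\<bar>) = (LINT x:{-R..R}|lborel. \<bar>w s x - w t x\<bar>)" if "0 \<le> s" for s
  proof -
    have "AE x in lborel. indicator {-R..R} x *\<^sub>R \<bar>u s x - u t x\<bar> = indicator {-R..R} x *\<^sub>R \<bar>w s x - w t x\<bar>"
      using eq[OF t] eq[OF that] by eventually_elim simp
    then show ?thesis unfolding set_lebesgue_integral_def by (intro integral_cong_AE) auto
  qed
  then have "\<forall>\<^sub>F s in at t within {0..}. (LINT x:{-R..R}|lborel. \<bar>u s x - u t x\<bar>) = (LINT x:{-R..R}|lborel. \<bar>w s x - w t x\<bar>)"
    by (auto simp: eventually_at_filter)
  then show "((\<lambda>s. LINT x:{-R..R}|lborel. \<bar>w s x - w t x\<bar>) \<longlongrightarrow> 0) (at t within {0..})"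
    using u t by (subst tendsto_cong[symmetric]) (auto simp: entropic_def)
next
  fix k \<phi> \<phi>t \<phi>x assume \<phi>: "test_fun \<phi> \<phi>t \<phi>x"
  note [measurable] = test_fun_measurable[OF \<phi>]
  have [measurable]: "{0..} \<times> UNIV \<in> sets (borel :: (real \<times> real) measure)"
    by (auto intro!: borel_closed closed_Times)
  have "AE z in lborel. z \<in> {0..} \<times> UNIV \<longrightarrow> u (fst z) (snd z) = w (fst z) (snd z)"
  proof -
    have m: "{z \<in> space (lborel \<Otimes>\<^sub>M lborel). z \<in> {0..} \<times> UNIV \<longrightarrow> u (fst z) (snd z) = w (fst z) (snd z)} \<in> sets (lborel \<Otimes>\<^sub>M lborel)"
      unfolding lborel_prod by measurable
    have "AE t in lborel. AE x in lborel. (t, x) \<in> {0..} \<times> UNIV \<longrightarrow> u (fst (t, x)) (snd (t, x)) = w (fst (t, x)) (snd (t, x))"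
    proof (rule AE_I2)
      fix t :: real show "AE x in lborel. (t, x) \<in> {0..} \<times> UNIV \<longrightarrow> u (fst (t, x)) (snd (t, x)) = w (fst (t, x)) (snd (t, x))"
        using eq[of t] by (cases "0 \<le> t") auto
    qed
    from lborel_pair.AE_pair_measure[OF m this] show ?thesis unfolding lborel_prod .
  qed
  then have "(LINT z:({0..} \<times> UNIV)|lborel. \<bar>u (fst z) (snd z) - k\<bar> * \<phi>t z
                + sgn (u (fst z) (snd z) - k) * (F (u (fst z) (snd z)) - F k) * \<phi>x z) =
     (LINT z:({0..} \<times> UNIV)|lborel. \<bar>w (fst z) (snd z) - k\<bar> * \<phi>t z
                + sgn (w (fst z) (snd z) - k) * (F (w (fst z) (snd z)) - F k) * \<phi>x z)"
    unfolding set_lebesgue_integral_def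
  proof (intro integral_cong_AE)
    assume "AE z in lborel. z \<in> {0..} \<times> UNIV \<longrightarrow> u (fst z) (snd z) = w (fst z) (snd z)"
    then show "AE z in lborel. indicator ({0..} \<times> UNIV) z *\<^sub>R (\<bar>u (fst z) (snd z) - k\<bar> * \<phi>t z
                + sgn (u (fst z) (snd z) - k) * (F (u (fst z) (snd z)) - F k) * \<phi>x z) =
       indicator ({0..} \<times> UNIV) z *\<^sub>R (\<bar>w (fst z) (snd z) - k\<bar> * \<phi>t z
                + sgn (w (fst z) (snd z) - k) * (F (w (fst z) (snd z)) - F k) * \<phi>x z)"
    proof (rule eventually_mono)
      fix z assume "z \<in> {0..} \<times> UNIV \<longrightarrow> u (fst z) (snd z) = w (fst z) (snd z)"
      then show "indicator ({0..} \<times> UNIV) z *\<^sub>R (\<bar>u (fst z) (snd z) - k\<bar> * \<phi>t z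
                + sgn (u (fst z) (snd z) - k) * (F (u (fst z) (snd z)) - F k) * \<phi>x z) =
       indicator ({0..} \<times> UNIV) z *\<^sub>R (\<bar>w (fst z) (snd z) - k\<bar> * \<phi>t z
                + sgn (w (fst z) (snd z) - k) * (F (w (fst z) (snd z)) - F k) * \<phi>x z)"
        by (cases "z \<in> {0..} \<times> UNIV") (simp_all only: indicator_simps scaleR_zero_left simp_thms)
    qed
  qed (measurable)
  then show "0 \<le> (LINT z:({0..} \<times> UNIV)|lborel. \<bar>w (fst z) (snd z) - k\<bar> * \<phi>t z
                + sgn (w (fst z) (snd z) - k) * (F (w (fst z) (snd z)) - F k) * \<phi>x z)
            + (LINT x|lborel. \<bar>u0 x - k\<bar> * \<phi> (0, x))"
    using u[unfolded entropic_def, THEN conjunct2, rule_format, OF \<phi>, of k] by (simp only:)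
qed

text \<open>The support grows at speed L + 1 from a start at R + 2: the cone argument requires a
  speed strictly above the Lipschitz constant and leaves the margin 2.\<close>

locale compact_sol = entropy_sol +
  fixes a b R L :: real
  assumes ab: "a \<le> 0" "0 \<le> b" and R0: "0 \<le> R" and L0: "0 \<le> L"
    and range_u: "\<And>t x. a \<le> u t x \<and> u t x \<le> b"
    and supp_u: "\<And>t x. 0 \<le> t \<Longrightarrow> R + 2 + (L + 1) * t \<le> \<bar>x\<bar> \<Longrightarrow> u t x = 0"
    and supp_u0: "\<And>x. R < \<bar>x\<bar> \<Longrightarrow> u0 x = 0"
    and range_u0: "\<And>x. a \<le> u0 x \<and> u0 x \<le> b"
    and Lip: "\<And>p q. p \<in> {a..b} \<Longrightarrow> q \<in> {a..b} \<Longrightarrow> \<bar>F p - F q\<bar> \<le> L * \<bar>p - q\<bar>"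
    and F0: "F 0 = 0"

lemma entropy_solutionD:
  assumes u: "entropy_solution F u0 u"
    and w: "\<And>t x. 0 \<le> t \<Longrightarrow> w t x = u t x" "\<And>t x. t < 0 \<Longrightarrow> w t x = 0"
  shows "(\<lambda>z. w (fst z) (snd z)) \<in> borel_measurable borel" "entropic F u0 w"
proof -
  have eq: "(\<lambda>z. w (fst z) (snd z)) = (\<lambda>z. indicator ({0..} \<times> UNIV) z *\<^sub>R (case z of (t, x) \<Rightarrow> u t x))"
  proof
    fix z show "w (fst z) (snd z) = indicator ({0..} \<times> UNIV) z *\<^sub>R (case z of (t, x) \<Rightarrow> u t x)"
      using w(1)[of "fst z" "snd z"] w(2)[of "fst z" "snd z"]
      by (cases "0 \<le> fst z") (auto simp: indicator_def mem_Times_iff split_beta)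
  qed
  show "(\<lambda>z. w (fst z) (snd z)) \<in> borel_measurable borel"
    using u unfolding eq by (simp add: entropy_solution_def set_borel_measurable_def)
  show "entropic F u0 w" unfolding entropic_def
  proof (intro conjI allI impI)
    fix R t :: real assume t: "0 \<le> t"
    have "\<forall>\<^sub>F s in at t within {0..}. (LINT x:{-R..R}|lborel. \<bar>u s x - u t x\<bar>) = (LINT x:{-R..R}|lborel. \<bar>w s x - w t x\<bar>)"
      using w t by (auto simp: eventually_at_filter)
    then show "((\<lambda>s. LINT x:{-R..R}|lborel. \<bar>w s x - w t x\<bar>) \<longlongrightarrow> 0) (at t within {0..})"
      using u t by (subst tendsto_cong[symmetric]) (auto simp: entropy_solution_def)
  next
    fix k \<phi> \<phi>t \<phi>x assume \<phi>: "test_fun \<phi> \<phi>t \<phi>x"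
    have "(LINT (t, x):({0..} \<times> UNIV)|lborel. \<bar>u t x - k\<bar> * \<phi>t (t, x) + sgn (u t x - k) * (F (u t x) - F k) * \<phi>x (t, x))
       = (LINT z:({0..} \<times> UNIV)|lborel. \<bar>w (fst z) (snd z) - k\<bar> * \<phi>t z
                + sgn (w (fst z) (snd z) - k) * (F (w (fst z) (snd z)) - F k) * \<phi>x z)"
      unfolding set_lebesgue_integral_def
      by (intro Bochner_Integration.integral_cong refl) (auto simp: indicator_def w split_beta)
    then show "0 \<le> (LINT z:({0..} \<times> UNIV)|lborel. \<bar>w (fst z) (snd z) - k\<bar> * \<phi>t z
                + sgn (w (fst z) (snd z) - k) * (F (w (fst z) (snd z)) - F k) * \<phi>x z)
            + (LINT x|lborel. \<bar>u0 x - k\<bar> * \<phi> (0, x))"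
      using u[unfolded entropy_solution_def, THEN conjunct2, THEN conjunct2, THEN conjunct2, rule_format, OF \<phi>, of k]
      by (simp only:)
  qed
qed

lemma entropy_sol_iff_entropic:
  "entropy_sol F u0 u \<longleftrightarrow> entropic F u0 u \<and> (\<lambda>z. u (fst z) (snd z)) \<in> borel_measurable borel \<and>
     (\<exists>B. \<forall>t x. \<bar>u t x\<bar> \<le> B) \<and>
     (\<forall>r. \<exists>L. \<forall>p\<in>{-r..r}. \<forall>q\<in>{-r..r}. \<bar>F p - F q\<bar> \<le> L * \<bar>p - q\<bar>) \<and>
     u0 \<in> borel_measurable borel \<and> (\<exists>B. \<forall>x. \<bar>u0 x\<bar> \<le> B)"
  unfolding entropy_sol_def entropic_def by blast

lemma entropy_sol_cong_AE:
  assumes u: "entropy_sol F u0 u" and w: "(\<lambda>z. w (fst z) (snd z)) \<in> borel_measurable borel"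
    "\<And>t x. \<bar>w t x\<bar> \<le> B" and eq: "\<And>t. 0 \<le> t \<Longrightarrow> AE x in lborel. u t x = w t x"
  shows "entropy_sol F u0 w"
proof -
  interpret entropy_sol F u0 u by (rule u)
  have "entropic F u0 w"
    by (rule entropic_cong_AE[OF meas w(1) measurable_F eq]) (use u in \<open>auto simp: entropy_sol_iff_entropic\<close>)
  then show ?thesis using u w by (auto simp: entropy_sol_iff_entropic)
qed

text \<open>Passing to a representative with values in the range of the data and with compact support.\<close>
lemma entropy_solution_normalize:
  assumes u: "entropy_solution F u0 u" and F0: "F 0 = 0"
    and F: "\<And>r. \<exists>L. \<forall>p\<in>{-r..r}. \<forall>q\<in>{-r..r}. \<bar>F p - F q\<bar> \<le> L * \<bar>p - q\<bar>"
    and u0[measurable]: "u0 \<in> borel_measurable borel" and ab: "a \<le> 0" "0 \<le> b"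
    and range: "\<And>x. a \<le> u0 x \<and> u0 x \<le> b" and supp: "\<And>x. R < \<bar>x\<bar> \<Longrightarrow> u0 x = 0" and R: "0 \<le> R"
    and Lip: "\<And>p q. p \<in> {a..b} \<Longrightarrow> q \<in> {a..b} \<Longrightarrow> \<bar>F p - F q\<bar> \<le> L * \<bar>p - q\<bar>" and L: "0 \<le> L"
  obtains w where "compact_sol F u0 w a b R L" "\<And>t. 0 \<le> t \<Longrightarrow> AE x in lborel. u t x = w t x"
proof -
  obtain B where B: "\<And>t. 0 \<le> t \<Longrightarrow> AE x in lborel. \<bar>u t x\<bar> \<le> B"
    using u unfolding entropy_solution_def by blast
  define u1 where "u1 t x = (if 0 \<le> t then u t x else 0)" for t x
  have u1[measurable]: "(\<lambda>z. u1 (fst z) (snd z)) \<in> borel_measurable borel" and e1: "entropic F u0 u1"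
    by (rule entropy_solutionD[OF u]; simp add: u1_def)+
  \<comment> \<open>The order of the corrections matters: the maximum principle is available only
    for a solution bounded everywhere, and the support estimate uses \<open>L\<close>, which is a
    Lipschitz constant only for values in \<open>{a..b}\<close>.\<close>
  define u2 where "u2 t x = max (- \<bar>B\<bar>) (min \<bar>B\<bar> (u1 t x))" for t x
  have u2[measurable]: "(\<lambda>z. u2 (fst z) (snd z)) \<in> borel_measurable borel" unfolding u2_def by measurable
  have "continuous_on UNIV F" by (rule locally_Lipschitz_continuous[OF F])
  then have Fm: "F \<in> borel_measurable borel" by (rule borel_measurable_continuous_onI)
  have eq2: "AE x in lborel. u1 t x = u2 t x" if "0 \<le> t" for t
    using B[OF that] by eventually_elim (use that in \<open>auto simp: u1_def u2_def max_def min_def\<close>)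
  have e2: "entropic F u0 u2" by (rule entropic_cong_AE[OF u1 u2 Fm eq2 e1])
  have "\<bar>u2 t x\<bar> \<le> \<bar>B\<bar>" for t x unfolding u2_def by (auto simp: abs_le_iff)
  moreover have "\<bar>u0 x\<bar> \<le> \<bar>a\<bar> + \<bar>b\<bar>" for x using range[of x] by linarith
  ultimately have s2: "entropy_sol F u0 u2"
    unfolding entropy_sol_iff_entropic using e2 u2 F u0 by blast
  interpret s2: entropy_sol F u0 u2 by (rule s2)
  interpret n2: entropy_sol "\<lambda>p. - F (- p)" "\<lambda>x. - u0 x" "\<lambda>t x. - u2 t x" by (rule s2.reflect)
  define u3 where "u3 t x = max a (min b (u2 t x))" for t x
  have u3[measurable]: "(\<lambda>z. u3 (fst z) (snd z)) \<in> borel_measurable borel" unfolding u3_def by measurable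
  have eq3: "AE x in lborel. u2 t x = u3 t x" if "0 \<le> t" for t
  proof -
    have "AE x in lborel. u2 t x \<le> b" using s2.max_principle[OF _ that] range by blast
    moreover have "AE x in lborel. - u2 t x \<le> - a" using n2.max_principle[OF _ that, of "-a"] range by simp
    ultimately show ?thesis by eventually_elim (auto simp: u3_def)
  qed
  have r3: "a \<le> u3 t x \<and> u3 t x \<le> b" for t x using ab unfolding u3_def by auto
  have B3: "\<bar>u3 t x\<bar> \<le> \<bar>a\<bar> + \<bar>b\<bar>" for t x using r3[of t x] by linarith
  have s3: "entropy_sol F u0 u3" by (rule entropy_sol_cong_AE[OF s2 u3 B3 eq3])
  interpret s3: entropy_sol F u0 u3 by (rule s3)
  interpret n3: entropy_sol "\<lambda>p. - F (- p)" "\<lambda>x. - u0 x" "\<lambda>t x. - u3 t x" by (rule s3.reflect)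
  define w where "w t x = (if 0 \<le> t \<and> R + 2 + (L + 1) * t \<le> \<bar>x\<bar> then 0 else u3 t x)" for t x
  have w[measurable]: "(\<lambda>z. w (fst z) (snd z)) \<in> borel_measurable borel" unfolding w_def by measurable
  have Lu: "\<bar>F (u3 t x) - F 0\<bar> \<le> L * \<bar>u3 t x\<bar>" for t x
    using Lip[of "u3 t x" 0] r3[of t x] ab by simp
  have eqw: "AE x in lborel. u3 t x = w t x" if "0 \<le> t" for t
  proof -
    have "AE x in lborel. R + 2 + (L + 1) * t \<le> \<bar>x\<bar> \<longrightarrow> u3 t x \<le> 0"
      by (rule s3.one_sided_support[OF Lu L _ that]) (simp add: supp)
    moreover have "AE x in lborel. R + 2 + (L + 1) * t \<le> \<bar>x\<bar> \<longrightarrow> - u3 t x \<le> 0"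
    proof (rule n3.one_sided_support[OF _ L _ that])
      show "\<bar>- F (- (- u3 t x)) - - F (- 0)\<bar> \<le> L * \<bar>- u3 t x\<bar>" for t x
        using Lu[of t x] by (simp add: abs_minus_commute)
    qed (simp add: supp)
    ultimately show ?thesis by eventually_elim (auto simp: w_def)
  qed
  have rw: "a \<le> w t x \<and> w t x \<le> b" for t x using r3[of t x] ab by (auto simp: w_def)
  have "\<bar>w t x\<bar> \<le> \<bar>a\<bar> + \<bar>b\<bar>" for t x using rw[of t x] by linarith
  then have sw: "entropy_sol F u0 w" by (rule entropy_sol_cong_AE[OF s3 w _ eqw])
  have "compact_sol F u0 w a b R L"
    unfolding compact_sol_def compact_sol_axioms_def
    using sw ab R L rw supp range Lip F0 by (auto simp: w_def)
  moreover have "AE x in lborel. u t x = w t x" if "0 \<le> t" for t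
    using eq2[OF that] eq3[OF that] eqw[OF that] by eventually_elim (use that in \<open>simp add: u1_def\<close>)
  ultimately show thesis by (rule that)
qed

section \<open>Time evolution of mollified primitives\<close>

lemma mol_le:
  assumes "integrable lborel v" "0 < \<epsilon>" "\<And>y. v y \<le> c"
  shows "mol \<epsilon> v x \<le> c"
proof -
  have k: "integrable lborel (\<lambda>y. hat ((x - y) / \<epsilon> + 1) / \<epsilon>)" "(LINT y|lborel. hat ((x - y) / \<epsilon> + 1) / \<epsilon>) = 1"
    using kernel_integral[OF assms(2), of x] by (auto simp: has_bochner_integral_iff)
  have "mol \<epsilon> v x \<le> (LINT y|lborel. hat ((x - y) / \<epsilon> + 1) / \<epsilon> * c)"
    unfolding mol_def using kernel_nonneg[OF assms(2)] assms(3)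
    by (intro integral_mono integrable_mol assms integrable_mult_left k mult_left_mono)
  then show ?thesis by (simp only: Bochner_Integration.integral_mult_left_zero k(2) mult_1_left)
qed

lemma mol_scale:
  assumes "integrable lborel v" "integrable lborel w" "0 < \<epsilon>"
  shows "mol \<epsilon> (\<lambda>y. c * v y - w y) x = c * mol \<epsilon> v x - mol \<epsilon> w x"
proof -
  have "mol \<epsilon> (\<lambda>y. c * v y) x = c * mol \<epsilon> v x"
    unfolding mol_def by (simp only: mult.left_commute[of _ c] Bochner_Integration.integral_mult_right_zero)
  then show ?thesis using mol_diff[of "\<lambda>y. c * v y" w \<epsilon> x] assms by simp
qed

context compact_sol begin

definition X :: "real \<Rightarrow> real" where "X t = R + 2 + (L + 1) * t"

definition K :: real where "K = \<bar>a\<bar> + \<bar>b\<bar>"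

lemma X_mono: "s \<le> t \<Longrightarrow> X s \<le> X t"
  unfolding X_def using L0 by (intro add_left_mono mult_left_mono) auto

lemma X_pos: "0 \<le> t \<Longrightarrow> 0 < X t"
  unfolding X_def using mult_nonneg_nonneg[of "L + 1" t] L0 R0 by linarith

lemma abs_u: "\<bar>u t x\<bar> \<le> K" and abs_u0: "\<bar>u0 x\<bar> \<le> K"
  using range_u[of t x] range_u0[of x] unfolding K_def by linarith+

lemma K0: "0 \<le> K" unfolding K_def by simp

lemma u_eq_0: "0 \<le> s \<Longrightarrow> s \<le> t \<Longrightarrow> X t \<le> \<bar>x\<bar> \<Longrightarrow> u s x = 0"
  using supp_u[of s x] X_mono[of s t] by (simp add: X_def)

lemma abs_Fu: "\<bar>F (u t x)\<bar> \<le> L * K"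
proof -
  have "\<bar>F (u t x) - F 0\<bar> \<le> L * \<bar>u t x - 0\<bar>" using range_u ab by (intro Lip) auto
  also have "\<dots> \<le> L * K" using abs_u[of t x] L0 by (intro mult_left_mono) auto
  finally show ?thesis by (simp add: F0)
qed

lemma integrable_u: "0 \<le> t \<Longrightarrow> integrable lborel (u t)"
  by (rule integrable_bounded_support[where R = "X t", OF _ abs_u]) (auto intro!: u_eq_0[of t t])

lemma integrable_Fu: "0 \<le> t \<Longrightarrow> integrable lborel (\<lambda>x. F (u t x))"
  by (rule integrable_bounded_support[where R = "X t", OF _ abs_Fu]) (auto simp: u_eq_0[of t t] F0)

lemma integrable_u0: "integrable lborel u0"
  by (rule integrable_bounded_support[OF _ abs_u0 supp_u0]) auto

text \<open>All solutions at times within 1 of t are supported in one bounded interval, so local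
  convergence is convergence on the line.\<close>

lemma L1_tendsto:
  assumes t: "0 \<le> t"
  shows "((\<lambda>s. LINT x|lborel. \<bar>u s x - u t x\<bar>) \<longlongrightarrow> 0) (at t within {0..})"
proof -
  have "\<forall>\<^sub>F s in at t within {0..}. (LINT x:{-X (t+1)..X (t+1)}|lborel. \<bar>u s x - u t x\<bar>) = (LINT x|lborel. \<bar>u s x - u t x\<bar>)"
    unfolding eventually_at
  proof (intro exI[of _ 1] conjI ballI impI)
    fix s assume s: "s \<in> {0..}" "s \<noteq> t \<and> dist s t < 1"
    have "indicator {-X (t+1)..X (t+1)} x *\<^sub>R \<bar>u s x - u t x\<bar> = \<bar>u s x - u t x\<bar>" for x
    proof (cases "\<bar>x\<bar> \<le> X (t+1)")
      case True then show ?thesis by (auto simp: abs_le_iff indicator_def)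
    next
      case False
      then have "u s x = 0" "u t x = 0" using s t by (auto intro!: u_eq_0[of _ "t+1"] simp: dist_real_def)
      then show ?thesis by simp
    qed
    then show "(LINT x:{-X (t+1)..X (t+1)}|lborel. \<bar>u s x - u t x\<bar>) = (LINT x|lborel. \<bar>u s x - u t x\<bar>)"
      by (simp only: set_lebesgue_integral_def)
  qed simp
  then show ?thesis using L1_cont[OF t, of "X (t+1)"] by (subst tendsto_cong[symmetric])
qed

lemma L1_tendsto_F:
  assumes t: "0 \<le> t"
  shows "((\<lambda>s. LINT x|lborel. \<bar>F (u s x) - F (u t x)\<bar>) \<longlongrightarrow> 0) (at t within {0..})"
proof (rule Lim_null_comparison)
  show "\<forall>\<^sub>F s in at t within {0..}. norm (LINT x|lborel. \<bar>F (u s x) - F (u t x)\<bar>) \<le> L * (LINT x|lborel. \<bar>u s x - u t x\<bar>)"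
    unfolding eventually_at_filter
  proof (intro always_eventually allI impI)
    fix s :: real assume s: "s \<in> {0..}"
    have "(LINT x|lborel. \<bar>F (u s x) - F (u t x)\<bar>) \<le> (LINT x|lborel. L * \<bar>u s x - u t x\<bar>)"
      using s t integrable_u integrable_Fu range_u by (intro integral_mono) (auto intro!: Lip)
    then show "norm (LINT x|lborel. \<bar>F (u s x) - F (u t x)\<bar>) \<le> L * (LINT x|lborel. \<bar>u s x - u t x\<bar>)"
      by simp
  qed
  show "((\<lambda>s. L * (LINT x|lborel. \<bar>u s x - u t x\<bar>)) \<longlongrightarrow> 0) (at t within {0..})"
    by (rule tendsto_mult_right_zero[OF L1_tendsto[OF t]])
qed

lemma measurable_time_integral:
  fixes G \<kappa> :: "real \<Rightarrow> real"
  assumes [measurable]: "G \<in> borel_measurable borel" "\<kappa> \<in> borel_measurable borel"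
  shows "(\<lambda>t. (LINT x|lborel. \<kappa> x * G (u t x))) \<in> borel_measurable borel"
proof -
  have "(\<lambda>(t, x). \<kappa> x * G (u t x)) \<in> borel_measurable (lborel \<Otimes>\<^sub>M lborel)"
  proof -
    have u: "(\<lambda>z. u (fst z) (snd z)) \<in> borel_measurable (lborel \<Otimes>\<^sub>M lborel)"
      using meas unfolding lborel_prod by simp
    have k: "(\<lambda>z. \<kappa> (snd z)) \<in> borel_measurable (lborel \<Otimes>\<^sub>M lborel)"
      by (rule measurable_compose[OF measurable_snd]) simp
    show ?thesis unfolding case_prod_beta'
      by (intro borel_measurable_times k measurable_compose[OF u assms(1)])
  qed
  from lborel.borel_measurable_lebesgue_integral[OF this] show ?thesis by simp
qed

text \<open>Testing with the product of a time cutoff and a function of space. The derivative of the time cutoff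
  is the mollifier kernel, so the first term is a mollification in time.\<close>
lemma weak_product:
  assumes \<kappa>: "\<And>x. (\<kappa> has_real_derivative \<kappa>' x) (at x)" "continuous_on UNIV \<kappa>'"
      "\<And>x. 0 \<le> \<kappa> x" "\<And>x. \<kappa> x \<le> 1" "bounded {x. \<kappa> x \<noteq> 0}" and C: "\<And>x. \<bar>\<kappa>' x\<bar> \<le> C"
    and \<tau>: "0 \<le> \<tau>" and h: "0 < h" "h \<le> 1"
  defines "m \<equiv> \<lambda>t. (LINT x|lborel. \<kappa> x * u t x)" and "n \<equiv> \<lambda>t. (LINT x|lborel. \<kappa>' x * F (u t x))"
  shows "\<bar>mol h (\<lambda>t. indicator {0..\<tau>+1} t * m t) \<tau> - (LINT x|lborel. \<kappa> x * u0 x) - (LINT t:{0..\<tau>}|lborel. n t)\<bar>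
     \<le> h * (C * L * K * (2 * X (\<tau> + 1)))"
proof -
  \<comment> \<open>\<theta> is 1 on [0, \<tau>], falls to 0 on [\<tau>, \<tau> + h], and is cut off
    near time -2 only for compact support. Replacing \<theta> by the indicator of [0, \<tau>] in the
    flux term thus costs h times a bound for \<open>n\<close>.\<close>
  define \<theta> where "\<theta> t = sstep (t + 2) * sstep ((\<tau> - t) / h + 1)" for t
  define \<theta>' where "\<theta>' t = hat (t + 2) * sstep ((\<tau> - t) / h + 1) - sstep (t + 2) * (hat ((\<tau> - t) / h + 1) / h)" for t
  have D\<theta>: "(\<theta> has_real_derivative \<theta>' t) (at t)" for t
  proof -
    have "((\<lambda>t. sstep ((\<tau> - t) / h + 1)) has_real_derivative hat ((\<tau> - t) / h + 1) * (- 1 / h)) (at t)"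
      by (rule DERIV_chain2[OF DERIV_sstep]) (use h in \<open>auto intro!: derivative_eq_intros\<close>)
    moreover have "((\<lambda>t. sstep (t + 2)) has_real_derivative hat (t + 2) * 1) (at t)"
      by (rule DERIV_chain2[OF DERIV_sstep]) (auto intro!: derivative_eq_intros)
    ultimately have "(\<theta> has_real_derivative hat (t + 2) * 1 * sstep ((\<tau> - t) / h + 1) + hat ((\<tau> - t) / h + 1) * (- 1 / h) * sstep (t + 2)) (at t)"
      unfolding \<theta>_def by (intro DERIV_mult)
    then show ?thesis by (rule DERIV_cong) (simp add: \<theta>'_def)
  qed
  have c\<kappa>: "continuous_on UNIV \<kappa>" using \<kappa>(1) DERIV_isCont continuous_at_imp_continuous_on by blast
  have [measurable]: "\<kappa> \<in> borel_measurable borel" "\<kappa>' \<in> borel_measurable borel"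
    using c\<kappa> \<kappa>(2) by (auto intro: borel_measurable_continuous_onI)
  have c\<theta>': "continuous_on UNIV \<theta>'" unfolding \<theta>'_def using h by (intro continuous_intros) auto
  have c\<theta>: "continuous_on UNIV \<theta>" unfolding \<theta>_def using h by (intro continuous_intros) auto
  have [measurable]: "\<theta> \<in> borel_measurable borel" "\<theta>' \<in> borel_measurable borel"
    using c\<theta> c\<theta>' by (auto intro: borel_measurable_continuous_onI)
  define \<phi> where "\<phi> = (\<lambda>z. \<theta> (fst z) * \<kappa> (snd z))"
  define \<phi>t where "\<phi>t = (\<lambda>z. \<theta>' (fst z) * \<kappa> (snd z))"
  define \<phi>x where "\<phi>x = (\<lambda>z. \<theta> (fst z) * \<kappa>' (snd z))"
  have \<phi>: "test_fun \<phi> \<phi>t \<phi>x"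
    unfolding test_fun_def
  proof (intro conjI allI)
    show "0 \<le> \<phi> z" for z by (simp add: \<phi>_def \<theta>_def sstep_nonneg \<kappa>)
    have "{z. \<phi> z \<noteq> 0} \<subseteq> {-2..\<tau> + h} \<times> {x. \<kappa> x \<noteq> 0}"
    proof
      fix z assume "z \<in> {z. \<phi> z \<noteq> 0}"
      then have *: "sstep (fst z + 2) \<noteq> 0" "sstep ((\<tau> - fst z) / h + 1) \<noteq> 0" "\<kappa> (snd z) \<noteq> 0"
        by (auto simp: \<phi>_def \<theta>_def)
      have "0 < fst z + 2" using *(1) sstep_le_0[of "fst z + 2"] by linarith
      moreover have "0 < (\<tau> - fst z) / h + 1" using *(2) sstep_le_0[of "(\<tau> - fst z) / h + 1"] by linarith
      then have "fst z < \<tau> + h" using h by (simp add: field_simps)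
      ultimately show "z \<in> {-2..\<tau> + h} \<times> {x. \<kappa> x \<noteq> 0}" using *(3) by (simp add: mem_Times_iff)
    qed
    then show "bounded {z. \<phi> z \<noteq> 0}" by (rule bounded_subset[rotated]) (intro bounded_Times \<kappa>; simp)
    show "((\<lambda>s. \<phi> (s, x)) has_real_derivative \<phi>t (t, x)) (at t)" for t x
      unfolding \<phi>_def \<phi>t_def fst_conv snd_conv by (rule DERIV_cmult_right[OF D\<theta>])
    show "((\<lambda>y. \<phi> (t, y)) has_real_derivative \<phi>x (t, x)) (at x)" for t x
      unfolding \<phi>_def \<phi>x_def fst_conv snd_conv by (rule DERIV_cmult[OF \<kappa>(1)])
    show "continuous_on UNIV \<phi>t" unfolding \<phi>t_def
      by (intro continuous_intros continuous_on_compose2[OF c\<theta>'] continuous_on_compose2[OF c\<kappa>]) auto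
    show "continuous_on UNIV \<phi>x" unfolding \<phi>x_def
      by (intro continuous_intros continuous_on_compose2[OF c\<theta>] continuous_on_compose2[OF \<kappa>(2)]) auto
  qed
  note int = integrable_uF[OF \<phi>]
  have \<theta>0: "\<theta> 0 = 1" using \<tau> h by (simp add: \<theta>_def sstep_ge_1)
  have \<theta>'_eq: "\<theta>' t = - (hat ((\<tau> - t) / h + 1) / h)" if "0 \<le> t" for t
    using that by (simp add: \<theta>'_def hat_eq_0 sstep_ge_1)
  have \<theta>_late: "\<theta> t = 0" if "\<tau> + h \<le> t" for t
    using that h by (simp add: \<theta>_def sstep_le_0 field_simps)
  have \<theta>_early: "\<theta> t = 1" if "0 \<le> t" "t \<le> \<tau>" for t
    using that h by (simp add: \<theta>_def sstep_ge_1)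
  have \<theta>_le: "\<bar>\<theta> t\<bar> \<le> 1" for t
    using mult_mono[of "sstep (t + 2)" 1 "sstep ((\<tau> - t) / h + 1)" 1] sstep_nonneg sstep_le_1 by (simp add: \<theta>_def)
  have A: "(LINT z:({0..} \<times> UNIV)|lborel. u (fst z) (snd z) * \<phi>t z) = - mol h (\<lambda>t. indicator {0..\<tau>+1} t * m t) \<tau>"
  proof -
    have "(LINT z:({0..} \<times> UNIV)|lborel. u (fst z) (snd z) * \<phi>t z) =
       (LINT t|lborel. LINT x|lborel. indicator ({0..} \<times> UNIV) (t, x) *\<^sub>R (u (fst (t, x)) (snd (t, x)) * \<phi>t (t, x)))"
      unfolding set_lebesgue_integral_def
      by (subst lborel_pair.integral_fst') (use int(1) in \<open>auto simp: set_integrable_def lborel_prod\<close>)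
    also have "\<dots> = (LINT t|lborel. - (hat ((\<tau> - t) / h + 1) / h * (indicator {0..\<tau>+1} t * m t)))"
    proof (intro Bochner_Integration.integral_cong refl)
      fix t :: real
      have "(LINT x|lborel. indicator ({0..} \<times> UNIV) (t, x) *\<^sub>R (u (fst (t, x)) (snd (t, x)) * \<phi>t (t, x)))
         = (LINT x|lborel. (indicator {0..} t * \<theta>' t) * (\<kappa> x * u t x))"
        by (intro Bochner_Integration.integral_cong refl) (simp add: \<phi>t_def indicator_def)
      also have "\<dots> = indicator {0..} t * \<theta>' t * m t" unfolding m_def by (rule integral_mult_right_zero)
      also have "\<dots> = - (hat ((\<tau> - t) / h + 1) / h * (indicator {0..\<tau>+1} t * m t))"
      proof (cases "0 \<le> t \<and> t \<le> \<tau> + 1")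
        case True then show ?thesis by (simp add: \<theta>'_eq)
      next
        case False
        show ?thesis
        proof (cases "0 \<le> t")
          case True
          then have "\<theta>' t = 0" using False h kernel_eq_0[of h t \<tau>] by (simp add: \<theta>'_eq)
          then show ?thesis using False by simp
        qed simp
      qed
      finally show "(LINT x|lborel. indicator ({0..} \<times> UNIV) (t, x) *\<^sub>R (u (fst (t, x)) (snd (t, x)) * \<phi>t (t, x))) = \<dots>" .
    qed
    also have "\<dots> = - mol h (\<lambda>t. indicator {0..\<tau>+1} t * m t) \<tau>"
      unfolding mol_def by (rule Bochner_Integration.integral_minus)
    finally show ?thesis .
  qed
  have nB: "\<bar>n t\<bar> \<le> C * L * K * (2 * X (\<tau> + 1))" if "0 \<le> t" "t \<le> \<tau> + 1" for t
  proof -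
    have C0: "0 \<le> C" using C[of 0] by linarith
    have X0: "0 < X (\<tau> + 1)" using X_pos[of "\<tau> + 1"] \<tau> by simp
    have iF: "integrable lborel (\<lambda>x. F (u t x))" by (rule integrable_Fu[OF that(1)])
    have "\<bar>n t\<bar> \<le> (LINT x|lborel. C * L * K * indicator {-X (\<tau> + 1)..X (\<tau> + 1)} x)"
      unfolding n_def
    proof (rule integral_abs_bound_integral)
      show "integrable lborel (\<lambda>x. \<kappa>' x * F (u t x))" by (rule integrable_bounded_mult[OF iF _ C]) simp
      show "integrable lborel (\<lambda>x. C * L * K * indicator {-X (\<tau> + 1)..X (\<tau> + 1)} x)"
        by (intro integrable_mult_right integrable_real_indicator) (auto simp: emeasure_lborel_Icc_eq)
      fix x
      show "\<bar>\<kappa>' x * F (u t x)\<bar> \<le> C * L * K * indicator {-X (\<tau> + 1)..X (\<tau> + 1)} x"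
      proof (cases "x \<in> {-X (\<tau> + 1)..X (\<tau> + 1)}")
        case True
        have "\<bar>\<kappa>' x\<bar> * \<bar>F (u t x)\<bar> \<le> C * (L * K)"
          using C abs_Fu C0 by (intro mult_mono) auto
        then show ?thesis using True by (simp add: abs_mult)
      next
        case False
        then have "X (\<tau> + 1) \<le> \<bar>x\<bar>" by auto
        then have "u t x = 0" using u_eq_0[OF that] by blast
        then show ?thesis using False by (simp add: F0)
      qed
    qed
    also have "\<dots> = C * L * K * (2 * X (\<tau> + 1))" using X0 by simp
    finally show ?thesis .
  qed
  have [measurable]: "n \<in> borel_measurable borel"
    unfolding n_def by (rule measurable_time_integral) auto
  have Bn: "\<bar>(LINT z:({0..} \<times> UNIV)|lborel. F (u (fst z) (snd z)) * \<phi>x z) - (LINT t:{0..\<tau>}|lborel. n t)\<bar> \<le> h * (C * L * K * (2 * X (\<tau> + 1)))"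
  proof -
    define N where "N = C * L * K * (2 * X (\<tau> + 1))"
    have N0: "0 \<le> N" using nB[of 0] \<tau> unfolding N_def by (smt (verit) abs_ge_zero)
    have "(LINT z:({0..} \<times> UNIV)|lborel. F (u (fst z) (snd z)) * \<phi>x z) =
       (LINT t|lborel. LINT x|lborel. indicator ({0..} \<times> UNIV) (t, x) *\<^sub>R (F (u (fst (t, x)) (snd (t, x))) * \<phi>x (t, x)))"
      unfolding set_lebesgue_integral_def
      by (subst lborel_pair.integral_fst') (use int(2) in \<open>auto simp: set_integrable_def lborel_prod\<close>)
    also have "\<dots> = (LINT t|lborel. indicator {0..\<tau> + h} t * \<theta> t * n t)"
    proof (intro Bochner_Integration.integral_cong refl)
      fix t :: real
      have "(LINT x|lborel. indicator ({0..} \<times> UNIV) (t, x) *\<^sub>R (F (u (fst (t, x)) (snd (t, x))) * \<phi>x (t, x)))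
         = (LINT x|lborel. (indicator {0..} t * \<theta> t) * (\<kappa>' x * F (u t x)))"
        by (intro Bochner_Integration.integral_cong refl) (simp add: \<phi>x_def indicator_def)
      also have "\<dots> = indicator {0..} t * \<theta> t * n t" unfolding n_def by (rule integral_mult_right_zero)
      also have "\<dots> = indicator {0..\<tau> + h} t * \<theta> t * n t"
        using \<theta>_late[of t] by (auto simp: indicator_def)
      finally show "(LINT x|lborel. indicator ({0..} \<times> UNIV) (t, x) *\<^sub>R (F (u (fst (t, x)) (snd (t, x))) * \<phi>x (t, x))) = \<dots>" .
    qed
    finally have e1: "(LINT z:({0..} \<times> UNIV)|lborel. F (u (fst z) (snd z)) * \<phi>x z) = (LINT t|lborel. indicator {0..\<tau> + h} t * \<theta> t * n t)" .
    have e2: "(LINT t:{0..\<tau>}|lborel. n t) = (LINT t|lborel. indicator {0..\<tau>} t * n t)"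
      by (simp add: set_lebesgue_integral_def)
    have b1: "\<bar>indicator {0..\<tau> + h} t * \<theta> t * n t\<bar> \<le> N" for t
    proof (cases "t \<in> {0..\<tau> + h}")
      case True
      then have "\<bar>\<theta> t\<bar> * \<bar>n t\<bar> \<le> 1 * N" using nB[of t] \<theta>_le h unfolding N_def by (intro mult_mono) auto
      then show ?thesis using True by (simp add: abs_mult)
    qed (use N0 in simp)
    have i1: "integrable lborel (\<lambda>t. indicator {0..\<tau> + h} t * \<theta> t * n t)"
      by (rule integrable_bounded_support[where R = "\<tau> + h", OF _ b1]) (auto simp: indicator_def)
    have b2: "\<bar>indicator {0..\<tau>} t * n t\<bar> \<le> N" for t
      using nB[of t] N0 by (auto simp: indicator_def N_def)
    have i2: "integrable lborel (\<lambda>t. indicator {0..\<tau>} t * n t)"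
      by (rule integrable_bounded_support[where R = "\<tau>", OF _ b2]) (auto simp: indicator_def)
    have "\<bar>LINT t|lborel. indicator {0..\<tau> + h} t * \<theta> t * n t - indicator {0..\<tau>} t * n t\<bar> \<le> (LINT t|lborel. N * indicator {\<tau>..\<tau> + h} t)"
    proof (rule integral_abs_bound_integral)
      fix t
      show "\<bar>indicator {0..\<tau> + h} t * \<theta> t * n t - indicator {0..\<tau>} t * n t\<bar> \<le> N * indicator {\<tau>..\<tau> + h} t"
      proof (cases "0 \<le> t \<and> t \<le> \<tau>")
        case True
        then have "t = \<tau> \<or> t < \<tau>" by auto
        then show ?thesis using \<theta>_early[of t] True h N0 by (auto simp: indicator_def)
      next
        case False
        then have "indicator {0..\<tau>} t = (0::real)" by (auto simp: indicator_def)
        moreover have "indicator {0..\<tau> + h} t * \<theta> t * n t = 0" if "t \<notin> {\<tau>..\<tau> + h}"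
          using that False by (auto simp: indicator_def)
        ultimately show ?thesis using b1[of t] by (cases "t \<in> {\<tau>..\<tau> + h}") auto
      qed
    qed (use i1 i2 in \<open>auto simp: emeasure_lborel_Icc_eq intro!: integrable_mult_right integrable_real_indicator\<close>)
    then show ?thesis unfolding e1 e2 using i1 i2 h by (simp add: N_def mult.commute)
  qed
  have Cu: "(LINT x|lborel. u0 x * \<phi> (0, x)) = (LINT x|lborel. \<kappa> x * u0 x)"
    by (simp add: \<phi>_def \<theta>0 mult.commute)
  show ?thesis using weak_form[OF \<phi>] Bn unfolding A Cu by linarith
qed

text \<open>The width of the time cutoff in \<open>weak_product\<close> tends to 0. By L1 continuity
  the time average of the tested solution converges to its value at \<tau> itself, for every
  \<tau>.\<close>

lemma weak_integrated:
  assumes \<kappa>: "\<And>x. (\<kappa> has_real_derivative \<kappa>' x) (at x)" "continuous_on UNIV \<kappa>'"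
      "\<And>x. 0 \<le> \<kappa> x" "\<And>x. \<kappa> x \<le> 1" "bounded {x. \<kappa> x \<noteq> 0}" and C: "\<And>x. \<bar>\<kappa>' x\<bar> \<le> C"
    and \<tau>: "0 \<le> \<tau>"
  shows "(LINT x|lborel. \<kappa> x * u \<tau> x) =
     (LINT x|lborel. \<kappa> x * u0 x) + (LINT t:{0..\<tau>}|lborel. (LINT x|lborel. \<kappa>' x * F (u t x)))"
proof -
  define m where "m t = (LINT x|lborel. \<kappa> x * u t x)" for t
  define D where "D = m \<tau> - (LINT x|lborel. \<kappa> x * u0 x) - (LINT t:{0..\<tau>}|lborel. (LINT x|lborel. \<kappa>' x * F (u t x)))"
  define N where "N = C * L * K * (2 * X (\<tau> + 1))"
  have c\<kappa>: "continuous_on UNIV \<kappa>" using \<kappa>(1) DERIV_isCont continuous_at_imp_continuous_on by blast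
  have [measurable]: "\<kappa> \<in> borel_measurable borel"
    using c\<kappa> by (auto intro: borel_measurable_continuous_onI)
  have C0: "0 \<le> C" using C[of 0] by linarith
  have X0: "0 < X (\<tau> + 1)" using X_pos[of "\<tau> + 1"] \<tau> by simp
  have N0: "0 \<le> N" unfolding N_def using C0 L0 K0 X0 by simp
  have \<kappa>_abs: "\<bar>\<kappa> x\<bar> \<le> 1" for x using \<kappa>(3,4)[of x] by simp
  have imu: "integrable lborel (\<lambda>x. \<kappa> x * u t x)" if "0 \<le> t" for t
    by (rule integrable_bounded_mult[OF integrable_u[OF that] _ \<kappa>_abs]) simp
  have m_diff: "\<bar>m s - m t\<bar> \<le> (LINT x|lborel. \<bar>u s x - u t x\<bar>)" if "0 \<le> s" "0 \<le> t" for s t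
  proof -
    have "m s - m t = (LINT x|lborel. \<kappa> x * u s x - \<kappa> x * u t x)"
      unfolding m_def by (rule Bochner_Integration.integral_diff[symmetric]) (use imu that in auto)
    moreover have "\<bar>LINT x|lborel. \<kappa> x * u s x - \<kappa> x * u t x\<bar> \<le> (LINT x|lborel. \<bar>u s x - u t x\<bar>)"
    proof (rule integral_abs_bound_integral)
      fix x
      have "\<bar>\<kappa> x\<bar> * \<bar>u s x - u t x\<bar> \<le> 1 * \<bar>u s x - u t x\<bar>" by (intro mult_right_mono \<kappa>_abs) simp
      then show "\<bar>\<kappa> x * u s x - \<kappa> x * u t x\<bar> \<le> \<bar>u s x - u t x\<bar>" by (simp add: right_diff_distrib[symmetric] abs_mult)
    qed (use imu that integrable_u in auto)
    ultimately show ?thesis by simp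
  qed
  have m_bd: "\<bar>m t\<bar> \<le> K * (2 * X (\<tau> + 1))" if "0 \<le> t" "t \<le> \<tau> + 1" for t
  proof -
    have "\<bar>m t\<bar> \<le> (LINT x|lborel. K * indicator {-X (\<tau> + 1)..X (\<tau> + 1)} x)"
      unfolding m_def
    proof (rule integral_abs_bound_integral)
      show "integrable lborel (\<lambda>x. K * indicator {-X (\<tau> + 1)..X (\<tau> + 1)} x)"
        by (intro integrable_mult_right integrable_real_indicator) (auto simp: emeasure_lborel_Icc_eq)
      fix x
      show "\<bar>\<kappa> x * u t x\<bar> \<le> K * indicator {-X (\<tau> + 1)..X (\<tau> + 1)} x"
      proof (cases "x \<in> {-X (\<tau> + 1)..X (\<tau> + 1)}")
        case True
        have "\<bar>\<kappa> x\<bar> * \<bar>u t x\<bar> \<le> 1 * K" using \<kappa>_abs abs_u by (intro mult_mono) auto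
        then show ?thesis using True by (simp add: abs_mult)
      next
        case False
        then have "X (\<tau> + 1) \<le> \<bar>x\<bar>" by auto
        then show ?thesis using u_eq_0[OF that] False by simp
      qed
    qed (rule imu[OF that(1)])
    also have "\<dots> = K * (2 * X (\<tau> + 1))" using X0 by simp
    finally show ?thesis .
  qed
  have [measurable]: "m \<in> borel_measurable borel"
    unfolding m_def using measurable_time_integral[of "\<lambda>p. p" \<kappa>] by simp
  have im: "integrable lborel (\<lambda>t. indicator {0..\<tau>+1} t * m t)"
  proof (rule integrable_bounded_support[where R = "\<tau> + 1" and B = "K * (2 * X (\<tau> + 1))"])
    show "\<bar>indicator {0..\<tau>+1} t * m t\<bar> \<le> K * (2 * X (\<tau> + 1))" for t
      using m_bd[of t] K0 X0 by (auto simp: indicator_def)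
  qed (auto simp: indicator_def)
  have "\<bar>D\<bar> \<le> e" if e: "0 < e" for e
  proof -
    have "eventually (\<lambda>s. (LINT x|lborel. \<bar>u s x - u \<tau> x\<bar>) < e / 2) (at \<tau> within {0..})"
      by (rule order_tendstoD[OF L1_tendsto[OF \<tau>]]) (use e in simp)
    then obtain d where d: "0 < d" "\<And>s. 0 \<le> s \<Longrightarrow> s \<noteq> \<tau> \<Longrightarrow> dist s \<tau> < d \<Longrightarrow> (LINT x|lborel. \<bar>u s x - u \<tau> x\<bar>) < e / 2"
      unfolding eventually_at by auto
    \<comment> \<open>Averaging stays within the continuity distance \<open>d\<close>, and the
      cutoff error h N stays below e/2.\<close>
    define h where "h = min (min d 1) (e / 2 / (N + 1))"
    have h: "0 < h" "h \<le> 1" "h \<le> d" unfolding h_def using d e N0 by auto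
    have hN: "h * N \<le> e / 2"
    proof -
      have "h * N \<le> h * (N + 1)" using h by simp
      also have "\<dots> \<le> e / 2 / (N + 1) * (N + 1)" unfolding h_def using N0 by (intro mult_right_mono) auto
      also have "\<dots> = e / 2"
      proof -
        have "p / q * q = p" if "q \<noteq> 0" for p q :: real using that by simp
        then show ?thesis by this (use N0 in simp)
      qed
      finally show ?thesis .
    qed
    have 1: "\<bar>mol h (\<lambda>t. indicator {0..\<tau>+1} t * m t) \<tau> - m \<tau>\<bar> \<le> e / 2"
    proof (rule mol_const_diff[OF im h(1)])
      fix s assume s: "\<tau> < s" "s < \<tau> + h"
      then have "(LINT x|lborel. \<bar>u s x - u \<tau> x\<bar>) < e / 2" using d(2)[of s] h \<tau> by (auto simp: dist_real_def)
      then have "\<bar>m s - m \<tau>\<bar> \<le> e / 2" using m_diff[of s \<tau>] s \<tau> by simp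
      then show "\<bar>indicator {0..\<tau>+1} s * m s - m \<tau>\<bar> \<le> e / 2" using s \<tau> h by simp
    qed
    have 2: "\<bar>mol h (\<lambda>t. indicator {0..\<tau>+1} t * m t) \<tau> - (LINT x|lborel. \<kappa> x * u0 x) -
      (LINT t:{0..\<tau>}|lborel. (LINT x|lborel. \<kappa>' x * F (u t x)))\<bar> \<le> h * N"
      unfolding m_def N_def by (rule weak_product) (use \<kappa> C \<tau> h in auto)
    show ?thesis unfolding D_def using 1 2 hN by linarith
  qed
  then have "\<bar>D\<bar> \<le> 0" by (rule field_le_epsilon) simp
  then show ?thesis by (simp add: D_def m_def)
qed

text \<open>The smooth step defining \<open>mol_prim\<close> is not compactly supported to the left.
  It is multiplied by a cutoff equal to 1 on the support of the solution up to time \<tau>; there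
  the derivative of the product is minus the mollifier kernel.\<close>

lemma mol_prim_evolution:
  assumes \<tau>: "0 \<le> \<tau>" and e: "0 < \<epsilon>"
  shows "mol_prim \<epsilon> (u \<tau>) x = mol_prim \<epsilon> u0 x - (LINT s:{0..\<tau>}|lborel. mol \<epsilon> (\<lambda>y. F (u s y)) x)"
proof -
  define Y where "Y = max (X \<tau>) R"
  define \<kappa> where "\<kappa> y = sstep ((x - y) / \<epsilon> + 1) * sstep (y + Y + 1)" for y
  define \<kappa>' where "\<kappa>' y = hat (y + Y + 1) * sstep ((x - y) / \<epsilon> + 1) - sstep (y + Y + 1) * (hat ((x - y) / \<epsilon> + 1) / \<epsilon>)" for y
  have D: "(\<kappa> has_real_derivative \<kappa>' y) (at y)" for y
  proof -
    have "((\<lambda>y. sstep ((x - y) / \<epsilon> + 1)) has_real_derivative hat ((x - y) / \<epsilon> + 1) * (- 1 / \<epsilon>)) (at y)"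
      by (rule DERIV_chain2[OF DERIV_sstep]) (use e in \<open>auto intro!: derivative_eq_intros\<close>)
    moreover have "((\<lambda>y. sstep (y + Y + 1)) has_real_derivative hat (y + Y + 1) * 1) (at y)"
      by (rule DERIV_chain2[OF DERIV_sstep]) (auto intro!: derivative_eq_intros)
    ultimately have "(\<kappa> has_real_derivative hat ((x - y) / \<epsilon> + 1) * (- 1 / \<epsilon>) * sstep (y + Y + 1) + hat (y + Y + 1) * 1 * sstep ((x - y) / \<epsilon> + 1)) (at y)"
      unfolding \<kappa>_def by (intro DERIV_mult)
    then show ?thesis by (rule DERIV_cong) (simp add: \<kappa>'_def)
  qed
  have bd: "bounded {y. \<kappa> y \<noteq> 0}"
  proof -
    have "{y. \<kappa> y \<noteq> 0} \<subseteq> {-Y - 1..x + \<epsilon>}"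
    proof
      fix y assume "y \<in> {y. \<kappa> y \<noteq> 0}"
      then have *: "sstep ((x - y) / \<epsilon> + 1) \<noteq> 0" "sstep (y + Y + 1) \<noteq> 0" by (auto simp: \<kappa>_def)
      have "0 < y + Y + 1" using *(2) sstep_le_0[of "y + Y + 1"] by linarith
      moreover have "0 < (x - y) / \<epsilon> + 1" using *(1) sstep_le_0[of "(x - y) / \<epsilon> + 1"] by linarith
      then have "y < x + \<epsilon>" using e by (simp add: field_simps)
      ultimately show "y \<in> {-Y - 1..x + \<epsilon>}" by simp
    qed
    then show ?thesis by (rule bounded_subset[rotated]) simp
  qed
  have c: "continuous_on UNIV \<kappa>'" unfolding \<kappa>'_def using e by (intro continuous_intros) auto
  have C: "\<bar>\<kappa>' y\<bar> \<le> 2 + 2 / \<epsilon>" for y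
  proof -
    have "\<bar>hat (y + Y + 1) * sstep ((x - y) / \<epsilon> + 1)\<bar> \<le> 2 * 1"
      unfolding abs_mult using hat_nonneg hat_le sstep_nonneg sstep_le_1 by (intro mult_mono) auto
    moreover have "\<bar>sstep (y + Y + 1) * (hat ((x - y) / \<epsilon> + 1) / \<epsilon>)\<bar> \<le> 1 * (2 / \<epsilon>)"
      unfolding abs_mult using kernel_nonneg[OF e] kernel_le[OF e] sstep_nonneg sstep_le_1
      by (intro mult_mono) (simp_all only: abs_of_nonneg abs_ge_zero zero_le_one)
    ultimately show ?thesis unfolding \<kappa>'_def by linarith
  qed
  have \<kappa>01: "0 \<le> \<kappa> y" "\<kappa> y \<le> 1" for y
    unfolding \<kappa>_def using sstep_nonneg sstep_le_1 by (auto intro: mult_le_one)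
  have "(LINT y|lborel. \<kappa> y * u \<tau> y) = mol_prim \<epsilon> (u \<tau>) x"
    unfolding mol_prim_def
  proof (intro Bochner_Integration.integral_cong refl)
    fix y
    show "\<kappa> y * u \<tau> y = sstep ((x - y) / \<epsilon> + 1) * u \<tau> y"
      using u_eq_0[OF \<tau> order_refl, of y] sstep_ge_1[of "y + Y + 1"] unfolding \<kappa>_def Y_def
      by (cases "X \<tau> \<le> \<bar>y\<bar>") auto
  qed
  moreover have "(LINT y|lborel. \<kappa> y * u0 y) = mol_prim \<epsilon> u0 x"
    unfolding mol_prim_def
  proof (intro Bochner_Integration.integral_cong refl)
    fix y
    show "\<kappa> y * u0 y = sstep ((x - y) / \<epsilon> + 1) * u0 y"
      using supp_u0[of y] sstep_ge_1[of "y + Y + 1"] unfolding \<kappa>_def Y_def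
      by (cases "R < \<bar>y\<bar>") auto
  qed
  moreover have "(LINT s:{0..\<tau>}|lborel. (LINT y|lborel. \<kappa>' y * F (u s y))) = - (LINT s:{0..\<tau>}|lborel. mol \<epsilon> (\<lambda>y. F (u s y)) x)"
  proof -
    have "(LINT y|lborel. \<kappa>' y * F (u s y)) = - mol \<epsilon> (\<lambda>y. F (u s y)) x" if s: "s \<in> {0..\<tau>}" for s
    proof -
      have "(LINT y|lborel. \<kappa>' y * F (u s y)) = (LINT y|lborel. - (hat ((x - y) / \<epsilon> + 1) / \<epsilon> * F (u s y)))"
      proof (intro Bochner_Integration.integral_cong refl)
        fix y
        show "\<kappa>' y * F (u s y) = - (hat ((x - y) / \<epsilon> + 1) / \<epsilon> * F (u s y))"
        proof (cases "X \<tau> \<le> \<bar>y\<bar>")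
          case True
          then have "u s y = 0" using u_eq_0[of s \<tau> y] s by auto
          then show ?thesis by (simp add: F0)
        next
          case False
          then have "1 \<le> y + Y + 1" unfolding Y_def by linarith
          then show ?thesis by (simp add: \<kappa>'_def hat_eq_0 sstep_ge_1)
        qed
      qed
      also have "\<dots> = - mol \<epsilon> (\<lambda>y. F (u s y)) x" unfolding mol_def by (rule Bochner_Integration.integral_minus)
      finally show ?thesis .
    qed
    then have "(LINT s:{0..\<tau>}|lborel. (LINT y|lborel. \<kappa>' y * F (u s y))) = (LINT s:{0..\<tau>}|lborel. - mol \<epsilon> (\<lambda>y. F (u s y)) x)"
      by (intro set_lebesgue_integral_cong) auto
    then show ?thesis unfolding set_lebesgue_integral_def by simp
  qed
  ultimately show ?thesis
    using weak_integrated[OF D c \<kappa>01 bd C \<tau>] by simp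
qed

end

section \<open>Primitives of entropy solutions\<close>

lemma distribution_fun_diff:
  assumes "integrable lborel v" "x \<le> y"
  shows "distribution_fun v y - distribution_fun v x = (LINT z|lborel. indicator {x<..y} z *\<^sub>R v z)"
proof -
  have i: "integrable lborel (\<lambda>z. indicator A z *\<^sub>R v z)" if "A \<in> sets borel" for A
    using assms(1) that by (intro integrable_mult_indicator) auto
  have "distribution_fun v y - distribution_fun v x = (LINT z|lborel. indicator {..y} z *\<^sub>R v z - indicator {..x} z *\<^sub>R v z)"
    unfolding distribution_fun_def set_lebesgue_integral_def
    by (rule Bochner_Integration.integral_diff[symmetric]; rule i; simp)
  also have "\<dots> = (LINT z|lborel. indicator {x<..y} z *\<^sub>R v z)"
    using assms(2) by (intro Bochner_Integration.integral_cong refl) (auto simp: indicator_def)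
  finally show ?thesis .
qed

lemma distribution_fun_slope_on:
  assumes v: "integrable lborel v" and "x \<le> y"
    and ab: "\<And>z. x < z \<Longrightarrow> z < y \<Longrightarrow> a \<le> v z \<and> v z \<le> b"
  shows "a * (y - x) \<le> distribution_fun v y - distribution_fun v x \<and>
    distribution_fun v y - distribution_fun v x \<le> b * (y - x)"
proof -
  have i: "integrable lborel (\<lambda>z. indicator {x<..y} z *\<^sub>R v z)" "integrable lborel (\<lambda>z. indicator {x<..<y} z *\<^sub>R v z)"
    using v by (intro integrable_mult_indicator; simp)+
  have c: "integrable lborel (\<lambda>z. c * indicator {x<..<y} z)" for c :: real
    by (intro integrable_mult_right integrable_real_indicator) (use assms(2) in auto)
  have I: "(LINT z|lborel. c * indicator {x<..<y} z) = c * (y - x)" for c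
    using assms(2) by simp
  have eq: "(LINT z|lborel. indicator {x<..y} z *\<^sub>R v z) = (LINT z|lborel. indicator {x<..<y} z *\<^sub>R v z)"
  proof (rule integral_cong_AE)
    show "AE z in lborel. indicator {x<..y} z *\<^sub>R v z = indicator {x<..<y} z *\<^sub>R v z"
      using AE_lborel_singleton[of y] by eventually_elim (auto simp: indicator_def)
  qed (use i in \<open>auto dest: borel_measurable_integrable\<close>)
  have "(LINT z|lborel. a * indicator {x<..<y} z) \<le> (LINT z|lborel. indicator {x<..<y} z *\<^sub>R v z)"
    using ab by (intro integral_mono i c) (auto simp: indicator_def)
  moreover have "(LINT z|lborel. indicator {x<..<y} z *\<^sub>R v z) \<le> (LINT z|lborel. b * indicator {x<..<y} z)"
    using ab by (intro integral_mono i c) (auto simp: indicator_def)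
  ultimately show ?thesis unfolding distribution_fun_diff[OF v assms(2)] I eq by simp
qed

lemma distribution_fun_slope:
  assumes v: "integrable lborel v" and ab: "\<And>z. a \<le> v z \<and> v z \<le> b" and "x \<le> y"
  shows "a * (y - x) \<le> distribution_fun v y - distribution_fun v x \<and>
    distribution_fun v y - distribution_fun v x \<le> b * (y - x)"
  by (rule distribution_fun_slope_on[OF v assms(3) ab])

lemma distribution_fun_eq_0: "(\<And>y. y < x \<Longrightarrow> v y = 0) \<Longrightarrow> v x = 0 \<Longrightarrow> distribution_fun v x = 0"
  unfolding distribution_fun_def set_lebesgue_integral_def
  by (rule integral_eq_zero_AE) (auto simp: indicator_def less_le)

lemma distribution_fun_eq_total:
  assumes "\<And>y. x < y \<Longrightarrow> v y = 0" shows "distribution_fun v x = (LINT y|lborel. v y)"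
  unfolding distribution_fun_def set_lebesgue_integral_def
  by (intro Bochner_Integration.integral_cong refl) (use assms in \<open>auto simp: indicator_def not_le\<close>)

lemma C1_imp_continuous:
  fixes \<Phi> :: "real \<Rightarrow> real \<Rightarrow> real"
  assumes S: "open S"
    and dt: "\<And>t x. (t, x) \<in> S \<Longrightarrow> ((\<lambda>s. \<Phi> s x) has_real_derivative \<Phi>t (t, x)) (at t)"
    and dx: "\<And>t x. (t, x) \<in> S \<Longrightarrow> ((\<lambda>y. \<Phi> t y) has_real_derivative \<Phi>x (t, x)) (at x)"
    and ct: "continuous_on S \<Phi>t" and cx: "continuous_on S \<Phi>x"
  shows "continuous_on S (\<lambda>z. \<Phi> (fst z) (snd z))"
proof -
  have "((\<lambda>w. \<Phi> (fst w) (snd w)) \<longlongrightarrow> \<Phi> (fst z) (snd z)) (at z)" if z: "z \<in> S" for z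
  proof -
    obtain t x where tx: "z = (t, x)" by (cases z)
    obtain d0 where d0: "0 < d0" "ball z d0 \<subseteq> S" using S z by (auto simp: open_contains_ball)
    have ict: "isCont \<Phi>t z" and icx: "isCont \<Phi>x z"
      using ct cx S z by (auto simp: continuous_on_eq_continuous_at)
    obtain d1 where d1: "0 < d1" "\<And>w. dist w z < d1 \<Longrightarrow> \<bar>\<Phi>t w - \<Phi>t z\<bar> < 1"
      using ict unfolding continuous_at_eps_delta dist_real_def by (meson zero_less_one)
    obtain d2 where d2: "0 < d2" "\<And>w. dist w z < d2 \<Longrightarrow> \<bar>\<Phi>x w - \<Phi>x z\<bar> < 1"
      using icx unfolding continuous_at_eps_delta dist_real_def by (meson zero_less_one)
    define d where "d = min d0 (min d1 d2)"
    define M where "M = \<bar>\<Phi>t z\<bar> + \<bar>\<Phi>x z\<bar> + 1"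
    have d: "0 < d" using d0 d1 d2 by (simp add: d_def)
    have near: "(s, y) \<in> S \<and> \<bar>\<Phi>t (s, y)\<bar> \<le> M \<and> \<bar>\<Phi>x (s, y)\<bar> \<le> M"
      if "\<bar>s - t\<bar> + \<bar>y - x\<bar> < d" for s y
    proof -
      have "dist (s, y) z \<le> \<bar>s - t\<bar> + \<bar>y - x\<bar>"
        by (simp add: tx dist_Pair_Pair dist_real_def sqrt_sum_squares_le_sum_abs)
      then have *: "dist (s, y) z < d1" "dist (s, y) z < d2" "dist (s, y) z < d0"
        using that unfolding d_def by linarith+
      have "(s, y) \<in> ball z d0" using *(3) by (simp add: dist_commute)
      moreover have "\<bar>\<Phi>t (s, y) - \<Phi>t z\<bar> < 1" "\<bar>\<Phi>x (s, y) - \<Phi>x z\<bar> < 1" using d1(2)[OF *(1)] d2(2)[OF *(2)] .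
      then have "\<bar>\<Phi>t (s, y)\<bar> \<le> M" "\<bar>\<Phi>x (s, y)\<bar> \<le> M" unfolding M_def by linarith+
      ultimately show ?thesis using d0 by blast
    qed
    have bd: "\<bar>\<Phi> s y - \<Phi> t x\<bar> \<le> M * \<bar>s - t\<bar> + M * \<bar>y - x\<bar>" if sy: "\<bar>s - t\<bar> + \<bar>y - x\<bar> < d" for s y
    proof -
      have 1: "norm (\<Phi> s y - \<Phi> t y) \<le> M * norm (s - t)"
      proof (rule field_differentiable_bound[where S = "closed_segment t s" and f' = "\<lambda>s. \<Phi>t (s, y)"])
        fix p assume "p \<in> closed_segment t s"
        then have "\<bar>p - t\<bar> \<le> \<bar>s - t\<bar>" by (auto simp: closed_segment_eq_real_ivl split: if_splits)
        then have "\<bar>p - t\<bar> + \<bar>y - x\<bar> < d" using sy by linarith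
        note n = near[OF this]
        show "((\<lambda>s. \<Phi> s y) has_real_derivative \<Phi>t (p, y)) (at p within closed_segment t s)"
          using n by (intro dt[THEN has_field_derivative_at_within]) simp
        show "norm (\<Phi>t (p, y)) \<le> M" using n by simp
      qed auto
      have 2: "norm (\<Phi> t y - \<Phi> t x) \<le> M * norm (y - x)"
      proof (rule field_differentiable_bound[where S = "closed_segment x y" and f' = "\<lambda>z. \<Phi>x (t, z)"])
        fix p assume "p \<in> closed_segment x y"
        then have "\<bar>p - x\<bar> \<le> \<bar>y - x\<bar>" by (auto simp: closed_segment_eq_real_ivl split: if_splits)
        then have "\<bar>t - t\<bar> + \<bar>p - x\<bar> < d" using sy by linarith
        note n = near[OF this]
        show "((\<lambda>z. \<Phi> t z) has_real_derivative \<Phi>x (t, p)) (at p within closed_segment x y)"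
          using n by (intro dx[THEN has_field_derivative_at_within]) simp
        show "norm (\<Phi>x (t, p)) \<le> M" using n by simp
      qed auto
      show ?thesis using 1 2 by simp
    qed
    show ?thesis
    proof (rule LIM_zero_cancel, rule Lim_null_comparison)
      have "((\<lambda>w. \<bar>fst w - t\<bar> + \<bar>snd w - x\<bar>) \<longlongrightarrow> 0) (at z)"
        unfolding tx by (auto intro!: tendsto_eq_intros)
      then have "\<forall>\<^sub>F w in at z. \<bar>fst w - t\<bar> + \<bar>snd w - x\<bar> < d"
        by (rule order_tendstoD) (rule d)
      then show "\<forall>\<^sub>F w in at z. norm (\<Phi> (fst w) (snd w) - \<Phi> (fst z) (snd z)) \<le> M * \<bar>fst w - t\<bar> + M * \<bar>snd w - x\<bar>"
        by (rule eventually_mono) (use bd in \<open>simp add: tx\<close>)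
      show "((\<lambda>w. M * \<bar>fst w - t\<bar> + M * \<bar>snd w - x\<bar>) \<longlongrightarrow> 0) (at z)"
        unfolding tx by (auto intro!: tendsto_eq_intros)
    qed
  qed
  then show ?thesis
    by (intro continuous_at_imp_continuous_on ballI) (simp add: isCont_def)
qed

lemma Lipschitz_combine:
  fixes A B D c k p q :: real
  assumes "\<bar>A - B\<bar> \<le> c * p" "\<bar>B - D\<bar> \<le> k * q" "0 \<le> c" "0 \<le> k" "0 \<le> p" "0 \<le> q"
  shows "\<bar>A - D\<bar> \<le> (c + k) * (p + q)"
proof -
  have "0 \<le> c * q" "0 \<le> k * p" using assms by auto
  moreover have "(c + k) * (p + q) = c * p + c * q + k * p + k * q" by (simp add: algebra_simps)
  ultimately show ?thesis using assms(1,2) by linarith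
qed

lemma le_if_le_eps:
  fixes x y C :: real
  assumes "\<And>\<epsilon>. 0 < \<epsilon> \<Longrightarrow> x \<le> y + C * \<epsilon>" shows "x \<le> y"
proof (rule field_le_epsilon)
  fix e :: real assume e: "0 < e"
  define \<epsilon> where "\<epsilon> = e / (\<bar>C\<bar> + 1)"
  have "0 < \<epsilon>" using e by (simp add: \<epsilon>_def)
  have "C * \<epsilon> \<le> (\<bar>C\<bar> + 1) * \<epsilon>" using \<open>0 < \<epsilon>\<close> by (intro mult_right_mono) auto
  also have "\<dots> = e" by (simp add: \<epsilon>_def)
  finally show "x \<le> y + e" using assms[OF \<open>0 < \<epsilon>\<close>] by linarith
qed

context compact_sol begin

abbreviation U :: "real \<Rightarrow> real \<Rightarrow> real" where "U t \<equiv> distribution_fun (u t)"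
abbreviation U0 :: "real \<Rightarrow> real" where "U0 \<equiv> distribution_fun u0"

lemma mol_prim_U: "0 \<le> t \<Longrightarrow> 0 < \<epsilon> \<Longrightarrow> \<bar>mol_prim \<epsilon> (u t) x - U t x\<bar> \<le> K * \<epsilon>"
  unfolding distribution_fun_def by (rule mol_prim_close[OF integrable_u _ abs_u])

lemma mol_prim_U0: "0 < \<epsilon> \<Longrightarrow> \<bar>mol_prim \<epsilon> u0 x - U0 x\<bar> \<le> K * \<epsilon>"
  unfolding distribution_fun_def by (rule mol_prim_close[OF integrable_u0 _ abs_u0])

lemma abs_mol_u: "0 \<le> t \<Longrightarrow> 0 < \<epsilon> \<Longrightarrow> \<bar>mol \<epsilon> (u t) x\<bar> \<le> K"
  using mol_const_diff[OF integrable_u, of t \<epsilon> x 0 K] abs_u by simp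

lemma abs_mol_Fu: "0 \<le> t \<Longrightarrow> 0 < \<epsilon> \<Longrightarrow> \<bar>mol \<epsilon> (\<lambda>y. F (u t y)) x\<bar> \<le> L * K"
  using mol_const_diff[OF integrable_Fu, of t \<epsilon> x 0 "L * K"] abs_Fu by simp

text \<open>At a fixed scale the mollified solution is continuous in both variables: the bounded
  kernel turns L1 continuity in time into uniform continuity, and the Lipschitz kernel gives
  continuity in x.\<close>

lemma continuous_mol_u:
  assumes e: "0 < \<epsilon>" shows "continuous_on ({0..} \<times> UNIV) (\<lambda>z. mol \<epsilon> (u (fst z)) (snd z))"
    and "continuous_on ({0..} \<times> UNIV) (\<lambda>z. mol \<epsilon> (\<lambda>y. F (u (fst z) y)) (snd z))"
proof -
  have *: "continuous_on ({0..} \<times> UNIV) (\<lambda>z. mol \<epsilon> (v (fst z)) (snd z))"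
    if i: "\<And>t. 0 \<le> t \<Longrightarrow> integrable lborel (v t)" 
      and lim: "\<And>t. 0 \<le> t \<Longrightarrow> ((\<lambda>s. LINT x|lborel. \<bar>v s x - v t x\<bar>) \<longlongrightarrow> 0) (at t within {0..})"
    for v :: "real \<Rightarrow> real \<Rightarrow> real"
    unfolding continuous_on_def
  proof
    fix z :: "real \<times> real" assume z: "z \<in> {0..} \<times> UNIV"
    obtain t x where tx: "z = (t, x)" by (cases z)
    have t: "0 \<le> t" using z tx by simp
    define G where "G s = (LINT x|lborel. \<bar>v s x - v t x\<bar>)" for s
    define C where "C = 16 / \<epsilon>\<^sup>2 * (LINT y|lborel. \<bar>v t y\<bar>)"
    have "((\<lambda>w. 2 / \<epsilon> * G (fst w) + C * \<bar>snd w - x\<bar>) \<longlongrightarrow> 2 / \<epsilon> * 0 + C * \<bar>x - x\<bar>) (at z within {0..} \<times> UNIV)"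
    proof (intro tendsto_intros)
      have "continuous (at t within {0..}) G"
        using lim[OF t] unfolding continuous_within G_def by simp
      have fst_lim: "((\<lambda>w. fst w) \<longlongrightarrow> t) (at z within {0..} \<times> UNIV)"
        unfolding tx by (auto intro!: tendsto_eq_intros)
      have "((\<lambda>w. G (fst w)) \<longlongrightarrow> G t) (at z within {0..} \<times> UNIV)"
        using \<open>continuous (at t within {0..}) G\<close>
      proof (rule continuous_within_tendsto_compose[OF _ _ fst_lim])
        show "\<forall>\<^sub>F w in at z within {0..} \<times> UNIV. fst w \<in> {0..}"
          unfolding eventually_at_filter by (intro always_eventually allI impI) auto
      qed
      then show "((\<lambda>w. G (fst w)) \<longlongrightarrow> 0) (at z within {0..} \<times> UNIV)" by (simp add: G_def)
      show "((\<lambda>w. snd w) \<longlongrightarrow> x) (at z within {0..} \<times> UNIV)"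
        unfolding tx by (auto intro!: tendsto_eq_intros)
    qed
    then have lim0: "((\<lambda>w. 2 / \<epsilon> * G (fst w) + C * \<bar>snd w - x\<bar>) \<longlongrightarrow> 0) (at z within {0..} \<times> UNIV)" by simp
    show "((\<lambda>w. mol \<epsilon> (v (fst w)) (snd w)) \<longlongrightarrow> mol \<epsilon> (v (fst z)) (snd z)) (at z within {0..} \<times> UNIV)"
    proof (rule LIM_zero_cancel, rule Lim_null_comparison[OF _ lim0])
      show "\<forall>\<^sub>F w in at z within {0..} \<times> UNIV. norm (mol \<epsilon> (v (fst w)) (snd w) - mol \<epsilon> (v (fst z)) (snd z))
        \<le> 2 / \<epsilon> * G (fst w) + C * \<bar>snd w - x\<bar>"
        unfolding eventually_at_filter
      proof (intro always_eventually allI impI)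
        fix w :: "real \<times> real" assume "w \<in> {0..} \<times> UNIV"
        then have w: "0 \<le> fst w" by auto
        have "\<bar>mol \<epsilon> (\<lambda>x. v (fst w) x - v t x) (snd w)\<bar> \<le> 2 / \<epsilon> * G (fst w)"
          unfolding G_def by (rule mol_L1_bound) (use i w t e in auto)
        moreover have "mol \<epsilon> (\<lambda>x. v (fst w) x - v t x) (snd w) = mol \<epsilon> (v (fst w)) (snd w) - mol \<epsilon> (v t) (snd w)"
          by (rule mol_diff[OF i[OF w] i[OF t] e])
        moreover have "\<bar>mol \<epsilon> (v t) (snd w) - mol \<epsilon> (v t) x\<bar> \<le> C * \<bar>snd w - x\<bar>"
          unfolding C_def by (rule mol_Lipschitz[OF i[OF t] e])
        ultimately show "norm (mol \<epsilon> (v (fst w)) (snd w) - mol \<epsilon> (v (fst z)) (snd z)) \<le> 2 / \<epsilon> * G (fst w) + C * \<bar>snd w - x\<bar>"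
          unfolding tx fst_conv snd_conv real_norm_def by linarith
      qed
    qed
  qed
  show "continuous_on ({0..} \<times> UNIV) (\<lambda>z. mol \<epsilon> (u (fst z)) (snd z))"
    by (rule *[OF integrable_u L1_tendsto])
  show "continuous_on ({0..} \<times> UNIV) (\<lambda>z. mol \<epsilon> (\<lambda>y. F (u (fst z) y)) (snd z))"
    by (rule *[where v = "\<lambda>t y. F (u t y)", OF integrable_Fu L1_tendsto_F])
qed

lemma continuous_mol_Fu_time:
  assumes "0 < \<epsilon>" "A \<subseteq> {0..}" shows "continuous_on A (\<lambda>s. mol \<epsilon> (\<lambda>y. F (u s y)) x)"
proof -
  have "(\<lambda>s. (s, x)) ` A \<subseteq> {0..} \<times> UNIV" using assms(2) by auto
  from continuous_on_compose2[OF continuous_mol_u(2)[OF assms(1)] _ this] show ?thesis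
    by (simp add: continuous_on_Pair continuous_on_id continuous_on_const)
qed

lemma mol_prim_evolution':
  assumes \<tau>: "0 \<le> \<tau>" and e: "0 < \<epsilon>"
  shows "mol_prim \<epsilon> (u \<tau>) x = mol_prim \<epsilon> u0 x - integral {0..\<tau>} (\<lambda>s. mol \<epsilon> (\<lambda>y. F (u s y)) x)"
proof -
  have "set_integrable lborel {0..\<tau>} (\<lambda>s. mol \<epsilon> (\<lambda>y. F (u s y)) x)"
    unfolding set_integrable_def
    by (rule borel_integrable_compact) (auto intro!: continuous_mol_Fu_time e)
  from set_borel_integral_eq_integral(2)[OF this] show ?thesis
    unfolding mol_prim_evolution[OF assms] by simp
qed

lemma mol_prim_increment:
  assumes "0 \<le> s" "s \<le> t" and e: "0 < \<epsilon>"
  shows "mol_prim \<epsilon> (u t) x - mol_prim \<epsilon> (u s) x = - integral {s..t} (\<lambda>r. mol \<epsilon> (\<lambda>y. F (u r y)) x)"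
proof -
  have "integral {0..s} (\<lambda>r. mol \<epsilon> (\<lambda>y. F (u r y)) x) + integral {s..t} (\<lambda>r. mol \<epsilon> (\<lambda>y. F (u r y)) x)
      = integral {0..t} (\<lambda>r. mol \<epsilon> (\<lambda>y. F (u r y)) x)"
    by (rule Henstock_Kurzweil_Integration.integral_combine)
       (use assms in \<open>auto intro!: integrable_continuous_real continuous_mol_Fu_time\<close>)
  then show ?thesis using assms by (simp add: mol_prim_evolution')
qed

lemma mol_prim_Lipschitz_time:
  assumes "0 \<le> s" "0 \<le> t" and e: "0 < \<epsilon>"
  shows "\<bar>mol_prim \<epsilon> (u t) x - mol_prim \<epsilon> (u s) x\<bar> \<le> L * K * \<bar>t - s\<bar>"
proof -
  have *: "\<bar>mol_prim \<epsilon> (u t) x - mol_prim \<epsilon> (u s) x\<bar> \<le> L * K * (t - s)" if "0 \<le> s" "s \<le> t" for s t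
  proof -
    have "norm (integral {s..t} (\<lambda>r. mol \<epsilon> (\<lambda>y. F (u r y)) x)) \<le> L * K * (t - s)"
      by (rule integral_bound) (use that e abs_mol_Fu in \<open>auto intro!: continuous_mol_Fu_time\<close>)
    then show ?thesis unfolding mol_prim_increment[OF that e] by simp
  qed
  show ?thesis using *[of s t] *[of t s] assms by (cases "s \<le> t") (auto simp: abs_minus_commute)
qed

lemma U_Lipschitz_time:
  assumes "0 \<le> s" "0 \<le> t" shows "\<bar>U t x - U s x\<bar> \<le> L * K * \<bar>t - s\<bar>"
proof (rule le_if_le_eps[where C = "2 * K"])
  fix \<epsilon> :: real assume e: "0 < \<epsilon>"
  show "\<bar>U t x - U s x\<bar> \<le> L * K * \<bar>t - s\<bar> + 2 * K * \<epsilon>"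
    using mol_prim_U[OF assms(1) e, of x] mol_prim_U[OF assms(2) e, of x] mol_prim_Lipschitz_time[OF assms e, of x]
    by linarith
qed

lemma U_slope: "0 \<le> t \<Longrightarrow> x \<le> y \<Longrightarrow> a * (y - x) \<le> U t y - U t x \<and> U t y - U t x \<le> b * (y - x)"
  by (rule distribution_fun_slope[OF integrable_u range_u])

lemma U0_slope: "x \<le> y \<Longrightarrow> a * (y - x) \<le> U0 y - U0 x \<and> U0 y - U0 x \<le> b * (y - x)"
  by (rule distribution_fun_slope[OF integrable_u0 range_u0])

lemma U_Lipschitz_space: "0 \<le> t \<Longrightarrow> \<bar>U t x - U t y\<bar> \<le> K * \<bar>x - y\<bar>"
proof -
  assume t: "0 \<le> t"
  have *: "\<bar>U t y - U t x\<bar> \<le> K * (y - x)" if "x \<le> y" for x y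
  proof -
    have "(- K) * (y - x) \<le> a * (y - x)" "b * (y - x) \<le> K * (y - x)"
      using that unfolding K_def by (auto intro!: mult_right_mono)
    then show ?thesis using U_slope[OF t that] unfolding abs_le_iff by linarith
  qed
  show ?thesis using *[of x y] *[of y x] by (cases "x \<le> y") (auto simp: abs_minus_commute)
qed

text \<open>The time is truncated at 0 because \<open>Lipschitz2_continuous\<close> asks for a bound
  on the whole plane.\<close>

lemma U_Lipschitz:
  "\<bar>U (max 0 t) x - U (max 0 s) y\<bar> \<le> (L * K + K) * (\<bar>t - s\<bar> + \<bar>x - y\<bar>)"
proof (rule Lipschitz_combine)
  have "\<bar>U (max 0 t) x - U (max 0 s) x\<bar> \<le> L * K * \<bar>max 0 t - max 0 s\<bar>"
    by (rule U_Lipschitz_time) auto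
  also have "\<dots> \<le> L * K * \<bar>t - s\<bar>"
    using L0 K0 by (intro mult_left_mono) auto
  finally show "\<bar>U (max 0 t) x - U (max 0 s) x\<bar> \<le> L * K * \<bar>t - s\<bar>" .
  show "\<bar>U (max 0 s) x - U (max 0 s) y\<bar> \<le> K * \<bar>x - y\<bar>" by (rule U_Lipschitz_space) simp
qed (use L0 K0 in auto)

text \<open>The entropy inequality contains the initial datum only under an integral. The evolution
  formula at time 0 identifies it with the trace of the solution.\<close>

lemma U_init: "U 0 x = U0 x"
proof -
  have "\<bar>U 0 x - U0 x\<bar> \<le> 0"
  proof (rule le_if_le_eps[where C = "2 * K"])
    fix \<epsilon> :: real assume e: "0 < \<epsilon>"
    have "mol_prim \<epsilon> (u 0) x = mol_prim \<epsilon> u0 x" using mol_prim_evolution'[of 0 \<epsilon> x] e by simp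
    then show "\<bar>U 0 x - U0 x\<bar> \<le> 0 + 2 * K * \<epsilon>"
      using mol_prim_U[OF order_refl e, of x] mol_prim_U0[OF e, of x] by linarith
  qed
  then show ?thesis by simp
qed

lemma U_left: "0 \<le> t \<Longrightarrow> x \<le> - X t \<Longrightarrow> U t x = 0"
  by (rule distribution_fun_eq_0) (use u_eq_0[of t t] X_pos[of t] in auto)

lemma U0_left: "x < - R \<Longrightarrow> U0 x = 0"
  by (rule distribution_fun_eq_0) (use supp_u0 R0 in auto)

lemma U0_right: "R \<le> x \<Longrightarrow> U0 x = (LINT y|lborel. u0 y)"
  by (rule distribution_fun_eq_total) (use supp_u0 R0 in auto)

text \<open>To the right of the support the mollified flux is zero, since the kernel looks only to
  the right; hence the mollified primitive is constant in time there.\<close>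

lemma U_far: 
  assumes t: "0 \<le> t" and x: "X t \<le> x" shows "U t x = U0 x"
proof -
  have "\<bar>U t x - U0 x\<bar> \<le> 0"
  proof (rule le_if_le_eps[where C = "2 * K"])
    fix \<epsilon> :: real assume e: "0 < \<epsilon>"
    have "mol \<epsilon> (\<lambda>y. F (u s y)) x = 0" if s: "s \<in> {0..t}" for s
    proof -
      have "\<bar>mol \<epsilon> (\<lambda>y. F (u s y)) x - 0\<bar> \<le> 0"
      proof (rule mol_const_diff[OF integrable_Fu e])
        fix y assume "x < y"
        then have "u s y = 0" using s x X_pos[OF t] by (intro u_eq_0[of s t]) auto
        then show "\<bar>F (u s y) - 0\<bar> \<le> 0" by (simp add: F0)
      qed (use s in simp)
      then show ?thesis by simp
    qed
    then have "integral {0..t} (\<lambda>s. mol \<epsilon> (\<lambda>y. F (u s y)) x) = integral {0..t} (\<lambda>s. 0)"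
      by (intro Henstock_Kurzweil_Integration.integral_cong) auto
    then have "mol_prim \<epsilon> (u t) x = mol_prim \<epsilon> u0 x" using mol_prim_evolution'[OF t e, of x] by simp
    then show "\<bar>U t x - U0 x\<bar> \<le> 0 + 2 * K * \<epsilon>"
      using mol_prim_U[OF t e, of x] mol_prim_U0[OF e, of x] by linarith
  qed
  then show ?thesis by simp
qed

lemma R_le_X: "0 \<le> t \<Longrightarrow> R < X t"
  unfolding X_def using mult_nonneg_nonneg[of "L + 1" t] L0 by linarith

lemma mass_conserved: assumes "0 \<le> t" shows "(LINT x|lborel. u t x) = (LINT x|lborel. u0 x)"
proof -
  have "U t (X t) = (LINT x|lborel. u t x)"
    by (rule distribution_fun_eq_total) (use u_eq_0[OF assms order_refl] X_pos[OF assms] in auto)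
  then show ?thesis using U_far[OF assms, of "X t"] U0_right[of "X t"] R_le_X[OF assms] by simp
qed

lemma DERIV_mol_prim_time:
  assumes t: "0 < t" and e: "0 < \<epsilon>"
  shows "((\<lambda>s. mol_prim \<epsilon> (u s) x) has_real_derivative - mol \<epsilon> (\<lambda>y. F (u t y)) x) (at t)"
proof (rule has_field_derivative_transform_within_open)
  let ?f = "\<lambda>s. mol \<epsilon> (\<lambda>y. F (u s y)) x"
  have "((\<lambda>s. integral {0..s} ?f) has_real_derivative ?f t) (at t within {0..t+1})"
    by (rule integral_has_real_derivative) (use t e in \<open>auto intro!: continuous_mol_Fu_time\<close>)
  then have "((\<lambda>s. integral {0..s} ?f) has_real_derivative ?f t) (at t)"
    using t by (subst (asm) at_within_interior) auto
  then show "((\<lambda>s. mol_prim \<epsilon> u0 x - integral {0..s} ?f) has_real_derivative - ?f t) (at t)"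
    by (auto intro!: derivative_eq_intros)
  show "open {0::real<..}" by (rule open_greaterThan)
  show "t \<in> {0<..}" using t by simp
  show "mol_prim \<epsilon> u0 x - integral {0..s} ?f = mol_prim \<epsilon> (u s) x" if "s \<in> {0<..}" for s
    using that e by (simp add: mol_prim_evolution')
qed

lemma mol_prim_C1:
  assumes e: "0 < \<epsilon>"
  shows "(t, x) \<in> {0<..} \<times> UNIV \<Longrightarrow> ((\<lambda>s. mol_prim \<epsilon> (u s) x) has_real_derivative
      (\<lambda>z. - mol \<epsilon> (\<lambda>y. F (u (fst z) y)) (snd z)) (t, x)) (at t)"
    and "(t, x) \<in> {0<..} \<times> UNIV \<Longrightarrow> ((\<lambda>y. mol_prim \<epsilon> (u t) y) has_real_derivative
      (\<lambda>z. mol \<epsilon> (u (fst z)) (snd z)) (t, x)) (at x)"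
    and "continuous_on ({0<..} \<times> UNIV) (\<lambda>z. - mol \<epsilon> (\<lambda>y. F (u (fst z) y)) (snd z))"
    and "continuous_on ({0<..} \<times> UNIV) (\<lambda>z. mol \<epsilon> (u (fst z)) (snd z))"
    and "open ({0<..} \<times> UNIV :: (real \<times> real) set)"
proof -
  show "(t, x) \<in> {0<..} \<times> UNIV \<Longrightarrow> ((\<lambda>s. mol_prim \<epsilon> (u s) x) has_real_derivative
      (\<lambda>z. - mol \<epsilon> (\<lambda>y. F (u (fst z) y)) (snd z)) (t, x)) (at t)"
    using DERIV_mol_prim_time[OF _ e] by simp
  show "(t, x) \<in> {0<..} \<times> UNIV \<Longrightarrow> ((\<lambda>y. mol_prim \<epsilon> (u t) y) has_real_derivative
      (\<lambda>z. mol \<epsilon> (u (fst z)) (snd z)) (t, x)) (at x)"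
    using DERIV_mol_prim[OF integrable_u e] by simp
  have s: "({0<..} :: real set) \<times> UNIV \<subseteq> {0..} \<times> (UNIV :: real set)" by auto
  show "continuous_on ({0<..} \<times> UNIV) (\<lambda>z. - mol \<epsilon> (\<lambda>y. F (u (fst z) y)) (snd z))"
    "continuous_on ({0<..} \<times> UNIV) (\<lambda>z. mol \<epsilon> (u (fst z)) (snd z))"
    using continuous_on_subset[OF continuous_mol_u(1)[OF e] s] continuous_on_subset[OF continuous_mol_u(2)[OF e] s]
    by (auto intro!: continuous_intros)
  show "open ({0<..} \<times> UNIV :: (real \<times> real) set)" by (intro open_Times) auto
qed

text \<open>The primitive lies below every characteristic value: along a line of slope q it grows at most at the
  rate given by the conjugate flux.\<close>
lemma upper_bound:
  assumes qc: "\<And>p. p \<in> {a..b} \<Longrightarrow> q * p - F p \<le> c" and t: "0 \<le> t"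
  shows "U t x \<le> U0 (x - t * q) + t * c"
proof (cases "t = 0")
  case True then show ?thesis by (simp add: U_init)
next
  case False
  then have t: "0 < t" using t by simp
  show ?thesis
  proof (rule le_if_le_eps[where C = "2 * K"])
    fix \<epsilon> :: real assume e: "0 < \<epsilon>"
    define w where "w s = mol_prim \<epsilon> (u s) (x - (t - s) * q)" for s
    define w' where "w' s = - mol \<epsilon> (\<lambda>y. F (u s y)) (x - (t - s) * q) + q * mol \<epsilon> (u s) (x - (t - s) * q)" for s
    have Dw: "(w has_real_derivative w' s) (at s)" if s: "0 < s" for s
    proof -
      have "((\<lambda>h. mol_prim \<epsilon> (u (s + h)) ((x - (t - s) * q) + h * q)) has_real_derivative
         (\<lambda>z. - mol \<epsilon> (\<lambda>y. F (u (fst z) y)) (snd z)) (s, x - (t - s) * q)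
           + q * (\<lambda>z. mol \<epsilon> (u (fst z)) (snd z)) (s, x - (t - s) * q)) (at 0)"
        by (rule DERIV_along_line[OF mol_prim_C1(5) _ mol_prim_C1(1)[OF e] mol_prim_C1(2)[OF e] mol_prim_C1(3)[OF e] mol_prim_C1(4)[OF e]])
           (use s in auto)
      moreover have "(\<lambda>h. mol_prim \<epsilon> (u (s + h)) ((x - (t - s) * q) + h * q)) = (\<lambda>h. w (h + s))"
        unfolding w_def by (simp add: algebra_simps)
      ultimately show ?thesis unfolding w'_def using DERIV_shift[of w "w' s" 0 s] by (simp add: w'_def)
    qed
    have cw: "continuous_on {0..t} w"
    proof -
      have cq: "continuous_on {0..t} (\<lambda>s. x - (t - s) * q)" by (intro continuous_intros)
      have "\<bar>mol_prim \<epsilon> (u (max 0 t)) x - mol_prim \<epsilon> (u (max 0 s)) y\<bar> \<le> (L * K + K) * (\<bar>t - s\<bar> + \<bar>x - y\<bar>)" for t s x y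
      proof (rule Lipschitz_combine)
        have "\<bar>mol_prim \<epsilon> (u (max 0 t)) x - mol_prim \<epsilon> (u (max 0 s)) x\<bar> \<le> L * K * \<bar>max 0 t - max 0 s\<bar>"
          by (rule mol_prim_Lipschitz_time) (use e in auto)
        also have "\<dots> \<le> L * K * \<bar>t - s\<bar>"
          using L0 K0 by (intro mult_left_mono) auto
        finally show "\<bar>mol_prim \<epsilon> (u (max 0 t)) x - mol_prim \<epsilon> (u (max 0 s)) x\<bar> \<le> L * K * \<bar>t - s\<bar>" .
        have "norm (mol_prim \<epsilon> (u (max 0 s)) x - mol_prim \<epsilon> (u (max 0 s)) y) \<le> K * norm (x - y)"
          by (rule field_differentiable_bound[where S = UNIV and f' = "mol \<epsilon> (u (max 0 s))"])
             (use DERIV_mol_prim[OF integrable_u e] abs_mol_u e in auto)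
        then show "\<bar>mol_prim \<epsilon> (u (max 0 s)) x - mol_prim \<epsilon> (u (max 0 s)) y\<bar> \<le> K * \<bar>x - y\<bar>" by simp
      qed (use L0 K0 in auto)
      from Lipschitz2_continuous[where H = "\<lambda>t. mol_prim \<epsilon> (u (max 0 t))" and A = "{0..t}" and p = "\<lambda>s. s" and q = "\<lambda>s. x - (t - s) * q", OF this continuous_on_id cq]
      show ?thesis unfolding w_def by (rule continuous_on_eq) (auto simp: max_def)
    qed
    obtain l z where z: "0 < z" "z < t" "(w has_real_derivative l) (at z)" "w t - w 0 = (t - 0) * l"
      using MVT[OF t cw] Dw by (meson real_differentiable_def)
    have "l = w' z" using DERIV_unique[OF z(3) Dw[OF z(1)]] .
    \<comment> \<open>Mollification is linear and preserves bounds, so the derivative along the line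
      is an average of q u - F(u), which the hypothesis bounds by c.\<close>
    also have "w' z = mol \<epsilon> (\<lambda>y. q * u z y - F (u z y)) (x - (t - z) * q)"
      unfolding w'_def using z(1) e by (subst mol_scale) (auto intro!: integrable_u integrable_Fu)
    also have "\<dots> \<le> c"
      by (rule mol_le) (use z(1) e qc range_u in \<open>auto intro!: integrable_u integrable_Fu Bochner_Integration.integrable_diff integrable_mult_right\<close>)
    finally have "l \<le> c" .
    then have "t * l \<le> t * c" using t by (intro mult_left_mono) auto
    moreover have "w t - w 0 = t * l" using z(4) by simp
    ultimately have "w t \<le> w 0 + t * c" by linarith
    moreover have "w t = mol_prim \<epsilon> (u t) x" "w 0 = mol_prim \<epsilon> (u 0) (x - t * q)" by (simp_all add: w_def)
    ultimately show "U t x \<le> U0 (x - t * q) + t * c + 2 * K * \<epsilon>"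
      using mol_prim_U[of t \<epsilon> x] mol_prim_U[of 0 \<epsilon> "x - t * q"] t e U_init[of "x - t * q"] by simp
  qed
qed

end

section \<open>Comparison from below by the touching argument\<close>

context compact_sol begin

text \<open>The partial derivatives of the mollified primitive are minus the mollified flux and the
  mollified solution. This is the error of replacing them by -F(u) and u.\<close>

definition moll_error :: "real \<Rightarrow> real \<times> real \<Rightarrow> real" where
  "moll_error \<epsilon> z = \<bar>mol \<epsilon> (\<lambda>y. F (u (fst z) y)) (snd z) - F (u (fst z) (snd z))\<bar>
     + \<bar>mol \<epsilon> (u (fst z)) (snd z) - u (fst z) (snd z)\<bar>"

lemma measurable_moll_error [measurable]: "moll_error \<epsilon> \<in> borel_measurable borel"
proof -
  have u: "(\<lambda>(z :: real \<times> real, y). u (fst z) y) \<in> borel_measurable (borel \<Otimes>\<^sub>M lborel)"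
  proof -
    have "(\<lambda>w. (fst (fst w), snd w)) \<in> ((borel :: (real \<times> real) measure) \<Otimes>\<^sub>M lborel) \<rightarrow>\<^sub>M ((borel :: real measure) \<Otimes>\<^sub>M (borel :: real measure))"
    proof (rule measurable_Pair)
      show "(\<lambda>w. fst (fst w)) \<in> (borel :: (real \<times> real) measure) \<Otimes>\<^sub>M lborel \<rightarrow>\<^sub>M (borel :: real measure)"
        by (rule measurable_compose[OF measurable_fst measurable_fst_snd_real(1)])
      show "(\<lambda>w. snd w) \<in> (borel :: (real \<times> real) measure) \<Otimes>\<^sub>M lborel \<rightarrow>\<^sub>M (borel :: real measure)"
        using measurable_snd[of "borel :: (real \<times> real) measure" "lborel :: real measure"] by simp
    qed
    from measurable_compose[OF this[unfolded borel_prod] meas] show ?thesis by (simp add: case_prod_beta')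
  qed
  then have Fu: "(\<lambda>(z :: real \<times> real, y). F (u (fst z) y)) \<in> borel_measurable (borel \<Otimes>\<^sub>M lborel)"
    unfolding case_prod_beta' by (rule measurable_compose[OF _ measurable_F])
  have s: "(\<lambda>z. snd z) \<in> borel_measurable (borel :: (real \<times> real) measure)" by measurable
  have "(\<lambda>z. mol \<epsilon> (\<lambda>y. F (u (fst z) y)) (snd z)) \<in> borel_measurable borel"
    by (rule measurable_mol[OF Fu s])
  moreover have "(\<lambda>z. mol \<epsilon> (\<lambda>y. u (fst z) y) (snd z)) \<in> borel_measurable borel"
    by (rule measurable_mol[OF u s])
  moreover have "(\<lambda>z. F (u (fst z) (snd z))) \<in> borel_measurable borel"
    by (rule measurable_compose[OF meas measurable_F])
  ultimately show ?thesis unfolding moll_error_def using meas by measurable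
qed

text \<open>At each time both parts tend to 0 in L1 by \<open>mol_tendsto_L1\<close>. The
  contraction property bounds them by twice the L1 norms, which is the domination in time.\<close>

lemma moll_error_tendsto:
  assumes \<epsilon>: "\<And>n. 0 < \<epsilon> n" "\<epsilon> \<longlonglongrightarrow> 0" and T: "0 \<le> T1"
  shows "(\<lambda>n. \<integral>\<^sup>+z. ennreal (moll_error (\<epsilon> n) z) * indicator ({T1..T2} \<times> UNIV) z \<partial>lborel) \<longlonglongrightarrow> 0"
proof -
  define e where "e n t = (\<integral>\<^sup>+x. ennreal (moll_error (\<epsilon> n) (t, x)) \<partial>lborel) * indicator {T1..T2} t" for n t
  have eq: "(\<integral>\<^sup>+z. ennreal (moll_error (\<epsilon> n) z) * indicator ({T1..T2} \<times> UNIV) z \<partial>lborel) = (\<integral>\<^sup>+t. e n t \<partial>lborel)" for n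
  proof -
    have m: "(\<lambda>z. ennreal (moll_error (\<epsilon> n) z) * indicator ({T1..T2} \<times> UNIV) z) \<in> borel_measurable (lborel \<Otimes>\<^sub>M lborel)"
    proof -
      have [measurable]: "{T1..T2} \<times> UNIV \<in> sets (borel :: (real \<times> real) measure)"
        by (auto intro!: borel_closed closed_Times)
      show ?thesis unfolding lborel_prod by measurable
    qed
    have "(\<integral>\<^sup>+z. ennreal (moll_error (\<epsilon> n) z) * indicator ({T1..T2} \<times> UNIV) z \<partial>lborel)
       = (\<integral>\<^sup>+t. \<integral>\<^sup>+x. ennreal (moll_error (\<epsilon> n) (t, x)) * indicator ({T1..T2} \<times> UNIV) (t, x) \<partial>lborel \<partial>lborel)"
      using lborel.nn_integral_fst[OF m] by (simp add: lborel_prod)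
    also have "\<dots> = (\<integral>\<^sup>+t. e n t \<partial>lborel)"
      unfolding e_def by (intro nn_integral_cong) (auto simp: indicator_def)
    finally show ?thesis .
  qed
  have me: "(\<lambda>t. e n t) \<in> borel_measurable lborel" for n
  proof -
    have "(\<lambda>z. ennreal (moll_error (\<epsilon> n) z)) \<in> borel_measurable (lborel \<Otimes>\<^sub>M lborel)"
      unfolding lborel_prod by measurable
    from lborel.borel_measurable_nn_integral_fst[OF this] show ?thesis unfolding e_def by measurable
  qed
  have inner: "(\<integral>\<^sup>+x. ennreal (moll_error (\<epsilon> n) (t, x)) \<partial>lborel) =
     (\<integral>\<^sup>+x. ennreal \<bar>mol (\<epsilon> n) (\<lambda>y. F (u t y)) x - F (u t x)\<bar> \<partial>lborel) + (\<integral>\<^sup>+x. ennreal \<bar>mol (\<epsilon> n) (u t) x - u t x\<bar> \<partial>lborel)" for n t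
  proof -
    have m: "(\<lambda>x. mol (\<epsilon> n) v x) \<in> borel_measurable lborel" if "v \<in> borel_measurable borel" for v
    proof -
      have "(\<lambda>(z::real, y). v y) \<in> borel_measurable (lborel \<Otimes>\<^sub>M lborel)"
        unfolding case_prod_beta' using measurable_compose[OF measurable_snd, of v] that by simp
      from measurable_mol[OF this, of "\<lambda>x. x"] show ?thesis by simp
    qed
    have "u t \<in> borel_measurable borel" by (rule borel_section[OF meas])
    then have "u t \<in> borel_measurable lborel" "(\<lambda>y. F (u t y)) \<in> borel_measurable lborel"
      "mol (\<epsilon> n) (u t) \<in> borel_measurable lborel" "mol (\<epsilon> n) (\<lambda>y. F (u t y)) \<in> borel_measurable lborel"
      by (auto intro!: m measurable_compose[OF _ measurable_F])
    then show ?thesis unfolding moll_error_def fst_conv snd_conv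
      by (subst nn_integral_add[symmetric]) (auto simp: ennreal_plus)
  qed
  have "(\<lambda>n. \<integral>\<^sup>+t. e n t \<partial>lborel) \<longlonglongrightarrow> (\<integral>\<^sup>+t. 0 \<partial>(lborel :: real measure))"
  proof (rule nn_integral_dominated_convergence[where w = "\<lambda>t. ennreal (2 * (L * K + K) * (2 * X T2)) * indicator {T1..T2} t"])
    show "AE t in lborel. e n t \<le> ennreal (2 * (L * K + K) * (2 * X T2)) * indicator {T1..T2} t" for n
    proof (rule AE_I2)
      fix t
      show "e n t \<le> ennreal (2 * (L * K + K) * (2 * X T2)) * indicator {T1..T2} t"
      proof (cases "t \<in> {T1..T2}")
        case True
        then have t: "0 \<le> t" "t \<le> T2" using T by auto
        have XT: "0 < X T2" using X_pos[of T2] t by simp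
        have bnd: "(\<integral>\<^sup>+x. ennreal \<bar>mol (\<epsilon> n) v x - v x\<bar> \<partial>lborel) \<le> ennreal (2 * (C * (2 * X T2)))"
          if v: "v \<in> borel_measurable borel" "\<And>x. \<bar>v x\<bar> \<le> C" "\<And>x. X T2 \<le> \<bar>x\<bar> \<Longrightarrow> v x = 0" for v C
        proof -
          have C0: "0 \<le> C" using v(2)[of 0] by linarith
          have iv: "integrable lborel v" by (rule integrable_bounded_support[where R = "X T2", OF v(1,2)]) (use v(3) in auto)
          have V: "(\<integral>\<^sup>+x. ennreal \<bar>v x\<bar> \<partial>lborel) \<le> ennreal (C * (2 * X T2))"
          proof -
            have "(\<integral>\<^sup>+x. ennreal \<bar>v x\<bar> \<partial>lborel) \<le> (\<integral>\<^sup>+x. ennreal C * indicator {-X T2..X T2} x \<partial>lborel)"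
            proof (rule nn_integral_mono)
              fix x show "ennreal \<bar>v x\<bar> \<le> ennreal C * indicator {-X T2..X T2} x"
              proof (cases "x \<in> {-X T2..X T2}")
                case True then show ?thesis using v(2)[of x] by (simp add: ennreal_leI)
              next
                case False
                then have "X T2 \<le> \<bar>x\<bar>" by auto
                then show ?thesis using v(3) by simp
              qed
            qed
            also have "\<dots> = ennreal C * ennreal (2 * X T2)" using XT by (simp add: nn_integral_cmult_indicator)
            also have "\<dots> = ennreal (C * (2 * X T2))" using C0 XT by (intro ennreal_mult[symmetric]) auto
            finally show ?thesis .
          qed
          have mm: "mol (\<epsilon> n) v \<in> borel_measurable lborel"
          proof -
            have "(\<lambda>(z::real, y). v y) \<in> borel_measurable (lborel \<Otimes>\<^sub>M lborel)"
              unfolding case_prod_beta' using measurable_compose[OF measurable_snd, of v] v(1) by simp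
            from measurable_mol[OF this, of "\<lambda>x. x"] show ?thesis by simp
          qed
          have "(\<integral>\<^sup>+x. ennreal \<bar>mol (\<epsilon> n) v x - v x\<bar> \<partial>lborel) \<le> (\<integral>\<^sup>+x. ennreal \<bar>mol (\<epsilon> n) v x\<bar> + ennreal \<bar>v x\<bar> \<partial>lborel)"
          proof (rule nn_integral_mono)
            fix x
            have "\<bar>mol (\<epsilon> n) v x - v x\<bar> \<le> \<bar>mol (\<epsilon> n) v x\<bar> + \<bar>v x\<bar>" by simp
            then have "ennreal \<bar>mol (\<epsilon> n) v x - v x\<bar> \<le> ennreal (\<bar>mol (\<epsilon> n) v x\<bar> + \<bar>v x\<bar>)" by (rule ennreal_leI)
            then show "ennreal \<bar>mol (\<epsilon> n) v x - v x\<bar> \<le> ennreal \<bar>mol (\<epsilon> n) v x\<bar> + ennreal \<bar>v x\<bar>" by (simp add: ennreal_plus)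
          qed
          also have "\<dots> = (\<integral>\<^sup>+x. ennreal \<bar>mol (\<epsilon> n) v x\<bar> \<partial>lborel) + (\<integral>\<^sup>+x. ennreal \<bar>v x\<bar> \<partial>lborel)"
            using mm v(1) by (intro nn_integral_add) auto
          also have "\<dots> \<le> ennreal (C * (2 * X T2)) + ennreal (C * (2 * X T2))"
            by (intro add_mono V order_trans[OF mol_L1_contraction[OF iv \<epsilon>(1)] V])
          also have "\<dots> = ennreal (2 * (C * (2 * X T2)))"
          proof -
            have "0 \<le> C * (2 * X T2)" using C0 XT by simp
            then show ?thesis by (simp add: ennreal_plus[symmetric] del: ennreal_plus)
          qed
          finally show ?thesis .
        qed
        have um: "u t \<in> borel_measurable borel" by (rule borel_section[OF meas])
        have uz: "u t x = 0" if "X T2 \<le> \<bar>x\<bar>" for x using u_eq_0[OF t that] .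
        have "e n t \<le> ennreal (2 * (L * K * (2 * X T2))) + ennreal (2 * (K * (2 * X T2)))"
          unfolding e_def inner using True
          by (simp only: indicator_simps mult_1_right)
             (intro add_mono bnd abs_Fu abs_u um measurable_compose[OF um measurable_F]; simp add: uz F0)
        also have "\<dots> = ennreal (2 * (L * K * (2 * X T2)) + 2 * (K * (2 * X T2)))"
          using L0 K0 XT by (intro ennreal_plus[symmetric]) auto
        also have "2 * (L * K * (2 * X T2)) + 2 * (K * (2 * X T2)) = 2 * (L * K + K) * (2 * X T2)"
          by (simp add: algebra_simps)
        finally show ?thesis using True by simp
      qed (simp add: e_def)
    qed
    show "(\<integral>\<^sup>+t. ennreal (2 * (L * K + K) * (2 * X T2)) * indicator {T1..T2} t \<partial>lborel) < \<infinity>"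
      by (subst nn_integral_cmult_indicator) (auto simp: ennreal_mult_less_top emeasure_lborel_Icc_eq)
    show "AE t in lborel. (\<lambda>n. e n t) \<longlonglongrightarrow> 0"
    proof (rule AE_I2)
      fix t
      show "(\<lambda>n. e n t) \<longlonglongrightarrow> 0"
      proof (cases "t \<in> {T1..T2}")
        case True
        then have t: "0 \<le> t" using T by auto
        have um: "u t \<in> borel_measurable borel" by (rule borel_section[OF meas])
        have "(\<lambda>n. \<integral>\<^sup>+x. ennreal \<bar>mol (\<epsilon> n) (u t) x - u t x\<bar> \<partial>lborel) \<longlonglongrightarrow> 0"
          by (rule mol_tendsto_L1[where R = "X t", OF um abs_u _ \<epsilon>]) (use u_eq_0[OF t order_refl] in auto)
        moreover have "(\<lambda>n. \<integral>\<^sup>+x. ennreal \<bar>mol (\<epsilon> n) (\<lambda>y. F (u t y)) x - F (u t x)\<bar> \<partial>lborel) \<longlonglongrightarrow> 0"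
          by (rule mol_tendsto_L1[where R = "X t" and v = "\<lambda>y. F (u t y)", OF measurable_compose[OF um measurable_F] abs_Fu _ \<epsilon>])
             (use u_eq_0[OF t order_refl] F0 in auto)
        ultimately have "(\<lambda>n. (\<integral>\<^sup>+x. ennreal \<bar>mol (\<epsilon> n) (\<lambda>y. F (u t y)) x - F (u t x)\<bar> \<partial>lborel)
           + (\<integral>\<^sup>+x. ennreal \<bar>mol (\<epsilon> n) (u t) x - u t x\<bar> \<partial>lborel)) \<longlonglongrightarrow> 0 + 0"
          by (intro tendsto_add)
        then show ?thesis unfolding e_def inner using True by (simp only: indicator_simps mult_1_right add_0_right)
      qed (simp add: e_def)
    qed
  qed (use me in auto)
  then show ?thesis unfolding eq by simp
qed

text \<open>The entropy inequality, tested with the square of the positive part of the distance below a local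
  minimum, forces the solution to be constant near a touching point.\<close>
lemma touching_constant:
  fixes \<Phi> :: "real \<Rightarrow> real \<Rightarrow> real"
  assumes dt: "\<And>t x. ((\<lambda>s. \<Phi> s x) has_real_derivative \<Phi>t (t, x)) (at t)"
    and dx: "\<And>t x. ((\<lambda>y. \<Phi> t y) has_real_derivative \<Phi>x (t, x)) (at x)"
    and ct: "continuous_on UNIV \<Phi>t" and cx: "continuous_on UNIV \<Phi>x"
    and r: "0 < r" "0 < \<eta>" and pos: "\<And>z. dist z z0 \<le> r \<Longrightarrow> 0 < fst z"
    and low: "\<And>z. dist z z0 \<le> r \<Longrightarrow> m \<le> U (fst z) (snd z) - \<Phi> (fst z) (snd z)"
    and high: "\<And>z. r / 2 \<le> dist z z0 \<Longrightarrow> dist z z0 \<le> r \<Longrightarrow> m + 2 * \<eta> \<le> U (fst z) (snd z) - \<Phi> (fst z) (snd z)"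
    and sub: "\<And>z. dist z z0 \<le> r \<Longrightarrow> \<Phi>t z + F k + L1 * \<bar>\<Phi>x z - k\<bar> \<le> - \<gamma>" and \<gamma>: "0 < \<gamma>"
    and L1: "\<And>t x. \<bar>F (u t x) - F k\<bar> \<le> L1 * \<bar>u t x - k\<bar>"
    and \<rho>: "\<rho> \<le> r" "\<And>z. dist z z0 < \<rho> \<Longrightarrow> U (fst z) (snd z) - \<Phi> (fst z) (snd z) \<le> m + \<eta> / 4"
  shows "AE z in lborel. dist z z0 < \<rho> \<longrightarrow> u (fst z) (snd z) = k"
proof -
  define w where "w z = \<bar>u (fst z) (snd z) - k\<bar> * indicator (ball z0 \<rho>) z" for z
  define Q where "Q = K + \<bar>k\<bar>"
  have Q0: "0 \<le> Q" using K0 by (simp add: Q_def)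
  have uk: "\<bar>u t x - k\<bar> \<le> Q" for t x using abs_u[of t x] unfolding Q_def by linarith
  define C1 where "C1 = 4 * \<eta> * (Q + \<bar>L1\<bar> * Q)"
  have C10: "0 \<le> C1" using Q0 r by (simp add: C1_def)
  have [measurable]: "(\<lambda>z. u (fst z) (snd z)) \<in> borel_measurable borel" by (rule meas)
  have wm[measurable]: "w \<in> borel_measurable borel" unfolding w_def
    by (intro borel_measurable_times borel_measurable_abs borel_measurable_diff meas borel_measurable_const
        borel_measurable_indicator borel_open open_ball)
  have iw: "integrable lborel w"
  proof (rule integrable_bounded_support2[where R = "norm z0 + \<bar>\<rho>\<bar>" and B = Q])
    show "\<bar>w z\<bar> \<le> Q" for z using uk Q0 by (simp add: w_def indicator_def)
    show "w z = 0" if "norm z0 + \<bar>\<rho>\<bar> < norm z" for z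
    proof -
      have "norm z \<le> norm z0 + dist z0 z" using norm_triangle_sub[of z z0] by (simp add: dist_norm norm_minus_commute)
      then have "z \<notin> ball z0 \<rho>" using that by auto
      then show ?thesis by (simp add: w_def)
    qed
  qed (rule wm)
  \<comment> \<open>The scale tends to 0 and is so small from the start that the mollified primitive
    stays within \<eta>/4 of \<open>U\<close>.\<close>
  define \<epsilon> where "\<epsilon> n = \<eta> / (4 * (K + 1)) / real (Suc n)" for n
  have e0: "0 < \<epsilon> n" for n unfolding \<epsilon>_def using r K0 by simp
  have elim: "\<epsilon> \<longlonglongrightarrow> 0"
    unfolding \<epsilon>_def by (rule real_tendsto_divide_at_top[OF tendsto_const]) (rule filterlim_compose[OF filterlim_real_sequentially filterlim_Suc])
  have eK: "K * \<epsilon> n \<le> \<eta> / 4" for n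
  proof -
    have "\<epsilon> n \<le> \<eta> / (4 * (K + 1)) / 1" unfolding \<epsilon>_def using r K0 by (intro divide_left_mono) auto
    then have "K * \<epsilon> n \<le> (K + 1) * (\<eta> / (4 * (K + 1)))" using K0 e0[of n] by (intro mult_mono) auto
    also have "\<dots> = \<eta> / 4" using K0 by (simp add: field_simps)
    finally show ?thesis .
  qed
  \<comment> \<open>The left side does not depend on n: the mass of |u - k| near the touching point
    is bounded by the mollification error alone.\<close>
  have key: "\<gamma> * \<eta> * integral\<^sup>L lborel w \<le> C1 * (LINT z|lborel. moll_error (\<epsilon> n) z * indicator (ball z0 r) z)"
    and imE: "integrable lborel (\<lambda>z. moll_error (\<epsilon> n) z * indicator (ball z0 r) z)" for n
  proof -
    note e = e0[of n]
    define V where "V z = mol_prim (\<epsilon> n) (u (fst z)) (snd z)" for z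
    define mF where "mF z = mol (\<epsilon> n) (\<lambda>y. F (u (fst z) y)) (snd z)" for z
    define mu where "mu z = mol (\<epsilon> n) (u (fst z)) (snd z)" for z
    \<comment> \<open>As \<open>V\<close> is within \<eta>/4 of \<open>U\<close>, P vanishes between
      the radii r/2 and r, where U - \<Phi> is at least m + 2 \<eta>. Hence its square, set to zero
      beyond r, is C1. Within \<rho> it satisfies P \<ge> \<eta>/2, and P \<le> 2 \<eta> on the
      whole ball.\<close>
    define P where "P z = max 0 (m + \<eta> - V z + \<Phi> (fst z) (snd z))" for z
    define \<phi> where "\<phi> z = (if dist z z0 < r then (P z)\<^sup>2 else 0)" for z
    define \<phi>t where "\<phi>t z = (if dist z z0 < r then 2 * P z * (mF z + \<Phi>t z) else 0)" for z
    define \<phi>x where "\<phi>x z = (if dist z z0 < r then 2 * P z * (\<Phi>x z - mu z) else 0)" for z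
    have VU: "\<bar>V z - U (fst z) (snd z)\<bar> \<le> \<eta> / 4" if "0 < fst z" for z
      unfolding V_def using mol_prim_U[of "fst z" "\<epsilon> n" "snd z"] that e eK[of n] by simp
    have P_out: "P z = 0" if "r / 2 \<le> dist z z0" "dist z z0 \<le> r" for z
    proof -
      have "m + \<eta> - V z + \<Phi> (fst z) (snd z) \<le> 0"
        using high[OF that] VU[OF pos[OF that(2)]] r by linarith
      then show ?thesis by (simp add: P_def)
    qed
    have P_le: "P z \<le> 2 * \<eta>" if "dist z z0 \<le> r" for z
      unfolding P_def using low[OF that] VU[OF pos[OF that]] r by linarith
    have P_ge: "\<eta> / 2 \<le> P z" if "dist z z0 < \<rho>" for z
    proof -
      have "dist z z0 \<le> r" using that \<rho>(1) by simp
      then show ?thesis unfolding P_def using \<rho>(2)[OF that] VU[OF pos, of z] by linarith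
    qed
    have P0: "0 \<le> P z" for z by (simp add: P_def)
    have opos: "open {z :: real \<times> real. dist z z0 < r}" "open {z :: real \<times> real. r / 2 < dist z z0}"
      by (intro open_Collect_less continuous_intros)+
    have cover: "{z. dist z z0 < r} \<union> {z. r / 2 < dist z z0} = UNIV" using r by auto
    have sub0: "{z. dist z z0 < r} \<subseteq> {0<..} \<times> UNIV"
    proof
      fix z assume "z \<in> {z. dist z z0 < r}"
      then have "0 < fst z" using pos[of z] by simp
      then show "z \<in> {0<..} \<times> UNIV" by (simp add: mem_Times_iff)
    qed
    have cV: "continuous_on {z. dist z z0 < r} V"
      unfolding V_def by (rule continuous_on_subset[OF C1_imp_continuous[OF mol_prim_C1(5)[OF e] mol_prim_C1(1)[OF e] mol_prim_C1(2)[OF e] mol_prim_C1(3)[OF e] mol_prim_C1(4)[OF e]] sub0])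
    have c\<Phi>: "continuous_on UNIV (\<lambda>z. \<Phi> (fst z) (snd z))"
      by (rule C1_imp_continuous[OF open_UNIV dt dx ct cx])
    have cP: "continuous_on {z. dist z z0 < r} P"
      unfolding P_def by (intro continuous_intros cV continuous_on_subset[OF c\<Phi>]) auto
    have cmF: "continuous_on {z. dist z z0 < r} mF"
      unfolding mF_def using continuous_on_minus[OF continuous_on_subset[OF mol_prim_C1(3)[OF e] sub0]] by simp
    have cmu: "continuous_on {z. dist z z0 < r} mu"
      unfolding mu_def by (rule continuous_on_subset[OF mol_prim_C1(4)[OF e] sub0])
    have c\<phi>t: "continuous_on UNIV \<phi>t"
    proof -
      have "continuous_on {z. dist z z0 < r} (\<lambda>z. 2 * P z * (mF z + \<Phi>t z))"
        by (intro continuous_intros cP cmF continuous_on_subset[OF ct]) auto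
      then have "continuous_on {z. dist z z0 < r} \<phi>t" by (rule continuous_on_eq) (simp add: \<phi>t_def)
      moreover have "continuous_on {z. r / 2 < dist z z0} \<phi>t"
        by (rule continuous_on_eq[OF continuous_on_const[of _ 0]]) (simp add: \<phi>t_def P_out)
      ultimately show ?thesis using continuous_on_open_Un[OF opos] unfolding cover by blast
    qed
    have c\<phi>x: "continuous_on UNIV \<phi>x"
    proof -
      have "continuous_on {z. dist z z0 < r} (\<lambda>z. 2 * P z * (\<Phi>x z - mu z))"
        by (intro continuous_intros cP cmu continuous_on_subset[OF cx]) auto
      then have "continuous_on {z. dist z z0 < r} \<phi>x" by (rule continuous_on_eq) (simp add: \<phi>x_def)
      moreover have "continuous_on {z. r / 2 < dist z z0} \<phi>x"
        by (rule continuous_on_eq[OF continuous_on_const[of _ 0]]) (simp add: \<phi>x_def P_out)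
      ultimately show ?thesis using continuous_on_open_Un[OF opos] unfolding cover by blast
    qed
    have \<phi>_far: "\<phi> z = 0" if "r / 2 < dist z z0" for z using that P_out[of z] by (simp add: \<phi>_def)
    have \<phi>: "test_fun \<phi> \<phi>t \<phi>x"
      unfolding test_fun_def
    proof (intro conjI allI c\<phi>t c\<phi>x)
      show "0 \<le> \<phi> z" for z by (simp add: \<phi>_def)
      have "{z. \<phi> z \<noteq> 0} \<subseteq> ball z0 r" by (auto simp: \<phi>_def dist_commute split: if_splits)
      then show "bounded {z. \<phi> z \<noteq> 0}" by (rule bounded_subset[OF bounded_ball])
      show "((\<lambda>s. \<phi> (s, x)) has_real_derivative \<phi>t (t, x)) (at t)" for t x
      proof (cases "dist (t, x) z0 < r")
        case True
        then have t0: "0 < t" using pos[of "(t, x)"] by simp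
        have "((\<lambda>s. (max 0 (m + \<eta> - mol_prim (\<epsilon> n) (u s) x + \<Phi> s x))\<^sup>2) has_real_derivative
           (2 * max 0 (m + \<eta> - mol_prim (\<epsilon> n) (u t) x + \<Phi> t x)) * (mF (t, x) + \<Phi>t (t, x))) (at t)"
          by (rule DERIV_chain2[OF DERIV_pos_part_square])
             (auto intro!: derivative_eq_intros DERIV_mol_prim_time[OF t0 e] dt simp: mF_def)
        then have D: "((\<lambda>s. (P (s, x))\<^sup>2) has_real_derivative \<phi>t (t, x)) (at t)"
          using True unfolding \<phi>t_def P_def V_def by simp
        show ?thesis
        proof (rule has_field_derivative_transform_within_open[OF D])
          show "open {s. dist (s, x) z0 < r}" by (intro open_Collect_less continuous_intros)
        qed (use True in \<open>auto simp: \<phi>_def\<close>)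
      next
        case False
        then have r2: "r / 2 < dist (t, x) z0" using r by simp
        have "((\<lambda>s. \<phi> (s, x)) has_real_derivative 0) (at t)"
        proof (rule has_field_derivative_transform_within_open[OF DERIV_const[of 0]])
          show "open {s. r / 2 < dist (s, x) z0}" by (intro open_Collect_less continuous_intros)
        qed (use r2 \<phi>_far in auto)
        then show ?thesis using False by (simp add: \<phi>t_def)
      qed
      show "((\<lambda>y. \<phi> (t, y)) has_real_derivative \<phi>x (t, x)) (at x)" for t x
      proof (cases "dist (t, x) z0 < r")
        case True
        then have t0: "0 < t" using pos[of "(t, x)"] by simp
        have "((\<lambda>y. (max 0 (m + \<eta> - mol_prim (\<epsilon> n) (u t) y + \<Phi> t y))\<^sup>2) has_real_derivative
           (2 * max 0 (m + \<eta> - mol_prim (\<epsilon> n) (u t) x + \<Phi> t x)) * (\<Phi>x (t, x) - mu (t, x))) (at x)"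
          by (rule DERIV_chain2[OF DERIV_pos_part_square])
             (use t0 in \<open>auto intro!: derivative_eq_intros DERIV_mol_prim[OF integrable_u e] dx simp: mu_def\<close>)
        then have D: "((\<lambda>y. (P (t, y))\<^sup>2) has_real_derivative \<phi>x (t, x)) (at x)"
          using True unfolding \<phi>x_def P_def V_def by simp
        show ?thesis
        proof (rule has_field_derivative_transform_within_open[OF D])
          show "open {y. dist (t, y) z0 < r}" by (intro open_Collect_less continuous_intros)
        qed (use True in \<open>auto simp: \<phi>_def\<close>)
      next
        case False
        then have r2: "r / 2 < dist (t, x) z0" using r by simp
        have "((\<lambda>y. \<phi> (t, y)) has_real_derivative 0) (at x)"
        proof (rule has_field_derivative_transform_within_open[OF DERIV_const[of 0]])
          show "open {y. r / 2 < dist (t, y) z0}" by (intro open_Collect_less continuous_intros)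
        qed (use r2 \<phi>_far in auto)
        then show ?thesis using False by (simp add: \<phi>x_def)
      qed
    qed
    let ?E = "moll_error (\<epsilon> n)"
    have E_le: "\<bar>?E z\<bar> \<le> 2 * (L * K) + 2 * K" if "0 \<le> fst z" for z
      unfolding moll_error_def
      using abs_mol_u[OF that e, of "snd z"] abs_mol_Fu[OF that e, of "snd z"] abs_u[of "fst z" "snd z"] abs_Fu[of "fst z" "snd z"]
      by linarith
    show imE: "integrable lborel (\<lambda>z. ?E z * indicator (ball z0 r) z)"
    proof (rule integrable_bounded_support2[where R = "norm z0 + r" and B = "2 * (L * K) + 2 * K"])
      have nn: "0 \<le> 2 * (L * K) + 2 * K" using L0 K0 by simp
      show "\<bar>?E z * indicator (ball z0 r) z\<bar> \<le> 2 * (L * K) + 2 * K" for z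
        using E_le[of z] pos[of z] nn by (cases "z \<in> ball z0 r") (auto simp: dist_commute)
      show "?E z * indicator (ball z0 r) z = 0" if "norm z0 + r < norm z" for z
      proof -
        have "norm z \<le> norm z0 + dist z0 z" using norm_triangle_sub[of z z0] by (simp add: dist_norm norm_minus_commute)
        then have "z \<notin> ball z0 r" using that by auto
        then show ?thesis by simp
      qed
    qed (intro borel_measurable_times measurable_moll_error borel_measurable_indicator borel_open open_ball)
    define J where "J z = \<bar>u (fst z) (snd z) - k\<bar> * \<phi>t z + sgn (u (fst z) (snd z) - k) * (F (u (fst z) (snd z)) - F k) * \<phi>x z" for z
    have J_le: "indicator ({0..} \<times> UNIV) z *\<^sub>R J z \<le> C1 * (?E z * indicator (ball z0 r) z) - \<gamma> * \<eta> * w z" for z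
    proof (cases "dist z z0 < r")
      case False
      then have "z \<notin> ball z0 r" "z \<notin> ball z0 \<rho>" using \<rho>(1) by (auto simp: dist_commute)
      then show ?thesis using False by (simp add: J_def \<phi>t_def \<phi>x_def w_def)
    next
      case True
      define d where "d = u (fst z) (snd z) - k"
      define D where "D = sgn d * (F (u (fst z) (snd z)) - F k)"
      have DL: "\<bar>D\<bar> \<le> L1 * \<bar>d\<bar>"
        using L1[of "fst z" "snd z"] unfolding D_def d_def by (auto simp: abs_mult sgn_if)
      have dQ: "\<bar>d\<bar> \<le> Q" unfolding d_def by (rule uk)
      have L1d: "L1 * \<bar>d\<bar> \<le> \<bar>L1\<bar> * Q" using dQ by (intro mult_mono) auto
      define a1 where "a1 = mF z - F (u (fst z) (snd z))"
      define a2 where "a2 = mu z - u (fst z) (snd z)"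
      have Ez: "?E z = \<bar>a1\<bar> + \<bar>a2\<bar>" by (simp add: moll_error_def a1_def a2_def mF_def mu_def)
      have sd: "sgn d * d = \<bar>d\<bar>" by (simp add: sgn_if)
      \<comment> \<open>With this identity the terms that are products of the increments of u and
        F(u) cancel. Up to mollification errors there remains |d| times the residual of \<Phi> at
        the constant k, and \<open>sub\<close> makes that at most -\<gamma> |d|.\<close>
      have sF: "D * d = \<bar>d\<bar> * (F (u (fst z) (snd z)) - F k)"
        unfolding D_def using sd by (simp add: algebra_simps) (metis mult.assoc mult.commute)
      have "\<bar>d\<bar> * (mF z + \<Phi>t z) + D * (\<Phi>x z - mu z) = \<bar>d\<bar> * (\<Phi>t z + F k) + D * (\<Phi>x z - k) + (\<bar>d\<bar> * a1 - D * a2)"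
      proof -
        have "mF z = a1 + (F (u (fst z) (snd z)) - F k) + F k" "mu z = a2 + d + k" by (simp_all add: a1_def a2_def d_def)
        then show ?thesis using sF by (simp add: algebra_simps)
      qed
      also have "\<dots> \<le> \<bar>d\<bar> * (- \<gamma>) + (Q + \<bar>L1\<bar> * Q) * (\<bar>a1\<bar> + \<bar>a2\<bar>)"
      proof -
        have "D * (\<Phi>x z - k) \<le> L1 * \<bar>d\<bar> * \<bar>\<Phi>x z - k\<bar>"
        proof -
          have "D * (\<Phi>x z - k) \<le> \<bar>D\<bar> * \<bar>\<Phi>x z - k\<bar>" using abs_ge_self[of "D * (\<Phi>x z - k)"] by (simp add: abs_mult)
          also have "\<dots> \<le> L1 * \<bar>d\<bar> * \<bar>\<Phi>x z - k\<bar>" using DL by (intro mult_right_mono) auto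
          finally show ?thesis .
        qed
        then have "\<bar>d\<bar> * (\<Phi>t z + F k) + D * (\<Phi>x z - k) \<le> \<bar>d\<bar> * (\<Phi>t z + F k + L1 * \<bar>\<Phi>x z - k\<bar>)"
          by (simp add: algebra_simps)
        also have "\<dots> \<le> \<bar>d\<bar> * (- \<gamma>)" using sub[of z] True by (intro mult_left_mono) auto
        finally have 1: "\<bar>d\<bar> * (\<Phi>t z + F k) + D * (\<Phi>x z - k) \<le> \<bar>d\<bar> * (- \<gamma>)" .
        have "\<bar>d\<bar> * a1 \<le> Q * \<bar>a1\<bar>" using mult_mono[OF dQ abs_ge_self[of a1]] Q0 mult_mono[OF dQ order_refl[of "\<bar>a1\<bar>"]]
            mult_left_mono[OF abs_ge_self[of a1], of "\<bar>d\<bar>"] by simp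
        moreover have "- D * a2 \<le> (\<bar>L1\<bar> * Q) * \<bar>a2\<bar>"
        proof -
          have "- D * a2 \<le> \<bar>D\<bar> * \<bar>a2\<bar>" using abs_ge_minus_self[of "D * a2"] by (simp add: abs_mult)
          also have "\<dots> \<le> (\<bar>L1\<bar> * Q) * \<bar>a2\<bar>" using DL L1d by (intro mult_right_mono) auto
          finally show ?thesis .
        qed
        moreover have "0 \<le> Q * \<bar>a2\<bar>" "0 \<le> (\<bar>L1\<bar> * Q) * \<bar>a1\<bar>" using Q0 by auto
        ultimately have "\<bar>d\<bar> * a1 - D * a2 \<le> (Q + \<bar>L1\<bar> * Q) * (\<bar>a1\<bar> + \<bar>a2\<bar>)"
          by (simp add: distrib_left distrib_right)
        with 1 show ?thesis by linarith
      qed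
      finally have main: "\<bar>d\<bar> * (mF z + \<Phi>t z) + D * (\<Phi>x z - mu z) \<le> - (\<gamma> * \<bar>d\<bar>) + (Q + \<bar>L1\<bar> * Q) * ?E z"
        unfolding Ez by (simp add: mult.commute)
      have "J z = 2 * P z * (\<bar>d\<bar> * (mF z + \<Phi>t z) + D * (\<Phi>x z - mu z))"
        unfolding J_def \<phi>t_def \<phi>x_def using True by (simp add: D_def d_def algebra_simps)
      also have "\<dots> \<le> 2 * P z * (- (\<gamma> * \<bar>d\<bar>) + (Q + \<bar>L1\<bar> * Q) * ?E z)"
        using main P0[of z] by (intro mult_left_mono) auto
      also have "\<dots> = - (2 * P z * (\<gamma> * \<bar>d\<bar>)) + 2 * P z * ((Q + \<bar>L1\<bar> * Q) * ?E z)"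
        by (simp add: algebra_simps)
      also have "\<dots> \<le> - (\<gamma> * \<eta> * w z) + C1 * ?E z"
      proof (rule add_mono)
        have E0: "0 \<le> ?E z" by (simp add: moll_error_def)
        have "2 * P z * ((Q + \<bar>L1\<bar> * Q) * ?E z) \<le> (4 * \<eta>) * ((Q + \<bar>L1\<bar> * Q) * ?E z)"
          using P_le[of z] True E0 Q0 by (intro mult_right_mono) auto
        then show "2 * P z * ((Q + \<bar>L1\<bar> * Q) * ?E z) \<le> C1 * ?E z" by (simp add: C1_def mult.assoc)
        show "- (2 * P z * (\<gamma> * \<bar>d\<bar>)) \<le> - (\<gamma> * \<eta> * w z)"
        proof (cases "dist z z0 < \<rho>")
          case True
          then have "w z = \<bar>d\<bar>" by (simp add: w_def d_def dist_commute)
          moreover have "\<eta> * (\<gamma> * \<bar>d\<bar>) \<le> 2 * P z * (\<gamma> * \<bar>d\<bar>)" using P_ge[OF True] \<gamma> by (intro mult_right_mono) auto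
          ultimately show ?thesis by (simp add: mult_ac)
        next
          case False
          then have "w z = 0" by (simp add: w_def dist_commute)
          moreover have "0 \<le> 2 * P z * (\<gamma> * \<bar>d\<bar>)" using P0[of z] \<gamma> by simp
          ultimately show ?thesis by simp
        qed
      qed
      finally have "J z \<le> C1 * ?E z - \<gamma> * \<eta> * w z" by simp
      moreover have "z \<in> {0..} \<times> UNIV" using pos[of z] True by (auto simp: mem_Times_iff)
      ultimately show ?thesis using True by (simp add: dist_commute)
    qed
    have z0t: "\<phi> (0, x) = 0" for x
      using pos[of "(0, x)"] by (auto simp: \<phi>_def)
    have "0 \<le> (LINT z:({0..} \<times> UNIV)|lborel. J z)"
      using entropy[OF \<phi>, of k] unfolding J_def z0t by simp
    also have "\<dots> \<le> (LINT z|lborel. C1 * (?E z * indicator (ball z0 r) z) - \<gamma> * \<eta> * w z)"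
      unfolding set_lebesgue_integral_def
    proof (rule integral_mono)
      show "integrable lborel (\<lambda>z. indicator ({0..} \<times> UNIV) z *\<^sub>R J z)"
        using set_integral_add(1)[OF integrable_uF(3,4)[OF \<phi>]] unfolding J_def set_integrable_def .
    qed (use imE iw J_le in \<open>auto intro!: Bochner_Integration.integrable_diff integrable_mult_right\<close>)
    also have "\<dots> = C1 * (LINT z|lborel. ?E z * indicator (ball z0 r) z) - \<gamma> * \<eta> * integral\<^sup>L lborel w"
      using imE iw by (subst Bochner_Integration.integral_diff) (auto intro!: integrable_mult_right simp del: mult_eq_0_iff)
    finally show "\<gamma> * \<eta> * integral\<^sup>L lborel w \<le> C1 * (LINT z|lborel. ?E z * indicator (ball z0 r) z)" by simp
  qed
  have w0: "0 \<le> w z" for z by (simp add: w_def)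
  have le: "ennreal (\<gamma> * \<eta> * integral\<^sup>L lborel w) \<le> ennreal C1 * (\<integral>\<^sup>+z. ennreal (moll_error (\<epsilon> n) z) * indicator ({fst z0 - r..fst z0 + r} \<times> UNIV) z \<partial>lborel)" for n
  proof -
    have nn: "0 \<le> moll_error (\<epsilon> n) z * indicator (ball z0 r) z" for z by (simp add: moll_error_def)
    have "ennreal (\<gamma> * \<eta> * integral\<^sup>L lborel w) \<le> ennreal (C1 * (LINT z|lborel. moll_error (\<epsilon> n) z * indicator (ball z0 r) z))"
      by (rule ennreal_leI[OF key])
    also have "\<dots> = ennreal C1 * ennreal (LINT z|lborel. moll_error (\<epsilon> n) z * indicator (ball z0 r) z)"
      using C10 nn by (intro ennreal_mult Bochner_Integration.integral_nonneg)
    also have "ennreal (LINT z|lborel. moll_error (\<epsilon> n) z * indicator (ball z0 r) z) = (\<integral>\<^sup>+z. ennreal (moll_error (\<epsilon> n) z * indicator (ball z0 r) z) \<partial>lborel)"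
      by (rule nn_integral_eq_integral[OF imE, symmetric]) (use nn in auto)
    also have "\<dots> \<le> (\<integral>\<^sup>+z. ennreal (moll_error (\<epsilon> n) z) * indicator ({fst z0 - r..fst z0 + r} \<times> UNIV) z \<partial>lborel)"
    proof (rule nn_integral_mono)
      fix z
      show "ennreal (moll_error (\<epsilon> n) z * indicator (ball z0 r) z) \<le> ennreal (moll_error (\<epsilon> n) z) * indicator ({fst z0 - r..fst z0 + r} \<times> UNIV) z"
      proof (cases "z \<in> ball z0 r")
        case True
        then have "\<bar>fst z0 - fst z\<bar> < r" using dist_fst_le[of z0 z] by (simp add: dist_real_def)
        then have "z \<in> {fst z0 - r..fst z0 + r} \<times> UNIV" by (auto simp: mem_Times_iff)
        then show ?thesis using True by simp
      qed simp
    qed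
    finally show ?thesis by (simp add: mult_left_mono)
  qed
  \<comment> \<open>The mollification error tends to 0 while the left side of \<open>le\<close> is
    fixed, so the integral of \<open>w\<close> is zero.\<close>
  have lim: "(\<lambda>n. ennreal C1 * (\<integral>\<^sup>+z. ennreal (moll_error (\<epsilon> n) z) * indicator ({fst z0 - r..fst z0 + r} \<times> UNIV) z \<partial>lborel)) \<longlonglongrightarrow> ennreal C1 * 0"
  proof (intro ennreal_tendsto_cmult moll_error_tendsto e0 elim)
    have "dist (fst z0 - r, snd z0) z0 \<le> r" using r by (simp add: dist_prod_def dist_real_def)
    from pos[OF this] show "0 \<le> fst z0 - r" by simp
  qed simp
  have "ennreal (\<gamma> * \<eta> * integral\<^sup>L lborel w) \<le> ennreal C1 * 0"
    by (rule LIMSEQ_le_const[OF lim]) (use le in blast)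
  then have "\<gamma> * \<eta> * integral\<^sup>L lborel w \<le> 0" by (simp add: ennreal_eq_0_iff)
  then have "integral\<^sup>L lborel w \<le> 0" using \<gamma> r by (simp add: mult_le_0_iff)
  moreover have "0 \<le> integral\<^sup>L lborel w" using w0 by (intro Bochner_Integration.integral_nonneg)
  ultimately have "AE z in lborel. w z = 0"
    using integral_nonneg_eq_0_iff_AE[OF iw] w0 by auto
  then show ?thesis
    by (rule eventually_mono) (auto simp: w_def dist_commute indicator_def split: if_splits)
qed

end

context compact_sol begin

lemma mol_Fu_const:
  assumes t: "0 \<le> t" and e: "0 < \<epsilon>" and k: "AE y in lborel. x < y \<longrightarrow> y < x + \<epsilon> \<longrightarrow> u t y = k"
  shows "mol \<epsilon> (\<lambda>y. F (u t y)) x = F k"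
proof -
  have um: "u t \<in> borel_measurable borel" by (rule borel_section[OF meas])
  have Fm: "(\<lambda>y. F (u t y)) \<in> borel_measurable lborel"
    using measurable_compose[OF um measurable_F] by simp
  have km: "(\<lambda>y. hat ((x - y) / \<epsilon> + 1) / \<epsilon>) \<in> borel_measurable lborel" by measurable
  have "mol \<epsilon> (\<lambda>y. F (u t y)) x = (LINT y|lborel. hat ((x - y) / \<epsilon> + 1) / \<epsilon> * F k)"
    unfolding mol_def
  proof (rule integral_cong_AE)
    show "AE y in lborel. hat ((x - y) / \<epsilon> + 1) / \<epsilon> * F (u t y) = hat ((x - y) / \<epsilon> + 1) / \<epsilon> * F k"
      using k
    proof (rule eventually_mono)
      fix y assume "x < y \<longrightarrow> y < x + \<epsilon> \<longrightarrow> u t y = k"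
      then show "hat ((x - y) / \<epsilon> + 1) / \<epsilon> * F (u t y) = hat ((x - y) / \<epsilon> + 1) / \<epsilon> * F k"
        using kernel_eq_0[OF e, of y x] by (cases "x < y \<and> y < x + \<epsilon>") auto
    qed
  qed (intro borel_measurable_times km Fm borel_measurable_const)+
  also have "\<dots> = F k"
    using kernel_integral[OF e, of x] by (simp only: has_bochner_integral_iff Bochner_Integration.integral_mult_left_zero mult_1_left)
  finally show ?thesis .
qed

text \<open>If the inequality failed, \<open>touching_constant\<close> with k the slope of \<Phi>
  would make u equal to k near the point, so that U would change in time at the rate -F k. Since
  \<Phi> changes at a smaller rate, U - \<Phi> would be smaller at an earlier time, against
  minimality. In other words, U is a viscosity supersolution.\<close>

lemma no_touching:
  fixes \<Phi> :: "real \<Rightarrow> real \<Rightarrow> real"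
  assumes dt: "\<And>t x. ((\<lambda>s. \<Phi> s x) has_real_derivative \<Phi>t (t, x)) (at t)"
    and dx: "\<And>t x. ((\<lambda>y. \<Phi> t y) has_real_derivative \<Phi>x (t, x)) (at x)"
    and ct: "continuous_on UNIV \<Phi>t" and cx: "continuous_on UNIV \<Phi>x"
    and r: "0 < r" and pos: "\<And>z. dist z (t0, x0) \<le> r \<Longrightarrow> 0 < fst z"
    and low: "\<And>z. dist z (t0, x0) \<le> r \<Longrightarrow> U t0 x0 - \<Phi> t0 x0 + (dist z (t0, x0))\<^sup>2 \<le> U (fst z) (snd z) - \<Phi> (fst z) (snd z)"
  shows "0 \<le> \<Phi>t (t0, x0) + F (\<Phi>x (t0, x0))"
proof (rule ccontr)
  assume neg: "\<not> ?thesis"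
  define z0 where "z0 = (t0, x0)"
  define k where "k = \<Phi>x z0"
  define m where "m = U t0 x0 - \<Phi> t0 x0"
  define \<gamma> where "\<gamma> = - (\<Phi>t z0 + F k) / 2"
  have \<gamma>: "0 < \<gamma>" using neg by (simp add: \<gamma>_def k_def z0_def)
  have t0: "0 < t0" using pos[of "(t0, x0)"] r by simp
  define q where "q = max K \<bar>k\<bar>"
  obtain L2 where L2: "\<forall>p\<in>{-q..q}. \<forall>s\<in>{-q..q}. \<bar>F p - F s\<bar> \<le> L2 * \<bar>p - s\<bar>" using F_Lipschitz by blast
  define L1 where "L1 = \<bar>L2\<bar>"
  have L1: "\<bar>F (u t x) - F k\<bar> \<le> L1 * \<bar>u t x - k\<bar>" for t x
  proof -
    have "u t x \<in> {-q..q}" "k \<in> {-q..q}" using abs_u[of t x] unfolding q_def by auto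
    then have "\<bar>F (u t x) - F k\<bar> \<le> L2 * \<bar>u t x - k\<bar>" using L2 by blast
    also have "\<dots> \<le> L1 * \<bar>u t x - k\<bar>" unfolding L1_def by (intro mult_right_mono) auto
    finally show ?thesis .
  qed
  define G where "G z = \<Phi>t z + F k + L1 * \<bar>\<Phi>x z - k\<bar>" for z
  have cG: "continuous_on UNIV G" unfolding G_def by (intro continuous_intros ct cx)
  have "\<Phi>t z0 + F k = - 2 * \<gamma>" unfolding \<gamma>_def by simp
  then have G0: "z0 \<in> {z. G z < - \<gamma>}" using \<gamma> by (simp add: G_def k_def[symmetric])
  have oG: "open {z. G z < - \<gamma>}" by (intro open_Collect_less cG continuous_on_const)
  obtain r1 where r1: "0 < r1" "ball z0 r1 \<subseteq> {z. G z < - \<gamma>}"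
    using openE[OF oG G0] by blast
  define r2 where "r2 = min r (r1 / 2)"
  have r2: "0 < r2" "r2 \<le> r" "r2 < r1" using r r1 by (auto simp: r2_def)
  \<comment> \<open>Between the radii r2/2 and r2 the squared distance in \<open>low\<close> is at
    least a quarter of \<open>r2\<^sup>2\<close>, that is 2 \<eta>.\<close>
  define \<eta> where "\<eta> = r2\<^sup>2 / 8"
  have \<eta>: "0 < \<eta>" using r2 by (simp add: \<eta>_def)
  have c\<Phi>: "continuous_on UNIV (\<lambda>z. \<Phi> (fst z) (snd z))"
    by (rule C1_imp_continuous[OF open_UNIV dt dx ct cx])
  have cU: "continuous_on UNIV (\<lambda>z. U (max 0 (fst z)) (snd z))"
    by (rule Lipschitz2_continuous[where H = "\<lambda>t. U (max 0 t)", OF U_Lipschitz]) (intro continuous_intros)+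
  have oe: "open {z. U (max 0 (fst z)) (snd z) - \<Phi> (fst z) (snd z) < m + \<eta> / 4}"
    by (intro open_Collect_less continuous_intros cU c\<Phi>)
  have z0e: "z0 \<in> {z. U (max 0 (fst z)) (snd z) - \<Phi> (fst z) (snd z) < m + \<eta> / 4}"
    using \<eta> t0 by (simp add: z0_def m_def max_def)
  obtain \<rho>0 where \<rho>0: "0 < \<rho>0" "ball z0 \<rho>0 \<subseteq> {z. U (max 0 (fst z)) (snd z) - \<Phi> (fst z) (snd z) < m + \<eta> / 4}"
    using openE[OF oe z0e] by blast
  define \<rho> where "\<rho> = min \<rho>0 r2"
  have \<rho>: "0 < \<rho>" "\<rho> \<le> r2" using \<rho>0 r2 by (auto simp: \<rho>_def)
  have AEk: "AE z in lborel. dist z z0 < \<rho> \<longrightarrow> u (fst z) (snd z) = k"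
  proof (rule touching_constant[OF dt dx ct cx r2(1) \<eta>, where m = m and \<gamma> = \<gamma> and ?L1.0 = L1])
    fix z assume z: "dist z z0 \<le> r2"
    then have zr: "dist z (t0, x0) \<le> r" using r2 by (simp add: z0_def)
    show "0 < fst z" by (rule pos[OF zr])
    have "0 \<le> (dist z (t0, x0))\<^sup>2" by simp
    then show "m \<le> U (fst z) (snd z) - \<Phi> (fst z) (snd z)" using low[OF zr] unfolding m_def by linarith
    have "z \<in> ball z0 r1" using z r2 by (simp add: dist_commute)
    then have "G z < - \<gamma>" using r1(2) by blast
    then show "\<Phi>t z + F k + L1 * \<bar>\<Phi>x z - k\<bar> \<le> - \<gamma>" unfolding G_def by simp
  next
    fix z assume z: "r2 / 2 \<le> dist z z0" "dist z z0 \<le> r2"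
    then have zr: "dist z (t0, x0) \<le> r" using r2 by (simp add: z0_def)
    have "(r2 / 2)\<^sup>2 \<le> (dist z z0)\<^sup>2" using z r2 by (intro power_mono) auto
    then have "2 * \<eta> \<le> (dist z (t0, x0))\<^sup>2" by (simp add: \<eta>_def z0_def power_divide)
    then show "m + 2 * \<eta> \<le> U (fst z) (snd z) - \<Phi> (fst z) (snd z)" using low[OF zr] unfolding m_def by linarith
  next
    fix z assume z: "dist z z0 < \<rho>"
    then have "z \<in> ball z0 \<rho>0" by (simp add: \<rho>_def dist_commute)
    then have "U (max 0 (fst z)) (snd z) - \<Phi> (fst z) (snd z) < m + \<eta> / 4" using \<rho>0(2) by blast
    moreover have "0 < fst z" using pos[of z] z \<rho> r2 by (simp add: z0_def)
    ultimately show "U (fst z) (snd z) - \<Phi> (fst z) (snd z) \<le> m + \<eta> / 4" by (simp add: max_def)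
  qed (fact \<gamma> L1 \<rho>(2))+
  \<comment> \<open>Points less than 2 h away in each coordinate are still within \<rho>. The factor
    2 leaves room for times slightly after t0 in \<open>f_const\<close>.\<close>
  define h where "h = \<rho> / 4"
  have h: "0 < h" using \<rho> by (simp add: h_def)
  have near: "dist (s, y) z0 < \<rho>" if "\<bar>s - t0\<bar> < 2 * h" "\<bar>y - x0\<bar> < 2 * h" for s y
  proof -
    have "dist (s, y) z0 \<le> \<bar>s - t0\<bar> + \<bar>y - x0\<bar>"
      by (simp add: z0_def dist_Pair_Pair dist_real_def sqrt_sum_squares_le_sum_abs)
    then show ?thesis using that unfolding h_def by linarith
  qed
  have hpos: "0 < s" if "\<bar>s - t0\<bar> < 2 * h" for s
    using pos[of "(s, x0)"] near[OF that, of x0] h \<rho> r2 by (simp add: z0_def)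
  have AEt: "AE s in lborel. AE y in lborel. dist (s, y) z0 < \<rho> \<longrightarrow> u s y = k"
    using AE_lborel_sections[OF AEk] by simp
  \<comment> \<open>Constancy is known only at almost every time. The mollified flux is continuous
    in time, so it can be evaluated at good times shortly after s.\<close>
  have f_const: "mol \<epsilon> (\<lambda>y. F (u s y)) x0 = F k" if s: "s \<in> {t0 - h..t0}" and e: "0 < \<epsilon>" "\<epsilon> < h" for s \<epsilon>
  proof (rule ccontr)
    let ?f = "\<lambda>s. mol \<epsilon> (\<lambda>y. F (u s y)) x0"
    assume ne: "?f s \<noteq> F k"
    have s0: "0 < s" using hpos[of s] s h by auto
    have "continuous_on {0..} ?f" by (rule continuous_mol_Fu_time[OF e(1)]) simp
    then have "(?f \<longlongrightarrow> ?f s) (at s within {0..})" using s0 by (simp add: continuous_on_def)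
    then have "eventually (\<lambda>r. dist (?f r) (?f s) < \<bar>?f s - F k\<bar>) (at s within {0..})"
      by (rule tendstoD) (use ne in simp)
    then obtain d where d: "0 < d" "\<And>r. 0 \<le> r \<Longrightarrow> r \<noteq> s \<Longrightarrow> dist r s < d \<Longrightarrow> dist (?f r) (?f s) < \<bar>?f s - F k\<bar>"
      unfolding eventually_at by auto
    obtain s' where s': "s < s'" "s' < s + min d h" "AE y in lborel. dist (s', y) z0 < \<rho> \<longrightarrow> u s' y = k"
      using AE_Ioo_ex[OF AEt, of s "s + min d h"] d(1) h by auto
    have s'h: "\<bar>s' - t0\<bar> < 2 * h" using s' s by auto
    have "?f s' = F k"
    proof (rule mol_Fu_const)
      show "0 \<le> s'" using s' s0 by simp
      show "AE y in lborel. x0 < y \<longrightarrow> y < x0 + \<epsilon> \<longrightarrow> u s' y = k"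
        using s'(3)
      proof (rule eventually_mono, intro impI)
        fix y assume "dist (s', y) z0 < \<rho> \<longrightarrow> u s' y = k" "x0 < y" "y < x0 + \<epsilon>"
        then show "u s' y = k" using near[OF s'h, of y] e h by auto
      qed
    qed (rule e(1))
    moreover have "dist (?f s') (?f s) < \<bar>?f s - F k\<bar>" using d(2)[of s'] s' s0 by (simp add: dist_real_def)
    ultimately show False by (simp add: dist_real_def abs_minus_commute)
  qed
  have t0h: "0 \<le> t0 - h" using hpos[of "t0 - h"] h by simp
  have "\<bar>U t0 x0 - U (t0 - h) x0 + h * F k\<bar> \<le> 0"
  proof (rule le_if_le_eps[where C = "2 * K"])
    fix \<epsilon>' :: real assume e': "0 < \<epsilon>'"
    define \<epsilon> where "\<epsilon> = min \<epsilon>' (h / 2)"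
    have e: "0 < \<epsilon>" "\<epsilon> < h" "\<epsilon> \<le> \<epsilon>'" using e' h by (auto simp: \<epsilon>_def)
    have "integral {t0 - h..t0} (\<lambda>s. mol \<epsilon> (\<lambda>y. F (u s y)) x0) = integral {t0 - h..t0} (\<lambda>s. F k)"
      by (intro Henstock_Kurzweil_Integration.integral_cong f_const e)
    also have "\<dots> = h * F k" using h by simp
    finally have "mol_prim \<epsilon> (u t0) x0 - mol_prim \<epsilon> (u (t0 - h)) x0 = - (h * F k)"
      using mol_prim_increment[OF t0h _ e(1), of t0 x0] h by simp
    moreover have "\<bar>mol_prim \<epsilon> (u t0) x0 - U t0 x0\<bar> \<le> K * \<epsilon>" "\<bar>mol_prim \<epsilon> (u (t0 - h)) x0 - U (t0 - h) x0\<bar> \<le> K * \<epsilon>"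
      using t0 t0h e by (auto intro!: mol_prim_U)
    moreover have "K * \<epsilon> \<le> K * \<epsilon>'" using e K0 by (intro mult_left_mono) auto
    ultimately show "\<bar>U t0 x0 - U (t0 - h) x0 + h * F k\<bar> \<le> 0 + 2 * K * \<epsilon>'" by linarith
  qed
  then have Ueq: "U (t0 - h) x0 = U t0 x0 + h * F k" by simp
  obtain \<xi> where \<xi>: "t0 - h < \<xi>" "\<xi> < t0" "\<Phi> t0 x0 - \<Phi> (t0 - h) x0 = (t0 - (t0 - h)) * \<Phi>t (\<xi>, x0)"
    using MVT2[of "t0 - h" t0 "\<lambda>s. \<Phi> s x0" "\<lambda>s. \<Phi>t (s, x0)"] h dt by auto
  have "(\<xi>, x0) \<in> ball z0 r1" using near[of \<xi> x0] \<xi> h \<rho> r2 by (simp add: dist_commute)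
  then have "G (\<xi>, x0) < - \<gamma>" using r1(2) by blast
  moreover have "0 \<le> L1 * \<bar>\<Phi>x (\<xi>, x0) - k\<bar>" by (simp add: L1_def)
  ultimately have "\<Phi>t (\<xi>, x0) + F k < 0" using \<gamma> unfolding G_def by linarith
  then have "h * (\<Phi>t (\<xi>, x0) + F k) < 0" using h by (simp add: mult_pos_neg)
  moreover have "U (t0 - h) x0 - \<Phi> (t0 - h) x0 = m + h * (\<Phi>t (\<xi>, x0) + F k)"
    using Ueq \<xi>(3) by (simp add: m_def algebra_simps)
  moreover have "m \<le> U (t0 - h) x0 - \<Phi> (t0 - h) x0"
  proof -
    have "dist (t0 - h, x0) (t0, x0) \<le> r" using near[of "t0 - h" x0] h \<rho> r2 by (simp add: z0_def)
    from low[OF this] show ?thesis using zero_le_power2[of "dist (t0 - h, x0) (t0, x0)"] unfolding m_def fst_conv snd_conv by linarith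
  qed
  ultimately show False by linarith
qed

text \<open>If the Hopf-Lax function exceeded the bound at (t, x), a smoothed and penalized copy of
  it would, up to a constant, touch U from below at an interior point of a space-time box: on the
  sides both functions are the same constant, at time 0 the data are ordered, and a penalty excludes
  the final time. The term \<epsilon> s makes the subsolution strict, which contradicts
  \<open>no_touching\<close>.\<close>

lemma comparison:
  assumes hl: "hopf_lax g g' a' b' A0" and ab': "0 \<in> {a'..b'}" and g0: "g 0 = 0"
    and Fg: "\<And>p. p \<in> {a'..b'} \<Longrightarrow> F p \<le> g p + \<eta>" and \<eta>: "0 \<le> \<eta>" and \<kappa>: "0 \<le> \<kappa>"
    and A0: "\<And>x. A0 x \<le> U0 x + \<kappa>"
    and left: "\<And>x. x \<le> - Y \<Longrightarrow> A0 x = 0" and right: "\<And>x. Y \<le> x \<Longrightarrow> A0 x = (LINT y|lborel. u0 y)"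
    and t: "0 \<le> t"
  shows "hopf_lax.HL g g' a' b' A0 t x \<le> U t x + \<kappa> + \<eta> * t"
proof -
  interpret H: hopf_lax g g' a' b' A0 by (rule hl)
  obtain C where C: "\<And>t s x y. \<bar>H.HL t x - H.HL s y\<bar> \<le> C * (\<bar>t - s\<bar> + \<bar>x - y\<bar>)"
    using H.HL_Lipschitz by blast
  have C0: "0 \<le> C" using C[of 1 0 0 0] by simp
  have "bounded (g' ` {a'..b'})"
    by (intro compact_imp_bounded compact_continuous_image continuous_on_subset[OF H.cont_g']) auto
  then obtain G where G: "\<forall>k\<in>{a'..b'}. \<bar>g' k\<bar> \<le> G" unfolding bounded_iff by auto
  have G0: "0 \<le> G" using G ab' by force
  \<comment> \<open>One unit of extra time: the penalty N (max 0 (s - t))^2 vanishes up to t and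
    reaches N, a bound for the excess of the Hopf-Lax function over \<open>U\<close>, at the final
    time.\<close>
  define T1 where "T1 = t + 1"
  have T1: "0 < T1" "t < T1" using t by (auto simp: T1_def)
  define Z where "Z = max (max (X T1) (\<bar>Y\<bar> + T1 * G)) (\<bar>x\<bar> + 1)"
  have Z: "X T1 \<le> Z" "\<bar>Y\<bar> + T1 * G \<le> Z" "\<bar>x\<bar> < Z" by (auto simp: Z_def)
  have Z0: "0 < Z" using Z(3) by linarith
  have far: "H.HL s y = U s y" if s: "0 \<le> s" "s \<le> T1" and y: "\<bar>y\<bar> = Z" for s y
  proof -
    have sg: "\<bar>s * g' k\<bar> \<le> T1 * G" if "k \<in> {a'..b'}" for k
      unfolding abs_mult using G that s by (intro mult_mono) auto
    have Xs: "X s \<le> Z" using X_mono[OF s(2)] Z by simp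
    show ?thesis
    proof (cases "0 \<le> y")
      case True
      then have yZ: "y = Z" using y by simp
      have "H.HL s y = (LINT y|lborel. u0 y)"
      proof (rule H.HL_const[OF ab' g0 s(1)])
        fix k assume "k \<in> {a'..b'}"
        then have "Y \<le> y - s * g' k" using sg[of k] Z yZ by linarith
        then show "A0 (y - s * g' k) = (LINT y|lborel. u0 y)" by (rule right)
      qed
      moreover have "U s y = (LINT y|lborel. u0 y)"
        using U_far[OF s(1), of y] U0_right[of y] R_le_X[OF s(1)] Xs yZ by simp
      ultimately show ?thesis by simp
    next
      case False
      then have yZ: "y = - Z" using y by simp
      have "H.HL s y = 0"
      proof (rule H.HL_const[OF ab' g0 s(1)])
        fix k assume "k \<in> {a'..b'}"
        then have "y - s * g' k \<le> - Y" using sg[of k] Z yZ by linarith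
        then show "A0 (y - s * g' k) = 0" by (rule left)
      qed
      moreover have "U s y = 0" using U_left[OF s(1), of y] Xs yZ by simp
      ultimately show ?thesis by simp
    qed
  qed
  have cU: "continuous_on A (\<lambda>z. U (max 0 (fst z)) (snd z))" for A
    by (rule Lipschitz2_continuous[where H = "\<lambda>t. U (max 0 t)", OF U_Lipschitz]) (intro continuous_intros)+
  have cH: "continuous_on A (\<lambda>z. H.HL (fst z) (snd z))" for A
    by (rule Lipschitz2_continuous[where H = H.HL, OF C]) (intro continuous_intros)+
  have "bounded ((\<lambda>z. H.HL (fst z) (snd z) - U (max 0 (fst z)) (snd z)) ` ({0..T1} \<times> {-Z..Z}))"
    by (intro compact_imp_bounded compact_continuous_image continuous_intros cU cH compact_Times compact_Icc)
  then obtain N where N': "\<forall>z\<in>{0..T1} \<times> {-Z..Z}. \<bar>H.HL (fst z) (snd z) - U (max 0 (fst z)) (snd z)\<bar> \<le> N"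
    unfolding bounded_iff by auto
  have N: "H.HL s y - U s y \<le> N" if "0 \<le> s" "s \<le> T1" "- Z \<le> y" "y \<le> Z" for s y
    using N'[rule_format, of "(s, y)"] that by (simp add: max_def abs_le_iff)
  have N0: "0 \<le> N" using N'[rule_format, of "(0, 0)"] T1 Z0 abs_ge_zero order_trans by (force simp del: abs_le_iff)
  show ?thesis
  proof (rule le_if_le_eps[where C = "t + 4 * C"])
    fix \<epsilon> :: real assume e: "0 < \<epsilon>"
    obtain \<Phi> \<Phi>t \<Phi>x where
      dt: "\<And>t x. ((\<lambda>s. \<Phi> s x) has_real_derivative \<Phi>t (t, x)) (at t)" and
      dx: "\<And>t x. ((\<lambda>y. \<Phi> t y) has_real_derivative \<Phi>x (t, x)) (at x)" and
      ct: "continuous_on UNIV \<Phi>t" and cx: "continuous_on UNIV \<Phi>x" and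
      slope: "\<And>t x. \<Phi>x (t, x) \<in> {a'..b'}" and
      close: "\<And>t x. \<bar>\<Phi> t x - H.HL t x\<bar> \<le> 2 * C * \<epsilon>" and
      pde: "\<And>t x. 0 \<le> t \<Longrightarrow> \<Phi>t (t, x) + g (\<Phi>x (t, x)) \<le> 0"
    proof (rule Steklov_average[where H = H.HL and C = C and a = a' and b = b' and g' = g' and g = g and \<epsilon> = \<epsilon>])
      show "H.HL (t + h) (x + h * g' k) \<le> H.HL t x + h * (k * g' k - g k)"
        if "0 \<le> t" "0 \<le> h" "k \<in> {a'..b'}" for t h x k
        using H.HL_dynamic[OF that, of x] by (simp add: H.legendre_def)
    qed (use C H.HL_slope e that in auto)
    \<comment> \<open>The correction terms account for the error of the data, the error of the flux
      together with the strictness margin \<epsilon>, the smoothing, and the final time.\<close>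
    define ee where "ee s y = U (max 0 s) y - \<Phi> s y + \<kappa> + (\<eta> + \<epsilon>) * s + 2 * C * \<epsilon> + N * (max 0 (s - t))\<^sup>2" for s y
    have "0 \<le> ee t x"
    proof (rule ccontr)
      assume neg: "\<not> 0 \<le> ee t x"
      define Bx where "Bx = {0..T1} \<times> {-Z..Z}"
      have ce: "continuous_on Bx (\<lambda>z. ee (fst z) (snd z))"
        unfolding ee_def by (intro continuous_intros cU C1_imp_continuous[OF open_UNIV dt dx ct cx, THEN continuous_on_subset]) auto
      have "compact Bx" "Bx \<noteq> {}" unfolding Bx_def using T1 Z0 by (auto intro!: compact_Times)
      then obtain z0 where z0: "z0 \<in> Bx" "\<And>z. z \<in> Bx \<Longrightarrow> ee (fst z0) (snd z0) \<le> ee (fst z) (snd z)"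
        using continuous_attains_inf[OF _ _ ce] by blast
      obtain s0 y0 where sy: "z0 = (s0, y0)" by (cases z0)
      have "(t, x) \<in> Bx" unfolding Bx_def using t T1 Z by auto
      then have m: "ee s0 y0 < 0" using z0(2)[of "(t, x)"] neg sy by simp
      have b0: "0 \<le> s0" "s0 \<le> T1" "- Z \<le> y0" "y0 \<le> Z" using z0(1) sy by (auto simp: Bx_def)
      have pen: "0 \<le> N * (max 0 (s0 - t))\<^sup>2" "0 \<le> (\<eta> + \<epsilon>) * s0" using N0 b0 \<eta> e by auto
      have cl: "\<Phi> s0 y0 \<le> H.HL s0 y0 + 2 * C * \<epsilon>" using close[of s0 y0] by (simp add: abs_le_iff)
      have em: "ee s0 y0 = U s0 y0 - \<Phi> s0 y0 + \<kappa> + (\<eta> + \<epsilon>) * s0 + 2 * C * \<epsilon> + N * (max 0 (s0 - t))\<^sup>2"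
        using b0 by (simp add: ee_def max_def)
      have 1: "s0 \<noteq> 0"
      proof
        assume "s0 = 0"
        then have "H.HL s0 y0 \<le> U s0 y0 + \<kappa>" using A0[of y0] by (simp add: H.HL_0 U_init)
        then show False using m em pen cl by linarith
      qed
      have 2: "s0 \<noteq> T1"
      proof
        assume *: "s0 = T1"
        then have "N * (max 0 (s0 - t))\<^sup>2 = N" by (simp add: T1_def)
        then show False using m em pen cl N[OF b0] \<kappa> by linarith
      qed
      have 3: "\<bar>y0\<bar> \<noteq> Z"
      proof
        assume "\<bar>y0\<bar> = Z"
        then have "H.HL s0 y0 = U s0 y0" using far b0 by simp
        then show False using m em pen cl \<kappa> by linarith
      qed
      define O1 where "O1 = {0<..<T1} \<times> {-Z<..<Z}"
      have "open O1" unfolding O1_def by (intro open_Times) auto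
      moreover have "z0 \<in> O1" using b0 1 2 3 by (auto simp: sy O1_def)
      ultimately obtain r where r: "0 < r" "cball z0 r \<subseteq> O1" by (auto simp: open_contains_cball)
      \<comment> \<open>Subtracting the squared distance turns a minimum of \<open>ee\<close> into
        the strict touching required by \<open>no_touching\<close>. The subtracted term and its
        derivatives vanish at the point.\<close>
      define \<Psi> where "\<Psi> s y = \<Phi> s y - \<kappa> - (\<eta> + \<epsilon>) * s - 2 * C * \<epsilon> - N * (max 0 (s - t))\<^sup>2 - ((s - s0)\<^sup>2 + (y - y0)\<^sup>2)" for s y
      define \<Psi>t where "\<Psi>t z = \<Phi>t z - (\<eta> + \<epsilon>) - N * (2 * max 0 (fst z - t)) - 2 * (fst z - s0)" for z
      define \<Psi>x where "\<Psi>x z = \<Phi>x z - 2 * (snd z - y0)" for z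
      have "0 \<le> \<Psi>t (s0, y0) + F (\<Psi>x (s0, y0))"
      proof (rule no_touching[where \<Phi> = \<Psi> and r = r])
        show "((\<lambda>s. \<Psi> s y) has_real_derivative \<Psi>t (s, y)) (at s)" for s y
        proof -
          have D: "((\<lambda>s. (max 0 (s - t))\<^sup>2) has_real_derivative 2 * max 0 (s - t) * 1) (at s)"
            by (rule DERIV_chain2[OF DERIV_pos_part_square]) (auto intro!: derivative_eq_intros)
          have "((\<lambda>s. \<Phi> s y - \<kappa> - (\<eta> + \<epsilon>) * s - 2 * C * \<epsilon> - N * p s - ((s - s0)\<^sup>2 + (y - y0)\<^sup>2)) has_real_derivative
              \<Phi>t (s, y) - (\<eta> + \<epsilon>) - N * (2 * max 0 (s - t)) - 2 * (s - s0)) (at s)"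
            if "(p has_real_derivative 2 * max 0 (s - t) * 1) (at s)" for p
            by (auto intro!: derivative_eq_intros dt that)
          from this[OF D] show ?thesis unfolding \<Psi>_def \<Psi>t_def fst_conv .
        qed
        show "((\<lambda>y. \<Psi> s y) has_real_derivative \<Psi>x (s, y)) (at y)" for s y
          unfolding \<Psi>_def \<Psi>x_def by (auto intro!: derivative_eq_intros dx)
        show "continuous_on UNIV \<Psi>t" unfolding \<Psi>t_def by (intro continuous_intros ct)
        show "continuous_on UNIV \<Psi>x" unfolding \<Psi>x_def by (intro continuous_intros cx)
        show "0 < r" by (rule r)
        fix z assume z: "dist z (s0, y0) \<le> r"
        then have zO: "z \<in> O1" using r(2) by (auto simp: sy dist_commute)
        then show z1: "0 < fst z" by (auto simp: O1_def)
        have "z \<in> Bx" using zO by (auto simp: O1_def Bx_def)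
        then have "ee s0 y0 \<le> ee (fst z) (snd z)" using z0(2) sy by simp
        moreover have "(dist z (s0, y0))\<^sup>2 = (fst z - s0)\<^sup>2 + (snd z - y0)\<^sup>2"
          by (cases z) (simp add: dist_Pair_Pair dist_real_def)
        moreover have "U s y - \<Psi> s y = ee s y + ((s - s0)\<^sup>2 + (y - y0)\<^sup>2)" if "0 \<le> s" for s y
          using that by (simp add: ee_def \<Psi>_def max_def)
        ultimately show "U s0 y0 - \<Psi> s0 y0 + (dist z (s0, y0))\<^sup>2 \<le> U (fst z) (snd z) - \<Psi> (fst z) (snd z)"
          using z1 b0 by simp
      qed
      moreover have "F (\<Phi>x (s0, y0)) \<le> g (\<Phi>x (s0, y0)) + \<eta>" by (rule Fg[OF slope])
      moreover have "\<Phi>t (s0, y0) + g (\<Phi>x (s0, y0)) \<le> 0" by (rule pde[OF b0(1)])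
      moreover have "0 \<le> N * (2 * max 0 (s0 - t))" using N0 by simp
      ultimately show False using e unfolding \<Psi>t_def \<Psi>x_def by simp
    qed
    moreover have "H.HL t x \<le> \<Phi> t x + 2 * C * \<epsilon>" using close[of t x] by (simp add: abs_le_iff)
    moreover have "ee t x = U t x - \<Phi> t x + \<kappa> + (\<eta> + \<epsilon>) * t + 2 * C * \<epsilon>"
      using t by (simp add: ee_def max_def)
    ultimately show "H.HL t x \<le> U t x + \<kappa> + \<eta> * t + (t + 4 * C) * \<epsilon>"
      by (simp add: algebra_simps)
  qed
qed

end

section \<open>Spreading of characteristics\<close>

context hopf_lax begin

text \<open>The derivative in k of the minimized expression is \<open>t * g'' k\<close> times the
  difference between k and the slope of the datum at the foot. That slope lies in [a, b], so at an
  end of the interval a nonzero derivative would point inwards; minimizers at the ends satisfy the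
  first-order condition too.\<close>

lemma HL_minimizer:
  assumes A0: "\<And>x. (A0 has_real_derivative w0 x) (at x)" and w0: "\<And>x. a \<le> w0 x \<and> w0 x \<le> b"
    and g'': "\<And>k. (g' has_real_derivative g'' k) (at k)" "\<And>k. 0 < g'' k" and t: "0 < t"
  obtains k where "k \<in> {a..b}" "HL t x = A0 (x - t * g' k) + t * legendre k" "k = w0 (x - t * g' k)"
proof -
  obtain k where k: "k \<in> {a..b}" "HL t x = A0 (x - t * g' k) + t * legendre k" using HL_attained by blast
  define f where "f m = A0 (x - t * g' m) + t * legendre m" for m
  define f' where "f' m = t * g'' m * (m - w0 (x - t * g' m))" for m
  have D: "(f has_real_derivative f' m) (at m)" for m
  proof -
    have 1: "((\<lambda>m. A0 (x - t * g' m)) has_real_derivative w0 (x - t * g' m) * (- (t * g'' m))) (at m)"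
      by (rule DERIV_chain2[OF A0]) (auto intro!: derivative_eq_intros g'')
    have 2: "((\<lambda>m. t * legendre m) has_real_derivative t * (m * g'' m)) (at m)"
      unfolding legendre_def by (auto intro!: derivative_eq_intros g'' DERIV_g)
    show ?thesis unfolding f_def
      by (rule DERIV_cong[OF DERIV_add[OF 1 2]]) (simp add: f'_def algebra_simps)
  qed
  have min: "f k \<le> f m" if "m \<in> {a..b}" for m
    using HL_le[OF that, of t x] k(2) by (simp add: f_def)
  have tg: "0 < t * g'' k" using t g''(2) by simp
  have "k = w0 (x - t * g' k)"
  proof (rule ccontr)
    assume ne: "k \<noteq> w0 (x - t * g' k)"
    show False
    proof (cases "k < w0 (x - t * g' k)")
      case True
      then have "f' k < 0" using tg unfolding f'_def by (simp add: mult_pos_neg)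
      then obtain d where d: "0 < d" "\<And>h. 0 < h \<Longrightarrow> h < d \<Longrightarrow> f (k + h) < f k"
        using DERIV_neg_dec_right[OF D] by blast
      have kb: "k < b" using True w0[of "x - t * g' k"] by linarith
      define h where "h = min (d / 2) (b - k)"
      have "0 < h" "h < d" "k + h \<in> {a..b}" using d kb k(1) by (auto simp: h_def min_def)
      then show False using d(2)[of h] min[of "k + h"] by simp
    next
      case False
      then have "0 < f' k" using tg ne unfolding f'_def by simp
      then obtain d where d: "0 < d" "\<And>h. 0 < h \<Longrightarrow> h < d \<Longrightarrow> f (k - h) < f k"
        using DERIV_pos_inc_left[OF D] by blast
      have ka: "a < k" using False ne w0[of "x - t * g' k"] by linarith
      define h where "h = min (d / 2) (k - a)"
      have "0 < h" "h < d" "k - h \<in> {a..b}" using d ka k(1) by (auto simp: h_def min_def)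
      then show False using d(2)[of h] min[of "k - h"] by simp
    qed
  qed
  with k show thesis by (rule that)
qed

lemma strict_tangent:
  assumes s: "\<And>k m. k < m \<Longrightarrow> g' k < g' m" and "k \<noteq> m"
  shows "m * g' k - g m < legendre k"
proof -
  have "g k + g' k * (m - k) < g m"
  proof (cases m k rule: linorder_cases)
    case less
    obtain z where z: "m < z" "z < k" "g k - g m = (k - m) * g' z"
      using MVT2[OF less, of g g'] DERIV_g by blast
    have "(k - m) * g' z < (k - m) * g' k" using z s[of z k] by (intro mult_strict_left_mono) auto
    then show ?thesis using z(3) by (simp add: algebra_simps)
  next
    case greater
    obtain z where z: "k < z" "z < m" "g m - g k = (m - k) * g' z"
      using MVT2[OF greater, of g g'] DERIV_g by blast
    have "(m - k) * g' k < (m - k) * g' z" using z s[of k z] by (intro mult_strict_left_mono) auto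
    then show ?thesis using z(3) by (simp add: algebra_simps)
  qed (use assms in simp)
  then show ?thesis by (simp add: legendre_def algebra_simps)
qed

text \<open>If two minimizing lines crossed, exchanging their feet would give competitors whose
  speeds lie between the old ones; the intermediate value theorem supplies their parameters m and n.
  Strict convexity makes the total cost of the exchanged pair strictly smaller.\<close>

lemma minimizers_do_not_cross:
  assumes s: "\<And>k m. k < m \<Longrightarrow> g' k < g' m" and t: "0 < t" and x: "x1 < x2"
    and k1: "k1 \<in> {a..b}" "HL t x1 = A0 (x1 - t * g' k1) + t * legendre k1"
    and k2: "k2 \<in> {a..b}" "HL t x2 = A0 (x2 - t * g' k2) + t * legendre k2"
  shows "x1 - t * g' k1 \<le> x2 - t * g' k2"
proof (rule ccontr)
  define y1 where "y1 = x1 - t * g' k1"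
  define y2 where "y2 = x2 - t * g' k2"
  assume "\<not> ?thesis"
  then have y: "y2 < y1" by (simp add: y1_def y2_def)
  have g12: "t * g' k1 < t * g' k2" using y x by (simp add: y1_def y2_def)
  then have "g' k1 < g' k2" using t by simp
  then have k12: "k1 < k2" using mono_g'[of k2 k1] by (meson leD not_le_imp_less)
  have ivt: "\<exists>m. k1 \<le> m \<and> m \<le> k2 \<and> t * g' m = v" if "t * g' k1 \<le> v" "v \<le> t * g' k2" for v
  proof -
    have "continuous_on {k1..k2} (\<lambda>m. t * g' m)"
      by (intro continuous_intros continuous_on_subset[OF cont_g']) auto
    then show ?thesis using IVT'[of "\<lambda>m. t * g' m" k1 v k2] that k12 by auto
  qed
  obtain m where m: "k1 \<le> m" "m \<le> k2" "t * g' m = x1 - y2" using ivt[of "x1 - y2"] x y by (auto simp: y1_def y2_def)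
  obtain n where n: "k1 \<le> n" "n \<le> k2" "t * g' n = x2 - y1" using ivt[of "x2 - y1"] x y by (auto simp: y1_def y2_def)
  have mn: "m \<in> {a..b}" "n \<in> {a..b}" using m n k1 k2 by auto
  have tk1: "t * g' k1 = x1 - y1" and tk2: "t * g' k2 = x2 - y2" by (simp_all add: y1_def y2_def)
  have "HL t x1 \<le> A0 y2 + t * legendre m" using HL_le[OF mn(1), of t x1] m(3) by simp
  moreover have "HL t x2 \<le> A0 y1 + t * legendre n" using HL_le[OF mn(2), of t x2] n(3) by simp
  ultimately have le: "t * legendre k1 + t * legendre k2 \<le> t * legendre m + t * legendre n"
    using k1(2) k2(2) by (simp add: y1_def[symmetric] y2_def[symmetric])
  have tl: "t * legendre j = j * (t * g' j) - t * g j" for j by (simp add: legendre_def algebra_simps)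
  have strict: "i * (t * g' j) - t * g i < t * legendre j" if "j \<noteq> i" for i j
  proof -
    have "t * (i * g' j - g i) < t * legendre j" using strict_tangent[OF s that] t by (intro mult_strict_left_mono) auto
    then show ?thesis by (simp add: algebra_simps)
  qed
  have ne: "k1 \<noteq> m" "k2 \<noteq> n" "k1 \<noteq> n" "k2 \<noteq> m"
    using m(3) n(3) tk1 tk2 x y by auto
  show False
  \<comment> \<open>The order of m and n decides which of them supports the conjugate at which old
    speed, so that the remaining product, (n - m)(y1 - y2) or (m - n)(x2 - x1), is
    nonnegative.\<close>
  proof (cases "m \<le> n")
    case True
    have "m * (x1 - y1) - t * g m < t * legendre k1" using strict[OF ne(1)] tk1 by simp
    moreover have "n * (x2 - y2) - t * g n < t * legendre k2" using strict[OF ne(2)] tk2 by simp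
    moreover have "t * legendre m = m * (x1 - y2) - t * g m" "t * legendre n = n * (x2 - y1) - t * g n"
      using tl m(3) n(3) by simp_all
    moreover have "0 \<le> (n - m) * (y1 - y2)" using True y by simp
    ultimately show False using le by (simp add: algebra_simps)
  next
    case False
    have "n * (x1 - y1) - t * g n < t * legendre k1" using strict[OF ne(3)] tk1 by simp
    moreover have "m * (x2 - y2) - t * g m < t * legendre k2" using strict[OF ne(4)] tk2 by simp
    moreover have "t * legendre m = m * (x1 - y2) - t * g m" "t * legendre n = n * (x2 - y1) - t * g n"
      using tl m(3) n(3) by simp_all
    moreover have "0 \<le> (m - n) * (x2 - x1)" using False x by simp
    ultimately show False using le by (simp add: algebra_simps)
  qed
qed

text \<open>By definition x2 - x1 = (y2 - y1) + t (g'(k2) - g'(k1)), and each k is the slope of the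
  datum at its foot. The feet are ordered because minimizers do not cross, so the one-sided bound on
  \<open>w0\<close> limits the second term by a multiple of y2 - y1.\<close>

lemma expansive_foot:
  assumes A0: "\<And>x. (A0 has_real_derivative w0 x) (at x)" and w0: "\<And>x. a \<le> w0 x \<and> w0 x \<le> b"
    and g'': "\<And>k. (g' has_real_derivative g'' k) (at k)" "\<And>k. 0 < g'' k" and t: "0 \<le> t"
    and osl: "\<And>x y. x \<le> y \<Longrightarrow> w0 y - w0 x \<le> c * (y - x)" and c: "0 \<le> c"
    and \<Lambda>: "\<And>k m. k \<in> {a..b} \<Longrightarrow> m \<in> {a..b} \<Longrightarrow> k \<le> m \<Longrightarrow> g' m - g' k \<le> \<Lambda> * (m - k)" "0 \<le> \<Lambda>"
  obtains y k where "\<And>x. k x \<in> {a..b}" "\<And>x. y x = x - t * g' (k x)"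
    "\<And>x. HL t x = A0 (y x) + t * legendre (k x)"
    "\<And>x1 x2. x1 < x2 \<Longrightarrow> x2 - x1 \<le> (1 + t * \<Lambda> * c) * (y x2 - y x1)"
proof (cases "t = 0")
  case True
  show thesis
    by (rule that[of "\<lambda>_. a" "\<lambda>x. x"]) (use ab True in \<open>auto simp: HL_0\<close>)
next
  case False
  then have t: "0 < t" using t by simp
  have "\<forall>x. \<exists>k. k \<in> {a..b} \<and> HL t x = A0 (x - t * g' k) + t * legendre k \<and> k = w0 (x - t * g' k)"
    using HL_minimizer[OF A0 w0 g'' t] by metis
  then obtain k where k: "\<And>x. k x \<in> {a..b}" "\<And>x. HL t x = A0 (x - t * g' (k x)) + t * legendre (k x)"
      "\<And>x. k x = w0 (x - t * g' (k x))"
    by metis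
  have s: "g' p < g' q" if "p < q" for p q
    by (rule DERIV_pos_imp_increasing[OF that]) (use g'' in blast)
  show thesis
  proof (rule that[of k "\<lambda>x. x - t * g' (k x)"])
    fix x1 x2 :: real assume x: "x1 < x2"
    define y1 where "y1 = x1 - t * g' (k x1)"
    define y2 where "y2 = x2 - t * g' (k x2)"
    have y: "y1 \<le> y2"
      unfolding y1_def y2_def by (rule minimizers_do_not_cross[OF s t x k(1) k(2) k(1) k(2)])
    have gk: "g' (k x2) - g' (k x1) \<le> \<Lambda> * (c * (y2 - y1))"
    proof (cases "k x1 \<le> k x2")
      case True
      have "g' (k x2) - g' (k x1) \<le> \<Lambda> * (k x2 - k x1)" by (rule \<Lambda>(1)[OF k(1) k(1) True])
      also have "\<dots> \<le> \<Lambda> * (c * (y2 - y1))"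
        using osl[OF y] k(3)[of x1] k(3)[of x2] \<Lambda>(2) by (intro mult_left_mono) (auto simp: y1_def y2_def)
      finally show ?thesis .
    next
      case False
      then have "g' (k x2) \<le> g' (k x1)" by (intro mono_g') auto
      moreover have "0 \<le> \<Lambda> * (c * (y2 - y1))" using \<Lambda>(2) c y by simp
      ultimately show ?thesis by linarith
    qed
    have "t * (g' (k x2) - g' (k x1)) \<le> t * (\<Lambda> * (c * (y2 - y1)))" using gk t by (intro mult_left_mono) auto
    moreover have "x2 - x1 = (y2 - y1) + t * (g' (k x2) - g' (k x1))"
      by (simp add: y1_def y2_def algebra_simps)
    ultimately have "x2 - x1 \<le> (y2 - y1) + t * (\<Lambda> * (c * (y2 - y1)))" by linarith
    also have "\<dots> = (1 + t * \<Lambda> * c) * (y2 - y1)" by (simp add: algebra_simps)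
    finally show "x2 - x1 \<le> (1 + t * \<Lambda> * c) * ((x2 - t * g' (k x2)) - (x1 - t * g' (k x1)))"
      by (simp add: y1_def y2_def)
  qed (use k in auto)
qed

end

text \<open>A change of variables inequality for an expanding, possibly discontinuous, map y, proved with
  Riemann sums: the intervals of length \<open>\<delta> / C\<close> to the right of the images of the nodes are disjoint.\<close>
lemma rearrangement:
  fixes D h y :: "real \<Rightarrow> real"
  assumes D: "\<And>x z. \<bar>D x - D z\<bar> \<le> \<Lambda> * \<bar>x - z\<bar>" and h: "\<And>x z. \<bar>h x - h z\<bar> \<le> \<Lambda> * \<bar>x - z\<bar>"
    and h0: "\<And>x. 0 \<le> h x" and hi: "h integrable_on UNIV"
    and Dh: "\<And>x. D x \<le> h (y x) + \<zeta>"
    and y: "\<And>x1 x2. x1 < x2 \<Longrightarrow> x2 - x1 \<le> C * (y x2 - y x1)" and C: "0 < C" and X: "0 < X"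
  shows "integral {-X..X} D \<le> C * integral UNIV h + 2 * X * \<zeta>"
proof -
  have \<Lambda>: "0 \<le> \<Lambda>" using D[of 1 0] by simp
  have cD: "continuous_on A D" and ch: "continuous_on A h" for A
    using Lipschitz2_continuous[where H = "\<lambda>(t::real) x. D x" and C = \<Lambda> and p = "\<lambda>_. 0" and q = "\<lambda>x. x" and A = A]
      Lipschitz2_continuous[where H = "\<lambda>(t::real) x. h x" and C = \<Lambda> and p = "\<lambda>_. 0" and q = "\<lambda>x. x" and A = A]
      order_trans[OF D mult_left_mono[OF _ \<Lambda>]] order_trans[OF h mult_left_mono[OF _ \<Lambda>]]
    by (auto simp: continuous_on_id continuous_on_const)
  have iD: "D integrable_on {p..q}" and ih: "h integrable_on {p..q}" for p q
    by (intro integrable_continuous_real cD ch)+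
  have ymono: "y x1 \<le> y x2" if "x1 \<le> x2" for x1 x2
  proof (cases "x1 = x2")
    case False
    then have "0 < x2 - x1" "x2 - x1 \<le> C * (y x2 - y x1)" using that y by auto
    then have "0 < C * (y x2 - y x1)" by linarith
    then show ?thesis using C by (simp add: zero_less_mult_iff)
  qed simp
  \<comment> \<open>The errors per step are of order \<open>\<delta>\<^sup>2\<close>: \<Lambda>
    comes from freezing \<open>D\<close> at the left end, \<Lambda>/C from freezing \<open>h\<close>
    on the image interval of length \<delta>/C.\<close>
  define E where "E = \<Lambda> + \<Lambda> / C"
  have E: "0 \<le> E" using \<Lambda> C by (simp add: E_def)
  have step: "integral {x..x + \<delta>} D \<le> C * integral {y x..y (x + \<delta>)} h + (\<delta> * \<zeta> + E * \<delta>\<^sup>2)" if \<delta>: "0 < \<delta>" for x \<delta>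
  proof -
    have "integral {x..x + \<delta>} D \<le> integral {x..x + \<delta>} (\<lambda>_. h (y x) + \<zeta> + \<Lambda> * \<delta>)"
    proof (rule integral_le[OF iD])
      fix z assume z: "z \<in> {x..x + \<delta>}"
      have "D z \<le> D x + \<Lambda> * \<bar>z - x\<bar>" using D[of z x] by linarith
      moreover have "\<Lambda> * \<bar>z - x\<bar> \<le> \<Lambda> * \<delta>" using z \<Lambda> by (intro mult_left_mono) auto
      ultimately show "D z \<le> h (y x) + \<zeta> + \<Lambda> * \<delta>" using Dh[of x] by linarith
    qed (rule integrable_const_ivl)
    also have "\<dots> = \<delta> * h (y x) + \<delta> * \<zeta> + \<Lambda> * \<delta>\<^sup>2"
      using \<delta> by (simp add: algebra_simps power2_eq_square)
    also have "\<delta> * h (y x) \<le> C * integral {y x..y (x + \<delta>)} h + \<Lambda> / C * \<delta>\<^sup>2"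
    proof -
      define d where "d = \<delta> / C"
      have d: "0 < d" "C * d = \<delta>" using \<delta> C by (simp_all add: d_def)
      have "\<delta> \<le> C * (y (x + \<delta>) - y x)" using y[of x "x + \<delta>"] \<delta> by simp
      then have "C * d \<le> C * (y (x + \<delta>) - y x)" using d by simp
      then have dy: "y x + d \<le> y (x + \<delta>)" using C by simp
      have "integral {y x..y x + d} (\<lambda>_. h (y x) - \<Lambda> * d) \<le> integral {y x..y x + d} h"
      proof (rule integral_le[OF _ ih])
        fix z assume z: "z \<in> {y x..y x + d}"
        have "h (y x) - \<Lambda> * \<bar>z - y x\<bar> \<le> h z" using h[of z "y x"] by linarith
        moreover have "\<Lambda> * \<bar>z - y x\<bar> \<le> \<Lambda> * d" using z \<Lambda> by (intro mult_left_mono) auto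
        ultimately show "h (y x) - \<Lambda> * d \<le> h z" by linarith
      qed (rule integrable_const_ivl)
      also have "integral {y x..y x + d} h \<le> integral {y x..y (x + \<delta>)} h"
        by (rule integral_subset_le) (use dy ih h0 in auto)
      finally have "d * (h (y x) - \<Lambda> * d) \<le> integral {y x..y (x + \<delta>)} h" using d by simp
      then have "C * (d * (h (y x) - \<Lambda> * d)) \<le> C * integral {y x..y (x + \<delta>)} h" using C by (intro mult_left_mono) auto
      moreover have "C * (d * (h (y x) - \<Lambda> * d)) = \<delta> * h (y x) - \<Lambda> / C * \<delta>\<^sup>2"
        using C by (simp add: d_def field_simps power2_eq_square)
      ultimately show ?thesis by linarith
    qed
    finally show ?thesis by (simp add: E_def algebra_simps)
  qed
  have sums: "integral {-X..-X + real n * \<delta>} D \<le> C * integral {y (-X)..y (-X + real n * \<delta>)} h + real n * (\<delta> * \<zeta> + E * \<delta>\<^sup>2)"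
    if \<delta>: "0 < \<delta>" for n \<delta>
  proof (induction n)
    case 0 then show ?case by simp
  next
    case (Suc n)
    define x where "x = -X + real n * \<delta>"
    have x: "-X \<le> x" "-X + real (Suc n) * \<delta> = x + \<delta>" using \<delta> by (simp_all add: x_def algebra_simps)
    have "integral {-X..x + \<delta>} D = integral {-X..x} D + integral {x..x + \<delta>} D"
      by (rule Henstock_Kurzweil_Integration.integral_combine[symmetric]) (use x \<delta> iD in auto)
    also have "\<dots> \<le> (C * integral {y (-X)..y x} h + real n * (\<delta> * \<zeta> + E * \<delta>\<^sup>2)) + (C * integral {y x..y (x + \<delta>)} h + (\<delta> * \<zeta> + E * \<delta>\<^sup>2))"
      using Suc.IH step[OF \<delta>, of x] by (simp add: x_def)
    also have "\<dots> = C * (integral {y (-X)..y x} h + integral {y x..y (x + \<delta>)} h) + real (Suc n) * (\<delta> * \<zeta> + E * \<delta>\<^sup>2)"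
      by (simp add: algebra_simps)
    also have "integral {y (-X)..y x} h + integral {y x..y (x + \<delta>)} h = integral {y (-X)..y (x + \<delta>)} h"
      by (rule Henstock_Kurzweil_Integration.integral_combine) (use ymono[OF x(1)] ymono[of x "x + \<delta>"] \<delta> ih in auto)
    finally show ?case unfolding x(2) .
  qed
  show ?thesis
  proof (rule field_le_epsilon)
    fix e :: real assume e: "0 < e"
    \<comment> \<open>With n steps of length 2 X / n the accumulated error is 4 X^2 E / n.\<close>
    obtain n :: nat where n: "4 * X\<^sup>2 * E / e < real n" using reals_Archimedean2 by blast
    have "0 \<le> 4 * X\<^sup>2 * E / e" using E e by simp
    then have n0: "0 < real n" using n by linarith
    define \<delta> where "\<delta> = 2 * X / real n"
    have \<delta>: "0 < \<delta>" "real n * \<delta> = 2 * X" using X n0 by (simp_all add: \<delta>_def)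
    have "integral {-X..X} D \<le> C * integral {y (-X)..y X} h + real n * (\<delta> * \<zeta> + E * \<delta>\<^sup>2)"
      using sums[OF \<delta>(1), of n] unfolding \<delta>(2) by simp
    also have "integral {y (-X)..y X} h \<le> integral UNIV h"
      by (rule integral_subset_le) (use ih hi h0 in auto)
    also have "real n * (\<delta> * \<zeta> + E * \<delta>\<^sup>2) = 2 * X * \<zeta> + 4 * X\<^sup>2 * E / real n"
    proof -
      have "real n * (\<delta> * \<zeta> + E * \<delta>\<^sup>2) = (real n * \<delta>) * \<zeta> + (real n * \<delta>) * E * \<delta>" by (simp add: algebra_simps power2_eq_square)
      then show ?thesis unfolding \<delta>(2) by (simp add: \<delta>_def power2_eq_square)
    qed
    also have "4 * X\<^sup>2 * E / real n \<le> e" using n n0 e by (simp add: field_simps)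
    finally show "integral {-X..X} D \<le> C * integral UNIV h + 2 * X * \<zeta> + e" using C by simp
  qed
qed

lemma distribution_fun_translate: "distribution_fun (\<lambda>y. v (y + d)) x = distribution_fun v (x + d)"
proof -
  have "distribution_fun v (x + d) = (LINT y|lborel. indicator {..x + d} (d + 1 * y) *\<^sub>R v (d + 1 * y))"
    unfolding distribution_fun_def set_lebesgue_integral_def by (subst lborel_integral_real_affine[where c = 1 and t = d]) auto
  also have "\<dots> = distribution_fun (\<lambda>y. v (y + d)) x"
    unfolding distribution_fun_def set_lebesgue_integral_def
    by (intro Bochner_Integration.integral_cong refl) (auto simp: indicator_def add.commute)
  finally show ?thesis by simp
qed

lemma integrable_translate:
  fixes v :: "real \<Rightarrow> real"
  assumes "integrable lborel v" shows "integrable lborel (\<lambda>y. v (y + d))"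
  using lborel_integrable_real_affine[OF assms, of 1 d] by (simp add: add.commute)

lemma integral_translate:
  fixes v :: "real \<Rightarrow> real"
  shows "(LINT y|lborel. v (y + d)) = (LINT y|lborel. v y)"
  using lborel_integral_real_affine[of 1 v d] by (simp add: add.commute)

section \<open>Cell averages\<close>

text \<open>The affine term is odd about the midpoint d/2. Bounding a function by an affine one
  therefore bounds its centred average by the constant term alone, which is where the second order
  comes from.\<close>

lemma has_integral_centered:
  fixes A p d :: real
  assumes "0 \<le> d" shows "((\<lambda>r. A + (r - d / 2) * p) has_integral d * A) {0..d}"
proof -
  have "((\<lambda>r. A + (r - d / 2) * p) has_integral (A * d + (d - d / 2)\<^sup>2 / 2 * p) - (A * 0 + (0 - d / 2)\<^sup>2 / 2 * p)) {0..d}"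
    by (rule fundamental_theorem_of_calculus[OF assms])
      (auto intro!: derivative_eq_intros simp flip: has_real_derivative_iff_has_vector_derivative)
  then show ?thesis by (simp add: power2_eq_square algebra_simps)
qed

text \<open>\<open>W\<close> is the average of the primitive over [x - d/2, x + d/2], so
  \<open>w\<close> is a difference quotient. The defect 2 d in the hypothesis is the one that cell
  averages have; at distance d it costs the factor 3. The error from below keeps the term v (x - d)
  - v (x + d), which integrates to zero.\<close>

lemma one_sided_Lipschitz_average:
  assumes v[measurable]: "v \<in> borel_measurable borel" and M: "\<And>x. \<bar>v x\<bar> \<le> M" and R: "\<And>x. R < \<bar>x\<bar> \<Longrightarrow> v x = 0" "0 \<le> R"
    and osl: "\<And>x z. 0 \<le> z \<Longrightarrow> v (x + z) \<le> v x + c * (z + 2 * d)" and c: "0 \<le> c" and d: "0 < d"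
  obtains W w where "\<And>x. (W has_real_derivative w x) (at x)" "\<And>x. -M \<le> w x \<and> w x \<le> M"
    "\<And>x y. x \<le> y \<Longrightarrow> w y - w x \<le> 3 * c * (y - x)"
    "\<And>x. W x \<le> distribution_fun v x + 4 * c * d\<^sup>2"
    "\<And>x. distribution_fun v x - W x \<le> d * (v (x - d) - v (x + d) + 6 * c * d)"
    "\<And>x. x < - R - d \<Longrightarrow> W x = 0" "\<And>x. R + d \<le> x \<Longrightarrow> W x = (LINT y|lborel. v y)"
proof -
  define V where "V = distribution_fun v"
  have iv: "integrable lborel v" by (rule integrable_bounded_support[OF v M R(1)])
  have Mb: "- M \<le> v z \<and> v z \<le> M" for z using M[of z] by linarith
  note slope = distribution_fun_slope_on[OF iv, folded V_def]
  have VL: "- M * (y - x) \<le> V y - V x \<and> V y - V x \<le> M * (y - x)" if "x \<le> y" for x y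
    by (rule slope[OF that Mb])
  have Lip: "\<bar>V x - V y\<bar> \<le> M * \<bar>x - y\<bar>" for x y
    using VL[of x y] VL[of y x] by (cases "x \<le> y") auto
  have M0: "0 \<le> M" using M[of 0] by linarith
  have cV: "continuous_on A V" for A
    using Lipschitz2_continuous[where H = "\<lambda>(t::real) x. V x" and C = M and p = "\<lambda>_. 0" and q = "\<lambda>x. x" and A = A]
      order_trans[OF Lip mult_left_mono[OF _ M0]] by (auto simp: continuous_on_id continuous_on_const)
  have cV': "continuous_on A (\<lambda>x. V (x - d / 2))" for A
    by (intro continuous_on_compose2[OF cV[of UNIV]] continuous_intros) auto
  define W where "W x = integral {0..d} (\<lambda>r. V (x + r - d / 2)) / d" for x
  define w where "w x = (V (x + d / 2) - V (x - d / 2)) / d" for x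
  have iV: "(\<lambda>r. V (x + r - d / 2)) integrable_on {0..d}" for x
    by (intro integrable_continuous_real continuous_on_compose2[OF cV[of UNIV]] continuous_intros) auto
  have above: "W x \<le> A" if "\<And>s. \<bar>s\<bar> \<le> d / 2 \<Longrightarrow> V (x + s) \<le> A + s * p" for x A p
  proof -
    have "integral {0..d} (\<lambda>r. V (x + r - d / 2)) \<le> d * A"
      by (rule has_integral_le[OF integrable_integral[OF iV] has_integral_centered[of d A p]])
        (use d that[of "r - d / 2" for r] in \<open>auto simp: algebra_simps abs_if split: if_splits\<close>)
    then show ?thesis using d by (simp add: W_def field_simps)
  qed
  have below: "A \<le> W x" if "\<And>s. \<bar>s\<bar> \<le> d / 2 \<Longrightarrow> A + s * p \<le> V (x + s)" for x A p
  proof -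
    have "d * A \<le> integral {0..d} (\<lambda>r. V (x + r - d / 2))"
      by (rule has_integral_le[OF has_integral_centered[of d A p] integrable_integral[OF iV]])
        (use d that[of "r - d / 2" for r] in \<open>auto simp: algebra_simps abs_if split: if_splits\<close>)
    then show ?thesis using d by (simp add: W_def field_simps)
  qed
  have osl': "v y \<le> v x + c * (y - x + 2 * d)" if "x \<le> y" for x y
    using osl[of "y - x" x] that by simp
  have osl3: "v y \<le> v x + 3 * c * d" if "x \<le> y" "y \<le> x + d" for x y
  proof -
    have "c * (y - x + 2 * d) \<le> c * (3 * d)" using that c by (intro mult_left_mono) auto
    then show ?thesis using osl'[OF that(1)] by simp
  qed
  show thesis
  proof (rule that[of W w])
    fix x
    show "(W has_real_derivative w x) (at x)"
      unfolding W_def[abs_def] w_def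
      using DERIV_cdivide[OF sliding_integral_DERIV[OF cV', OF less_imp_le[OF d], of x], of d] by (simp add: algebra_simps)
    show "-M \<le> w x \<and> w x \<le> M"
      using VL[of "x - d / 2" "x + d / 2"] d by (auto simp: w_def field_simps)
    have "W x \<le> V x + 4 * c * d\<^sup>2"
    \<comment> \<open>Comparison with the line of slope v x: over a distance d the density rises by
      at most 3 c d, which bounds V from above on both sides of x up to second order.\<close>
    proof (rule above[where p = "v x"])
      fix s assume s: "\<bar>s\<bar> \<le> d / 2"
      have cd: "3 * c * d * \<bar>s\<bar> \<le> 4 * c * d\<^sup>2"
      proof -
        have "3 * c * d * \<bar>s\<bar> \<le> 3 * c * d * d" using s c d by (intro mult_left_mono) auto
        moreover have "0 \<le> c * d\<^sup>2" using c by simp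
        ultimately show ?thesis by (simp add: power2_eq_square)
      qed
      show "V (x + s) \<le> V x + 4 * c * d\<^sup>2 + s * v x"
      proof (cases "0 \<le> s")
        case True
        have "V (x + s) - V x \<le> (v x + 3 * c * d) * (x + s - x)"
          by (rule slope[THEN conjunct2, of x "x + s" "- M"]) (use osl3[of x] Mb s True d in auto)
        then show ?thesis using cd True by (simp add: algebra_simps)
      next
        case False
        have *: "v x - 3 * c * d \<le> v z" if "x + s < z" "z < x" for z using osl3[of z x] that s d by linarith
        have "(v x - 3 * c * d) * (x - (x + s)) \<le> V x - V (x + s)"
          by (rule slope[THEN conjunct1, of "x + s" x _ M]) (use * Mb False in auto)
        then show ?thesis using cd False by (simp add: algebra_simps)
      qed
    qed
    then show "W x \<le> distribution_fun v x + 4 * c * d\<^sup>2" by (simp add: V_def)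
    \<comment> \<open>\<open>P\<close> bounds v from above just left of x and \<open>Q\<close> from
      below just right of x, the directions in which the one-sided bound gives information from x -
      d and x + d.\<close>
    define P where "P = v (x - d) + 3 * c * d"
    define Q where "Q = v (x + d) - 3 * c * d"
    have PQ: "0 \<le> P - Q" "P - Q = v (x - d) - v (x + d) + 6 * c * d"
    proof -
      have "c * (x + d - (x - d) + 2 * d) = 4 * c * d" by (simp add: algebra_simps)
      moreover have "0 \<le> c * d" using c d by simp
      ultimately show "0 \<le> P - Q" using osl'[of "x - d" "x + d"] d by (simp add: P_def Q_def)
    qed (simp add: P_def Q_def)
    have "V x - d * (P - Q) \<le> W x"
    proof (rule below[where p = P])
      fix s assume s: "\<bar>s\<bar> \<le> d / 2"
      have dPQ: "\<bar>s\<bar> * (P - Q) \<le> d * (P - Q)" "0 \<le> \<bar>s\<bar> * (P - Q)" "0 \<le> d * (P - Q)"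
        using s d PQ(1) by (auto intro: mult_right_mono)
      show "V x - d * (P - Q) + s * P \<le> V (x + s)"
      proof (cases "0 \<le> s")
        case True
        have *: "Q \<le> v z" if "x < z" "z < x + s" for z using osl3[of z "x + d"] that s d by (simp add: Q_def)
        have "Q * (x + s - x) \<le> V (x + s) - V x"
          by (rule slope[THEN conjunct1, of x "x + s" _ M]) (use * Mb True in auto)
        then show ?thesis using dPQ True by (simp add: algebra_simps)
      next
        case False
        have *: "v z \<le> P" if "x + s < z" "z < x" for z using osl3[of "x - d" z] that s d by (simp add: P_def)
        have "V x - V (x + s) \<le> P * (x - (x + s))"
          by (rule slope[THEN conjunct2, of "x + s" x "-M"]) (use * Mb False in auto)
        then show ?thesis using dPQ False by (simp add: algebra_simps)
      qed
    qed
    then show "distribution_fun v x - W x \<le> d * (v (x - d) - v (x + d) + 6 * c * d)"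
      unfolding PQ(2) V_def by linarith
  next
    fix x y :: real assume xy: "x \<le> y"
    \<comment> \<open>d (w y - w x) is an increment of the primitive of q, so the upper bound q
      \<le> 3 c d becomes the one-sided Lipschitz bound of \<open>w\<close>.\<close>
    define q where "q z = v (z + d) - v z" for z
    have iq: "integrable lborel q" unfolding q_def by (intro Bochner_Integration.integrable_diff integrable_translate iv)
    have D: "distribution_fun q z = V (z + d) - V z" for z
      unfolding V_def distribution_fun_translate[symmetric, of v z d] unfolding q_def distribution_fun_def
      by (rule set_integral_diff(2); unfold set_integrable_def; intro integrable_mult_indicator integrable_translate iv) auto
    have qb: "- 2 * M \<le> q z \<and> q z \<le> 3 * c * d" for z
      using Mb[of z] Mb[of "z + d"] osl3[of z "z + d"] d by (simp add: q_def)
    have "distribution_fun q (y - d / 2) - distribution_fun q (x - d / 2) \<le> 3 * c * d * ((y - d / 2) - (x - d / 2))"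
      by (rule distribution_fun_slope_on[OF iq _ qb, THEN conjunct2]) (use xy in simp)
    moreover have dw: "d * w x = V (x + d / 2) - V (x - d / 2)" for x using d by (simp add: w_def)
    have "d * (w y - w x) = (V (y + d / 2) - V (y - d / 2)) - (V (x + d / 2) - V (x - d / 2))"
      by (simp only: right_diff_distrib dw)
    ultimately have "d * (w y - w x) \<le> d * (3 * c * (y - x))" unfolding D by (simp add: algebra_simps)
    then show "w y - w x \<le> 3 * c * (y - x)" using d by simp
  next
    fix x assume x: "x < - R - d"
    have 0: "V (x + s) = 0 + s * 0" if "\<bar>s\<bar> \<le> d / 2" for s
      unfolding V_def using x that d R by (subst distribution_fun_eq_0) auto
    show "W x = 0" by (rule antisym; rule above[of x 0 0] below[of 0 0 x]; simp only: 0 order_refl)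
  next
    fix x assume x: "R + d \<le> x"
    have 0: "V (x + s) = (LINT y|lborel. v y) + s * 0" if "\<bar>s\<bar> \<le> d / 2" for s
      unfolding V_def using x that d R by (subst distribution_fun_eq_total) auto
    show "W x = (LINT y|lborel. v y)"
      by (rule antisym; rule above[of x "LINT y|lborel. v y" 0] below[of "LINT y|lborel. v y" 0 x]; simp only: 0 order_refl)
  qed
qed

lemma cell_average_measurable [measurable]: "cell_average dx v \<in> borel_measurable borel"
proof -
  have "(\<lambda>x. (\<lambda>k::int. let i = real_of_int k in 1 / dx * (LINT y:{(i - 1/2) * dx..(i + 1/2) * dx}|lborel. v y)) \<lfloor>x / dx + 1/2\<rfloor>)
      \<in> borel_measurable borel"
    by (rule measurable_compose[where N = "count_space UNIV"]) measurable
  then show ?thesis by (simp add: cell_average_def[abs_def])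
qed

locale osl_datum =
  fixes u0 :: "real \<Rightarrow> real" and c M R :: real
  assumes u0_meas[measurable]: "u0 \<in> borel_measurable borel"
    and bounded: "\<And>x. \<bar>u0 x\<bar> \<le> M" and support: "\<And>x. R < \<bar>x\<bar> \<Longrightarrow> u0 x = 0" and R0: "0 \<le> R"
    and osl: "\<And>x y. x \<le> y \<Longrightarrow> u0 y \<le> u0 x + c * (y - x)" and c0: "0 \<le> c"
begin

abbreviation "U0 \<equiv> distribution_fun u0"

lemma M0: "0 \<le> M" using bounded[of 0] by linarith

lemma integrable_u0: "integrable lborel u0"
  by (rule integrable_bounded_support[OF u0_meas bounded support])

lemma osl_le: "x \<le> y \<Longrightarrow> y \<le> x + d \<Longrightarrow> u0 y \<le> u0 x + c * d"
  using osl[of x y] mult_left_mono[of "y - x" d c] c0 by linarith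

context
  fixes dx :: real
  assumes dx: "0 < dx"
begin

abbreviation "v0 \<equiv> cell_average dx u0"
abbreviation "V0 \<equiv> distribution_fun v0"

lemma cell:
  obtains p :: real and k :: int where "p = (real_of_int k - 1/2) * dx" "p \<le> x" "x < p + dx"
proof -
  have "real_of_int \<lfloor>x / dx + 1/2\<rfloor> \<le> x / dx + 1/2" "x / dx + 1/2 < real_of_int \<lfloor>x / dx + 1/2\<rfloor> + 1" by linarith+
  then have "real_of_int \<lfloor>x / dx + 1/2\<rfloor> - 1/2 \<le> x / dx" "x / dx < real_of_int \<lfloor>x / dx + 1/2\<rfloor> + 1/2" by linarith+
  then have "(real_of_int \<lfloor>x / dx + 1/2\<rfloor> - 1/2) * dx \<le> x" "x < (real_of_int \<lfloor>x / dx + 1/2\<rfloor> + 1/2) * dx"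
    unfolding pos_le_divide_eq[OF dx] pos_divide_less_eq[OF dx] .
  then show ?thesis by (intro that[OF refl, of "\<lfloor>x / dx + 1/2\<rfloor>"]) (simp_all add: algebra_simps)
qed

lemma cell_average_eq:
  assumes p: "p = (real_of_int k - 1/2) * dx" "p \<le> x" "x < p + dx"
  shows "v0 x = (U0 (p + dx) - U0 p) / dx"
proof -
  have "\<lfloor>x / dx + 1/2\<rfloor> = k" using p dx by (intro floor_unique) (auto simp: field_simps)
  moreover have "(real_of_int k + 1/2) * dx = p + dx" by (simp add: p(1) algebra_simps)
  moreover have "(LINT y:{p..p + dx}|lborel. u0 y) = U0 (p + dx) - U0 p"
    unfolding distribution_fun_diff[OF integrable_u0, of p "p + dx", OF less_imp_le, OF less_add_same_cancel1[THEN iffD2, OF dx]]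
      set_lebesgue_integral_def
  proof (rule integral_cong_AE)
    show "AE y in lborel. indicator {p..p + dx} y *\<^sub>R u0 y = indicator {p<..p + dx} y *\<^sub>R u0 y"
      using AE_lborel_singleton[of p] by eventually_elim (auto simp: indicator_def)
  qed measurable
  ultimately show ?thesis by (simp add: cell_average_def p(1) Let_def)
qed

lemma cell_average_between:
  assumes p: "p = (real_of_int k - 1/2) * dx" "p \<le> x" "x < p + dx"
    and ab: "\<And>y. p < y \<Longrightarrow> y < p + dx \<Longrightarrow> a \<le> u0 y \<and> u0 y \<le> b"
  shows "a \<le> v0 x \<and> v0 x \<le> b"
  using distribution_fun_slope_on[OF integrable_u0 _ ab, of p "p + dx"] dx
  unfolding cell_average_eq[OF p] by (auto simp: field_simps)

lemma cell_average_bounds: 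
  assumes "\<And>y. a \<le> u0 y \<and> u0 y \<le> b" shows "a \<le> v0 x \<and> v0 x \<le> b"
proof -
  obtain p k where "p = (real_of_int k - 1/2) * dx" "p \<le> x" "x < p + dx" using cell[of x] by blast
  then show ?thesis by (rule cell_average_between) (rule assms)
qed

lemma abs_v0: "\<bar>v0 x\<bar> \<le> M"
  using cell_average_bounds[of "-M" M x] bounded by (simp add: abs_le_iff minus_le_iff)

lemma v0_support: assumes "R + dx < \<bar>x\<bar>" shows "v0 x = 0"
proof -
  obtain p k where p: "p = (real_of_int k - 1/2) * dx" "p \<le> x" "x < p + dx" using cell[of x] by blast
  have "0 \<le> v0 x \<and> v0 x \<le> 0" by (rule cell_average_between[OF p]) (use p assms support in force)
  then show ?thesis by simp
qed

lemma integrable_v0: "integrable lborel v0"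
  by (rule integrable_bounded_support[OF cell_average_measurable abs_v0 v0_support])

text \<open>Both primitives gain the same mass over each cell and vanish far to the left, so they
  agree at all nodes by induction.\<close>

lemma V0_node: "V0 ((real_of_int k - 1/2) * dx) = U0 ((real_of_int k - 1/2) * dx)"
proof -
  define n where "n k = (real_of_int k - 1/2) * dx" for k
  have n1: "n (k + 1) = n k + dx" for k by (simp add: n_def algebra_simps)
  have incr: "V0 (n (k + 1)) - V0 (n k) = U0 (n (k + 1)) - U0 (n k)" for k
  proof -
    let ?m = "(U0 (n k + dx) - U0 (n k)) / dx"
    have "?m * (n k + dx - n k) \<le> V0 (n k + dx) - V0 (n k) \<and> V0 (n k + dx) - V0 (n k) \<le> ?m * (n k + dx - n k)"
      by (rule distribution_fun_slope_on[OF integrable_v0]) (use dx cell_average_eq[OF n_def, of k] in auto)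
    then show ?thesis using dx unfolding n1 by simp
  qed
  have left: "V0 (n k) = U0 (n k)" if "n k < - R - dx" for k
  proof -
    have "V0 (n k) = 0" by (rule distribution_fun_eq_0) (use that v0_support R0 dx in auto)
    moreover have "U0 (n k) = 0" by (rule distribution_fun_eq_0) (use that support R0 dx in auto)
    ultimately show ?thesis by simp
  qed
  obtain m :: nat where m: "(R + dx) / dx < real m" using reals_Archimedean2 by blast
  have m': "n k < - R - dx" if "k \<le> - int m" for k
  proof -
    have "real_of_int k \<le> - real m" using that by linarith
    then have "real_of_int k * dx \<le> - real m * dx" using dx by (intro mult_right_mono) auto
    moreover have "R + dx < real m * dx" using m dx by (simp add: field_simps)
    ultimately show ?thesis using dx by (simp add: n_def algebra_simps)
  qed
  have "V0 (n k) = U0 (n k)"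
  proof (cases "k \<le> - int m")
    case False
    then have "- int m \<le> k" by simp
    then show ?thesis
    proof (induction k rule: int_ge_induct)
      case base then show ?case by (intro left m') simp
    next
      case (step i) then show ?case using incr[of i] by simp
    qed
  qed (simp add: left m')
  then show ?thesis by (simp add: n_def)
qed

lemma V0_cell:
  obtains p k where "p = (real_of_int k - 1/2) * dx" "p \<le> x" "x < p + dx" "V0 p = U0 p" "V0 (p + dx) = U0 (p + dx)"
proof -
  obtain p k where p: "p = (real_of_int k - 1/2) * dx" "p \<le> x" "x < p + dx" using cell[of x] by blast
  have "p + dx = (real_of_int (k + 1) - 1/2) * dx" by (simp add: p(1) algebra_simps)
  then show ?thesis using that[OF p] V0_node[of k] V0_node[of "k + 1"] p(1) by metis
qed

text \<open>The averages over two different cells compare points that may be z + 2 dx apart.\<close>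

lemma v0_osl: assumes "0 \<le> z" shows "v0 (x + z) \<le> v0 x + c * (z + 2 * dx)"
proof -
  obtain p k where p: "p = (real_of_int k - 1/2) * dx" "p \<le> x" "x < p + dx" using cell[of x] by blast
  obtain q l where q: "q = (real_of_int l - 1/2) * dx" "q \<le> x + z" "x + z < q + dx" using cell[of "x + z"] by blast
  show ?thesis
  proof (cases "k \<le> l")
    case False
    then have "real_of_int l + 1 \<le> real_of_int k" by linarith
    then have "(real_of_int l + 1) * dx \<le> real_of_int k * dx" using dx by (intro mult_right_mono) auto
    then have "q + dx \<le> p" by (simp add: p(1) q(1) algebra_simps)
    then show ?thesis using p q assms by linarith
  next
    case True
    show ?thesis
    proof (cases "k = l")
      case True
      then have "p = q" using p q by simp
      then have "v0 (x + z) = v0 x" using cell_average_eq[OF p] cell_average_eq[OF q] by simp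
      moreover have "0 \<le> c * (z + 2 * dx)" using assms c0 dx by simp
      ultimately show ?thesis by linarith
    next
      case False
      then have "real_of_int k + 1 \<le> real_of_int l" using True by linarith
      then have "(real_of_int k + 1) * dx \<le> real_of_int l * dx" using dx by (intro mult_right_mono) auto
      then have pq: "p + dx \<le> q" by (simp add: p(1) q(1) algebra_simps)
      have le: "u0 y' \<le> u0 y + c * (z + 2 * dx)" if "p < y" "y < p + dx" "q < y'" "y' < q + dx" for y y'
        by (rule osl_le) (use that pq p q in auto)
      have "v0 (x + z) - c * (z + 2 * dx) \<le> v0 x \<and> v0 x \<le> M"
      proof (rule cell_average_between[OF p])
        fix y assume y: "p < y" "y < p + dx"
        have "-M \<le> v0 (x + z) \<and> v0 (x + z) \<le> u0 y + c * (z + 2 * dx)"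
          by (rule cell_average_between[OF q]) (use le[OF y] bounded in \<open>auto simp: abs_le_iff minus_le_iff\<close>)
        then show "v0 (x + z) - c * (z + 2 * dx) \<le> u0 y \<and> u0 y \<le> M" using bounded[of y] by linarith
      qed
      then show ?thesis by linarith
    qed
  qed
qed

text \<open>The primitives agree at the node left of x. From there to x both densities lie in the
  band between u0 (x + dx) - 2 c dx and u0 (x - dx) + 2 c dx, because any two points compared are at
  most 2 dx apart. The width of the band at jumps is not small, but its main part is a difference of
  translates.\<close>

lemma U0_V0_close: "\<bar>U0 x - V0 x\<bar> \<le> dx * (u0 (x - dx) - u0 (x + dx) + 4 * c * dx)"
proof -
  obtain p k where p: "p = (real_of_int k - 1/2) * dx" "p \<le> x" "x < p + dx" and V: "V0 p = U0 p"
    using V0_cell[of x] by blast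
  let ?a = "u0 (x + dx) - 2 * c * dx" and ?b = "u0 (x - dx) + 2 * c * dx"
  have ab: "?a \<le> u0 y \<and> u0 y \<le> ?b" if "p < y" "y < p + dx" for y
    using osl_le[of y "x + dx" "2 * dx"] osl_le[of "x - dx" y "2 * dx"] that p by simp
  have ab': "?a \<le> v0 y \<and> v0 y \<le> ?b" if "p < y" "y < x" for y
    by (rule cell_average_between[OF p(1) _ _ ab]) (use that p in auto)
  have "0 < dx / 2" "p + dx / 2 < p + dx" using dx by auto
  then have le: "?a \<le> ?b" using ab[of "p + dx / 2"] by linarith
  have "?a * (x - p) \<le> U0 x - U0 p \<and> U0 x - U0 p \<le> ?b * (x - p)"
    by (rule distribution_fun_slope_on[OF integrable_u0 p(2)]) (use ab p(3) in auto)
  moreover have "?a * (x - p) \<le> V0 x - V0 p \<and> V0 x - V0 p \<le> ?b * (x - p)"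
    by (rule distribution_fun_slope_on[OF integrable_v0 p(2)]) (use ab' in auto)
  ultimately have "\<bar>U0 x - V0 x\<bar> \<le> ?b * (x - p) - ?a * (x - p)" unfolding V by linarith
  then have "\<bar>U0 x - V0 x\<bar> \<le> (?b - ?a) * (x - p)" by (simp only: left_diff_distrib)
  also have "\<dots> \<le> (?b - ?a) * dx" using le p by (intro mult_left_mono) auto
  finally show ?thesis by (simp add: algebra_simps)
qed

text \<open>On a cell \<open>V0\<close> is the chord of \<open>U0\<close>, and the one-sided bound
  says that \<open>U0\<close> minus c/2 times the square of x is concave. Hence the chord exceeds
  \<open>U0\<close> by a second-order amount at most; no jump term appears in this
  direction.\<close>

lemma V0_le: "V0 x \<le> U0 x + 2 * c * dx\<^sup>2"
proof -
  obtain p k where p: "p = (real_of_int k - 1/2) * dx" "p \<le> x" "x < p + dx" and V: "V0 p = U0 p"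
    using V0_cell[of x] by blast
  let ?m = "(U0 (p + dx) - U0 p) / dx"
  define s where "s = x - p"
  have s: "0 \<le> s" "s < dx" using p by (auto simp: s_def)
  have "V0 x - V0 p \<le> ?m * (x - p)"
    by (rule distribution_fun_slope_on[OF integrable_v0 p(2), THEN conjunct2, where a1 = ?m])
      (use cell_average_eq[OF p(1)] p(3) in auto)
  then have 1: "V0 x - U0 p \<le> s / dx * (U0 (p + dx) - U0 p)" by (simp add: V s_def field_simps)
  have "U0 (p + dx) - U0 x \<le> (u0 x + c * dx) * (p + dx - x)"
    by (rule distribution_fun_slope_on[OF integrable_u0, THEN conjunct2, where a1 = "-M"])
      (use p osl_le[of x _ dx] bounded in \<open>auto simp: abs_le_iff minus_le_iff\<close>)
  then have 2: "U0 (p + dx) - U0 x \<le> (u0 x + c * dx) * (dx - s)" by (simp add: s_def algebra_simps)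
  have *: "u0 x - c * dx \<le> u0 z" if "p < z" "z < x" for z using osl_le[of z x dx] that p by linarith
  have "(u0 x - c * dx) * (x - p) \<le> U0 x - U0 p"
    by (rule distribution_fun_slope_on[OF integrable_u0 p(2), THEN conjunct1, where b1 = M])
      (use * bounded in \<open>auto simp: abs_le_iff\<close>)
  then have 3: "(u0 x - c * dx) * s \<le> U0 x - U0 p" by (simp add: s_def)
  define \<theta> where "\<theta> = s / dx"
  have t: "0 \<le> \<theta>" "\<theta> \<le> 1" "s = \<theta> * dx" using s dx by (auto simp: \<theta>_def)
  have "V0 x - U0 x \<le> \<theta> * (U0 (p + dx) - U0 x) - (1 - \<theta>) * (U0 x - U0 p)"
    using 1 by (simp add: \<theta>_def[symmetric] algebra_simps)
  also have "\<dots> \<le> \<theta> * ((u0 x + c * dx) * (dx - s)) - (1 - \<theta>) * ((u0 x - c * dx) * s)"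
    using t by (intro diff_mono mult_left_mono 2 3) auto
  also have "\<dots> = (\<theta> * (1 - \<theta>)) * (2 * c * dx\<^sup>2)" unfolding t(3) by (simp add: algebra_simps power2_eq_square)
  also have "\<dots> \<le> 1 * (2 * c * dx\<^sup>2)"
    using t c0 mult_le_one[of \<theta> "1 - \<theta>"] by (intro mult_right_mono) auto
  finally show ?thesis by linarith
qed

text \<open>The primitives agree at the nodes on either side of x, which are within one cell of x,
  and both are monotone.\<close>

lemma mono_shift:
  assumes pos: "\<And>x. 0 \<le> u0 x"
  shows "U0 (x - dx) \<le> V0 x" "V0 x \<le> U0 (x + dx)"
proof -
  obtain p k where p: "p = (real_of_int k - 1/2) * dx" "p \<le> x" "x < p + dx"
    and V: "V0 p = U0 p" "V0 (p + dx) = U0 (p + dx)"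
    using V0_cell[of x] by blast
  have v0: "0 \<le> v0 y \<and> v0 y \<le> M" and u0: "0 \<le> u0 y \<and> u0 y \<le> M" for y
    using cell_average_bounds[of 0 M y] pos[of y] bounded[of y] pos bounded by (auto simp: abs_le_iff)
  have mU: "U0 y \<le> U0 z" and mV: "V0 y \<le> V0 z" if "y \<le> z" for y z
    using distribution_fun_slope[OF integrable_u0 u0 that] distribution_fun_slope[OF integrable_v0 v0 that] by auto
  show "U0 (x - dx) \<le> V0 x" using mU[of "x - dx" p] mV[of p x] p V by linarith
  show "V0 x \<le> U0 (x + dx)" using mU[of "p + dx" "x + dx"] mV[of x "p + dx"] p V by linarith
qed

lemma V0_total: "(LINT x|lborel. v0 x) = (LINT x|lborel. u0 x)"
proof -
  obtain p k where p: "p = (real_of_int k - 1/2) * dx" "p \<le> R + 2 * dx" "R + 2 * dx < p + dx" and V: "V0 p = U0 p"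
    using V0_cell[of "R + 2 * dx"] by blast
  have "V0 p = (LINT x|lborel. v0 x)" by (rule distribution_fun_eq_total) (use p v0_support R0 dx in auto)
  moreover have "U0 p = (LINT x|lborel. u0 x)" by (rule distribution_fun_eq_total) (use p support R0 dx in auto)
  ultimately show ?thesis using V by simp
qed

end

end

section \<open>Piecewise linear fluxes\<close>

locale smooth_convex =
  fixes f f' f'' :: "real \<Rightarrow> real"
  assumes DERIV_f: "\<And>k. (f has_real_derivative f' k) (at k)"
    and DERIV_f': "\<And>k. (f' has_real_derivative f'' k) (at k)"
    and cont_f'': "continuous_on UNIV f''" and convex: "convex_on UNIV f"

lemma C2_convexE:
  assumes "C2 f" "convex_on UNIV f"
  obtains f' f'' where "smooth_convex f f' f''"
proof -
  obtain f' where f': "\<And>x. (f has_real_derivative f' x) (at x)"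
    using assms(1) unfolding C2_def C1_differentiable_on_def has_real_derivative_iff_has_vector_derivative by auto
  have "deriv f = f'" using f' by (intro ext DERIV_imp_deriv)
  then obtain f'' where "\<And>x. (f' has_real_derivative f'' x) (at x)" "continuous_on UNIV f''"
    using assms(1) unfolding C2_def C1_differentiable_on_def has_real_derivative_iff_has_vector_derivative by auto
  with f' assms(2) show ?thesis by (intro that[of f' f'']) (unfold_locales)
qed

context smooth_convex
begin

lemma mono_f': "x \<le> y \<Longrightarrow> f' x \<le> f' y"
proof (cases "x = y")
  case False
  assume xy: "x \<le> y"
  have t: "f w - f z \<ge> f' z * (w - z)" for w z
    by (rule convex_on_imp_above_tangent[OF convex]) (use DERIV_f in auto)
  have "(f' x - f' y) * (y - x) \<le> 0" using t[of x y] t[of y x] by (simp add: algebra_simps)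
  then show ?thesis using xy False by (simp add: mult_le_0_iff)
qed simp

lemma f''_nonneg: "0 \<le> f'' x"
  by (rule mono_on_imp_deriv_nonneg[OF _ DERIV_f', where A = UNIV]) (auto intro: mono_onI mono_f')

lemma continuous_f': "continuous_on A f'"
  using DERIV_f' DERIV_continuous_on has_field_derivative_at_within by blast

lemma bound_Lipschitz:
  fixes G :: "real \<Rightarrow> real"
  assumes "\<And>k. (G has_real_derivative G' k) (at k)" "\<And>k. k \<in> {p..q} \<Longrightarrow> \<bar>G' k\<bar> \<le> B" "x \<in> {p..q}" "y \<in> {p..q}"
  shows "\<bar>G x - G y\<bar> \<le> B * \<bar>x - y\<bar>"
  using field_differentiable_bound[OF convex_real_interval(5), of p q G G' B y x] assms
    has_field_derivative_at_within by (force simp: norm_minus_commute abs_minus_commute)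

lemma derivative_bounds:
  obtains B where "0 \<le> B" "\<And>k. k \<in> {-r..r} \<Longrightarrow> \<bar>f' k\<bar> \<le> B" "\<And>k. k \<in> {-r..r} \<Longrightarrow> \<bar>f'' k\<bar> \<le> B"
proof -
  have "bounded (f' ` {-r..r})" "bounded (f'' ` {-r..r})"
    by (auto intro!: compact_imp_bounded compact_continuous_image continuous_f' continuous_on_subset[OF cont_f''])
  then obtain B1 B2 where "\<forall>k\<in>{-r..r}. \<bar>f' k\<bar> \<le> B1" "\<forall>k\<in>{-r..r}. \<bar>f'' k\<bar> \<le> B2" unfolding bounded_iff by auto
  then have "\<And>k. k \<in> {-r..r} \<Longrightarrow> \<bar>f' k\<bar> \<le> \<bar>B1\<bar> + \<bar>B2\<bar>" "\<And>k. k \<in> {-r..r} \<Longrightarrow> \<bar>f'' k\<bar> \<le> \<bar>B1\<bar> + \<bar>B2\<bar>" by force+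
  then show ?thesis by (intro that[of "\<bar>B1\<bar> + \<bar>B2\<bar>"]) auto
qed

lemma f_Lipschitz: "\<exists>L. \<forall>p\<in>{-r..r}. \<forall>q\<in>{-r..r}. \<bar>f p - f q\<bar> \<le> L * \<bar>p - q\<bar>"
  using derivative_bounds[of r] bound_Lipschitz[OF DERIV_f, of "-r" r] by metis

context
  fixes \<delta> :: real
  assumes \<delta>: "0 < \<delta>"
begin

text \<open>By the mean value theorem the slope of the chord is a value of \<open>f'\<close>, so the
  interpolant is compared with \<open>f\<close> through \<open>f''\<close>. The formula is extended
  to the left end p, which \<open>flux_interp\<close> assigns to the previous cell.\<close>

lemma interp_cell:
  obtains p \<xi> and j :: int where "p = real_of_int j * \<delta>" "p < u" "u \<le> p + \<delta>" "p < \<xi>" "\<xi> < p + \<delta>"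
    "f (p + \<delta>) - f p = \<delta> * f' \<xi>" "\<And>w. p \<le> w \<Longrightarrow> w \<le> p + \<delta> \<Longrightarrow> flux_interp f \<delta> w = f p + (w - p) * f' \<xi>"
proof -
  define j where "j = \<lceil>u / \<delta>\<rceil> - 1"
  have "real_of_int j < u / \<delta>" "u / \<delta> \<le> real_of_int j + 1" unfolding j_def by linarith+
  then have u: "real_of_int j * \<delta> < u" "u \<le> (real_of_int j + 1) * \<delta>"
    using \<delta> by (simp_all add: pos_less_divide_eq pos_divide_le_eq)
  define p where "p = real_of_int j * \<delta>"
  have p1: "(real_of_int j + 1) * \<delta> = p + \<delta>" by (simp add: p_def algebra_simps)
  have "p < p + \<delta>" using \<delta> by simp
  from MVT2[OF this, of f f'] DERIV_f obtain \<xi> where \<xi>: "p < \<xi>" "\<xi> < p + \<delta>" "f (p + \<delta>) - f p = \<delta> * f' \<xi>" by auto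
  have eq: "flux_interp f \<delta> w = f p + (w - p) * f' \<xi>" if "p < w" "w \<le> p + \<delta>" for w
    using flux_interp_eq[OF \<delta>, of w j f] that \<xi>(3) \<delta> by (simp add: p1 flip: p_def)
  have "flux_interp f \<delta> p = f p"
    using flux_interp_eq[OF \<delta>, of p "j - 1" f] \<delta> by (simp add: p_def left_diff_distrib)
  with eq have "flux_interp f \<delta> w = f p + (w - p) * f' \<xi>" if "p \<le> w" "w \<le> p + \<delta>" for w
    using that by (cases "p = w") auto
  then show ?thesis using that[OF p_def _ _ \<xi>] u p1 by (simp flip: p_def)
qed

lemma interp_ge: "f u \<le> flux_interp f \<delta> u"
proof -
  obtain p \<xi> where p: "p < u" "u \<le> p + \<delta>" "f (p + \<delta>) - f p = \<delta> * f' \<xi>"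
      "\<And>w. p \<le> w \<Longrightarrow> w \<le> p + \<delta> \<Longrightarrow> flux_interp f \<delta> w = f p + (w - p) * f' \<xi>"
    using interp_cell[of u] by metis
  have "convex_on {p..p + \<delta>} f" by (rule convex_on_subset[OF convex]) auto
  then have le: "f u \<le> (f (p + \<delta>) - f p) / (p + \<delta> - p) * (u - p) + f p" by (rule convex_onD_Icc') (use p in auto)
  have "(f (p + \<delta>) - f p) / (p + \<delta> - p) = f' \<xi>" using p(3) \<delta> by simp
  from le[unfolded this] show ?thesis using p(4)[of u] p(1,2) by (simp add: mult.commute)
qed

lemma interp_0: "flux_interp f \<delta> 0 = f 0"
  using flux_interp_eq[OF \<delta>, of 0 "-1" f] \<delta> by simp

text \<open>The error is at most (u - p) B \<delta> with p the node left of u. Estimating u - p by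
  \<delta> gives the second-order bound on values. For u > 0 the node p is nonnegative because 0 is
  a node, and estimating u - p by u gives a bound proportional to u, which amounts to a change of
  speed by B \<delta>.\<close>

lemma interp_le:
  assumes B: "\<And>k. k \<in> {-r..r} \<Longrightarrow> \<bar>f'' k\<bar> \<le> B" "0 \<le> B" and u: "\<bar>u\<bar> + \<delta> \<le> r"
  shows "flux_interp f \<delta> u \<le> f u + B * \<delta>\<^sup>2" "0 \<le> u \<Longrightarrow> flux_interp f \<delta> u \<le> f u + B * \<delta> * u"
proof -
  obtain p \<xi> and j :: int where p: "p = real_of_int j * \<delta>" "p < u" "u \<le> p + \<delta>" "p < \<xi>" "\<xi> < p + \<delta>"
      and eq: "\<And>w. p \<le> w \<Longrightarrow> w \<le> p + \<delta> \<Longrightarrow> flux_interp f \<delta> w = f p + (w - p) * f' \<xi>"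
    using interp_cell[of u] by metis
  obtain \<zeta> where z: "p < \<zeta>" "\<zeta> < u" "f u - f p = (u - p) * f' \<zeta>" using MVT2[OF p(2), of f f'] DERIV_f by auto
  have "\<bar>f' \<xi> - f' \<zeta>\<bar> \<le> B * \<bar>\<xi> - \<zeta>\<bar>"
    by (rule bound_Lipschitz[OF DERIV_f' B(1)]) (use p z u in auto)
  also have "\<dots> \<le> B * \<delta>" using p z B(2) by (intro mult_left_mono) auto
  finally have "(u - p) * (f' \<xi> - f' \<zeta>) \<le> (u - p) * (B * \<delta>)" using p by (intro mult_left_mono) auto
  then have le: "flux_interp f \<delta> u \<le> f u + (u - p) * (B * \<delta>)" using eq[of u] p z by (simp add: algebra_simps)
  have "(u - p) * (B * \<delta>) \<le> \<delta> * (B * \<delta>)" using p B \<delta> by (intro mult_right_mono) auto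
  then show "flux_interp f \<delta> u \<le> f u + B * \<delta>\<^sup>2" using le by (simp add: power2_eq_square algebra_simps)
  assume u0: "0 \<le> u"
  show "flux_interp f \<delta> u \<le> f u + B * \<delta> * u"
  proof (cases "u = 0")
    case False
    then have "0 < (real_of_int j + 1) * \<delta>" using u0 p by (simp add: algebra_simps)
    then have "0 \<le> j" using \<delta> by (simp add: zero_less_mult_iff)
    then have "0 \<le> p" using p \<delta> by simp
    then have "(u - p) * (B * \<delta>) \<le> u * (B * \<delta>)" using B \<delta> by (intro mult_right_mono) auto
    then show ?thesis using le by (simp add: algebra_simps)
  qed (simp add: interp_0)
qed

text \<open>Across several cells the increment consists of a partial cell, an increment of
  \<open>f\<close> between nodes and another partial cell; all slopes are values of
  \<open>f'\<close> within \<delta> of the arguments.\<close>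

lemma interp_Lipschitz:
  assumes B: "\<And>k. k \<in> {-r..r} \<Longrightarrow> \<bar>f' k\<bar> \<le> B" and x: "\<bar>x\<bar> + \<delta> \<le> r" and y: "\<bar>y\<bar> + \<delta> \<le> r"
  shows "\<bar>flux_interp f \<delta> x - flux_interp f \<delta> y\<bar> \<le> B * \<bar>x - y\<bar>"
proof -
  have *: "\<bar>flux_interp f \<delta> y - flux_interp f \<delta> x\<bar> \<le> B * (y - x)"
    if x: "\<bar>x\<bar> + \<delta> \<le> r" and y: "\<bar>y\<bar> + \<delta> \<le> r" and xy: "x \<le> y" for x y
  proof -
    obtain p \<xi> and j :: int where p: "p = real_of_int j * \<delta>" "p < x" "x \<le> p + \<delta>" "p < \<xi>" "\<xi> < p + \<delta>"
      and fp: "f (p + \<delta>) - f p = \<delta> * f' \<xi>" and eq: "\<And>w. p \<le> w \<Longrightarrow> w \<le> p + \<delta> \<Longrightarrow> flux_interp f \<delta> w = f p + (w - p) * f' \<xi>"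
      using interp_cell[of x] by metis
    obtain q \<zeta> and l :: int where q: "q = real_of_int l * \<delta>" "q < y" "y \<le> q + \<delta>" "q < \<zeta>" "\<zeta> < q + \<delta>"
      and eq': "\<And>w. q \<le> w \<Longrightarrow> w \<le> q + \<delta> \<Longrightarrow> flux_interp f \<delta> w = f q + (w - q) * f' \<zeta>"
      using interp_cell[of y] by metis
    have f\<xi>: "\<bar>f' \<xi>\<bar> \<le> B" and f\<zeta>: "\<bar>f' \<zeta>\<bar> \<le> B" using p q x y by (auto intro!: B)
    have m: "\<bar>d * f' \<xi>\<bar> \<le> d * B" "\<bar>d * f' \<zeta>\<bar> \<le> d * B" if "0 \<le> d" for d
      using that f\<xi> f\<zeta> by (simp_all add: abs_mult mult_left_mono)
    show ?thesis
    proof (cases "y \<le> p + \<delta>")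
      case True
      then have "flux_interp f \<delta> y - flux_interp f \<delta> x = (y - x) * f' \<xi>" using eq[of x] eq[of y] p xy by (simp add: algebra_simps)
      then show ?thesis using m(1)[of "y - x"] xy by (simp add: mult.commute)
    next
      case False
      have "j + 1 \<le> l"
      proof (rule ccontr)
        assume "\<not> j + 1 \<le> l"
        then have "real_of_int l \<le> real_of_int j" by simp
        then have "q \<le> p" using \<delta> by (simp add: p(1) q(1) mult_right_mono)
        then show False using False q by linarith
      qed
      then have "real_of_int (j + 1) * \<delta> \<le> real_of_int l * \<delta>" using \<delta> by (intro mult_right_mono) auto
      then have pq: "p + \<delta> \<le> q" by (simp add: p(1) q(1) algebra_simps)
      have "\<bar>f q - f (p + \<delta>)\<bar> \<le> B * \<bar>q - (p + \<delta>)\<bar>"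
        by (rule bound_Lipschitz[OF DERIV_f B]) (use p q x y pq in auto)
      moreover have "flux_interp f \<delta> y - flux_interp f \<delta> x = (y - q) * f' \<zeta> + (f q - f (p + \<delta>)) + (p + \<delta> - x) * f' \<xi>"
        using eq[of x] eq'[of y] p q fp by (simp add: algebra_simps)
      moreover have "(y - q) * B + B * (q - (p + \<delta>)) + (p + \<delta> - x) * B = B * (y - x)" by (simp add: algebra_simps)
      ultimately show ?thesis using m(2)[of "y - q"] m(1)[of "p + \<delta> - x"] p q pq by linarith
    qed
  qed
  show ?thesis using *[OF x y] *[OF y x] by (cases "x \<le> y") (auto simp: abs_minus_commute)
qed

end

end

lemma entropy_solution_shift_flux: "entropy_solution F v0 v \<Longrightarrow> entropy_solution (\<lambda>p. F p - d) v0 v"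
  unfolding entropy_solution_def by simp

text \<open>The upper bound follows the minimizing characteristics of the Hopf-Lax function. Their foot points
  \<open>y x\<close> must not cluster, so that the integrated initial error controls the integrated error at time t.\<close>
lemma (in compact_sol) close_to_Hopf_Lax:
  assumes hl: "hopf_lax g g' a b W" and g0: "g 0 = 0" and Fg: "\<And>p. p \<in> {a..b} \<Longrightarrow> \<bar>F p - g p\<bar> \<le> \<eta>"
    and W: "\<And>x. W x \<le> U0 x + \<kappa>" and \<kappa>: "0 \<le> \<kappa>"
    and left: "\<And>x. x \<le> - Y \<Longrightarrow> W x = 0" and right: "\<And>x. Y \<le> x \<Longrightarrow> W x = (LINT y|lborel. u0 y)" and t: "0 \<le> t"
    and k: "\<And>x. k x \<in> {a..b}" and y: "\<And>x. y x = x - t * g' (k x)"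
    and HL: "\<And>x. hopf_lax.HL g g' a b W t x = W (y x) + t * convex_flux.legendre g g' (k x)"
    and spread: "\<And>x1 x2. x1 < x2 \<Longrightarrow> x2 - x1 \<le> C * (y x2 - y x1)" and C: "0 < C"
    and h: "\<And>x. U0 x - W x \<le> h x" "\<And>x. 0 \<le> h x" "\<And>x z. \<bar>h x - h z\<bar> \<le> \<Lambda> * \<bar>x - z\<bar>" "h integrable_on UNIV" and Z: "0 < Z"
  shows "hopf_lax.HL g g' a b W t x \<le> U t x + \<kappa> + \<eta> * t"
    and "integral {-Z..Z} (\<lambda>x. U t x - hopf_lax.HL g g' a b W t x) \<le> C * integral UNIV h + 2 * Z * (\<eta> * t)"
proof -
  interpret H: hopf_lax g g' a b W by (rule hl)
  have \<eta>: "0 \<le> \<eta>" using Fg[of 0] ab by auto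
  show "H.HL t x \<le> U t x + \<kappa> + \<eta> * t"
  proof (rule comparison[OF hl _ g0 _ \<eta> \<kappa> W left right t])
    fix p assume "p \<in> {a..b}" then show "F p \<le> g p + \<eta>" using Fg[of p] by linarith
  qed (use ab in auto)
  \<comment> \<open>The fluxes differ by at most \<eta>, so the conjugate of \<open>F\<close> at the
    speed \<open>g' (k x)\<close> exceeds that of \<open>g\<close> by at most \<eta>.\<close>
  have up: "U t x - H.HL t x \<le> h (y x) + \<eta> * t" for x
  proof -
    have "U t x \<le> U0 (x - t * g' (k x)) + t * (H.legendre (k x) + \<eta>)"
    proof (rule upper_bound[OF _ t])
      fix p assume "p \<in> {a..b}"
      then show "g' (k x) * p - F p \<le> H.legendre (k x) + \<eta>" using Fg[of p] H.legendre_ge[of p "k x"] by (simp add: mult.commute)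
    qed
    then show ?thesis using h(1)[of "y x"] unfolding HL y[symmetric] by (simp add: algebra_simps)
  qed
  obtain CH where CH: "\<And>x z. \<bar>H.HL t x - H.HL t z\<bar> \<le> CH * \<bar>x - z\<bar>"
    using H.HL_Lipschitz by (metis abs_zero add_0 diff_self)
  have \<Lambda>0: "0 \<le> \<Lambda>" using h(3)[of 1 0] by simp
  have CH0: "0 \<le> CH" using CH[of 1 0] by simp
  show "integral {-Z..Z} (\<lambda>x. U t x - H.HL t x) \<le> C * integral UNIV h + 2 * Z * (\<eta> * t)"
  proof (rule rearrangement[where \<Lambda> = "K + CH + \<Lambda>", OF _ _ h(2,4) up spread C Z])
    fix x z
    have "\<bar>(U t x - H.HL t x) - (U t z - H.HL t z)\<bar> \<le> K * \<bar>x - z\<bar> + CH * \<bar>x - z\<bar>"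
      using U_Lipschitz_space[OF t, of x z] CH[of x z] by linarith
    moreover have "0 \<le> \<Lambda> * \<bar>x - z\<bar>" "0 \<le> K * \<bar>x - z\<bar>" "0 \<le> CH * \<bar>x - z\<bar>" using \<Lambda>0 CH0 K0 by simp_all
    ultimately show "\<bar>(U t x - H.HL t x) - (U t z - H.HL t z)\<bar> \<le> (K + CH + \<Lambda>) * \<bar>x - z\<bar>"
      "\<bar>h x - h z\<bar> \<le> (K + CH + \<Lambda>) * \<bar>x - z\<bar>"
      using h(3)[of x z] by (simp_all add: algebra_simps)
  qed
qed

text \<open>Adding \<sigma> p to the flux is a Galilean shift: all speeds grow by \<sigma> and the
  conjugate cost of each k is unchanged. The Hopf-Lax function of the shifted flux and the
  translated datum lies below the primitive of v by \<open>comparison\<close>;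
  \<open>upper_bound\<close> along its minimizing line puts the translated primitive of u below
  it.\<close>

lemma shifted_comparison:
  assumes u: "compact_sol F u0 u 0 b R L" and v: "compact_sol G v0 v 0 b R' L'"
    and g: "convex_flux g g'" "g 0 = 0"
    and Fg: "\<And>p. p \<in> {0..b} \<Longrightarrow> g p \<le> F p" and Gg: "\<And>p. p \<in> {0..b} \<Longrightarrow> G p \<le> g p + \<sigma> * p"
    and shift: "\<And>x. distribution_fun u0 (x - d) \<le> distribution_fun v0 x"
    and total: "(LINT x|lborel. u0 x) = (LINT x|lborel. v0 x)" and t: "0 \<le> t"
  shows "distribution_fun (u t) (x - d - t * \<sigma>) \<le> distribution_fun (v t) x"
proof -
  interpret u: compact_sol F u0 u 0 b R L by (rule u)
  interpret v: compact_sol G v0 v 0 b R' L' by (rule v)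
  interpret g: convex_flux g g' by (rule g)
  define A where "A x = distribution_fun u0 (x - d)" for x
  interpret H: hopf_lax "\<lambda>p. g p + \<sigma> * p" "\<lambda>p. g' p + \<sigma>" 0 b A
  proof unfold_locales
    show "((\<lambda>p. g p + \<sigma> * p) has_real_derivative g' k + \<sigma>) (at k)" for k
      by (auto intro!: derivative_eq_intros g.DERIV_g)
    show "continuous_on UNIV (\<lambda>p. g' p + \<sigma>)" by (intro continuous_intros g.cont_g')
  qed (use u.ab g.mono_g' u.U0_slope[of "x - d" "y - d" for x y] in \<open>auto simp: A_def\<close>)
  have hl: "hopf_lax (\<lambda>p. g p + \<sigma> * p) (\<lambda>p. g' p + \<sigma>) 0 b A" by unfold_locales
  have "H.HL t x \<le> distribution_fun (v t) x + 0 + 0 * t"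
  proof (rule v.comparison[OF hl, where Y = "R + \<bar>d\<bar> + 1"])
    show "A z \<le> distribution_fun v0 z + 0" for z using shift[of z] by (simp add: A_def)
    show "A z = 0" if "z \<le> - (R + \<bar>d\<bar> + 1)" for z unfolding A_def by (rule u.U0_left) (use that in linarith)
    show "A z = (LINT y|lborel. v0 y)" if "R + \<bar>d\<bar> + 1 \<le> z" for z
      unfolding A_def total[symmetric] by (rule u.U0_right) (use that in linarith)
  qed (use u.ab g Gg t in auto)
  moreover obtain k where k: "H.HL t x = A (x - t * (g' k + \<sigma>)) + t * H.legendre k" using H.HL_attained by blast
  moreover have "distribution_fun (u t) (x - d - t * \<sigma>) \<le> distribution_fun u0 ((x - d - t * \<sigma>) - t * g' k) + t * H.legendre k"
  proof (rule u.upper_bound[OF _ t])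
    fix p assume "p \<in> {0..b}"
    then show "g' k * p - F p \<le> H.legendre k" using Fg[of p] g.legendre_ge[of p k] unfolding H.legendre_def g.legendre_def by (simp add: algebra_simps)
  qed
  ultimately show ?thesis by (simp add: A_def algebra_simps)
qed

section \<open>Wasserstein distances\<close>

locale continuous_cdf =
  fixes u :: "real \<Rightarrow> real" and X :: real
  assumes mono_cdf: "\<And>x y. x \<le> y \<Longrightarrow> distribution_fun u x \<le> distribution_fun u y"
    and cdf_left: "\<And>x. x \<le> - X \<Longrightarrow> distribution_fun u x = 0"
    and cdf_right: "\<And>x. X \<le> x \<Longrightarrow> distribution_fun u x = 1"
    and cdf_measurable: "distribution_fun u \<in> borel_measurable borel"
begin

lemma cdf_ge: "0 \<le> \<xi> \<Longrightarrow> \<xi> < distribution_fun u x \<Longrightarrow> - X \<le> x"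
  using cdf_left[of x] by linarith

lemma quantile_le: "0 \<le> \<xi> \<Longrightarrow> \<xi> < distribution_fun u x \<Longrightarrow> quantile_fun u \<xi> \<le> x"
  unfolding quantile_fun_def by (rule cInf_lower) (auto intro!: bdd_belowI[of _ "- X"] cdf_ge)

lemma less_cdf: "\<xi> < 1 \<Longrightarrow> quantile_fun u \<xi> < x \<Longrightarrow> \<xi> < distribution_fun u x"
proof -
  assume "\<xi> < 1" and q: "quantile_fun u \<xi> < x"
  then have "X \<in> {x. distribution_fun u x > \<xi>}" using cdf_right[of X] by simp
  then obtain y where "\<xi> < distribution_fun u y" "y < x"
    using cInf_lessD[OF _ q[unfolded quantile_fun_def]] by blast
  then show ?thesis using mono_cdf[of y x] by linarith
qed

lemma quantile_bounds: "0 \<le> \<xi> \<Longrightarrow> \<xi> < 1 \<Longrightarrow> - X \<le> quantile_fun u \<xi> \<and> quantile_fun u \<xi> \<le> X"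
  using quantile_le[of \<xi> X] cdf_right[of X] cdf_ge[of \<xi>] less_cdf[of \<xi>] dense_ge[of "quantile_fun u \<xi>" "- X"] by force

text \<open>The quantile function is monotone on [0, 1). Extended by -X to the left and X to the
  right it is monotone on the line, hence Borel.\<close>

lemma quantile_measurable: "(\<lambda>\<xi>. if \<xi> < 0 then - X else if \<xi> < 1 then quantile_fun u \<xi> else X) \<in> borel_measurable borel"
proof (rule borel_measurable_mono, rule monoI)
  fix \<xi> \<zeta> :: real assume le: "\<xi> \<le> \<zeta>"
  have X: "- X \<le> X" using quantile_bounds[of 0] by simp
  have "quantile_fun u \<xi> \<le> quantile_fun u \<zeta>" if "0 \<le> \<xi>" "\<zeta> < 1"
  proof (rule dense_ge)
    fix y assume "quantile_fun u \<zeta> < y"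
    then show "quantile_fun u \<xi> \<le> y" using less_cdf[of \<zeta> y] that le by (intro quantile_le) auto
  qed
  then show "(if \<xi> < 0 then - X else if \<xi> < 1 then quantile_fun u \<xi> else X)
      \<le> (if \<zeta> < 0 then - X else if \<zeta> < 1 then quantile_fun u \<zeta> else X)"
    using le X quantile_bounds[of \<xi>] quantile_bounds[of \<zeta>] by auto
qed

end

text \<open>Generalized inverses reverse the order of distribution functions. Points y above the
  right side are used, as the infimum in the quantile may not be attained.\<close>

lemma quantile_shift:
  assumes u: "continuous_cdf u X" and v: "continuous_cdf v Y"
    and "\<And>x. distribution_fun v (x - d) \<le> distribution_fun u x" and \<xi>: "0 \<le> \<xi>" "\<xi> < 1"
  shows "quantile_fun u \<xi> \<le> quantile_fun v \<xi> + d"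
proof (rule dense_ge)
  fix y assume "quantile_fun v \<xi> + d < y"
  then have "\<xi> < distribution_fun v (y - d)" by (intro continuous_cdf.less_cdf[OF v \<xi>(2)]) simp
  then show "quantile_fun u \<xi> \<le> y" using assms(3)[of y] by (intro continuous_cdf.quantile_le[OF u \<xi>(1)]) simp
qed

text \<open>Both sides are the area enclosed by the two graphs.\<close>
lemma quantile_L1_le:
  assumes u: "continuous_cdf u X" and v: "continuous_cdf v Y"
  shows "(\<integral>\<^sup>+\<xi>. ennreal \<bar>quantile_fun u \<xi> - quantile_fun v \<xi>\<bar> * indicator {0..<1} \<xi> \<partial>lborel)
    \<le> (\<integral>\<^sup>+x. ennreal \<bar>distribution_fun u x - distribution_fun v x\<bar> \<partial>lborel)"
proof -
  let ?U = "distribution_fun u" and ?V = "distribution_fun v"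
  note [measurable] = continuous_cdf.cdf_measurable[OF u] continuous_cdf.cdf_measurable[OF v]
  define A where "A = {z. ?V (fst z) \<le> snd z \<and> snd z < ?U (fst z) \<or> ?U (fst z) \<le> snd z \<and> snd z < ?V (fst z)}"
  have A[measurable]: "A \<in> sets (lborel \<Otimes>\<^sub>M lborel)"
  proof -
    have "Measurable.pred (borel \<Otimes>\<^sub>M borel) (\<lambda>z. ?V (fst z) \<le> snd z \<and> snd z < ?U (fst z) \<or> ?U (fst z) \<le> snd z \<and> snd z < ?V (fst z))"
      by measurable
    then show ?thesis unfolding A_def pred_def by (simp add: space_pair_measure cong: sets_pair_measure_cong)
  qed
  have "(\<integral>\<^sup>+\<xi>. ennreal \<bar>quantile_fun u \<xi> - quantile_fun v \<xi>\<bar> * indicator {0..<1} \<xi> \<partial>lborel)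
    \<le> (\<integral>\<^sup>+\<xi>. (\<integral>\<^sup>+x. indicator A (x, \<xi>) \<partial>lborel) \<partial>lborel)"
  proof (rule nn_integral_mono)
    fix \<xi> :: real
    show "ennreal \<bar>quantile_fun u \<xi> - quantile_fun v \<xi>\<bar> * indicator {0..<1} \<xi> \<le> (\<integral>\<^sup>+x. indicator A (x, \<xi>) \<partial>lborel)"
    proof (cases "\<xi> \<in> {0..<1}")
      case True
      then have \<xi>: "0 \<le> \<xi>" "\<xi> < 1" by auto
      let ?l = "min (quantile_fun u \<xi>) (quantile_fun v \<xi>)" and ?r = "max (quantile_fun u \<xi>) (quantile_fun v \<xi>)"
      have "ennreal \<bar>quantile_fun u \<xi> - quantile_fun v \<xi>\<bar> = emeasure lborel {?l<..<?r}"
        by (simp add: min_def max_def)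
      also have "\<dots> = (\<integral>\<^sup>+x. indicator {?l<..<?r} x \<partial>lborel)" by simp
      also have "\<dots> \<le> (\<integral>\<^sup>+x. indicator A (x, \<xi>) \<partial>lborel)"
      proof (rule nn_integral_mono)
        fix x
        have "(x, \<xi>) \<in> A" if x: "x \<in> {?l<..<?r}"
        proof (cases "quantile_fun u \<xi> < quantile_fun v \<xi>")
          case True
          then have "quantile_fun u \<xi> < x" "x < quantile_fun v \<xi>" using x by auto
          then have "\<xi> < distribution_fun u x" "\<not> \<xi> < distribution_fun v x"
            using continuous_cdf.less_cdf[OF u \<xi>(2), of x] continuous_cdf.quantile_le[OF v \<xi>(1), of x] by auto
          then show ?thesis by (auto simp: A_def)
        next
          case False
          then have "quantile_fun v \<xi> < x" "x < quantile_fun u \<xi>" using x by auto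
          then have "\<xi> < distribution_fun v x" "\<not> \<xi> < distribution_fun u x"
            using continuous_cdf.less_cdf[OF v \<xi>(2), of x] continuous_cdf.quantile_le[OF u \<xi>(1), of x] by auto
          then show ?thesis by (auto simp: A_def)
        qed
        then show "indicator {?l<..<?r} x \<le> (indicator A (x, \<xi>) :: ennreal)" by (auto simp: indicator_def)
      qed
      finally show ?thesis using True by simp
    qed simp
  qed
  also have "\<dots> = (\<integral>\<^sup>+x. (\<integral>\<^sup>+\<xi>. indicator A (x, \<xi>) \<partial>lborel) \<partial>lborel)"
    by (rule lborel_pair.Fubini') simp
  also have "\<dots> = (\<integral>\<^sup>+x. ennreal \<bar>?U x - ?V x\<bar> \<partial>lborel)"
  proof (rule nn_integral_cong)
    fix x
    have "(\<integral>\<^sup>+\<xi>. indicator A (x, \<xi>) \<partial>lborel) = (\<integral>\<^sup>+\<xi>. indicator {min (?U x) (?V x)..<max (?U x) (?V x)} \<xi> \<partial>lborel)"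
      by (intro nn_integral_cong) (auto simp: A_def indicator_def)
    also have "\<dots> = ennreal \<bar>?U x - ?V x\<bar>" by (simp add: min_def max_def)
    finally show "(\<integral>\<^sup>+\<xi>. indicator A (x, \<xi>) \<partial>lborel) = ennreal \<bar>?U x - ?V x\<bar>" .
  qed
  finally show ?thesis .
qed

text \<open>With D = C d the difference g of the quantiles satisfies |g|^r \<le> D^(r-1) |g|, and
  the integral of |g| is at most C d^2 = D d. The r-th root of D^r d is C d^(1 + 1/r), so the
  constant C is the same for all exponents.\<close>

lemma Wp_interpolation:
  assumes u: "continuous_cdf u X" and v: "continuous_cdf v Y"
    and inf: "\<And>\<xi>. 0 \<le> \<xi> \<Longrightarrow> \<xi> < 1 \<Longrightarrow> \<bar>quantile_fun u \<xi> - quantile_fun v \<xi>\<bar> \<le> C * d"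
    and one: "(\<integral>\<^sup>+x. ennreal \<bar>distribution_fun u x - distribution_fun v x\<bar> \<partial>lborel) \<le> ennreal (C * d\<^sup>2)"
    and C: "0 < C" and d: "0 < d" and p: "1 \<le> p"
  shows "Wp p u v \<le> ennreal (C * d powr (1 + enn2real (1 / p)))"
proof -
  define g where "g \<xi> = quantile_fun u \<xi> - quantile_fun v \<xi>" for \<xi>
  have g[measurable]: "g \<in> borel_measurable (restrict_space lborel {0..1})"
  proof -
    let ?q = "\<lambda>u X \<xi>. if \<xi> < 0 then - X else if \<xi> < 1 then quantile_fun u \<xi> else X"
    note [measurable] = continuous_cdf.quantile_measurable[OF u] continuous_cdf.quantile_measurable[OF v]
    have "(\<lambda>\<xi>. if \<xi> = 1 then g 1 else ?q u X \<xi> - ?q v Y \<xi>) \<in> borel_measurable borel" by measurable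
    then have "(\<lambda>\<xi>. if \<xi> = 1 then g 1 else ?q u X \<xi> - ?q v Y \<xi>) \<in> borel_measurable (restrict_space lborel {0..1})"
      by (intro measurable_restrict_space1) simp
    then show ?thesis
      by (rule measurable_cong[THEN iffD1, rotated]) (auto simp: space_restrict_space g_def)
  qed
  have ae: "AE \<xi> in restrict_space lborel {0..1}. \<xi> < 1 \<and> 0 \<le> (\<xi>::real)"
  proof -
    have "AE \<xi> in lborel. \<xi> \<in> {0..1} \<longrightarrow> \<xi> < 1 \<and> 0 \<le> (\<xi>::real)"
      using AE_lborel_singleton[of "1::real"] by eventually_elim auto
    then show ?thesis by (subst AE_restrict_space_iff) auto
  qed
  show ?thesis
  proof (cases "p = \<infinity>")
    case True
    have "Linf_norm (restrict_space lborel {0..1}) g \<le> ennreal (C * d)"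
      unfolding Linf_norm_def
    proof (rule esssup_I)
      show "AE \<xi> in restrict_space lborel {0..1}. ennreal \<bar>g \<xi>\<bar> \<le> ennreal (C * d)"
        using ae by eventually_elim (auto simp: g_def intro!: ennreal_leI inf)
    qed measurable
    then show ?thesis using True d by (simp add: Wp_def Lp_norm_def g_def[abs_def])
  next
    case False
    then obtain r where r: "p = ennreal r" "0 \<le> r" by (cases p) (auto simp: top_ennreal_def infinity_ennreal_def)
    have r1: "1 \<le> r" using p r by (simp flip: ennreal_1)
    define D where "D = C * d"
    have D: "0 < D" using C d by (simp add: D_def)
    define I where "I = (\<integral>\<^sup>+\<xi>. ennreal (\<bar>g \<xi>\<bar> powr r) \<partial>restrict_space lborel {0..1})"
    have "I \<le> (\<integral>\<^sup>+\<xi>. ennreal (D powr (r - 1)) * ennreal \<bar>g \<xi>\<bar> \<partial>restrict_space lborel {0..1})"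
      unfolding I_def
    proof (rule nn_integral_mono_AE)
      show "AE \<xi> in restrict_space lborel {0..1}. ennreal (\<bar>g \<xi>\<bar> powr r) \<le> ennreal (D powr (r - 1)) * ennreal \<bar>g \<xi>\<bar>"
        using ae
      proof eventually_elim
        fix \<xi> :: real assume \<xi>: "\<xi> < 1 \<and> 0 \<le> \<xi>"
        have "\<bar>g \<xi>\<bar> powr r = \<bar>g \<xi>\<bar> powr (r - 1) * \<bar>g \<xi>\<bar>"
          using powr_add[of "\<bar>g \<xi>\<bar>" "r - 1" 1] by (cases "g \<xi> = 0") auto
        also have "\<dots> \<le> D powr (r - 1) * \<bar>g \<xi>\<bar>"
          using inf[of \<xi>] \<xi> r1 by (intro mult_right_mono powr_mono2) (auto simp: g_def D_def)
        finally show "ennreal (\<bar>g \<xi>\<bar> powr r) \<le> ennreal (D powr (r - 1)) * ennreal \<bar>g \<xi>\<bar>"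
          by (subst ennreal_mult[symmetric]) (auto intro: ennreal_leI)
      qed
    qed
    also have "\<dots> = ennreal (D powr (r - 1)) * (\<integral>\<^sup>+\<xi>. ennreal \<bar>g \<xi>\<bar> \<partial>restrict_space lborel {0..1})"
      by (rule nn_integral_cmult) measurable
    also have "(\<integral>\<^sup>+\<xi>. ennreal \<bar>g \<xi>\<bar> \<partial>restrict_space lborel {0..1}) = (\<integral>\<^sup>+\<xi>. ennreal \<bar>g \<xi>\<bar> * indicator {0..<1} \<xi> \<partial>lborel)"
    proof -
      have "(\<integral>\<^sup>+\<xi>. ennreal \<bar>g \<xi>\<bar> \<partial>restrict_space lborel {0..1}) = (\<integral>\<^sup>+\<xi>. ennreal \<bar>g \<xi>\<bar> * indicator {0..1} \<xi> \<partial>lborel)"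
        by (rule nn_integral_restrict_space) simp
      also have "\<dots> = (\<integral>\<^sup>+\<xi>. ennreal \<bar>g \<xi>\<bar> * indicator {0..<1} \<xi> \<partial>lborel)"
      proof (rule nn_integral_cong_AE)
        show "AE \<xi> in lborel. ennreal \<bar>g \<xi>\<bar> * indicator {0..1} \<xi> = ennreal \<bar>g \<xi>\<bar> * indicator {0..<1} \<xi>"
          using AE_lborel_singleton[of "1::real"] by eventually_elim (auto simp: indicator_def)
      qed
      finally show ?thesis .
    qed
    also have "ennreal (D powr (r - 1)) * (\<integral>\<^sup>+\<xi>. ennreal \<bar>g \<xi>\<bar> * indicator {0..<1} \<xi> \<partial>lborel) \<le> ennreal (D powr (r - 1)) * ennreal (C * d\<^sup>2)"
      by (rule mult_left_mono) (use order_trans[OF quantile_L1_le[OF u v] one] in \<open>simp_all add: g_def\<close>)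
    also have "\<dots> = ennreal (D powr (r - 1) * (C * d\<^sup>2))" using C by (simp add: ennreal_mult)
    also have "D powr (r - 1) * (C * d\<^sup>2) = D powr r * d"
      using powr_add[of D "r - 1" 1] D by (simp add: D_def power2_eq_square)
    finally have I: "I \<le> ennreal (D powr r * d)" .
    have I': "I \<noteq> \<infinity>" using I by (metis ennreal_less_top infinity_ennreal_def leD top.not_eq_extremum)
    have "enn2real I \<le> D powr r * d" using I d D by (intro enn2real_leI) auto
    then have "enn2real I powr (1 / r) \<le> (D powr r * d) powr (1 / r)" using r1 by (intro powr_mono2) auto
    also have "\<dots> = D * d powr (1 / r)" using r1 D d by (simp add: powr_mult powr_powr)
    also have "\<dots> = C * d powr (1 + 1 / r)" using d by (simp add: D_def powr_add)
    finally have "ennreal (enn2real I powr (1 / r)) \<le> ennreal (C * d powr (1 + 1 / r))" by (rule ennreal_leI)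
    moreover have "Wp p u v = ennreal (enn2real I powr (1 / r))"
      using False I' r by (simp add: Wp_def Lp_norm_def I_def g_def Let_def)
    moreover have "enn2real (1 / p) = 1 / r" using r r1 by (simp add: divide_ennreal flip: ennreal_1)
    ultimately show ?thesis by simp
  qed
qed

lemma distribution_fun_cong_AE:
  assumes "u \<in> borel_measurable borel" "w \<in> borel_measurable borel" "AE x in lborel. u x = w x"
  shows "distribution_fun u = distribution_fun w"
proof
  fix x
  note [measurable] = assms(1,2)
  show "distribution_fun u x = distribution_fun w x"
    unfolding distribution_fun_def set_lebesgue_integral_def
  proof (rule integral_cong_AE)
    show "AE y in lborel. indicator {..x} y *\<^sub>R u y = indicator {..x} y *\<^sub>R w y"
      using assms(3) by eventually_elim simp
  qed measurable
qed

text \<open>The distance depends only on classes modulo null sets, so it is computed with the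
  normalized representatives, whose bounded supports settle the moment condition.\<close>

lemma W1_of_bounded_support:
  assumes u[measurable]: "u \<in> borel_measurable borel" and v[measurable]: "v \<in> borel_measurable borel"
    and w[measurable]: "w \<in> borel_measurable borel" and z[measurable]: "z \<in> borel_measurable borel"
    and uw: "AE x in lborel. u x = w x" and vz: "AE x in lborel. v x = z x"
    and B: "\<And>x. \<bar>w x\<bar> \<le> B" "\<And>x. \<bar>z x\<bar> \<le> B" and X: "\<And>x. X < \<bar>x\<bar> \<Longrightarrow> w x = 0" "\<And>x. X < \<bar>x\<bar> \<Longrightarrow> z x = 0"
    and eq: "(LINT x|lborel. w x) = (LINT x|lborel. z x)"
  shows "W1_defined u v" "W1 u v = (\<integral>\<^sup>+x. ennreal \<bar>distribution_fun w x - distribution_fun z x\<bar> \<partial>lborel)"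
proof -
  have iw: "integrable lborel w" and iz: "integrable lborel z"
    by (rule integrable_bounded_support[OF _ B(1) X(1)]; simp) (rule integrable_bounded_support[OF _ B(2) X(2)]; simp)
  have iu: "integrable lborel u" and iv: "integrable lborel v"
    using integrable_cong_AE[OF _ _ uw] integrable_cong_AE[OF _ _ vz] iw iz by auto
  have I: "(LINT x|lborel. u x) = (LINT x|lborel. w x)" "(LINT x|lborel. v x) = (LINT x|lborel. z x)"
    by (rule integral_cong_AE; use uw vz in simp)+
  have "integrable lborel (\<lambda>x. \<bar>x\<bar> * \<bar>w x - z x\<bar>)"
  proof (rule integrable_bounded_support[where B = "\<bar>X\<bar> * (2 * B)" and R = X])
    fix x
    show "\<bar>\<bar>x\<bar> * \<bar>w x - z x\<bar>\<bar> \<le> \<bar>X\<bar> * (2 * B)"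
    proof (cases "X < \<bar>x\<bar>")
      case True then show ?thesis using X B(1)[of x] by simp
    next
      case False
      then show ?thesis using B(1)[of x] B(2)[of x] unfolding abs_mult abs_abs by (intro mult_mono) auto
    qed
  qed (use X in auto)
  moreover have "AE x in lborel. \<bar>x\<bar> * \<bar>w x - z x\<bar> = \<bar>x\<bar> * \<bar>u x - v x\<bar>" using uw vz by eventually_elim simp
  ultimately have "integrable lborel (\<lambda>x. \<bar>x\<bar> * \<bar>u x - v x\<bar>)"
    by (subst (asm) integrable_cong_AE) auto
  then show "W1_defined u v" unfolding W1_defined_def using iu iv I eq by simp
  have "(LINT y:{..x}|lborel. u y - v y) = distribution_fun w x - distribution_fun z x" for x
    unfolding distribution_fun_cong_AE[OF u w uw, symmetric] distribution_fun_cong_AE[OF v z vz, symmetric] distribution_fun_def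
    by (rule set_integral_diff(2); unfold set_integrable_def; rule integrable_mult_indicator; use iu iv in simp)
  then show "W1 u v = (\<integral>\<^sup>+x. ennreal \<bar>distribution_fun w x - distribution_fun z x\<bar> \<partial>lborel)"
    by (simp add: W1_def)
qed

lemma closed_supp: "closed (supp v)"
  unfolding closed_def
proof (rule openI)
  fix x assume "x \<in> - supp v"
  then obtain e where e: "0 < e" "AE y in lborel. y \<in> ball x e \<longrightarrow> v y = 0" by (auto simp: supp_def)
  have "ball x (e / 2) \<subseteq> - supp v"
  proof
    fix w assume "w \<in> ball x (e / 2)"
    then have "y \<in> ball x e" if "y \<in> ball w (e / 2)" for y
      using that dist_triangle[of x y w] unfolding mem_ball by linarith
    then have "ball w (e / 2) \<subseteq> ball x e" by blast
    then have "AE y in lborel. y \<in> ball w (e / 2) \<longrightarrow> v y = 0" using e(2) by (auto elim!: eventually_mono)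
    then show "w \<in> - supp v" using e(1) by (auto simp: supp_def intro!: exI[of _ "e / 2"])
  qed
  then show "\<exists>e>0. ball x e \<subseteq> - supp v" using e(1) by (intro exI[of _ "e / 2"]) auto
qed

lemma mem_\<B>I:
  assumes u: "u \<in> borel_measurable borel" and w: "w \<in> borel_measurable borel" and uw: "AE x in lborel. u x = w x"
    and B: "\<And>x. 0 \<le> w x \<and> w x \<le> B" and X: "\<And>x. X < \<bar>x\<bar> \<Longrightarrow> w x = 0" and one: "(LINT x|lborel. w x) = 1"
  shows "u \<in> \<B>"
proof -
  note [measurable] = u w
  have "Linf_norm lborel u \<le> ennreal B" unfolding Linf_norm_def
  proof (rule esssup_I)
    show "AE x in lborel. ennreal \<bar>u x\<bar> \<le> ennreal B"
      using uw by eventually_elim (use B in \<open>auto intro!: ennreal_leI\<close>)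
  qed measurable
  then have "Linf_norm lborel u < \<infinity>" by (rule order_le_less_trans) simp
  moreover have "AE x in lborel. 0 \<le> u x" using uw by eventually_elim (use B in auto)
  moreover have "supp u \<subseteq> {-X..X}"
  proof
    fix x assume x: "x \<in> supp u"
    show "x \<in> {-X..X}"
    proof (rule ccontr)
      assume "x \<notin> {-X..X}"
      then have "X < \<bar>x\<bar>" by auto
      then have "AE y in lborel. y \<in> ball x (\<bar>x\<bar> - X) \<longrightarrow> u y = 0"
        using uw by eventually_elim (use X in \<open>force simp: dist_real_def\<close>)
      then show False using x \<open>X < \<bar>x\<bar>\<close> unfolding supp_def by (auto dest!: spec[of _ "\<bar>x\<bar> - X"])
    qed
  qed
  then have "compact (supp u)" using closed_supp compact_Icc by (metis closed_Int_compact inf.absorb_iff1)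
  moreover have "(LINT x|lborel. u x) = (LINT x|lborel. w x)" by (rule integral_cong_AE) (use uw in auto)
  ultimately show ?thesis using one u by (simp add: \<B>_def)
qed

lemma nn_integral_bounded_support:
  fixes D :: "real \<Rightarrow> real"
  assumes cont: "continuous_on UNIV D" and Z: "\<And>x. Z < \<bar>x\<bar> \<Longrightarrow> D x = 0"
  shows "(\<integral>\<^sup>+x. ennreal \<bar>D x\<bar> \<partial>lborel) = ennreal (integral {-Z..Z} (\<lambda>x. \<bar>D x\<bar>))"
proof -
  have D[measurable]: "D \<in> borel_measurable borel" using cont by (rule borel_measurable_continuous_onI)
  have "bounded (D ` {-Z..Z})" by (intro compact_imp_bounded compact_continuous_image continuous_on_subset[OF cont]) auto
  then obtain B where "\<forall>y\<in>D ` {-Z..Z}. norm y \<le> B" unfolding bounded_iff by blast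
  then have B: "\<bar>D x\<bar> \<le> B" if "x \<in> {-Z..Z}" for x using that by auto
  have i: "integrable lborel (\<lambda>x. \<bar>D x\<bar>)"
  proof (rule integrable_bounded_support[where B = "\<bar>B\<bar>" and R = Z])
    show "\<bar>\<bar>D x\<bar>\<bar> \<le> \<bar>B\<bar>" for x using B[of x] Z[of x] by (cases "x \<in> {-Z..Z}") (auto simp: abs_le_iff)
  qed (use Z in auto)
  have "((\<lambda>x. \<bar>D x\<bar>) has_integral (LINT x|lborel. \<bar>D x\<bar>)) UNIV" by (rule has_integral_integral_lborel[OF i])
  then have "((\<lambda>x. if x \<in> {-Z..Z} then \<bar>D x\<bar> else 0) has_integral (LINT x|lborel. \<bar>D x\<bar>)) UNIV"
    by (rule has_integral_eq[rotated]) (use Z in force)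
  then have "integral {-Z..Z} (\<lambda>x. \<bar>D x\<bar>) = (LINT x|lborel. \<bar>D x\<bar>)"
    by (intro integral_unique) (simp only: has_integral_restrict_UNIV)
  then show ?thesis using nn_integral_eq_integral[OF i] by simp
qed

section \<open>Error bounds\<close>

lemma abs_diff_le:
  fixes a b h e e' :: real
  assumes "h \<le> a + e + e'" "h \<le> b + e + e'" shows "\<bar>a - b\<bar> \<le> (a - h) + (b - h) + 2 * (e + e')"
  unfolding abs_le_iff using assms by auto

lemma (in compact_sol) continuous_U: "0 \<le> t \<Longrightarrow> continuous_on A (U t)"
  using Lipschitz2_continuous[where H = "\<lambda>(s::real) x. U t x" and C = K and p = "\<lambda>_. 0" and q = "\<lambda>x. x" and A = A]
    order_trans[OF U_Lipschitz_space[of t] mult_left_mono[OF _ K0]] by (auto simp: continuous_on_id continuous_on_const)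

lemma (in compact_sol) U_right: "0 \<le> t \<Longrightarrow> X t \<le> x \<Longrightarrow> U t x = (LINT y|lborel. u0 y)"
  using U_far[of t x] U0_right[of x] R_le_X[of t] by linarith

lemma (in compact_sol) cdf:
  assumes a: "a = 0" and one: "(LINT x|lborel. u0 x) = 1" and t: "0 \<le> t"
  shows "continuous_cdf (u t) (X t)"
proof
  fix x y :: real assume "x \<le> y"
  then show "U t x \<le> U t y" using U_slope[OF t] a by fastforce
qed (use U_left[OF t] U_right[OF t] one continuous_U[OF t] in \<open>auto intro: borel_measurable_continuous_onI\<close>)

text \<open>Nodes of the interpolation may lie up to \<delta> \<le> M + 1 outside [-M, M]; therefore
  \<open>B\<close> bounds the derivatives of \<open>f\<close> on the larger interval from -(2 M + 2)
  to 2 M + 2. \<open>k\<close> is the constant in \<delta> = O(\<Delta>x).\<close>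

locale front_tracking = osl_datum u0 c M R + smooth_convex f f' f''
  for u0 :: "real \<Rightarrow> real" and c M R :: real and f f' f'' :: "real \<Rightarrow> real" +
  fixes \<delta> dx k B T :: real
  assumes \<delta>: "0 < \<delta>" "\<delta> \<le> k * dx" "\<delta> \<le> M + 1" and dx: "0 < dx" and k: "0 \<le> k" and T: "0 \<le> T"
    and B: "0 \<le> B" "\<And>p. p \<in> {-(2 * M + 2)..2 * M + 2} \<Longrightarrow> \<bar>f' p\<bar> \<le> B"
      "\<And>p. p \<in> {-(2 * M + 2)..2 * M + 2} \<Longrightarrow> \<bar>f'' p\<bar> \<le> B"
begin

abbreviation "\<v> \<equiv> cell_average dx u0"

text \<open>Subtracting \<open>f 0\<close> leaves the entropy inequality unchanged, which only sees
  differences of the flux, and makes the flux of a compactly supported solution compactly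
  supported.\<close>

definition F where "F p = f p - f 0"
definition G where "G p = flux_interp f \<delta> p - f 0"

lemma B_range: "\<bar>p\<bar> \<le> M \<Longrightarrow> \<bar>p\<bar> + \<delta> \<le> 2 * M + 2" using \<delta> M0 by linarith

lemma DERIV_F: "(F has_real_derivative f' p) (at p)"
  using DERIV_diff[OF DERIV_f DERIV_const] by (simp add: F_def[abs_def])

lemma F_le_G: "F p \<le> G p" using interp_ge[OF \<delta>(1)] by (simp add: F_def G_def)

lemma G_le: "\<bar>p\<bar> \<le> M \<Longrightarrow> G p \<le> F p + B * \<delta>\<^sup>2" "0 \<le> p \<Longrightarrow> p \<le> M \<Longrightarrow> G p \<le> F p + B * \<delta> * p"
  using interp_le[of \<delta> "2 * M + 2" B p, OF \<delta>(1) B(3,1) B_range] M0 by (simp_all add: F_def G_def)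

lemma F_Lip: "p \<in> {-M..M} \<Longrightarrow> q \<in> {-M..M} \<Longrightarrow> \<bar>F p - F q\<bar> \<le> B * \<bar>p - q\<bar>"
  using bound_Lipschitz[of f f' "-(2 * M + 2)" "2 * M + 2" B p q, OF DERIV_f B(2)] M0 by (simp add: F_def)

lemma G_Lip: "p \<in> {-M..M} \<Longrightarrow> q \<in> {-M..M} \<Longrightarrow> \<bar>G p - G q\<bar> \<le> B * \<bar>p - q\<bar>"
  using interp_Lipschitz[OF \<delta>(1) B(2) B_range B_range, of p q] by (simp add: G_def abs_le_iff)

text \<open>The choice a = 0 is for nonnegative data, whose primitives are monotone; a = -M serves
  the general case.\<close>

lemma solutions_normalize:
  assumes u: "entropy_solution f u0 u" and v: "entropy_solution (flux_interp f \<delta>) \<v> v" and a: "a = - M \<or> a = 0"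
    and pos: "a = 0 \<Longrightarrow> (\<forall>x. 0 \<le> u0 x)"
  obtains w z where "compact_sol F u0 w a M R B" "compact_sol G \<v> z a M (R + dx) B"
    "\<And>t. 0 \<le> t \<Longrightarrow> AE x in lborel. u t x = w t x" "\<And>t. 0 \<le> t \<Longrightarrow> AE x in lborel. v t x = z t x"
proof -
  have u0: "a \<le> u0 x \<and> u0 x \<le> M" for x using a pos bounded[of x] by (auto simp: abs_le_iff)
  have aM: "a \<le> 0" "p \<in> {a..M} \<Longrightarrow> p \<in> {-M..M}" for p using a M0 by auto
  obtain w where w: "compact_sol F u0 w a M R B" "\<And>t. 0 \<le> t \<Longrightarrow> AE x in lborel. u t x = w t x"
  proof (rule entropy_solution_normalize[of F u0 u a M R B])
    show "entropy_solution F u0 u" using entropy_solution_shift_flux[OF u] by (simp add: F_def[abs_def])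
    show "\<exists>L. \<forall>p\<in>{-r..r}. \<forall>q\<in>{-r..r}. \<bar>F p - F q\<bar> \<le> L * \<bar>p - q\<bar>" for r using f_Lipschitz[of r] by (simp add: F_def)
  qed (use u0 aM M0 B(1) R0 support F_Lip in \<open>auto simp: F_def\<close>)
  obtain z where z: "compact_sol G \<v> z a M (R + dx) B" "\<And>t. 0 \<le> t \<Longrightarrow> AE x in lborel. v t x = z t x"
  proof (rule entropy_solution_normalize[of G \<v> v a M "R + dx" B])
    show "entropy_solution G \<v> v" using entropy_solution_shift_flux[OF v] by (simp add: G_def[abs_def])
    show "\<exists>L. \<forall>p\<in>{-r..r}. \<forall>q\<in>{-r..r}. \<bar>G p - G q\<bar> \<le> L * \<bar>p - q\<bar>" for r
    proof -
      obtain L where "\<And>p. p \<in> {-(r + \<delta>)..r + \<delta>} \<Longrightarrow> \<bar>f' p\<bar> \<le> L" using derivative_bounds[of "r + \<delta>"] by metis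
      then have "\<bar>flux_interp f \<delta> p - flux_interp f \<delta> q\<bar> \<le> L * \<bar>p - q\<bar>" if "p \<in> {-r..r}" "q \<in> {-r..r}" for p q
        by (rule interp_Lipschitz[OF \<delta>(1), where r = "r + \<delta>"]) (use that in auto)
      then show ?thesis by (intro exI[of _ L]) (simp add: G_def)
    qed
  qed (use cell_average_bounds[OF dx u0] aM M0 B(1) R0 dx v0_support[OF dx] G_Lip in \<open>auto simp: G_def interp_0[OF \<delta>(1)]\<close>)
  show thesis by (rule that[OF w(1) z(1) w(2) z(2)])
qed

text \<open>For \<Delta>x \<le> 1 both primitives agree outside [-Z, Z].\<close>

definition "Z = R + 3 + (B + 1) * T"
text \<open>The flux error divided by \<open>dx\<^sup>2\<close>: the interpolation contributes
  \<open>B * k\<^sup>2\<close> since \<delta> \<le> k dx, the quadratic term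
  \<open>M\<^sup>2 / 2\<close>.\<close>

definition "\<eta> = B * k\<^sup>2 + M\<^sup>2 / 2"
text \<open>In the first summand \<open>20 * c * (R + 3)\<close> bounds the integral of the initial
  error, counted for both solutions, and the last factor is the expansion bound of the foot points.
  The next two collect the errors of flux and data over [-Z, Z]; the last summand is for
  \<open>L1_coarse\<close>.\<close>

definition "C1 = 40 * c * (R + 3) * (1 + T * (B + 1) * (3 * c)) + 8 * Z * \<eta> * T + 24 * Z * c + 16 * M * Z\<^sup>2"

lemma constants_nonneg: "0 < Z" "0 \<le> \<eta>" "0 \<le> C1" "0 \<le> (B + 1) * T"
proof -
  show 1: "0 \<le> (B + 1) * T" using B T by simp
  show 2: "0 < Z" using 1 R0 by (simp add: Z_def)
  show 3: "0 \<le> \<eta>" using B k by (simp add: \<eta>_def)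
  show "0 \<le> C1" unfolding C1_def using 2 3 c0 R0 B T M0 by (intro add_nonneg_nonneg mult_nonneg_nonneg) auto
qed

context
  fixes w z :: "real \<Rightarrow> real \<Rightarrow> real" and t :: real
  assumes w: "compact_sol F u0 w (-M) M R B" and z: "compact_sol G \<v> z (-M) M (R + dx) B"
    and t: "0 \<le> t" "t \<le> T"
begin

interpretation w: compact_sol F u0 w "-M" M R B by (rule w)
interpretation z: compact_sol G \<v> z "-M" M "R + dx" B by (rule z)

lemma widths: "w.X t \<le> R + dx + 2 + (B + 1) * T" "z.X t \<le> R + dx + 2 + (B + 1) * T"
proof -
  have "(B + 1) * t \<le> (B + 1) * T" by (rule mult_left_mono[OF t(2)]) (use B in simp)
  then show "w.X t \<le> R + dx + 2 + (B + 1) * T" "z.X t \<le> R + dx + 2 + (B + 1) * T"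
    unfolding w.X_def z.X_def using dx by linarith+
qed

lemma outside: assumes "R + dx + 2 + (B + 1) * T \<le> \<bar>x\<bar>" shows "w.U t x = z.U t x"
proof (cases "0 \<le> x")
  case True
  then show ?thesis using w.U_right[OF t(1), of x] z.U_right[OF t(1), of x] widths assms V0_total[OF dx] by simp
next
  case False
  then show ?thesis using w.U_left[OF t(1), of x] z.U_left[OF t(1), of x] widths assms by simp
qed

text \<open>For large \<Delta>x crude bounds suffice: the primitives differ only on an interval of
  half-width Z dx, and there by at most a multiple of its length, so the integral is quadratic in
  \<Delta>x.\<close>

lemma L1_coarse: assumes "1 \<le> dx"
  shows "(\<integral>\<^sup>+x. ennreal \<bar>w.U t x - z.U t x\<bar> \<partial>lborel) \<le> ennreal (C1 * dx\<^sup>2)"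
proof -
  define Z' where "Z' = Z * dx"
  have "R + 2 + (B + 1) * T \<le> (R + 2 + (B + 1) * T) * dx"
    using mult_left_mono[OF assms, of "R + 2 + (B + 1) * T"] R0 constants_nonneg(4) by simp
  then have Z': "R + dx + 2 + (B + 1) * T \<le> Z'" by (simp add: Z'_def Z_def algebra_simps)
  have Z0: "0 < Z'" using constants_nonneg dx by (simp add: Z'_def)
  have out: "w.U t x - z.U t x = 0" if "Z' < \<bar>x\<bar>" for x using outside[of x] that Z' by simp
  have le: "\<bar>w.U t x - z.U t x\<bar> \<le> 8 * M * Z'" if x: "x \<in> {-Z'..Z'}" for x
  proof -
    have "w.U t (-Z') = 0" "z.U t (-Z') = 0" using w.U_left[OF t(1), of "-Z'"] z.U_left[OF t(1), of "-Z'"] widths Z' by auto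
    then have "\<bar>w.U t x - z.U t x\<bar> \<le> w.K * \<bar>x - (-Z')\<bar> + z.K * \<bar>x - (-Z')\<bar>"
      using w.U_Lipschitz_space[OF t(1), of x "-Z'"] z.U_Lipschitz_space[OF t(1), of x "-Z'"] by linarith
    also have "\<dots> = 4 * M * \<bar>x - (-Z')\<bar>" using M0 by (simp add: w.K_def z.K_def)
    also have "\<dots> \<le> 4 * M * (2 * Z')" using x M0 by (intro mult_left_mono) auto
    finally show ?thesis by simp
  qed
  have c: "continuous_on A (\<lambda>x. w.U t x - z.U t x)" for A by (intro continuous_intros w.continuous_U z.continuous_U t)
  have "(\<integral>\<^sup>+x. ennreal \<bar>w.U t x - z.U t x\<bar> \<partial>lborel) = ennreal (integral {-Z'..Z'} (\<lambda>x. \<bar>w.U t x - z.U t x\<bar>))"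
    by (rule nn_integral_bounded_support[OF c out])
  also have "\<dots> \<le> ennreal (integral {-Z'..Z'} (\<lambda>x. 8 * M * Z'))"
    by (intro ennreal_leI integral_le le integrable_continuous_real continuous_on_rabs c continuous_on_const)
  also have "integral {-Z'..Z'} (\<lambda>x. 8 * M * Z') = 16 * M * Z\<^sup>2 * dx\<^sup>2"
    using Z0 by (simp add: Z'_def power2_eq_square)
  also have "ennreal \<dots> \<le> ennreal (C1 * dx\<^sup>2)"
    using constants_nonneg c0 R0 B T M0 unfolding C1_def
    by (intro ennreal_leI mult_right_mono) (auto intro!: add_nonneg_nonneg mult_nonneg_nonneg)
  finally show ?thesis .
qed

lemma L1_fine: assumes dx1: "dx \<le> 1"
  shows "(\<integral>\<^sup>+x. ennreal \<bar>w.U t x - z.U t x\<bar> \<partial>lborel) \<le> ennreal (C1 * dx\<^sup>2)"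
proof -
  let ?V0 = "distribution_fun \<v>"
  have R': "0 \<le> R + dx" using R0 dx by simp
  obtain W d where W: "\<And>x. (W has_real_derivative d x) (at x)" "\<And>x. -M \<le> d x \<and> d x \<le> M"
    "\<And>x y. x \<le> y \<Longrightarrow> d y - d x \<le> 3 * c * (y - x)"
    "\<And>x. W x \<le> ?V0 x + 4 * c * dx\<^sup>2"
    "\<And>x. ?V0 x - W x \<le> dx * (\<v> (x - dx) - \<v> (x + dx) + 6 * c * dx)"
    "\<And>x. x < - (R + dx) - dx \<Longrightarrow> W x = 0" "\<And>x. R + dx + dx \<le> x \<Longrightarrow> W x = (LINT y|lborel. \<v> y)"
    using one_sided_Lipschitz_average[OF cell_average_measurable abs_v0[OF dx] v0_support[OF dx] R' v0_osl[OF dx] c0 dx] by blast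
  \<comment> \<open>The factor is 4 for \<open>W\<close> against the primitive of the cell averages
    and 2 more from there to \<open>U0\<close>.\<close>
  define \<kappa> where "\<kappa> = 6 * c * dx\<^sup>2"
  define \<epsilon> where "\<epsilon> = \<eta> * dx\<^sup>2"
  have \<kappa>0: "0 \<le> \<kappa>" "2 * c * dx\<^sup>2 \<ge> 0" using c0 by (simp_all add: \<kappa>_def)
  have WV: "W x \<le> ?V0 x + \<kappa>" and WU: "W x \<le> U0 x + \<kappa>" for x
    using W(4)[of x] V0_le[OF dx, of x] \<kappa>0 by (simp_all add: \<kappa>_def)
  have left: "W x = 0" if "x \<le> - (R + 3)" for x by (rule W(6)) (use that dx1 in linarith)
  have right: "W x = (LINT y|lborel. \<v> y)" if "R + 3 \<le> x" for x by (rule W(7)) (use that dx1 in linarith)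
  \<comment> \<open>One majorant of both initial errors, so that \<open>close_to_Hopf_Lax\<close>
    applies to either solution with the same \<open>h\<close>.\<close>
  define h where "h x = \<bar>U0 x - ?V0 x\<bar> + max 0 (?V0 x - W x)" for x
  have h0: "0 \<le> h x" and hU: "U0 x - W x \<le> h x" and hV: "?V0 x - W x \<le> h x" for x by (auto simp: h_def)
  have W_Lip: "\<bar>W x - W y\<bar> \<le> M * \<bar>x - y\<bar>" for x y
    using field_differentiable_bound[of UNIV W d M x y] W(1,2) has_field_derivative_at_within
    by (force simp: abs_le_iff minus_le_iff)
  have h_Lip: "\<bar>h x - h y\<bar> \<le> (w.K + z.K + z.K + M) * \<bar>x - y\<bar>" for x y
  proof -
    have U0L: "\<bar>U0 x - U0 y\<bar> \<le> w.K * \<bar>x - y\<bar>" and V0L: "\<bar>?V0 x - ?V0 y\<bar> \<le> z.K * \<bar>x - y\<bar>"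
      using w.U_Lipschitz_space[of 0 x y] z.U_Lipschitz_space[of 0 x y] by (simp_all add: w.U_init z.U_init)
    have "\<bar>h x - h y\<bar> \<le> \<bar>U0 x - U0 y\<bar> + \<bar>?V0 x - ?V0 y\<bar> + (\<bar>?V0 x - ?V0 y\<bar> + \<bar>W x - W y\<bar>)"
      unfolding h_def by linarith
    also have "\<dots> \<le> w.K * \<bar>x - y\<bar> + z.K * \<bar>x - y\<bar> + (z.K * \<bar>x - y\<bar> + M * \<bar>x - y\<bar>)"
      by (intro add_mono U0L V0L W_Lip)
    finally show ?thesis by (simp add: algebra_simps)
  qed
  have h_out: "h x = 0" if "R + 3 < \<bar>x\<bar>" for x
  proof (cases "0 \<le> x")
    case True
    then have "U0 x = (LINT y|lborel. u0 y)" "?V0 x = (LINT y|lborel. \<v> y)"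
      using w.U0_right[of x] z.U0_right[of x] that dx1 by auto
    then show ?thesis using right[of x] that True V0_total[OF dx] by (simp add: h_def)
  next
    case False
    then have "U0 x = 0" "?V0 x = 0" using w.U0_left[of x] z.U0_left[of x] that dx1 by auto
    then show ?thesis using left[of x] that False by (simp add: h_def)
  qed
  have ch: "continuous_on UNIV h"
  proof -
    have M': "0 \<le> w.K + z.K + z.K + M" using w.K0 z.K0 M0 by simp
    show ?thesis
      using Lipschitz2_continuous[where H = "\<lambda>(s::real) x. h x" and C = "w.K + z.K + z.K + M" and p = "\<lambda>_. 0" and q = "\<lambda>x. x" and A = UNIV]
        order_trans[OF h_Lip mult_left_mono[OF _ M']] by (auto simp: continuous_on_id continuous_on_const)
  qed
  have hm: "h \<in> borel_measurable borel" using ch by (rule borel_measurable_continuous_onI)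
  have "bounded (h ` {-(R + 3)..R + 3})"
    by (intro compact_imp_bounded compact_continuous_image continuous_on_subset[OF ch]) auto
  then obtain H where "\<forall>y\<in>h ` {-(R + 3)..R + 3}. norm y \<le> H" unfolding bounded_iff by blast
  then have H: "\<bar>h x\<bar> \<le> \<bar>H\<bar>" for x using h_out[of x] by (cases "x \<in> {-(R + 3)..R + 3}") force+
  have hi: "integrable lborel h" by (rule integrable_bounded_support[OF hm H h_out])
  have hI: "(h has_integral (LINT x|lborel. h x)) UNIV" by (rule has_integral_integral_lborel[OF hi])
  have int_h: "integral UNIV h \<le> 20 * c * (R + 3) * dx\<^sup>2"
  proof -
    \<comment> \<open>The differences of translates integrate to zero. The constants 4 from
      \<open>U0_V0_close\<close> and 6 from the averaging leave 10 c dx^2 on an interval of length 2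
      (R + 3).\<close>
    define \<phi> where "\<phi> x = dx * ((u0 (x + - dx) - u0 (x + dx)) + (\<v> (x + - dx) - \<v> (x + dx))) + 10 * c * dx\<^sup>2 * indicator {-(R + 3)..R + 3} x" for x
    note hb = has_bochner_integral_integrable[OF integrable_translate[OF integrable_u0], unfolded integral_translate]
      has_bochner_integral_integrable[OF integrable_translate[OF integrable_v0[OF dx]], unfolded integral_translate]
    have "has_bochner_integral lborel (indicator {-(R + 3)..R + 3} :: real \<Rightarrow> real) (measure lborel {-(R + 3)..R + 3})"
      by (rule has_bochner_integral_real_indicator) (simp_all add: emeasure_lborel_Icc_eq)
    then have hb': "has_bochner_integral lborel (indicator {-(R + 3)..R + 3} :: real \<Rightarrow> real) (2 * (R + 3))"
      using R0 by simp
    let ?m = "LINT x|lborel. u0 x" and ?n = "LINT x|lborel. \<v> x"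
    have "has_bochner_integral lborel \<phi> (dx * ((?m - ?m) + (?n - ?n)) + 10 * c * dx\<^sup>2 * (2 * (R + 3)))"
      unfolding \<phi>_def
      by (intro has_bochner_integral_add has_bochner_integral_diff has_bochner_integral_mult_right hb hb')
    then have i\<phi>: "integrable lborel \<phi>" "(LINT x|lborel. \<phi> x) = 10 * c * dx\<^sup>2 * (2 * (R + 3))"
      by (auto simp: has_bochner_integral_iff)
    have le: "h x \<le> \<phi> x" for x
    proof (cases "R + 3 < \<bar>x\<bar>")
      case True
      then have "u0 (x + - dx) = 0" "u0 (x + dx) = 0" "\<v> (x + - dx) = 0" "\<v> (x + dx) = 0"
        using dx dx1 by (auto intro!: support v0_support)
      then show ?thesis using h_out[OF True] c0 by (simp add: \<phi>_def)
    next
      case False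
      have "\<v> (x + dx) \<le> \<v> (x - dx) + c * (2 * dx + 2 * dx)" using v0_osl[OF dx, of "2 * dx" "x - dx"] dx by (simp add: add.commute)
      moreover have "0 \<le> c * dx" using c0 dx by simp
      ultimately have "0 \<le> dx * (\<v> (x - dx) - \<v> (x + dx) + 6 * c * dx)" using dx by (intro mult_nonneg_nonneg) (simp_all add: algebra_simps)
      then have "h x \<le> dx * (u0 (x - dx) - u0 (x + dx) + 4 * c * dx) + dx * (\<v> (x - dx) - \<v> (x + dx) + 6 * c * dx)"
        unfolding h_def by (intro add_mono U0_V0_close[OF dx] max.boundedI W(5))
      moreover have "indicator {-(R + 3)..R + 3} x = (1::real)" using False by (auto simp: indicator_def)
      ultimately show ?thesis unfolding \<phi>_def by (simp add: algebra_simps power2_eq_square)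
    qed
    have "(LINT x|lborel. h x) \<le> (LINT x|lborel. \<phi> x)" by (rule integral_mono[OF hi i\<phi>(1) le])
    also note i\<phi>(2)
    finally show ?thesis using integral_unique[OF hI] by (simp add: algebra_simps)
  qed
  \<comment> \<open>\<open>f''\<close> may vanish; the quadratic term makes \<open>g'\<close>
    strictly increasing, as the non-crossing of minimizers requires.\<close>
  define g where "g p = F p + dx\<^sup>2 * p\<^sup>2 / 2" for p
  define g' where "g' p = f' p + dx\<^sup>2 * p" for p
  have g: "(g has_real_derivative g' p) (at p)" "(g' has_real_derivative f'' p + dx\<^sup>2) (at p)" for p
  proof -
    have "((\<lambda>p. dx\<^sup>2 * p\<^sup>2 / 2) has_real_derivative dx\<^sup>2 * p) (at p)" "((\<lambda>p. dx\<^sup>2 * p) has_real_derivative dx\<^sup>2) (at p)"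
      by (auto intro!: derivative_eq_intros)
    from DERIV_add[OF DERIV_F this(1)] DERIV_add[OF DERIV_f' this(2)]
    show "(g has_real_derivative g' p) (at p)" "(g' has_real_derivative f'' p + dx\<^sup>2) (at p)"
      by (simp_all add: g_def[abs_def] g'_def[abs_def])
  qed
  interpret H: hopf_lax g g' "-M" M W
  proof unfold_locales
    show "g' p \<le> g' q" if "p \<le> q" for p q unfolding g'_def using mono_f'[OF that] that by (intro add_mono mult_left_mono) auto
    show "continuous_on UNIV g'" unfolding g'_def by (intro continuous_intros continuous_f')
    show "- M * (y - x) \<le> W y - W x \<and> W y - W x \<le> M * (y - x)" if "x \<le> y" for x y
      using W_Lip[of y x] that by (auto simp: abs_le_iff)
  qed (use g(1) M0 in auto)
  have hl: "hopf_lax g g' (-M) M W" by unfold_locales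
  \<comment> \<open>T in place of t makes the expansion bound uniform in time. The factor B + 1
    bounds the slope of \<open>g'\<close> because dx \<le> 1, and 3 c is the one-sided constant of
    the slope of \<open>W\<close>.\<close>
  define \<Gamma> where "\<Gamma> = 1 + T * (B + 1) * (3 * c)"
  have \<Gamma>0: "0 < \<Gamma>" using T B c0 by (simp add: \<Gamma>_def add_pos_nonneg)
  obtain y q where yq: "\<And>x. q x \<in> {-M..M}" "\<And>x. y x = x - t * g' (q x)"
    "\<And>x. H.HL t x = W (y x) + t * H.legendre (q x)"
    "\<And>x1 x2. x1 < x2 \<Longrightarrow> x2 - x1 \<le> (1 + t * (B + 1) * (3 * c)) * (y x2 - y x1)"
  proof (rule H.expansive_foot[OF W(1,2) g(2) _ t(1), where c = "3 * c" and \<Lambda> = "B + 1"])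
    show "0 < f'' p + dx\<^sup>2" for p using f''_nonneg[of p] dx by (simp add: add_nonneg_pos)
    show "g' m - g' p \<le> (B + 1) * (m - p)" if "p \<in> {-M..M}" "m \<in> {-M..M}" "p \<le> m" for p m
    proof -
      have "\<bar>f' m - f' p\<bar> \<le> B * \<bar>m - p\<bar>" by (rule bound_Lipschitz[OF DERIV_f' B(3)]) (use that M0 in auto)
      moreover have "dx\<^sup>2 * (m - p) \<le> 1 * (m - p)" using that dx dx1 by (intro mult_right_mono power_le_one) auto
      ultimately show ?thesis using that by (simp add: g'_def algebra_simps)
    qed
  qed (use W(3) c0 B in auto)
  have spread: "x2 - x1 \<le> \<Gamma> * (y x2 - y x1)" if "x1 < x2" for x1 x2
  proof -
    have pos: "0 < 1 + t * (B + 1) * (3 * c)" using t B c0 by (simp add: add_pos_nonneg)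
    have "0 < (1 + t * (B + 1) * (3 * c)) * (y x2 - y x1)" using yq(4)[OF that] that by linarith
    then have "0 \<le> y x2 - y x1" using pos by (simp add: zero_less_mult_iff)
    moreover have "1 + t * (B + 1) * (3 * c) \<le> \<Gamma>" unfolding \<Gamma>_def using t B c0 by (intro add_left_mono mult_right_mono) auto
    ultimately have "(1 + t * (B + 1) * (3 * c)) * (y x2 - y x1) \<le> \<Gamma> * (y x2 - y x1)" by (intro mult_right_mono)
    then show ?thesis using yq(4)[OF that] by linarith
  qed
  have gF: "\<bar>F p - g p\<bar> \<le> \<epsilon>" and gG: "\<bar>G p - g p\<bar> \<le> \<epsilon>" if p: "p \<in> {-M..M}" for p
  proof -
    have p2: "dx\<^sup>2 * p\<^sup>2 / 2 \<le> M\<^sup>2 / 2 * dx\<^sup>2" "0 \<le> dx\<^sup>2 * p\<^sup>2 / 2"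
      using mult_left_mono[of "p\<^sup>2" "M\<^sup>2" "dx\<^sup>2"] p abs_le_square_iff[of p M] M0 by (auto simp: abs_le_iff mult.commute)
    have "\<delta>\<^sup>2 \<le> (k * dx)\<^sup>2" using \<delta> by (intro power_mono) auto
    then have "B * \<delta>\<^sup>2 \<le> B * (k * dx)\<^sup>2" by (rule mult_left_mono) (rule B)
    then have B\<delta>: "B * \<delta>\<^sup>2 \<le> B * k\<^sup>2 * dx\<^sup>2" "0 \<le> B * \<delta>\<^sup>2" using B by (simp_all add: power_mult_distrib)
    have e: "\<epsilon> = B * k\<^sup>2 * dx\<^sup>2 + M\<^sup>2 / 2 * dx\<^sup>2" by (simp add: \<epsilon>_def \<eta>_def algebra_simps)
    have pM: "\<bar>p\<bar> \<le> M" using p by auto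
    show "\<bar>F p - g p\<bar> \<le> \<epsilon>" unfolding e g_def using p2 B\<delta> by linarith
    show "\<bar>G p - g p\<bar> \<le> \<epsilon>" unfolding e g_def using p2 B\<delta> F_le_G[of p] G_le(1)[OF pM] by linarith
  qed
  have rightU: "W x = (LINT y|lborel. u0 y)" if "R + 3 \<le> x" for x using right[OF that] V0_total[OF dx] by simp
  have g0: "g 0 = 0" by (simp add: g_def F_def)
  note hint = has_integral_integrable[OF hI]
  have wHL: "H.HL t x \<le> w.U t x + \<kappa> + \<epsilon> * t"
      "integral {-Z..Z} (\<lambda>x. w.U t x - H.HL t x) \<le> \<Gamma> * integral UNIV h + 2 * Z * (\<epsilon> * t)" for x
    by (rule w.close_to_Hopf_Lax[where Y = "R + 3", OF hl g0 gF WU \<kappa>0(1) left rightU t(1) yq(1,2,3) spread \<Gamma>0 hU h0 h_Lip hint constants_nonneg(1)];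
        assumption)+
  have zHL: "H.HL t x \<le> z.U t x + \<kappa> + \<epsilon> * t"
      "integral {-Z..Z} (\<lambda>x. z.U t x - H.HL t x) \<le> \<Gamma> * integral UNIV h + 2 * Z * (\<epsilon> * t)" for x
    by (rule z.close_to_Hopf_Lax[where Y = "R + 3", OF hl g0 gG WV \<kappa>0(1) left right t(1) yq(1,2,3) spread \<Gamma>0 hV h0 h_Lip hint constants_nonneg(1)];
        assumption)+
  have cw: "continuous_on A (w.U t)" and cz: "continuous_on A (z.U t)" for A by (intro w.continuous_U z.continuous_U t)+
  have cH: "continuous_on A (H.HL t)" for A
  proof -
    obtain L where L: "\<And>t s x y. \<bar>H.HL t x - H.HL s y\<bar> \<le> L * (\<bar>t - s\<bar> + \<bar>x - y\<bar>)" using H.HL_Lipschitz by blast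
    show ?thesis using Lipschitz2_continuous[OF L continuous_on_const continuous_on_id, of A t] by simp
  qed
  have out: "w.U t x - z.U t x = 0" if "Z < \<bar>x\<bar>" for x using outside[of x] that dx1 by (simp add: Z_def)
  let ?e = "\<kappa> + \<epsilon> * t"
  \<comment> \<open>The Hopf-Lax function lies below both primitives up to \<open>?e\<close>, so the
    absolute difference is dominated by the sum of the two signed differences, whose integrals are
    already estimated.\<close>
  have "integral {-Z..Z} (\<lambda>x. \<bar>w.U t x - z.U t x\<bar>) \<le> integral {-Z..Z} (\<lambda>x. (w.U t x - H.HL t x) + (z.U t x - H.HL t x) + 2 * ?e)"
  proof (rule integral_le)
    fix x
    show "\<bar>w.U t x - z.U t x\<bar> \<le> (w.U t x - H.HL t x) + (z.U t x - H.HL t x) + 2 * ?e"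
      by (rule abs_diff_le; rule wHL(1) zHL(1))
  qed (intro integrable_continuous_real continuous_intros cw cz cH)+
  also have "\<dots> = integral {-Z..Z} (\<lambda>x. w.U t x - H.HL t x) + integral {-Z..Z} (\<lambda>x. z.U t x - H.HL t x) + 2 * Z * (2 * ?e)"
  proof -
    have I: "(\<lambda>x. w.U t x - H.HL t x) integrable_on {-Z..Z}" "(\<lambda>x. z.U t x - H.HL t x) integrable_on {-Z..Z}"
      by (intro integrable_continuous_real continuous_intros cw cz cH)+
    show ?thesis
      unfolding Henstock_Kurzweil_Integration.integral_add[OF integrable_add[OF I] integrable_const_ivl]
        Henstock_Kurzweil_Integration.integral_add[OF I]
      using constants_nonneg(1) by simp
  qed
  also have "\<dots> \<le> 2 * (\<Gamma> * integral UNIV h + 2 * Z * (\<epsilon> * t)) + 2 * Z * (2 * ?e)"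
    by (rule add_right_mono) (use add_mono[OF wHL(2) zHL(2)] in \<open>simp only: mult_2\<close>)
  also have "\<dots> \<le> 2 * (\<Gamma> * (20 * c * (R + 3) * dx\<^sup>2) + 2 * Z * (\<epsilon> * T)) + 2 * Z * (2 * (\<kappa> + \<epsilon> * T))"
    using \<Gamma>0 constants_nonneg t int_h by (intro add_mono mult_left_mono order_refl) (auto simp: \<epsilon>_def)
  also have "\<dots> = (40 * c * (R + 3) * \<Gamma> + 8 * Z * \<eta> * T + 24 * Z * c) * dx\<^sup>2"
    by (simp add: \<epsilon>_def \<kappa>_def algebra_simps)
  also have "\<dots> \<le> C1 * dx\<^sup>2"
    unfolding C1_def \<Gamma>_def using M0 by (intro mult_right_mono) auto
  finally have le: "integral {-Z..Z} (\<lambda>x. \<bar>w.U t x - z.U t x\<bar>) \<le> C1 * dx\<^sup>2" .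
  have "(\<integral>\<^sup>+x. ennreal \<bar>w.U t x - z.U t x\<bar> \<partial>lborel) = ennreal (integral {-Z..Z} (\<lambda>x. \<bar>w.U t x - z.U t x\<bar>))"
    by (rule nn_integral_bounded_support[OF _ out]) (intro continuous_intros cw cz)
  then show ?thesis using ennreal_leI[OF le] by simp
qed

end

text \<open>On [0, M] the interpolated flux lies between F p and F p + B \<delta> p, so both
  applications of \<open>shifted_comparison\<close> use the smooth flux \<open>F\<close> in between:
  one with \<sigma> = B \<delta>, the other with \<sigma> = 0. Cell averaging contributes a shift by
  dx each time.\<close>

lemma quantiles_close:
  assumes w: "compact_sol F u0 w 0 M R B" and z: "compact_sol G \<v> z 0 M (R + dx) B"
    and one: "(LINT x|lborel. u0 x) = 1" and pos: "\<And>x. 0 \<le> u0 x" and t: "0 \<le> t" "t \<le> T" and \<xi>: "0 \<le> \<xi>" "\<xi> < 1"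
  shows "\<bar>quantile_fun (w t) \<xi> - quantile_fun (z t) \<xi>\<bar> \<le> (1 + B * k * T) * dx"
proof -
  interpret w: compact_sol F u0 w 0 M R B by (rule w)
  interpret z: compact_sol G \<v> z 0 M "R + dx" B by (rule z)
  have one': "(LINT x|lborel. \<v> x) = 1" using V0_total[OF dx] one by simp
  note cw = w.cdf[OF refl one t(1)] and cz = z.cdf[OF refl one' t(1)]
  have flux: "convex_flux F f'"
    by unfold_locales (auto intro: DERIV_F mono_f' continuous_f')
  have "distribution_fun (w t) (x - dx - t * (B * \<delta>)) \<le> distribution_fun (z t) x" for x
    by (rule shifted_comparison[OF w z flux _ _ _ mono_shift(1)[OF dx pos] _ t(1)])
      (use G_le(2) V0_total[OF dx] in \<open>auto simp: F_def\<close>)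
  then have 1: "quantile_fun (z t) \<xi> \<le> quantile_fun (w t) \<xi> + (dx + t * (B * \<delta>))"
    by (intro quantile_shift[OF cz cw _ \<xi>]) (simp add: diff_diff_eq)
  have "distribution_fun (z t) (x - dx - t * 0) \<le> distribution_fun (w t) x" for x
    by (rule shifted_comparison[OF z w flux _ F_le_G _ _ _ t(1)])
      (use mono_shift(2)[OF dx pos, of "x - dx" for x] V0_total[OF dx] in \<open>auto simp: F_def\<close>)
  then have 2: "quantile_fun (w t) \<xi> \<le> quantile_fun (z t) \<xi> + dx"
    by (intro quantile_shift[OF cw cz _ \<xi>]) simp
  have "t * (B * \<delta>) \<le> T * (B * (k * dx))" "0 \<le> t * (B * \<delta>)" using t B \<delta> by (auto intro!: mult_mono)
  then show ?thesis using 1 2 unfolding abs_le_iff by (simp add: algebra_simps)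
qed

end

section \<open>From the given data to the setting of the error bounds\<close>

lemma AE_zero_outside_supp: "AE y in lborel. y \<notin> supp v \<longrightarrow> v y = 0"
proof -
  define \<F> where "\<F> = {ball x e | x e. AE y in lborel. y \<in> ball x e \<longrightarrow> v y = 0}"
  \<comment> \<open>The complement of the support is a union of balls on which v vanishes almost
    everywhere. By Lindelof countably many of them suffice, so the exceptional null sets can be
    united.\<close>
  obtain \<F>' where F': "\<F>' \<subseteq> \<F>" "countable \<F>'" "\<Union>\<F>' = \<Union>\<F>"
    by (rule Lindelof[of \<F>]) (auto simp: \<F>_def)
  have "AE y in lborel. \<forall>B\<in>\<F>'. y \<in> B \<longrightarrow> v y = 0"
    using F'(1) by (subst AE_ball_countable[OF F'(2)]) (auto simp: \<F>_def)
  then show ?thesis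
  proof eventually_elim
    fix y assume *: "\<forall>B\<in>\<F>'. y \<in> B \<longrightarrow> v y = 0"
    show "y \<notin> supp v \<longrightarrow> v y = 0"
    proof
      assume "y \<notin> supp v"
      then obtain e where "0 < e" "AE z in lborel. z \<in> ball y e \<longrightarrow> v z = 0" by (auto simp: supp_def)
      then have "y \<in> \<Union>\<F>" unfolding \<F>_def by (intro UnionI[of "ball y e"]) auto
      then show "v y = 0" using * F'(3) by blast
    qed
  qed
qed

text \<open>The one-sided bound holds at every point, so zeros arbitrarily close on either side of a
  point outside the support force v to vanish there, not just almost everywhere. Comparison with the
  zeros at -R - 1 and R + 1 then bounds |v|; the sup norm is thus controlled by c and the
  support.\<close>

lemma osl_datumI:
  assumes v: "v \<in> BV" and lip: "Lip_plus_bound c v" and S: "supp v \<subseteq> {-R..R}" and R: "0 \<le> R"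
  shows "osl_datum v \<bar>c\<bar> (\<bar>c\<bar> * (2 * R + 2)) R"
proof -
  have osl: "v y \<le> v x + \<bar>c\<bar> * (y - x)" if "x \<le> y" for x y
  proof (cases "x = y")
    case False
    then have z: "0 < y - x" using that by simp
    then have "(v y - v x) / (y - x) \<le> c" using lip[unfolded Lip_plus_bound_def, rule_format, of "y - x" x] by simp
    then have "v y - v x \<le> c * (y - x)" using z by (simp add: pos_divide_le_eq)
    moreover have "c * (y - x) \<le> \<bar>c\<bar> * (y - x)" using z by (intro mult_right_mono) auto
    ultimately show ?thesis by linarith
  qed simp
  have zero: "v x = 0" if x: "R < \<bar>x\<bar>" for x
  proof (rule antisym)
    have ex: "\<exists>y. a < y \<and> y < b \<and> v y = 0" if ab: "a < b" "\<And>y. a < y \<Longrightarrow> y < b \<Longrightarrow> R < \<bar>y\<bar>" for a b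
    proof -
      obtain y where y: "a < y" "y < b" "y \<notin> supp v \<longrightarrow> v y = 0" by (rule AE_Ioo_ex[OF AE_zero_outside_supp ab(1)])
      have "y \<notin> {-R..R}" using ab(2)[OF y(1,2)] by auto
      then show ?thesis using S y by blast
    qed
    have near: "R < \<bar>y\<bar>" if "\<bar>y - x\<bar> < \<bar>x\<bar> - R" for y using that by linarith
    have small: "\<bar>c\<bar> * d \<le> \<bar>c\<bar> * \<epsilon>" if "d \<le> \<epsilon>" for d \<epsilon> using that by (rule mult_left_mono) simp
    show "v x \<le> 0"
    proof (rule le_if_le_eps[where C = "\<bar>c\<bar>"])
      fix \<epsilon> :: real assume e: "0 < \<epsilon>"
      have "\<exists>y. x - min \<epsilon> (\<bar>x\<bar> - R) < y \<and> y < x \<and> v y = 0"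
        by (rule ex) (use e x in \<open>simp, intro near, simp\<close>)
      then obtain y where y: "x - min \<epsilon> (\<bar>x\<bar> - R) < y" "y < x" "v y = 0" by blast
      then have "y \<le> x" "x - y \<le> \<epsilon>" by auto
      then show "v x \<le> 0 + \<bar>c\<bar> * \<epsilon>" using osl[of y x] small[of "x - y" \<epsilon>] y(3) by auto
    qed
    show "0 \<le> v x"
    proof (rule le_if_le_eps[where C = "\<bar>c\<bar>"])
      fix \<epsilon> :: real assume e: "0 < \<epsilon>"
      have "\<exists>y. x < y \<and> y < x + min \<epsilon> (\<bar>x\<bar> - R) \<and> v y = 0"
        by (rule ex) (use e x in \<open>simp, intro near, simp\<close>)
      then obtain y where y: "x < y" "y < x + min \<epsilon> (\<bar>x\<bar> - R)" "v y = 0" by blast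
      then have "x \<le> y" "y - x \<le> \<epsilon>" by auto
      then show "0 \<le> v x + \<bar>c\<bar> * \<epsilon>" using osl[of x y] small[of "y - x" \<epsilon>] y(3) by auto
    qed
  qed
  show ?thesis
  proof
    show "v \<in> borel_measurable borel" using v by (auto simp: BV_def dest: borel_measurable_integrable)
    show "\<bar>v x\<bar> \<le> \<bar>c\<bar> * (2 * R + 2)" for x
    proof (cases "R < \<bar>x\<bar>")
      case True
      then show ?thesis using zero R by simp
    next
      case False
      have "v (- R - 1) = 0" "v (R + 1) = 0" using zero R by auto
      moreover have "\<bar>c\<bar> * (x - (- R - 1)) \<le> \<bar>c\<bar> * (2 * R + 2)" "\<bar>c\<bar> * (R + 1 - x) \<le> \<bar>c\<bar> * (2 * R + 2)"
        using False by (intro mult_left_mono; simp)+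
      moreover have "- R - 1 \<le> x" "x \<le> R + 1" using False by auto
      ultimately show ?thesis using osl[of "- R - 1" x] osl[of x "R + 1"] by auto
    qed
  qed (use zero R osl in auto)
qed

text \<open>Just to the right of x there are points where v is nonnegative, and v at x is smaller
  than its value there by at most c \<epsilon>.\<close>

lemma osl_nonneg:
  assumes "osl_datum v c M R" "AE x in lborel. 0 \<le> v x" shows "0 \<le> v x"
proof (rule le_if_le_eps[where C = c])
  interpret osl_datum v c M R by (rule assms)
  fix \<epsilon> :: real assume "0 < \<epsilon>"
  then obtain y where y: "x < y" "y < x + \<epsilon>" "0 \<le> v y" using AE_Ioo_ex[OF assms(2), of x "x + \<epsilon>"] by auto
  then show "0 \<le> v x + c * \<epsilon>" using osl_le[of x y \<epsilon>] by simp
qed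

lemma entropy_solution_measurable: assumes "entropy_solution F v0 v" "0 \<le> t" shows "v t \<in> borel_measurable borel"
proof -
  have "(\<lambda>z. if 0 \<le> fst z then v (fst z) (snd z) else 0) \<in> borel_measurable borel"
    using entropy_solutionD(1)[OF assms(1), of "\<lambda>t x. if 0 \<le> t then v t x else 0"] by simp
  from borel_section[OF this, of t] assms(2) show ?thesis by simp
qed

text \<open>Covering the point 0 requires an index j with j \<delta> < 0, hence j \<le> -1, while
  admissible indices are at least -(M + 1)/\<delta>.\<close>

lemma mesh_bound:
  assumes "0 < \<delta>" "0 \<le> M" "{-M..M} \<subseteq> flux_domain M \<delta>" shows "\<delta> \<le> M + 1"
proof -
  have "0 \<in> flux_domain M \<delta>" using assms by auto
  then obtain j :: int where j: "- (M + 1) / \<delta> \<le> real_of_int j" "real_of_int j * \<delta> < 0"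
    by (auto simp: flux_domain_def node_index_def)
  then have "j < 0" using assms(1) by (simp add: mult_less_0_iff)
  then have "- (M + 1) / \<delta> \<le> -1" using j(1) by linarith
  then show ?thesis using assms(1) by (simp add: pos_divide_le_eq)
qed

theorem theorem2p2:
  fixes f :: "real \<Rightarrow> real" and S :: "real set" and T c K :: real
  assumes "C2 f" and "convex_on UNIV f" and "compact S" and "T > 0"
  shows "\<exists>C::real. \<forall>u0 u \<delta> \<Delta>x v.
    u0 \<in> BV \<and> Lip_plus_bound c u0 \<and> supp u0 = S \<and>
    entropy_solution f u0 u \<and>
    front_tracking_approximation f u0 \<delta> \<Delta>x v \<and> \<delta> \<le> K * \<Delta>x \<longrightarrow>
      (\<forall>t\<in>{0..<T}. W1_defined (u t) (v t) \<and>
         W1 (u t) (v t) \<le> ennreal (C * \<Delta>x^2)) \<and>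
      (u0 \<in> \<B> \<longrightarrow>
        (\<forall>t\<in>{0..<T}. u t \<in> \<B> \<and> v t \<in> \<B> \<and>
           (\<forall>p\<ge>1. Wp p (u t) (v t) \<le> ennreal (C * \<Delta>x powr (1 + enn2real (1 / p))))))"
proof -
  obtain R0 where R0: "\<forall>x\<in>S. \<bar>x\<bar> \<le> R0" using compact_imp_bounded[OF assms(3)] by (auto simp: bounded_iff)
  define R where "R = \<bar>R0\<bar>"
  have R: "S \<subseteq> {-R..R}" "0 \<le> R" using R0 by (force simp: R_def abs_le_iff)+
  define M where "M = \<bar>c\<bar> * (2 * R + 2)"
  obtain f' f'' where f: "smooth_convex f f' f''" using C2_convexE[OF assms(1,2)] .
  obtain B where B: "0 \<le> B" "\<And>p. p \<in> {-(2 * M + 2)..2 * M + 2} \<Longrightarrow> \<bar>f' p\<bar> \<le> B"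
      "\<And>p. p \<in> {-(2 * M + 2)..2 * M + 2} \<Longrightarrow> \<bar>f'' p\<bar> \<le> B"
    using smooth_convex.derivative_bounds[OF f, of "2 * M + 2"] by blast
  let ?C1 = "front_tracking.C1 \<bar>c\<bar> M R \<bar>K\<bar> B T"
  \<comment> \<open>The first summand serves W1 and the second the shift of the quantiles; the
    interpolation takes one constant for both. All ingredients come from f, S, T, c and K.\<close>
  define C where "C = ?C1 + (1 + B * \<bar>K\<bar> * T)"
  show ?thesis
  proof (intro exI[of _ C] allI impI)
    fix u0 u \<delta> \<Delta>x v
    assume A: "u0 \<in> BV \<and> Lip_plus_bound c u0 \<and> supp u0 = S \<and> entropy_solution f u0 u \<and>
      front_tracking_approximation f u0 \<delta> \<Delta>x v \<and> \<delta> \<le> K * \<Delta>x"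
    then have u: "entropy_solution f u0 u" and d: "0 < \<delta>" "0 < \<Delta>x" "\<delta> \<le> K * \<Delta>x"
      and cover: "{- enn2real (Linf_norm lborel u0)..enn2real (Linf_norm lborel u0)} \<subseteq> flux_domain (enn2real (Linf_norm lborel u0)) \<delta>"
      and v: "entropy_solution (flux_interp f \<delta>) (cell_average \<Delta>x u0) v"
      by (simp_all add: front_tracking_approximation_def Let_def)
    have datum: "osl_datum u0 \<bar>c\<bar> M R" unfolding M_def by (rule osl_datumI) (use A R in auto)
    interpret osl_datum u0 "\<bar>c\<bar>" M R by (rule datum)
    have "Linf_norm lborel u0 \<le> ennreal M" unfolding Linf_norm_def
      by (rule esssup_I) (use bounded in \<open>auto intro!: ennreal_leI\<close>)
    then have "enn2real (Linf_norm lborel u0) \<le> M" using M0 by (intro enn2real_leI)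
    \<comment> \<open>\<open>M\<close> was computed from c and the support. It dominates the sup
      norm of \<open>u0\<close>, in terms of which the mesh condition is stated.\<close>
    then have dM: "\<delta> \<le> M + 1" using mesh_bound[OF d(1) enn2real_nonneg cover] by linarith
    have "K * \<Delta>x \<le> \<bar>K\<bar> * \<Delta>x" using d(2) by (intro mult_right_mono) auto
    then have dK: "\<delta> \<le> \<bar>K\<bar> * \<Delta>x" using d(3) by linarith
    have ft: "front_tracking u0 \<bar>c\<bar> M R f f' f'' \<delta> \<Delta>x \<bar>K\<bar> B T"
      by (intro front_tracking.intro datum f front_tracking_axioms.intro d dK dM B) (use assms(4) in auto)
    interpret ft: front_tracking u0 "\<bar>c\<bar>" M R f f' f'' \<delta> \<Delta>x "\<bar>K\<bar>" B T by (rule ft)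
    have BKT: "0 \<le> B * \<bar>K\<bar> * T" using B(1) assms(4) by simp
    have C: "0 < C" "?C1 \<le> C" "1 + B * \<bar>K\<bar> * T \<le> C" using ft.constants_nonneg(3) BKT by (simp_all add: C_def)
    obtain w z where w: "compact_sol ft.F u0 w (- M) M R B" and z: "compact_sol ft.G (cell_average \<Delta>x u0) z (- M) M (R + \<Delta>x) B"
      and uw: "\<And>t. 0 \<le> t \<Longrightarrow> AE x in lborel. u t x = w t x" and vz: "\<And>t. 0 \<le> t \<Longrightarrow> AE x in lborel. v t x = z t x"
    proof (rule ft.solutions_normalize[OF u v, of "- M"])
      show "\<forall>x. 0 \<le> u0 x" if "- M = 0"
      proof
        show "0 \<le> u0 x" for x using that bounded[of x] by simp
      qed
    qed simp_all
    interpret w: compact_sol ft.F u0 w "- M" M R B by (rule w)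
    interpret z: compact_sol ft.G "cell_average \<Delta>x u0" z "- M" M "R + \<Delta>x" B by (rule z)
    note um = entropy_solution_measurable[OF u] and vm = entropy_solution_measurable[OF v]
    have wm: "w t \<in> borel_measurable borel" and zm: "z t \<in> borel_measurable borel" for t
      by (rule borel_section[OF w.meas] borel_section[OF z.meas])+
    have L1: "(\<integral>\<^sup>+x. ennreal \<bar>w.U t x - z.U t x\<bar> \<partial>lborel) \<le> ennreal (C * \<Delta>x\<^sup>2)" if t: "0 \<le> t" "t \<le> T" for t
    proof -
      have "(\<integral>\<^sup>+x. ennreal \<bar>w.U t x - z.U t x\<bar> \<partial>lborel) \<le> ennreal (?C1 * \<Delta>x\<^sup>2)"
        using ft.L1_fine[OF w z t] ft.L1_coarse[OF w z t] by (cases "\<Delta>x \<le> 1") auto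
      also have "\<dots> \<le> ennreal (C * \<Delta>x\<^sup>2)" using C by (intro ennreal_leI mult_right_mono) auto
      finally show ?thesis .
    qed
    show "(\<forall>t\<in>{0..<T}. W1_defined (u t) (v t) \<and> W1 (u t) (v t) \<le> ennreal (C * \<Delta>x^2)) \<and>
      (u0 \<in> \<B> \<longrightarrow> (\<forall>t\<in>{0..<T}. u t \<in> \<B> \<and> v t \<in> \<B> \<and>
        (\<forall>p\<ge>1. Wp p (u t) (v t) \<le> ennreal (C * \<Delta>x powr (1 + enn2real (1 / p))))))"
    proof (intro conjI ballI impI)
      fix t assume "t \<in> {0..<T}"
      then have t: "0 \<le> t" "t \<le> T" by auto
      have K: "\<bar>w t x\<bar> \<le> 2 * M" "\<bar>z t x\<bar> \<le> 2 * M" for x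
        using w.abs_u[of t x] z.abs_u[of t x] M0 by (simp_all add: w.K_def z.K_def)
      have X: "w t x = 0" "z t x = 0" if "max (w.X t) (z.X t) < \<bar>x\<bar>" for x
        using w.u_eq_0[of t t x] z.u_eq_0[of t t x] t that by simp_all
      have mass: "(LINT x|lborel. w t x) = (LINT x|lborel. z t x)"
        using w.mass_conserved[OF t(1)] z.mass_conserved[OF t(1)] V0_total[OF d(2)] by simp
      have W: "W1_defined (u t) (v t)" "W1 (u t) (v t) = (\<integral>\<^sup>+x. ennreal \<bar>w.U t x - z.U t x\<bar> \<partial>lborel)"
        by (rule W1_of_bounded_support[OF um[OF t(1)] vm[OF t(1)] wm zm uw[OF t(1)] vz[OF t(1)] K X mass]; assumption)+
      show "W1_defined (u t) (v t)" by (rule W)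
      show "W1 (u t) (v t) \<le> ennreal (C * \<Delta>x^2)" unfolding W(2) by (rule L1[OF t])
    next
      assume uB: "u0 \<in> \<B>"
      have pos: "0 \<le> u0 x" for x by (rule osl_nonneg[OF datum]) (use uB in \<open>simp add: \<B>_def\<close>)
      have one: "(LINT x|lborel. u0 x) = 1" using uB by (simp add: \<B>_def)
      have one': "(LINT x|lborel. cell_average \<Delta>x u0 x) = 1" using V0_total[OF d(2)] one by simp
      \<comment> \<open>A second pair of representatives, with values in [0, M]. Distribution
        functions depend only on the classes modulo null sets, so the L1 bound obtained for the pair
        \<open>w\<close>, \<open>z\<close> carries over.\<close>
      obtain w' z' where w': "compact_sol ft.F u0 w' 0 M R B" and z': "compact_sol ft.G (cell_average \<Delta>x u0) z' 0 M (R + \<Delta>x) B"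
        and uw': "\<And>t. 0 \<le> t \<Longrightarrow> AE x in lborel. u t x = w' t x" and vz': "\<And>t. 0 \<le> t \<Longrightarrow> AE x in lborel. v t x = z' t x"
        by (rule ft.solutions_normalize[OF u v, of 0]) (use pos in auto)
      interpret w': compact_sol ft.F u0 w' 0 M R B by (rule w')
      interpret z': compact_sol ft.G "cell_average \<Delta>x u0" z' 0 M "R + \<Delta>x" B by (rule z')
      fix t assume "t \<in> {0..<T}"
      then have t: "0 \<le> t" "t \<le> T" by auto
      have wm': "w' t \<in> borel_measurable borel" and zm': "z' t \<in> borel_measurable borel"
        by (rule borel_section[OF w'.meas] borel_section[OF z'.meas])+
      show "u t \<in> \<B>"
        by (rule mem_\<B>I[OF um[OF t(1)] wm' uw'[OF t(1)] w'.range_u, where X = "w'.X t"])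
          (use w'.u_eq_0[of t t] w'.mass_conserved[OF t(1)] one t in auto)
      show "v t \<in> \<B>"
        by (rule mem_\<B>I[OF vm[OF t(1)] zm' vz'[OF t(1)] z'.range_u, where X = "z'.X t"])
          (use z'.u_eq_0[of t t] z'.mass_conserved[OF t(1)] one' t in auto)
      have U: "distribution_fun (u t) = distribution_fun (w' t)" "distribution_fun (v t) = distribution_fun (z' t)"
        "distribution_fun (u t) = distribution_fun (w t)" "distribution_fun (v t) = distribution_fun (z t)"
        by (rule distribution_fun_cong_AE[OF um[OF t(1)] wm' uw'[OF t(1)]] distribution_fun_cong_AE[OF vm[OF t(1)] zm' vz'[OF t(1)]]
          distribution_fun_cong_AE[OF um[OF t(1)] wm uw[OF t(1)]] distribution_fun_cong_AE[OF vm[OF t(1)] zm vz[OF t(1)]])+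
      show "\<forall>p\<ge>1. Wp p (u t) (v t) \<le> ennreal (C * \<Delta>x powr (1 + enn2real (1 / p)))"
      proof (intro allI impI)
        fix p :: ennreal assume p: "1 \<le> p"
        have "Wp p (w' t) (z' t) \<le> ennreal (C * \<Delta>x powr (1 + enn2real (1 / p)))"
        proof (rule Wp_interpolation[OF w'.cdf[OF refl one t(1)] z'.cdf[OF refl one' t(1)] _ _ C(1) d(2) p])
          fix \<xi> :: real assume \<xi>: "0 \<le> \<xi>" "\<xi> < 1"
          have "(1 + B * \<bar>K\<bar> * T) * \<Delta>x \<le> C * \<Delta>x" using C d by (intro mult_right_mono) auto
          then show "\<bar>quantile_fun (w' t) \<xi> - quantile_fun (z' t) \<xi>\<bar> \<le> C * \<Delta>x"
            using ft.quantiles_close[OF w' z' one pos t \<xi>] by linarith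
        next
          show "(\<integral>\<^sup>+x. ennreal \<bar>w'.U t x - z'.U t x\<bar> \<partial>lborel) \<le> ennreal (C * \<Delta>x\<^sup>2)"
            using L1[OF t] by (simp only: U(1,2)[symmetric] U(3,4))
        qed
        moreover have "Wp p (u t) (v t) = Wp p (w' t) (z' t)"
          by (simp only: Wp_def quantile_fun_def U(1,2))
        ultimately show "Wp p (u t) (v t) \<le> ennreal (C * \<Delta>x powr (1 + enn2real (1 / p)))" by simp
      qed
    qed
  qed
qed

end
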